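(* For every fixed integer $r\ge 2$ and each $\mathsf{R}\in\{\mathsf{TS},\mathsf{TJ}\}$, \textsc{D$r$DSR} under $\mathsf{R}$ is $\mathtt{PSPACE}$-complete on chordal graphs.
   Context: Graphs are finite, simple, undirected. A graph is chordal if every cycle on at least four vertices has a chord. For an integer $r\ge1$, a distance-$r$ dominating set (D$r$DS) of $G$ is a set $D\subseteq V(G)$ such that every vertex is at distance at most $r$ from some vertex of $D$. A $\mathsf{TJ}$-sequence between D$r$DSs $D_s,D_t$ is a sequence $D_s=D_0,\dots,D_q=D_t$ of D$r$DSs with $D_i\setminus D_{i+1}=\{x_i\}$, $D_{i+1}\setminus D_i=\{y_i\}$; a $\mathsf{TS}$-sequence additionally requires $x_iy_i\in E(G)$. \textsc{D$r$DSR} under $\mathsf{R}$: given $G$ and D$r$DSs $D_s,D_t$, decide whether an $\mathsf{R}$-sequence between them exists. *)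

theory Defs
  imports
    Main
    "HOL-Library.Extended_Nat"
    "HOL-Computational_Algebra.Polynomial"
begin

section \<open>Deterministic multitape Turing machines\<close>

text \<open>
  States and tape symbols are natural numbers below the given bounds. A transition maps the current
  state and the list of scanned symbols (one per tape) to the next state and one action per tape.
  State 0 is the start state; states 1 and 2 are halting (accepting and rejecting).
\<close>

datatype head_move = Move_Left | Stay | Move_Right

record tm =
  tm_tapes :: nat
  tm_states :: nat
  tm_symbols :: nat
  tm_trans :: "nat \<Rightarrow> nat list \<Rightarrow> nat \<times> (nat \<times> head_move) list"

abbreviation (input) accept_state :: nat where "accept_state \<equiv> 1"
abbreviation (input) reject_state :: nat where "reject_state \<equiv> 2"

definition blank_sym :: nat where "blank_sym = 0"
definition start_sym :: nat where "start_sym = 1"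
definition bit_sym :: "bool \<Rightarrow> nat" where "bit_sym b = (if b then 3 else 2)"

definition wf_tm :: "tm \<Rightarrow> bool" where
  "wf_tm M \<longleftrightarrow>
     1 \<le> tm_tapes M \<and> 3 \<le> tm_states M \<and> 4 \<le> tm_symbols M \<and>
     (\<forall>q < tm_states M. \<forall>ss. length ss = tm_tapes M \<and> (\<forall>s \<in> set ss. s < tm_symbols M) \<longrightarrow>
        (case tm_trans M q ss of (q', as) \<Rightarrow>
           q' < tm_states M \<and> length as = tm_tapes M \<and>
           (\<forall>(s, d) \<in> set as. s < tm_symbols M)))"

text \<open>
  A tape is its content, infinite to the right, together with the head position; a left move from
  cell 0 leaves the head there. Cell 0 of every tape initially holds the start symbol and the
  input occupies the first tape from cell 1 on.
\<close>

type_synonym tape = "(nat \<Rightarrow> nat) \<times> nat"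
type_synonym config = "nat \<times> tape list"

fun move_head :: "head_move \<Rightarrow> nat \<Rightarrow> nat" where
  "move_head Move_Left h = h - 1"
| "move_head Stay h = h"
| "move_head Move_Right h = h + 1"

definition scanned :: "tape \<Rightarrow> nat" where
  "scanned T = fst T (snd T)"

definition act :: "nat \<times> head_move \<Rightarrow> tape \<Rightarrow> tape" where
  "act a T = ((fst T)(snd T := fst a), move_head (snd a) (snd T))"

definition tape_of :: "bool list \<Rightarrow> tape" where
  "tape_of x = ((\<lambda>i. if i = 0 then start_sym
                     else if i \<le> length x then bit_sym (x ! (i - 1))
                     else blank_sym), 0)"

definition init_config :: "tm \<Rightarrow> bool list \<Rightarrow> config" where
  "init_config M x = (0, tape_of x # replicate (tm_tapes M - 1) (tape_of []))"

definition halted :: "config \<Rightarrow> bool" where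
  "halted c \<longleftrightarrow> fst c = accept_state \<or> fst c = reject_state"

definition step :: "tm \<Rightarrow> config \<Rightarrow> config" where
  "step M c =
     (if halted c then c
      else (case tm_trans M (fst c) (map scanned (snd c)) of
              (q, as) \<Rightarrow> (q, map2 act as (snd c))))"

definition run :: "tm \<Rightarrow> bool list \<Rightarrow> nat \<Rightarrow> config" where
  "run M x t = (step M ^^ t) (init_config M x)"

text \<open>The output is written on the last tape, from cell 1 up to the first blank.\<close>

definition has_output :: "config \<Rightarrow> bool list \<Rightarrow> bool" where
  "has_output c y \<longleftrightarrow>
     (\<forall>i < length y. fst (last (snd c)) (i + 1) = bit_sym (y ! i)) \<and>
     fst (last (snd c)) (length y + 1) = blank_sym"


section \<open>PSPACE-completeness\<close>

type_synonym language = "bool list set"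

definition decides :: "tm \<Rightarrow> language \<Rightarrow> bool" where
  "decides M L \<longleftrightarrow>
     (\<forall>x. \<exists>t. fst (run M x t) = (if x \<in> L then accept_state else reject_state))"

text \<open>
  The work space is bounded tape by tape, which agrees with bounding the total up to the
  constant factor \<^term>\<open>tm_tapes M\<close>. The input tape is included.
\<close>

definition runs_in_space :: "tm \<Rightarrow> (nat \<Rightarrow> nat) \<Rightarrow> bool" where
  "runs_in_space M s \<longleftrightarrow>
     (\<forall>x t. \<forall>T \<in> set (snd (run M x t)). snd T < s (length x))"

definition PSPACE :: "language set" where
  "PSPACE =
     {L. \<exists>M (p :: nat poly). wf_tm M \<and> decides M L \<and> runs_in_space M (poly p)}"

definition computes_in_time ::
    "tm \<Rightarrow> (bool list \<Rightarrow> bool list) \<Rightarrow> (nat \<Rightarrow> nat) \<Rightarrow> bool" where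
  "computes_in_time M f b \<longleftrightarrow>
     (\<forall>x. \<exists>t \<le> b (length x). halted (run M x t) \<and> has_output (run M x t) (f x))"

definition poly_time_computable :: "(bool list \<Rightarrow> bool list) \<Rightarrow> bool" where
  "poly_time_computable f \<longleftrightarrow>
     (\<exists>M (p :: nat poly). wf_tm M \<and> computes_in_time M f (poly p))"

definition poly_time_reducible :: "language \<Rightarrow> language \<Rightarrow> bool" where
  "poly_time_reducible A B \<longleftrightarrow>
     (\<exists>f. poly_time_computable f \<and> (\<forall>x. x \<in> A \<longleftrightarrow> f x \<in> B))"

definition PSPACE_hard :: "language \<Rightarrow> bool" where
  "PSPACE_hard L \<longleftrightarrow> (\<forall>A \<in> PSPACE. poly_time_reducible A L)"

definition PSPACE_complete :: "language \<Rightarrow> bool" where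
  "PSPACE_complete L \<longleftrightarrow> L \<in> PSPACE \<and> PSPACE_hard L"


section \<open>Graphs\<close>

record 'a ugraph =
  verts :: "'a set"
  edges :: "'a set set"

definition simple_graph :: "'a ugraph \<Rightarrow> bool" where
  "simple_graph G \<longleftrightarrow>
     finite (verts G) \<and>
     (\<forall>e \<in> edges G. \<exists>u v. u \<in> verts G \<and> v \<in> verts G \<and> u \<noteq> v \<and> e = {u, v})"

text \<open>A cycle is given by the list of its vertices in cyclic order, without repeating the first.\<close>

definition cycle_edges :: "'a list \<Rightarrow> 'a set set" where
  "cycle_edges c = {{c ! i, c ! ((i + 1) mod length c)} | i. i < length c}"

definition is_cycle :: "'a ugraph \<Rightarrow> 'a list \<Rightarrow> bool" where
  "is_cycle G c \<longleftrightarrow>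
     3 \<le> length c \<and> distinct c \<and> set c \<subseteq> verts G \<and> cycle_edges c \<subseteq> edges G"

definition has_chord :: "'a ugraph \<Rightarrow> 'a list \<Rightarrow> bool" where
  "has_chord G c \<longleftrightarrow> (\<exists>e \<in> edges G. e \<subseteq> set c \<and> e \<notin> cycle_edges c)"

definition chordal :: "'a ugraph \<Rightarrow> bool" where
  "chordal G \<longleftrightarrow>
     simple_graph G \<and> (\<forall>c. is_cycle G c \<and> 4 \<le> length c \<longrightarrow> has_chord G c)"

definition is_walk :: "'a ugraph \<Rightarrow> 'a \<Rightarrow> 'a list \<Rightarrow> 'a \<Rightarrow> bool" where
  "is_walk G u w v \<longleftrightarrow>
     w \<noteq> [] \<and> hd w = u \<and> last w = v \<and> set w \<subseteq> verts G \<and>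
     successively (\<lambda>a b. {a, b} \<in> edges G) w"

text \<open>The distance is \<^term>\<open>\<infinity> :: enat\<close> if there is no walk, as the infimum of the empty set.\<close>

definition graph_dist :: "'a ugraph \<Rightarrow> 'a \<Rightarrow> 'a \<Rightarrow> enat" where
  "graph_dist G u v = Inf {enat (length w - 1) | w. is_walk G u w v}"


section \<open>Reconfiguration of distance-r dominating sets\<close>

definition dist_dominating :: "nat \<Rightarrow> 'a ugraph \<Rightarrow> 'a set \<Rightarrow> bool" where
  "dist_dominating r G D \<longleftrightarrow>
     D \<subseteq> verts G \<and> (\<forall>v \<in> verts G. \<exists>u \<in> D. graph_dist G u v \<le> enat r)"

datatype reconf_rule = TS | TJ

definition reconf_move :: "reconf_rule \<Rightarrow> 'a ugraph \<Rightarrow> 'a set \<Rightarrow> 'a set \<Rightarrow> bool" where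
  "reconf_move R G D D' \<longleftrightarrow>
     (\<exists>x y. D - D' = {x} \<and> D' - D = {y} \<and> (R = TS \<longrightarrow> {x, y} \<in> edges G))"

definition is_reconf_sequence ::
    "reconf_rule \<Rightarrow> nat \<Rightarrow> 'a ugraph \<Rightarrow> 'a set \<Rightarrow> 'a set list \<Rightarrow> 'a set \<Rightarrow> bool" where
  "is_reconf_sequence R r G Ds S Dt \<longleftrightarrow>
     S \<noteq> [] \<and> hd S = Ds \<and> last S = Dt \<and>
     (\<forall>D \<in> set S. dist_dominating r G D) \<and> successively (reconf_move R G) S"

text \<open>
  An instance whose graph has vertex set \<^term>\<open>{..<n :: nat}\<close> is encoded by \<^term>\<open>n\<close> in unary, the
  adjacency matrix row by row, and the characteristic vectors of the two sets.
\<close>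

definition encode_instance :: "nat \<Rightarrow> nat ugraph \<Rightarrow> nat set \<Rightarrow> nat set \<Rightarrow> bool list" where
  "encode_instance n G Ds Dt =
     replicate n True @ [False] @
     concat (map (\<lambda>i. map (\<lambda>j. {i, j} \<in> edges G) [0..<n]) [0..<n]) @
     map (\<lambda>i. i \<in> Ds) [0..<n] @
     map (\<lambda>i. i \<in> Dt) [0..<n]"

text \<open>
  The language of yes-instances with input graphs restricted to the class \<^term>\<open>\<C>\<close>; every word
  that does not encode an instance is outside the language.
\<close>

definition DrDSR :: "nat \<Rightarrow> reconf_rule \<Rightarrow> (nat ugraph \<Rightarrow> bool) \<Rightarrow> language" where
  "DrDSR r R \<C> =
     {encode_instance n G Ds Dt | n G Ds Dt.
        simple_graph G \<and> verts G = {..<n} \<and> \<C> G \<and>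
        dist_dominating r G Ds \<and> dist_dominating r G Dt \<and>
        (\<exists>S. is_reconf_sequence R r G Ds S Dt)}"

lemma concat_map_upt_nth:
  assumes "j < n" "i < m"
  shows "concat (map (\<lambda>i. map (f i) [0..<n]) [0..<m]) ! (i * n + j) = f i j"
  using assms(2)
proof (induction m)
  case (Suc m)
  have len: "length (concat (map (\<lambda>i. map (f i) [0..<n]) [0..<m])) = m * n" for m
    by (induction m) auto
  show ?case
  proof (cases "i < m")
    case True
    then have "Suc i * n \<le> m * n" by (intro mult_right_mono) auto
    then have "i * n + j < m * n" using assms(1) by simp
    then show ?thesis using Suc.IH[OF True] by (simp add: nth_append len)
  next
    case False
    then have "i = m" using Suc.prems by simp
    then show ?thesis using assms(1) by (simp add: nth_append len)
  qed
qed simp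

lemma encode_instance_inj:
  assumes eq: "encode_instance n G Ds Dt = encode_instance n' G' Ds' Dt'"
    and G: "simple_graph G" "verts G = {..<n}" "Ds \<subseteq> verts G" "Dt \<subseteq> verts G"
    and G': "simple_graph G'" "verts G' = {..<n'}" "Ds' \<subseteq> verts G'" "Dt' \<subseteq> verts G'"
  shows "n = n' \<and> G = G' \<and> Ds = Ds' \<and> Dt = Dt'"
proof -
  have tw: "takeWhile id (replicate k True @ [False] @ zs) = replicate k True" for k zs
    by (induction k) auto
  have n: "n = n'"
    using arg_cong[OF eq, of "\<lambda>zs. length (takeWhile id zs)"]
    unfolding encode_instance_def tw by simp
  have len: "length (concat (map (\<lambda>i. map (f i) [0..<n]) [0..<m])) = m * n"
    for f :: "nat \<Rightarrow> nat \<Rightarrow> bool" and m by (induction m) auto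
  have split: "xs = xs' \<and> ys = ys'"
    if "xs @ ys = xs' @ ys'" "length xs = length xs'" for xs ys xs' ys' :: "bool list"
    using that by simp
  from eq have cat:
    "concat (map (\<lambda>i. map (\<lambda>j. {i, j} \<in> edges G) [0..<n]) [0..<n]) @
       map (\<lambda>i. i \<in> Ds) [0..<n] @ map (\<lambda>i. i \<in> Dt) [0..<n] =
     concat (map (\<lambda>i. map (\<lambda>j. {i, j} \<in> edges G') [0..<n]) [0..<n]) @
       map (\<lambda>i. i \<in> Ds') [0..<n] @ map (\<lambda>i. i \<in> Dt') [0..<n]"
    unfolding encode_instance_def n[symmetric] by (simp only: same_append_eq)
  have parts1: "concat (map (\<lambda>i. map (\<lambda>j. {i, j} \<in> edges G) [0..<n]) [0..<n]) =
       concat (map (\<lambda>i. map (\<lambda>j. {i, j} \<in> edges G') [0..<n]) [0..<n])"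
    and rest: "map (\<lambda>i. i \<in> Ds) [0..<n] @ map (\<lambda>i. i \<in> Dt) [0..<n] =
       map (\<lambda>i. i \<in> Ds') [0..<n] @ map (\<lambda>i. i \<in> Dt') [0..<n]"
    using split[OF cat] by (simp_all only: len)
  have D: "map (\<lambda>i. i \<in> Ds) [0..<n] = map (\<lambda>i. i \<in> Ds') [0..<n]"
    "map (\<lambda>i. i \<in> Dt) [0..<n] = map (\<lambda>i. i \<in> Dt') [0..<n]"
    using split[OF rest] by (simp_all only: length_map)
  have E: "{i, j} \<in> edges G \<longleftrightarrow> {i, j} \<in> edges G'" if "i < n" "j < n" for i j
  proof -
    have "{i, j} \<in> edges G \<longleftrightarrow>
        concat (map (\<lambda>i. map (\<lambda>j. {i, j} \<in> edges G) [0..<n]) [0..<n]) ! (i * n + j)"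
      by (rule concat_map_upt_nth[OF that(2,1), symmetric])
    also have "\<dots> \<longleftrightarrow> {i, j} \<in> edges G'"
      unfolding parts1 by (rule concat_map_upt_nth[OF that(2,1)])
    finally show ?thesis .
  qed
  have "e \<in> edges G \<longleftrightarrow> e \<in> edges G'" for e
  proof
    assume e: "e \<in> edges G"
    then obtain u v where "u < n" "v < n" "e = {u, v}"
      using G(1,2) by (auto simp: simple_graph_def)
    then show "e \<in> edges G'" using E e by simp
  next
    assume e: "e \<in> edges G'"
    then obtain u v where "u < n" "v < n" "e = {u, v}"
      using G'(1,2) n by (auto simp: simple_graph_def)
    then show "e \<in> edges G" using E e by simp
  qed
  then have "G = G'"
    using G(2) G'(2) n by (intro ugraph.equality) auto
  moreover have "Ds = Ds'"
    using D(1) G(2,3) G'(2,3) n unfolding map_eq_conv set_upt by fastforce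
  moreover have "Dt = Dt'"
    using D(2) G(2,4) G'(2,4) n unfolding map_eq_conv set_upt by fastforce
  ultimately show ?thesis using n by blast
qed

end

theory Submission imports Defs begin

text \<open>
  Hardness. A run of a space-bounded machine is turned into a reconfiguration problem for hitting
  sets: tokens stay on groups of elements whose positions spell out configurations, the sets to be
  hit are clauses that allow a copy of the configuration to be altered only towards its successor,
  and the goal can be reached exactly if the machine accepts. Making the elements a clique and hanging
  a path of length \<open>r\<close> at every set turns hitting sets into distance dominating sets of a
  chordal graph. Elements are pairwise adjacent, so both rules allow
  the moves that are needed.

  Membership. Machines are obtained by compiling bounded arithmetic formulas and bit generators,
  which suffices for the reduction as well. Chordality is recognised by iterating a polynomial-size
  fixpoint: a graph has a hole if two nonadjacent neighbours of a vertex \<open>b\<close> are joined by a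
  walk outside the closed neighbourhood of \<open>b\<close>. Reachability between token sets is decided
  by Savitch's algorithm, whose stack is kept in the memory of an iterated generator, which avoids
  nondeterministic machines.
\<close>

section \<open>Structured programs for multitape machines\<close>

text \<open>A move replaces a single token, whereas one step of a machine alters several components
  of a configuration at once. Three copies X, Y, Z and a phase variable remove this obstacle: phase
  0 forces X = Y, phase 1 forces Z to be the successor of X, phase 2 forces Y = Z, and phase 3
  forces the states of X and Z to be accepting. In each of the phases 0, 1, 2 two copies are tied
  together while the remaining one can be rewritten value by value, and the phase can change only
  when the conditions of both phases hold. Tokens cannot be used for anything else: the sets of
  possible values of the variables are pairwise disjoint and as numerous as the tokens, so every
  variable always holds exactly one value.

  On the side of machines, time is bounded only for the reduction. For membership a bound on the
  head positions suffices: a generator computes the next memory from the current one in polynomial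
  time, its output has polynomial length, and it is iterated until a formula holds, possibly for
  exponentially many rounds.\<close>

text \<open>\<open>Until k a c\<close> repeats \<open>c\<close> until tape \<open>k\<close> scans \<open>a\<close>.\<close>

datatype com =
    Nop
  | Go nat head_move
  | Put nat nat
  | Comp com com (infixr ";;" 60)
  | Branch nat nat com com
  | Until nat nat com

type_synonym tapes = "nat \<Rightarrow> tape"

text \<open>\<open>Q\<close> constrains every head position reached by a movement: the constant
  \<open>True\<close> leaves only the time, \<open>h < B\<close> bounds the space. Jumps of the
  compiled code are charged as well; the additional 1 in \<open>BranchT\<close> and
  \<open>UntilF\<close> pays for the jump over the other branch and for the jump back.\<close>

inductive exec :: "(nat \<Rightarrow> bool) \<Rightarrow> com \<Rightarrow> tapes \<Rightarrow> nat \<Rightarrow> tapes \<Rightarrow> bool" for Q where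
  Nop: "exec Q Nop s 0 s"
| Go: "Q (move_head d (snd (s k))) \<Longrightarrow>
    exec Q (Go k d) s 1 (s(k := act (scanned (s k), d) (s k)))"
| Put: "exec Q (Put k a) s 1 (s(k := act (a, Stay) (s k)))"
| Comp: "exec Q c1 s t1 s1 \<Longrightarrow> exec Q c2 s1 t2 s2 \<Longrightarrow> exec Q (c1 ;; c2) s (t1 + t2) s2"
| BranchT: "scanned (s k) = a \<Longrightarrow> exec Q c1 s t s' \<Longrightarrow> exec Q (Branch k a c1 c2) s (1 + t + 1) s'"
| BranchF: "scanned (s k) \<noteq> a \<Longrightarrow> exec Q c2 s t s' \<Longrightarrow> exec Q (Branch k a c1 c2) s (1 + t) s'"
| UntilT: "scanned (s k) = a \<Longrightarrow> exec Q (Until k a c) s 1 s"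
| UntilF: "scanned (s k) \<noteq> a \<Longrightarrow> exec Q c s t1 s1 \<Longrightarrow> exec Q (Until k a c) s1 t2 s2 \<Longrightarrow>
    exec Q (Until k a c) s (1 + t1 + 1 + t2) s2"

lemma exec_mono: "exec Q c s t s' \<Longrightarrow> (\<And>h. Q h \<Longrightarrow> Q' h) \<Longrightarrow> exec Q' c s t s'"
proof (induction rule: exec.induct)
  case (UntilF s k a c t1 s1 t2 s2)
  show ?case by (rule exec.UntilF) (use UntilF in auto)
next
  case (BranchT s k a c1 t s' c2)
  show ?case by (rule exec.BranchT) (use BranchT in auto)
next
  case (BranchF s k a c2 t s' c1)
  show ?case by (rule exec.BranchF) (use BranchF in auto)
next
  case (Comp c1 s t1 s1 c2 t2 s2)
  show ?case by (rule exec.Comp) (use Comp in auto)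
next
  case (Go d s k)
  show ?case by (rule exec.Go) (use Go in auto)
qed (rule exec.intros; assumption?)+

lemma snd_act [simp]: "snd (act (a, d) T) = move_head d (snd T)"
  by (simp add: act_def)

lemma act_scanned_Stay [simp]: "act (scanned T, Stay) T = T"
  by (simp add: act_def scanned_def)

lemma move_head_le: "move_head d h \<le> Suc h"
  by (cases d) auto

text \<open>A step moves a head by at most one cell, so a bound on the time is also a bound on the
  space.\<close>

lemma exec_heads_lt:
  "exec Q c s t s' \<Longrightarrow> (\<forall>k. snd (s k) < C) \<Longrightarrow> exec (\<lambda>h. h < C + t) c s t s' \<and> (\<forall>k. snd (s' k) < C + t)"
proof (induction arbitrary: C rule: exec.induct)
  case (Nop s)
  then show ?case by (auto intro: exec.Nop)
next
  case (Go d s k)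
  have *: "move_head d (snd (s k)) < C + 1"
    using move_head_le[of d "snd (s k)"] Go(2) by (metis Suc_eq_plus1 le_less_trans Suc_mono)
  have "exec (\<lambda>h. h < C + 1) (Go k d) s 1 (s(k := act (scanned (s k), d) (s k)))"
    using exec.Go[of "\<lambda>h. h < C + 1" d s k] * by simp
  moreover have "\<forall>i. snd ((s(k := act (scanned (s k), d) (s k))) i) < C + 1"
    using Go(2) * by (auto simp: less_SucI)
  ultimately show ?case by blast
next
  case (Put k a s)
  then have "\<forall>i. snd ((s(k := act (a, Stay) (s k))) i) < C + 1" by (auto simp: less_SucI)
  then show ?case using exec.Put by blast
next
  case (Comp c1 s t1 s1 c2 t2 s2)
  have 1: "exec (\<lambda>h. h < C + t1) c1 s t1 s1" "\<forall>k. snd (s1 k) < C + t1"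
    using Comp.IH(1) Comp.prems by auto
  have 2: "exec (\<lambda>h. h < C + t1 + t2) c2 s1 t2 s2" "\<forall>k. snd (s2 k) < C + t1 + t2"
    using Comp.IH(2)[OF 1(2)] by auto
  show ?case using exec.Comp[OF exec_mono[OF 1(1)] 2(1)] 2(2) by (auto simp: add.assoc)
next
  case (BranchT s k a c1 t s' c2)
  have 1: "exec (\<lambda>h. h < C + t) c1 s t s'" "\<forall>k. snd (s' k) < C + t"
    using BranchT.IH BranchT.prems by auto
  have "exec (\<lambda>h. h < C + (1 + t + 1)) (Branch k a c1 c2) s (1 + t + 1) s'"
    by (rule exec.BranchT[OF BranchT(1) exec_mono[OF 1(1)]]) simp
  then show ?case using 1(2) by (auto simp: less_SucI)
next
  case (BranchF s k a c2 t s' c1)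
  have 1: "exec (\<lambda>h. h < C + t) c2 s t s'" "\<forall>k. snd (s' k) < C + t"
    using BranchF.IH BranchF.prems by auto
  have "exec (\<lambda>h. h < C + (1 + t)) (Branch k a c1 c2) s (1 + t) s'"
    by (rule exec.BranchF[OF BranchF(1) exec_mono[OF 1(1)]]) simp
  then show ?case using 1(2) by (auto simp: less_SucI)
next
  case (UntilT s k a c)
  show ?case using exec.UntilT[of s k a _ c] UntilT by (auto simp: less_SucI)
next
  case (UntilF s k a c t1 s1 t2 s2)
  have 1: "exec (\<lambda>h. h < C + t1) c s t1 s1" "\<forall>k. snd (s1 k) < C + t1"
    using UntilF.IH(1) UntilF.prems by auto
  have 2: "exec (\<lambda>h. h < C + t1 + t2) (Until k a c) s1 t2 s2" "\<forall>k. snd (s2 k) < C + t1 + t2"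
    using UntilF.IH(2)[OF 1(2)] by auto
  have "exec (\<lambda>h. h < C + (1 + t1 + 1 + t2)) (Until k a c) s (1 + t1 + 1 + t2) s2"
    by (rule exec.UntilF[OF UntilF(1) exec_mono[OF 1(1)] exec_mono[OF 2(1)]]) auto
  moreover have "\<forall>k. snd (s2 k) < C + (1 + t1 + 1 + t2)"
    using 2(2) by (metis add.assoc add.commute trans_less_add2)
  ultimately show ?case by blast
qed

section \<open>Compilation of programs into machine instructions\<close>

text \<open>An instruction reads one tape; the symbol found there determines the symbol written, the
  head movement and the next state.\<close>

type_synonym instr = "nat \<times> (nat \<Rightarrow> nat \<times> head_move \<times> nat)"

fun csize :: "com \<Rightarrow> nat" where
  "csize Nop = 0"
| "csize (Go k d) = 1"
| "csize (Put k a) = 1"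
| "csize (c1 ;; c2) = csize c1 + csize c2"
| "csize (Branch k a c1 c2) = csize c1 + csize c2 + 2"
| "csize (Until k a c) = csize c + 2"

text \<open>Addresses are absolute: \<open>p\<close> belongs to the first instruction, and control
  leaves the block at \<open>p + csize c\<close>. Besides its bodies, \<open>Branch\<close> needs a
  test and a jump over the second body, \<open>Until\<close> a test and a jump back.\<close>

fun code :: "com \<Rightarrow> nat \<Rightarrow> instr list" where
  "code Nop p = []"
| "code (Go k d) p = [(k, \<lambda>\<sigma>. (\<sigma>, d, p + 1))]"
| "code (Put k a) p = [(k, \<lambda>\<sigma>. (a, Stay, p + 1))]"
| "code (c1 ;; c2) p = code c1 p @ code c2 (p + csize c1)"
| "code (Branch k a c1 c2) p =
     (k, \<lambda>\<sigma>. (\<sigma>, Stay, if \<sigma> = a then p + 1 else p + 2 + csize c1)) # code c1 (p + 1) @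
     (k, \<lambda>\<sigma>. (\<sigma>, Stay, p + 2 + csize c1 + csize c2)) # code c2 (p + 2 + csize c1)"
| "code (Until k a c) p =
     (k, \<lambda>\<sigma>. (\<sigma>, Stay, if \<sigma> = a then p + 2 + csize c else p + 1)) # code c (p + 1) @
     [(k, \<lambda>\<sigma>. (\<sigma>, Stay, p))]"

fun wf_com :: "nat \<Rightarrow> com \<Rightarrow> bool" where
  "wf_com K Nop = True"
| "wf_com K (Go k d) = (k < K)"
| "wf_com K (Put k a) = (k < K \<and> a < 4)"
| "wf_com K (c1 ;; c2) = (wf_com K c1 \<and> wf_com K c2)"
| "wf_com K (Branch k a c1 c2) = (k < K \<and> wf_com K c1 \<and> wf_com K c2)"
| "wf_com K (Until k a c) = (k < K \<and> wf_com K c)"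

lemma length_code [simp]: "length (code c p) = csize c"
  by (induction c arbitrary: p) auto

lemma wf_com_mono: "wf_com K c \<Longrightarrow> K \<le> K' \<Longrightarrow> wf_com K' c"
  by (induction c) auto

definition wf_instr :: "nat \<Rightarrow> nat \<Rightarrow> instr \<Rightarrow> bool" where
  "wf_instr K n I \<longleftrightarrow> fst I < K \<and>
     (\<forall>\<sigma> < 4. case snd I \<sigma> of (\<sigma>', d, q) \<Rightarrow> \<sigma>' < 4 \<and> q \<le> n)"

lemma wf_instr_Pair [simp]: "wf_instr K n (k, f) \<longleftrightarrow>
    k < K \<and> (\<forall>\<sigma> < 4. case f \<sigma> of (\<sigma>', d, q) \<Rightarrow> \<sigma>' < 4 \<and> q \<le> n)"
  by (simp add: wf_instr_def)

lemma wf_code: "wf_com K c \<Longrightarrow> p + csize c \<le> n \<Longrightarrow> I \<in> set (code c p) \<Longrightarrow> wf_instr K n I"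
proof (induction c arbitrary: p)
  case (Comp c1 c2)
  then show ?case using Comp.IH(1)[of p] Comp.IH(2)[of "p + csize c1"] by auto
next
  case (Branch k a c1 c2)
  then show ?case using Branch.IH(1)[of "p + 1"] Branch.IH(2)[of "p + 2 + csize c1"] by auto
next
  case (Until k a c)
  then show ?case using Until.IH[of "p + 1"] by auto
qed auto

text \<open>Tape 1 of a program becomes the last tape of the machine, which carries the output.\<close>

definition pos :: "nat \<Rightarrow> nat \<Rightarrow> nat" where
  "pos K k = (if k = 0 then 0 else K - k)"

definition lay :: "nat \<Rightarrow> tapes \<Rightarrow> tape list" where
  "lay K s = map (\<lambda>j. s (pos K j)) [0..<K]"

lemma length_lay [simp]: "length (lay K s) = K"
  by (simp add: lay_def)

lemma pos_lt: "k < K \<Longrightarrow> pos K k < K"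
  by (auto simp: pos_def)

lemma pos_pos: "k < K \<Longrightarrow> pos K (pos K k) = k"
  by (auto simp: pos_def)

lemma lay_nth: "k < K \<Longrightarrow> lay K s ! pos K k = s k"
  by (simp add: lay_def pos_lt pos_pos)

lemma lay_upd: "k < K \<Longrightarrow> lay K (s(k := T)) = (lay K s)[pos K k := T]"
  by (rule nth_equalityI) (auto simp: lay_def nth_list_update pos_lt pos_pos)

lemma heads_lay: "\<forall>k. Q (snd (s k)) \<Longrightarrow> \<forall>T \<in> set (lay K s). Q (snd T)"
  by (simp add: lay_def)

text \<open>State 0 only jumps to state 3, the address of the first instruction; the last instruction
  decides between acceptance and rejection.\<close>

definition machine :: "nat \<Rightarrow> instr list \<Rightarrow> tm" where
  "machine K is = \<lparr> tm_tapes = K, tm_states = length is + 3, tm_symbols = 4,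
     tm_trans = (\<lambda>q ss.
       let stay = map (\<lambda>\<sigma>. (\<sigma>, Stay)) ss in
       if q < 3 then (3, stay)
       else case is ! (q - 3) of (k, f) \<Rightarrow>
         (case f (ss ! pos K k) of (\<sigma>, d, q') \<Rightarrow> (q', stay[pos K k := (\<sigma>, d)]))) \<rparr>"

definition tm_of_com :: "nat \<Rightarrow> com \<Rightarrow> nat \<Rightarrow> nat \<Rightarrow> tm" where
  "tm_of_com K c k a =
     machine K (code c 3 @ [(k, \<lambda>\<sigma>. (\<sigma>, Stay, if \<sigma> = a then accept_state else reject_state))])"

lemma wf_machine:
  assumes wi: "\<And>I. I \<in> set is \<Longrightarrow> wf_instr K (length is + 2) I" and ne: "is \<noteq> []" and "0 < K"
  shows "wf_tm (machine K is)"
proof -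
  have "case tm_trans (machine K is) q ss of (q', as) \<Rightarrow>
           q' < length is + 3 \<and> length as = K \<and> (\<forall>(s, d) \<in> set as. s < 4)"
    if q: "q < length is + 3" and ss: "length ss = K" "\<forall>s \<in> set ss. s < 4" for q ss
  proof (cases "q < 3")
    case True
    then show ?thesis using ss ne by (auto simp: machine_def Let_def)
  next
    case False
    obtain k f where I: "is ! (q - 3) = (k, f)" by (cases "is ! (q - 3)")
    have "q - 3 < length is" using q False by linarith
    then have w: "wf_instr K (length is + 2) (k, f)" using wi[of "is ! (q - 3)"] I nth_mem[of "q - 3" "is"] by simp
    obtain \<sigma> d q' where f: "f (ss ! pos K k) = (\<sigma>, d, q')" by (cases "f (ss ! pos K k)")
    have "k < K" using w by simp
    then have "ss ! pos K k < 4" using ss pos_lt[of k K] by simp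
    then have *: "\<sigma> < 4" "q' \<le> length is + 2" using w f by fastforce+
    have as: "\<forall>(s, d') \<in> set ((map (\<lambda>\<sigma>. (\<sigma>, Stay)) ss)[pos K k := (\<sigma>, d)]). s < 4"
    proof
      fix z assume "z \<in> set ((map (\<lambda>\<sigma>. (\<sigma>, Stay)) ss)[pos K k := (\<sigma>, d)])"
      then have "z \<in> insert (\<sigma>, d) (set (map (\<lambda>\<sigma>. (\<sigma>, Stay)) ss))"
        by (rule subsetD[OF set_update_subset_insert])
      then show "case z of (s, d') \<Rightarrow> s < 4" using ss * by auto
    qed
    have "tm_trans (machine K is) q ss = (q', (map (\<lambda>\<sigma>. (\<sigma>, Stay)) ss)[pos K k := (\<sigma>, d)])"
      using False I f by (simp add: machine_def Let_def)
    then show ?thesis using as ss * by simp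
  qed
  then show ?thesis using ne \<open>0 < K\<close> unfolding wf_tm_def
    by (simp add: machine_def Suc_le_eq)
qed

lemma wf_tm_of_com:
  assumes "wf_com K c" "k < K" 
  shows "wf_tm (tm_of_com K c k a)"
  unfolding tm_of_com_def
proof (rule wf_machine)
  fix I assume "I \<in> set (code c 3 @ [(k, \<lambda>\<sigma>. (\<sigma>, Stay, if \<sigma> = a then accept_state else reject_state))])"
  then consider "I \<in> set (code c 3)" | "I = (k, \<lambda>\<sigma>. (\<sigma>, Stay, if \<sigma> = a then accept_state else reject_state))"
    by auto
  then show "wf_instr K (length (code c 3 @ [(k, \<lambda>\<sigma>. (\<sigma>, Stay, if \<sigma> = a then accept_state else reject_state))]) + 2) I"
  proof cases
    case 1
    show ?thesis by (rule wf_code[OF assms(1) _ 1]) simp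
  next
    case 2
    then show ?thesis using assms(2) by simp
  qed
qed (use assms in simp_all)

lemma map2_act_lay:
  assumes "k < K"
  shows "map2 act ((map (\<lambda>\<sigma>. (\<sigma>, Stay)) (map scanned (lay K s)))[pos K k := (\<sigma>, d)]) (lay K s)
       = lay K (s(k := act (\<sigma>, d) (s k)))"
  unfolding lay_upd[OF assms]
proof (rule nth_equalityI)
  fix i
  assume "i < length (map2 act ((map (\<lambda>\<sigma>. (\<sigma>, Stay)) (map scanned (lay K s)))[pos K k := (\<sigma>, d)]) (lay K s))"
  then have "i < K" by simp
  then show "map2 act ((map (\<lambda>\<sigma>. (\<sigma>, Stay)) (map scanned (lay K s)))[pos K k := (\<sigma>, d)]) (lay K s) ! i
      = (lay K s)[pos K k := act (\<sigma>, d) (s k)] ! i"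
    using lay_nth[OF assms, of s] by (cases "i = pos K k") (auto simp: nth_list_update)
qed simp

lemma step_machine:
  assumes "is = xs @ (k, f) # ys" "length xs + 3 = q" "k < K" "f (scanned (s k)) = (\<sigma>, d, q')"
  shows "step (machine K is) (q, lay K s) = (q', lay K (s(k := act (\<sigma>, d) (s k))))"
proof -
  have "is ! (q - 3) = (k, f)" using assms(1,2) by (auto simp: nth_append)
  moreover have "f (map scanned (lay K s) ! pos K k) = (\<sigma>, d, q')"
    using assms(3,4) lay_nth[OF assms(3), of s] pos_lt[OF assms(3)] by simp
  ultimately show ?thesis using assms(2) map2_act_lay[OF assms(3), of s \<sigma> d]
    by (auto simp: step_def halted_def machine_def Let_def)
qed

lemma step_machine_stay:
  assumes "is = xs @ (k, f) # ys" "length xs + 3 = q" "k < K" "f (scanned (s k)) = (scanned (s k), Stay, q')"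
  shows "step (machine K is) (q, lay K s) = (q', lay K s)"
  using step_machine[of "is" xs k f ys q K s, OF assms(1-3)] assms(4) by simp

section \<open>Machine runs with a condition on all head positions\<close>

definition reaches_in :: "(nat \<Rightarrow> bool) \<Rightarrow> tm \<Rightarrow> config \<Rightarrow> nat \<Rightarrow> config \<Rightarrow> bool" where
  "reaches_in Q M c t c' \<longleftrightarrow> (step M ^^ t) c = c' \<and>
     (\<forall>u \<le> t. \<forall>T \<in> set (snd ((step M ^^ u) c)). Q (snd T))"

lemma reaches_in_0: "(\<forall>T \<in> set (snd c). Q (snd T)) \<Longrightarrow> reaches_in Q M c 0 c"
  by (simp add: reaches_in_def)

lemma reaches_in_trans:
  assumes "reaches_in Q M c t c'" "reaches_in Q M c' t' c''"
  shows "reaches_in Q M c (t + t') c''"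
proof -
  have eq: "(step M ^^ (t + u)) c = (step M ^^ u) c'" for u
    using assms(1) funpow_add[of u t "step M"] by (simp add: reaches_in_def add.commute)
  have "\<forall>T \<in> set (snd ((step M ^^ u) c)). Q (snd T)" if "u \<le> t + t'" for u
  proof (cases "u \<le> t")
    case True then show ?thesis using assms(1) by (simp add: reaches_in_def)
  next
    case False
    then have "u = t + (u - t)" "u - t \<le> t'" using that by linarith+
    then obtain v where "u = t + v" "v \<le> t'" by blast
    then show ?thesis using assms(2) eq[of v] by (simp add: reaches_in_def)
  qed
  then show ?thesis using assms(2) eq[of t'] by (simp add: reaches_in_def)
qed

lemma reaches_in_step:
  assumes "step M c = c'" "\<forall>T \<in> set (snd c). Q (snd T)" "\<forall>T \<in> set (snd c'). Q (snd T)"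
  shows "reaches_in Q M c 1 c'"
  using assms by (auto simp: reaches_in_def le_Suc_eq)

lemma reaches_in_step_lay:
  assumes "step M (q, lay K s) = (q', lay K s')" "\<forall>k. Q (snd (s k))" "\<forall>k. Q (snd (s' k))"
  shows "reaches_in Q M (q, lay K s) 1 (q', lay K s')"
  using reaches_in_step[OF assms(1)] heads_lay[OF assms(2)] heads_lay[OF assms(3)] by simp

text \<open>Induction over the execution, with the code placed anywhere in the instruction list. The
  prefix \<open>xs\<close> must have the length that makes \<open>p\<close> the address of the
  block; the offset 3 comes from the reserved states 0, 1 and 2.\<close>

lemma exec_machine:
  assumes "exec Q c s t s'" "wf_com K c" "is = xs @ code c p @ ys" "length xs + 3 = p" "\<forall>k. Q (snd (s k))"
  shows "reaches_in Q (machine K is) (p, lay K s) t (p + csize c, lay K s') \<and> (\<forall>k. Q (snd (s' k)))"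
  using assms
proof (induction arbitrary: xs ys p rule: exec.induct)
  case (Nop s)
  have "\<forall>T\<in>set (lay K s). Q (snd T)" by (rule heads_lay[OF Nop.prems(4)])
  then have "reaches_in Q (machine K is) (p, lay K s) 0 (p, lay K s)" by (intro reaches_in_0) simp
  with Nop.prems(4) show ?case by simp
next
  case (Go d s k)
  let ?s = "s(k := act (scanned (s k), d) (s k))"
  have "step (machine K is) (p, lay K s) = (p + 1, lay K ?s)"
    by (rule step_machine[of "is" xs k _ ys]) (use Go in simp_all)
  moreover have *: "\<forall>k. Q (snd (?s k))" using Go by auto
  ultimately have "reaches_in Q (machine K is) (p, lay K s) 1 (p + 1, lay K ?s)"
    using Go.prems(4) by (intro reaches_in_step_lay)
  then show ?case using * unfolding csize.simps by blast
next
  case (Put k a s)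
  let ?s = "s(k := act (a, Stay) (s k))"
  have "step (machine K is) (p, lay K s) = (p + 1, lay K ?s)"
    by (rule step_machine[of "is" xs k _ ys]) (use Put in simp_all)
  moreover have *: "\<forall>k. Q (snd (?s k))" using Put by auto
  ultimately have "reaches_in Q (machine K is) (p, lay K s) 1 (p + 1, lay K ?s)"
    using Put.prems(4) by (intro reaches_in_step_lay)
  then show ?case using * unfolding csize.simps by blast
next
  case (Comp c1 s t1 s1 c2 t2 s2)
  have 1: "reaches_in Q (machine K is) (p, lay K s) t1 (p + csize c1, lay K s1) \<and> (\<forall>k. Q (snd (s1 k)))"
    by (rule Comp.IH(1)[of xs p "code c2 (p + csize c1) @ ys"]) (use Comp.prems in simp_all)
  have 2: "reaches_in Q (machine K is) (p + csize c1, lay K s1) t2 (p + csize c1 + csize c2, lay K s2) \<and> (\<forall>k. Q (snd (s2 k)))"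
    by (rule Comp.IH(2)[of "xs @ code c1 p" "p + csize c1" "ys"]) (use Comp.prems 1 in simp_all)
  show ?case using reaches_in_trans 1 2 by (fastforce simp: add.assoc)
next
  case (BranchT s k a c1 t s' c2)
  let ?p = "p + csize (Branch k a c1 c2)"
  note H = BranchT.prems(4)
  have "step (machine K is) (p, lay K s) = (p + 1, lay K s)"
    by (rule step_machine_stay[of _ xs k "(\<lambda>\<sigma>. (\<sigma>, Stay, if \<sigma> = a then p + 1 else p + 2 + csize c1))"])
       (use BranchT.prems BranchT.hyps in simp_all)
  then have 0: "reaches_in Q (machine K is) (p, lay K s) 1 (p + 1, lay K s)"
    using H by (intro reaches_in_step_lay)
  have 1: "reaches_in Q (machine K is) (p + 1, lay K s) t (p + 1 + csize c1, lay K s') \<and> (\<forall>k. Q (snd (s' k)))"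
    by (rule BranchT.IH[of "xs @ [(k, \<lambda>\<sigma>. (\<sigma>, Stay, if \<sigma> = a then p + 1 else p + 2 + csize c1))]" "p + 1"
         "(k, \<lambda>\<sigma>. (\<sigma>, Stay, p + 2 + csize c1 + csize c2)) # code c2 (p + 2 + csize c1) @ ys"])
       (use BranchT.prems in simp_all)
  have "step (machine K is) (p + 1 + csize c1, lay K s') = (?p, lay K s')"
    by (rule step_machine_stay[of "is" "xs @ (k, \<lambda>\<sigma>. (\<sigma>, Stay, if \<sigma> = a then p + 1 else p + 2 + csize c1)) # code c1 (p + 1)"
         k "\<lambda>\<sigma>. (\<sigma>, Stay, p + 2 + csize c1 + csize c2)" "code c2 (p + 2 + csize c1) @ ys"])
       (use BranchT.prems in simp_all)
  then have 2: "reaches_in Q (machine K is) (p + 1 + csize c1, lay K s') 1 (?p, lay K s')"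
    using conjunct2[OF 1] by (intro reaches_in_step_lay)
  show ?case using reaches_in_trans[OF reaches_in_trans[OF 0 conjunct1[OF 1]] 2] 1 by simp
next
  case (BranchF s k a c2 t s' c1)
  let ?p = "p + csize (Branch k a c1 c2)"
  note H = BranchF.prems(4)
  have "step (machine K is) (p, lay K s) = (p + 2 + csize c1, lay K s)"
    by (rule step_machine_stay[of _ xs k "(\<lambda>\<sigma>. (\<sigma>, Stay, if \<sigma> = a then p + 1 else p + 2 + csize c1))"])
       (use BranchF.prems BranchF.hyps in simp_all)
  then have 0: "reaches_in Q (machine K is) (p, lay K s) 1 (p + 2 + csize c1, lay K s)"
    using H by (intro reaches_in_step_lay)
  have 1: "reaches_in Q (machine K is) (p + 2 + csize c1, lay K s) t (p + 2 + csize c1 + csize c2, lay K s') \<and> (\<forall>k. Q (snd (s' k)))"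
    by (rule BranchF.IH[of "xs @ (k, \<lambda>\<sigma>. (\<sigma>, Stay, if \<sigma> = a then p + 1 else p + 2 + csize c1)) # code c1 (p + 1) @
     [(k, \<lambda>\<sigma>. (\<sigma>, Stay, p + 2 + csize c1 + csize c2))]"])
       (use BranchF.prems in simp_all)
  show ?case using reaches_in_trans[OF 0 conjunct1[OF 1]] 1 by (simp add: algebra_simps)
next
  case (UntilT s k a c)
  note H = UntilT.prems(4)
  have "step (machine K is) (p, lay K s) = (p + csize (Until k a c), lay K s)"
    by (rule step_machine_stay[of _ xs k "(\<lambda>\<sigma>. (\<sigma>, Stay, if \<sigma> = a then p + 2 + csize c else p + 1))"])
       (use UntilT.prems UntilT.hyps in simp_all)
  then show ?case using reaches_in_step_lay[OF _ H H] H by blast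
next
  case (UntilF s k a c t1 s1 t2 s2)
  note H = UntilF.prems(4)
  have "step (machine K is) (p, lay K s) = (p + 1, lay K s)"
    by (rule step_machine_stay[of _ xs k "(\<lambda>\<sigma>. (\<sigma>, Stay, if \<sigma> = a then p + 2 + csize c else p + 1))"])
       (use UntilF.prems UntilF.hyps in simp_all)
  then have 0: "reaches_in Q (machine K is) (p, lay K s) 1 (p + 1, lay K s)"
    using H by (intro reaches_in_step_lay)
  have 1: "reaches_in Q (machine K is) (p + 1, lay K s) t1 (p + 1 + csize c, lay K s1) \<and> (\<forall>k. Q (snd (s1 k)))"
    by (rule UntilF.IH(1)[of "xs @ [(k, \<lambda>\<sigma>. (\<sigma>, Stay, if \<sigma> = a then p + 2 + csize c else p + 1))]" "p + 1"])
       (use UntilF.prems in simp_all)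
  have "step (machine K is) (p + 1 + csize c, lay K s1) = (p, lay K s1)"
    by (rule step_machine_stay[of "is" "xs @ (k, \<lambda>\<sigma>. (\<sigma>, Stay, if \<sigma> = a then p + 2 + csize c else p + 1)) # code c (p + 1)"
         k "\<lambda>\<sigma>. (\<sigma>, Stay, p)" ys])
       (use UntilF.prems in simp_all)
  then have 2: "reaches_in Q (machine K is) (p + 1 + csize c, lay K s1) 1 (p, lay K s1)"
    using conjunct2[OF 1] by (intro reaches_in_step_lay)
  have 3: "reaches_in Q (machine K is) (p, lay K s1) t2 (p + csize (Until k a c), lay K s2) \<and> (\<forall>k. Q (snd (s2 k)))"
    by (rule UntilF.IH(2)[of xs p ys]) (use UntilF.prems 1 in simp_all)
  show ?case using reaches_in_trans[OF reaches_in_trans[OF reaches_in_trans[OF 0 conjunct1[OF 1]] 2] conjunct1[OF 3]] 3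
    by simp
qed

section \<open>Runs of a compiled program on an input word\<close>

definition initial :: "bool list \<Rightarrow> tapes" where
  "initial x = (\<lambda>k. if k = 0 then tape_of x else tape_of [])"

lemma lay_initial:
  assumes "0 < K"
  shows "lay K (initial x) = tape_of x # replicate (K - 1) (tape_of [])"
proof (rule nth_equalityI)
  fix i assume "i < length (lay K (initial x))"
  then show "lay K (initial x) ! i = (tape_of x # replicate (K - 1) (tape_of [])) ! i"
    by (cases i) (simp_all add: lay_def initial_def pos_def)
qed (use assms in simp)

text \<open>The two additional steps leave state 0 and take the final decision. A halted
  configuration is frozen, so the condition on the heads extends from the run of the program to all
  times.\<close>

lemma tm_of_com_run:
  assumes "exec Q c (initial x) t s'" "wf_com K c" "k < K" "Q 0"
    and M_def: "M = tm_of_com K c k a"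
  shows "run M x (t + 2) = (if scanned (s' k) = a then accept_state else reject_state, lay K s')"
    and "T \<in> set (snd (run M x u)) \<Longrightarrow> Q (snd T)"
proof -
  let ?f = "\<lambda>\<sigma>. (\<sigma>, Stay, if \<sigma> = a then accept_state else reject_state)"
  let ?is = "code c 3 @ [(k, ?f)]"
  let ?q = "if scanned (s' k) = a then accept_state else reject_state"
  have M: "M = machine K ?is" by (simp add: M_def tm_of_com_def)
  have H: "\<forall>k. Q (snd (initial x k))" using assms(4) by (simp add: initial_def tape_of_def)
  have i: "init_config M x = (0, lay K (initial x))"
    using assms(3) by (simp add: init_config_def lay_initial M machine_def)
  have st: "map2 act (map (\<lambda>\<sigma>. (\<sigma>, Stay)) (map scanned Ts)) Ts = Ts" for Ts
    by (induction Ts) auto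
  have "step M (0, lay K (initial x)) = (3, lay K (initial x))"
    using st by (simp add: step_def halted_def M machine_def Let_def o_def)
  then have 0: "reaches_in Q M (0, lay K (initial x)) 1 (3, lay K (initial x))"
    using H by (intro reaches_in_step_lay)
  have 1: "reaches_in Q M (3, lay K (initial x)) t (3 + csize c, lay K s') \<and> (\<forall>k. Q (snd (s' k)))"
    unfolding M by (rule exec_machine[OF assms(1,2)]) (use H in simp_all)
  have "step M (3 + csize c, lay K s') = (?q, lay K s')"
    unfolding M by (rule step_machine_stay[of _ "code c 3" k ?f "[]"]) (use assms(3) in simp_all)
  then have 2: "reaches_in Q M (3 + csize c, lay K s') 1 (?q, lay K s')"
    using conjunct2[OF 1] by (intro reaches_in_step_lay)
  have R: "reaches_in Q M (0, lay K (initial x)) (t + 2) (?q, lay K s')"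
    using reaches_in_trans[OF reaches_in_trans[OF 0 conjunct1[OF 1]] 2] by simp
  then show run: "run M x (t + 2) = (?q, lay K s')" by (simp add: run_def i reaches_in_def)
  show "Q (snd T)" if "T \<in> set (snd (run M x u))"
  proof (cases "u \<le> t + 2")
    case True
    then show ?thesis using R that by (simp add: run_def i reaches_in_def)
  next
    case False
    have "step M (run M x (t + 2)) = run M x (t + 2)"
      unfolding run by (simp add: step_def halted_def)
    then have "(step M ^^ v) (run M x (t + 2)) = run M x (t + 2)" for v
      by (induction v) auto
    moreover have "run M x u = (step M ^^ (u - (t + 2))) (run M x (t + 2))"
    proof -
      have "step M ^^ u = (step M ^^ (u - (t + 2))) \<circ> (step M ^^ (t + 2))"
        using False funpow_add[of "u - (t + 2)" "t + 2" "step M"]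
        by (simp only: le_add_diff_inverse2 not_le less_imp_le)
      then show ?thesis by (simp add: run_def)
    qed
    ultimately have "run M x u = run M x (t + 2)" by simp
    then have "snd (run M x u) = lay K s'" by (simp only: run snd_conv)
    then show ?thesis using that heads_lay[OF conjunct2[OF 1]] by simp
  qed
qed

section \<open>Register programs\<close>

definition runs :: "nat \<Rightarrow> com \<Rightarrow> tapes \<Rightarrow> tapes \<Rightarrow> bool" where
  "runs T c s s' \<longleftrightarrow> (\<exists>t \<le> T. exec (\<lambda>_. True) c s t s')"

lemma runs_mono: "runs T c s s' \<Longrightarrow> T \<le> T' \<Longrightarrow> runs T' c s s'"
  unfolding runs_def using le_trans by blast

lemma runs_Nop: "runs 0 Nop s s"
  unfolding runs_def using exec.Nop by blast

lemma act_scanned: "act (scanned T, d) T = (fst T, move_head d (snd T))"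
  by (simp add: act_def scanned_def)

lemma runs_Go: "s' = s(k := (fst (s k), move_head d (snd (s k)))) \<Longrightarrow> runs 1 (Go k d) s s'"
  unfolding runs_def using exec.Go[of "\<lambda>_. True" d s k] by (auto simp: act_scanned)

lemma runs_Put: "s' = s(k := ((fst (s k))(snd (s k) := a), snd (s k))) \<Longrightarrow> runs 1 (Put k a) s s'"
  unfolding runs_def using exec.Put[of "\<lambda>_. True" k a s] by (auto simp: act_def)

lemma runs_Comp: "runs T1 c1 s s1 \<Longrightarrow> runs T2 c2 s1 s2 \<Longrightarrow> runs (T1 + T2) (c1 ;; c2) s s2"
  unfolding runs_def using exec.Comp add_mono by blast

lemma runs_Branch:
  assumes "scanned (s k) = a \<Longrightarrow> runs T c1 s s'" "scanned (s k) \<noteq> a \<Longrightarrow> runs T c2 s s'"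
  shows "runs (T + 2) (Branch k a c1 c2) s s'"
proof (cases "scanned (s k) = a")
  case True
  then obtain t where "t \<le> T" "exec (\<lambda>_. True) c1 s t s'" using assms unfolding runs_def by blast
  then show ?thesis unfolding runs_def using exec.BranchT[of s k a _ c1 t s' c2] True
    by (intro exI[of _ "1 + t + 1"]) auto
next
  case False
  then obtain t where "t \<le> T" "exec (\<lambda>_. True) c2 s t s'" using assms unfolding runs_def by blast
  then show ?thesis unfolding runs_def using exec.BranchF[of s k a _ c2 t s' c1] False
    by (intro exI[of _ "1 + t"]) auto
qed

lemma runs_Until_done: "scanned (s k) = a \<Longrightarrow> runs 1 (Until k a c) s s"
  unfolding runs_def using exec.UntilT by blast

lemma runs_Until_step:
  assumes "scanned (s k) \<noteq> a" "runs T1 c s s1" "runs T2 (Until k a c) s1 s2"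
  shows "runs (T1 + 2 + T2) (Until k a c) s s2"
proof -
  obtain t1 t2 where "t1 \<le> T1" "exec (\<lambda>_. True) c s t1 s1" "t2 \<le> T2" "exec (\<lambda>_. True) (Until k a c) s1 t2 s2"
    using assms(2,3) unfolding runs_def by blast
  then show ?thesis unfolding runs_def using exec.UntilF[of s k a _ c t1 s1 t2 s2] assms(1)
    by (intro exI[of _ "1 + t1 + 1 + t2"]) auto
qed

text \<open>A rule for loops whose number of rounds is known in advance: states are indexed by the
  rounds still to go, so that the exit condition becomes \<open>i = 0\<close>. Each round pays 2 for
  the test and the jump back.\<close>

lemma runs_countdown:
  assumes "\<And>i. i \<le> n \<Longrightarrow> scanned (S i k) = a \<longleftrightarrow> i = 0"
    and "\<And>i. i < n \<Longrightarrow> runs T c (S (Suc i)) (S i)"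
  shows "runs ((T + 2) * n + 1) (Until k a c) (S n) (S 0)"
  using assms
proof (induction n)
  case 0
  then show ?case using runs_Until_done[of "S 0" k a c] by simp
next
  case (Suc n)
  have "runs (T + 2 + ((T + 2) * n + 1)) (Until k a c) (S (Suc n)) (S 0)"
    by (rule runs_Until_step) (use Suc in auto)
  then show ?case by simp
qed

section \<open>Tapes as registers\<close>

definition cont :: "bool list \<Rightarrow> nat \<Rightarrow> nat" where
  "cont x = fst (tape_of x)"

lemma tape_of_eq: "tape_of x = (cont x, 0)"
  by (simp add: cont_def tape_of_def)

lemma bit_sym_simps [simp]: "bit_sym b \<noteq> 0" "bit_sym b \<noteq> Suc 0" "bit_sym b = 2 \<longleftrightarrow> \<not> b" "bit_sym b = 3 \<longleftrightarrow> b"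
  by (auto simp: bit_sym_def)

lemma cont_eq_1 [simp]: "cont x i = Suc 0 \<longleftrightarrow> i = 0"
  by (simp add: cont_def tape_of_def start_sym_def blank_sym_def)

lemma cont_eq_0 [simp]: "cont x i = 0 \<longleftrightarrow> length x < i"
  by (auto simp: cont_def tape_of_def start_sym_def blank_sym_def)

lemma cont_Suc: "cont x (Suc i) = (if i < length x then bit_sym (x ! i) else 0)"
  by (auto simp: cont_def tape_of_def blank_sym_def Suc_le_eq)

lemma cont_eq_3: "cont x (Suc i) = 3 \<longleftrightarrow> i < length x \<and> x ! i"
  by (simp add: cont_Suc)

lemma cont_snoc: "(cont bs)(Suc (length bs) := bit_sym b) = cont (bs @ [b])"
proof
  fix i show "((cont bs)(Suc (length bs) := bit_sym b)) i = cont (bs @ [b]) i"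
    by (cases i) (auto simp: cont_Suc nth_append cont_def tape_of_def)
qed

text \<open>Register \<open>r\<close> is the head position of tape \<open>r + 3\<close>, whose content never changes. Tape 0 holds
  the input, tape 1 the output and tape 2 a bit string serving as memory.\<close>

definition mk :: "tape \<Rightarrow> tape \<Rightarrow> tape \<Rightarrow> (nat \<Rightarrow> nat) \<Rightarrow> tapes" where
  "mk a b m \<rho> = (\<lambda>k. if k = 0 then a else if k = 1 then b else if k = 2 then m else (cont [], \<rho> (k - 3)))"

lemma mk_simps [simp]:
  "mk a b m \<rho> 0 = a" "mk a b m \<rho> (Suc 0) = b" "mk a b m \<rho> 2 = m" "mk a b m \<rho> (r + 3) = (cont [], \<rho> r)"
  "(mk a b m \<rho>)(0 := z) = mk z b m \<rho>" "(mk a b m \<rho>)(Suc 0 := z) = mk a z m \<rho>"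
  "(mk a b m \<rho>)(2 := z) = mk a b z \<rho>" "(mk a b m \<rho>)(r + 3 := (cont [], v)) = mk a b m (\<rho>(r := v))"
  by (auto simp: mk_def fun_eq_iff)

lemma initial_mk: "initial x = mk (tape_of x) (tape_of []) (tape_of []) (\<lambda>_. 0)"
  by (auto simp: initial_def mk_def fun_eq_iff tape_of_eq)

text \<open>The start symbol 1 occurs only in cell 0, so scanning it is the test for the register
  value 0. As a left move in cell 0 stays there, \<open>dec\<close> is truncated
  subtraction.\<close>

definition inc :: "nat \<Rightarrow> com" where "inc r = Go (r + 3) Move_Right"
definition dec :: "nat \<Rightarrow> com" where "dec r = Go (r + 3) Move_Left"
definition whilenz :: "nat \<Rightarrow> com \<Rightarrow> com" where "whilenz r c = Until (r + 3) 1 c"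
definition ifz :: "nat \<Rightarrow> com \<Rightarrow> com \<Rightarrow> com" where "ifz r c1 c2 = Branch (r + 3) 1 c1 c2"

lemma runs_inc: "runs 1 (inc r) (mk a b m \<rho>) (mk a b m (\<rho>(r := Suc (\<rho> r))))"
  unfolding inc_def by (rule runs_Go) simp

lemma runs_dec: "runs 1 (dec r) (mk a b m \<rho>) (mk a b m (\<rho>(r := \<rho> r - 1)))"
  unfolding dec_def by (rule runs_Go) simp

lemma scanned_reg: "scanned (mk a b m \<rho> (r + 3)) = 1 \<longleftrightarrow> \<rho> r = 0"
  by (simp add: scanned_def)

lemma runs_ifz:
  assumes "\<rho> r = 0 \<Longrightarrow> runs T c1 (mk a b m \<rho>) s'" "\<rho> r \<noteq> 0 \<Longrightarrow> runs T c2 (mk a b m \<rho>) s'"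
  shows "runs (T + 2) (ifz r c1 c2) (mk a b m \<rho>) s'"
  unfolding ifz_def
proof (rule runs_Branch)
  assume "scanned (mk a b m \<rho> (r + 3)) = 1"
  then have "\<rho> r = 0" unfolding scanned_reg .
  then show "runs T c1 (mk a b m \<rho>) s'" by (rule assms(1))
next
  assume "scanned (mk a b m \<rho> (r + 3)) \<noteq> 1"
  then have "\<rho> r \<noteq> 0" unfolding scanned_reg .
  then show "runs T c2 (mk a b m \<rho>) s'" by (rule assms(2))
qed

lemma runs_whilenz:
  assumes "\<And>i. i \<le> n \<Longrightarrow> R i r = i" "\<And>i. i < n \<Longrightarrow> runs T c (mk (A (Suc i)) b (M (Suc i)) (R (Suc i))) (mk (A i) b (M i) (R i))"
  shows "runs ((T + 2) * n + 1) (whilenz r c) (mk (A n) b (M n) (R n)) (mk (A 0) b (M 0) (R 0))"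
  unfolding whilenz_def
proof (rule runs_countdown[of n "\<lambda>i. mk (A i) b (M i) (R i)"])
  show "scanned (mk (A i) b (M i) (R i) (r + 3)) = 1 \<longleftrightarrow> i = 0" if "i \<le> n" for i
    by (simp only: scanned_reg assms(1)[OF that])
qed (rule assms(2))

lemma runs_rewind:
  assumes "s k = (c, h)" "\<And>i. c i = 1 \<longleftrightarrow> i = 0"
  shows "runs (3 * h + 1) (Until k 1 (Go k Move_Left)) s (s(k := (c, 0)))"
proof -
  have "runs ((1 + 2) * h + 1) (Until k 1 (Go k Move_Left)) (s(k := (c, h))) (s(k := (c, 0)))"
  proof (rule runs_countdown[of h "\<lambda>h. s(k := (c, h))"])
    show "scanned ((s(k := (c, i))) k) = 1 \<longleftrightarrow> i = 0" for i
      using assms(2)[of i] by (simp add: scanned_def)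
    show "runs 1 (Go k Move_Left) (s(k := (c, Suc i))) (s(k := (c, i)))" for i
      by (rule runs_Go) simp
  qed
  moreover have "s(k := (c, h)) = s" using assms(1) by auto
  moreover have "(1::nat) + 2 = 3" by simp
  ultimately show ?thesis by (simp only:)
qed

definition clear :: "nat \<Rightarrow> com" where
  "clear r = whilenz r (dec r)"

lemma runs_clear: "runs (3 * \<rho> r + 1) (clear r) (mk a b m \<rho>) (mk a b m (\<rho>(r := 0)))"
proof -
  have "runs ((1 + 2) * \<rho> r + 1) (whilenz r (dec r)) (mk a b m (\<rho>(r := \<rho> r))) (mk a b m (\<rho>(r := 0)))"
  proof (rule runs_whilenz[of "\<rho> r" "\<lambda>i. \<rho>(r := i)" r 1 _ "\<lambda>_. a" b "\<lambda>_. m"])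
    fix i
    show "runs 1 (dec r) (mk a b m (\<rho>(r := Suc i))) (mk a b m (\<rho>(r := i)))"
      using runs_dec[of r a b m "\<rho>(r := Suc i)"] by simp
  qed simp
  then show ?thesis unfolding clear_def fun_upd_triv by (rule runs_mono) simp
qed

definition move_add :: "nat \<Rightarrow> nat \<Rightarrow> com" where
  "move_add r d = whilenz r (dec r ;; inc d)"

lemma runs_move_add:
  assumes "r \<noteq> d"
  shows "runs (4 * \<rho> r + 1) (move_add r d) (mk a b m \<rho>) (mk a b m (\<rho>(r := 0, d := \<rho> d + \<rho> r)))"
proof -
  let ?R = "\<lambda>i. \<rho>(r := i, d := \<rho> d + (\<rho> r - i))"
  have "runs ((1 + 1 + 2) * \<rho> r + 1) (whilenz r (dec r ;; inc d)) (mk a b m (?R (\<rho> r))) (mk a b m (?R 0))"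
  proof (rule runs_whilenz[of "\<rho> r" ?R r "1 + 1" _ "\<lambda>_. a" b "\<lambda>_. m"])
    fix i assume i: "i < \<rho> r"
    have 1: "runs 1 (dec r) (mk a b m (?R (Suc i))) (mk a b m ((?R (Suc i))(r := i)))"
      using runs_dec[of r a b m "?R (Suc i)"] assms by simp
    have "((?R (Suc i))(r := i))(d := Suc (((?R (Suc i))(r := i)) d)) = ?R i"
      using assms i by (auto simp: fun_eq_iff)
    then have 2: "runs 1 (inc d) (mk a b m ((?R (Suc i))(r := i))) (mk a b m (?R i))"
      using runs_inc[of d a b m "(?R (Suc i))(r := i)"] by (simp only:)
    show "runs (1 + 1) (dec r ;; inc d) (mk a b m (?R (Suc i))) (mk a b m (?R i))"
      by (rule runs_Comp[OF 1 2])
  qed (use assms in simp)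
  moreover have "?R (\<rho> r) = \<rho>" using assms by auto
  moreover have "?R 0 = \<rho>(r := 0, d := \<rho> d + \<rho> r)" by simp
  ultimately have "runs ((1 + 1 + 2) * \<rho> r + 1) (move_add r d) (mk a b m \<rho>) (mk a b m (\<rho>(r := 0, d := \<rho> d + \<rho> r)))"
    unfolding move_add_def by (simp only:)
  then show ?thesis by (rule runs_mono) simp
qed

text \<open>Reading a register by a loop destroys it; the auxiliary register \<open>e\<close>
  collects a second copy, which is moved back afterwards.\<close>

definition copy :: "nat \<Rightarrow> nat \<Rightarrow> nat \<Rightarrow> com" where
  "copy r d e = whilenz r (dec r ;; inc d ;; inc e) ;; move_add e r"

lemma runs_copy:
  assumes "r \<noteq> d" "r \<noteq> e" "d \<noteq> e" "\<rho> e = 0"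
  shows "runs (9 * \<rho> r + 2) (copy r d e) (mk a b m \<rho>) (mk a b m (\<rho>(d := \<rho> d + \<rho> r)))"
proof -
  let ?R = "\<lambda>i. \<rho>(r := i, d := \<rho> d + (\<rho> r - i), e := \<rho> r - i)"
  have "runs ((1 + (1 + 1) + 2) * \<rho> r + 1) (whilenz r (dec r ;; inc d ;; inc e)) (mk a b m (?R (\<rho> r))) (mk a b m (?R 0))"
  proof (rule runs_whilenz[of "\<rho> r" ?R r "1 + (1 + 1)" _ "\<lambda>_. a" b "\<lambda>_. m"])
    fix i assume i: "i < \<rho> r"
    let ?R1 = "(?R (Suc i))(r := i)"
    have 1: "runs 1 (dec r) (mk a b m (?R (Suc i))) (mk a b m ?R1)"
      using runs_dec[of r a b m "?R (Suc i)"] assms by simp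
    let ?R2 = "?R1(d := Suc (?R1 d))"
    have 2: "runs 1 (inc d) (mk a b m ?R1) (mk a b m ?R2)"
      by (rule runs_inc)
    have "?R2(e := Suc (?R2 e)) = ?R i"
      using assms i by (auto simp: fun_eq_iff)
    then have 3: "runs 1 (inc e) (mk a b m ?R2) (mk a b m (?R i))"
      using runs_inc[of e a b m ?R2] by (simp only:)
    show "runs (1 + (1 + 1)) (dec r ;; inc d ;; inc e) (mk a b m (?R (Suc i))) (mk a b m (?R i))"
      by (intro runs_Comp[OF 1] runs_Comp[OF 2] 3)
  qed (use assms in simp)
  moreover have "?R (\<rho> r) = \<rho>" using assms by auto
  ultimately have "runs ((1 + (1 + 1) + 2) * \<rho> r + 1) (whilenz r (dec r ;; inc d ;; inc e)) (mk a b m \<rho>) (mk a b m (?R 0))"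
    by (simp only:)
  then have 1: "runs (5 * \<rho> r + 1) (whilenz r (dec r ;; inc d ;; inc e)) (mk a b m \<rho>) (mk a b m (?R 0))"
    by (rule runs_mono) simp
  have "(?R 0)(e := 0, r := ?R 0 r + ?R 0 e) = \<rho>(d := \<rho> d + \<rho> r)"
    using assms by (auto simp: fun_eq_iff)
  then have 2: "runs (4 * \<rho> r + 1) (move_add e r) (mk a b m (?R 0)) (mk a b m (\<rho>(d := \<rho> d + \<rho> r)))"
    using runs_move_add[of e r "?R 0" a b m] assms by simp
  show ?thesis unfolding copy_def using runs_Comp[OF 1 2] by simp
qed

section \<open>Bounded arithmetic formulas and bit generators\<close>

text \<open>Variables are de Bruijn levels: in the scope of \<open>k\<close> quantifiers over an environment of
  length \<open>n\<close>, the next bound variable is \<open>V (n + k)\<close>.\<close>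

datatype trm = V nat | Cst nat | Plus trm trm | Times trm trm

datatype fm =
    Less trm trm
  | InBit trm
  | MemBit trm
  | Neg fm
  | And fm fm
  | Ex trm fm

datatype gen = Emit fm | Loop trm gen | App gen gen | Guard fm gen

definition rho :: "nat list \<Rightarrow> nat \<Rightarrow> nat" where
  "rho e i = (if i < length e then e ! i else 0)"

primrec evalt :: "nat list \<Rightarrow> trm \<Rightarrow> nat" where
  "evalt e (V i) = rho e i"
| "evalt e (Cst c) = c"
| "evalt e (Plus t u) = evalt e t + evalt e u"
| "evalt e (Times t u) = evalt e t * evalt e u"

definition bitat :: "bool list \<Rightarrow> nat \<Rightarrow> bool" where
  "bitat x i \<longleftrightarrow> i < length x \<and> x ! i"

primrec evalf :: "bool list \<Rightarrow> bool list \<Rightarrow> nat list \<Rightarrow> fm \<Rightarrow> bool" where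
  "evalf x m e (Less t u) \<longleftrightarrow> evalt e t < evalt e u"
| "evalf x m e (InBit t) \<longleftrightarrow> bitat x (evalt e t)"
| "evalf x m e (MemBit t) \<longleftrightarrow> bitat m (evalt e t)"
| "evalf x m e (Neg f) \<longleftrightarrow> \<not> evalf x m e f"
| "evalf x m e (And f g) \<longleftrightarrow> evalf x m e f \<and> evalf x m e g"
| "evalf x m e (Ex t f) \<longleftrightarrow> (\<exists>v < evalt e t. evalf x m (e @ [v]) f)"

primrec outs :: "bool list \<Rightarrow> bool list \<Rightarrow> nat list \<Rightarrow> gen \<Rightarrow> bool list" where
  "outs x m e (Emit f) = [evalf x m e f]"
| "outs x m e (Loop t g) = concat (map (\<lambda>v. outs x m (e @ [v]) g) [0..<evalt e t])"
| "outs x m e (App g h) = outs x m e g @ outs x m e h"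
| "outs x m e (Guard f g) = (if evalf x m e f then outs x m e g else [])"

text \<open>\<open>N\<close> bounds the values in the environment: \<open>vb\<close> bounds the value of a term, and
  \<open>tb\<close>, \<open>fb\<close>, \<open>gb\<close> bound the running times of the compiled programs.\<close>

primrec vb :: "trm \<Rightarrow> nat \<Rightarrow> nat" where
  "vb (V i) N = N"
| "vb (Cst c) N = c"
| "vb (Plus t u) N = vb t N + vb u N"
| "vb (Times t u) N = vb t N * vb u N"

primrec tb :: "trm \<Rightarrow> nat \<Rightarrow> nat" where
  "tb (V i) N = 9 * N + 2"
| "tb (Cst c) N = c"
| "tb (Plus t u) N = tb t N + tb u N + (4 * vb u N + 1)"
| "tb (Times t u) N = tb t N + tb u N + ((9 * vb u N + 5) * vb t N + 1) + (3 * vb u N + 1) +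
     (4 * (vb t N * vb u N) + 1)"

definition cmpb :: "nat \<Rightarrow> nat \<Rightarrow> nat" where
  "cmpb v w = 4 * v + 3 * w + 6"

primrec fb :: "fm \<Rightarrow> nat \<Rightarrow> nat" where
  "fb (Less t u) N = tb t N + tb u N + cmpb (vb t N) (vb u N)"
| "fb (InBit t) N = tb t N + (8 * vb t N + 10)"
| "fb (MemBit t) N = tb t N + (8 * vb t N + 10)"
| "fb (Neg f) N = fb f N + 3"
| "fb (And f g) N = fb f N + (fb g N + 3)"
| "fb (Ex t f) N = tb t N + ((fb f (N + vb t N) + 3 * vb t N + 6) * vb t N + 3 * vb t N + 20)"

primrec gb :: "gen \<Rightarrow> nat \<Rightarrow> nat" where
  "gb (Emit f) N = fb f N + 5"
| "gb (Loop t g) N =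
     (let M = N + vb t N; T = tb (V 0) M + tb t N + cmpb M (vb t N) in
      T + ((gb g M + T + 4) * vb t N + 3 * vb t N + 2))"
| "gb (App g h) N = gb g N + gb h N"
| "gb (Guard f g) N = fb f N + (gb g N + 3)"

lemma rho_le: "(\<And>v. v \<in> set e \<Longrightarrow> v \<le> N) \<Longrightarrow> rho e i \<le> N"
  by (auto simp: rho_def)

lemma evalt_le: "(\<And>v. v \<in> set e \<Longrightarrow> v \<le> N) \<Longrightarrow> evalt e t \<le> vb t N"
  by (induction t) (auto simp: rho_le add_mono mult_mono)

lemma rho_snoc: "(rho e)(length e := v) = rho (e @ [v])"
  by (auto simp: rho_def fun_eq_iff nth_append)

lemma rho_snoc_0: "rho (e @ [0]) = rho e"
  by (auto simp: rho_def fun_eq_iff nth_append)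

lemma rho_Nil: "rho [] = (\<lambda>_. 0)"
  by (simp add: rho_def fun_eq_iff)

lemma rho_beyond [simp]: "length e \<le> i \<Longrightarrow> rho e i = 0"
  by (simp add: rho_def)

lemma rho_append [simp]: "i < length e \<Longrightarrow> rho (e @ es) i = rho e i"
  by (simp add: rho_def nth_append)

lemma rho_last [simp]: "rho (e @ [v]) (length e) = v"
  by (simp add: rho_def)

lemma rho_pair [simp]: "rho (e @ [v, w]) (length e) = v" "rho (e @ [v, w]) (Suc (length e)) = w"
  by (simp_all add: rho_def nth_append)

lemma rho_triple [simp]: "rho (e @ [u, v, w]) (length e) = u" "rho (e @ [u, v, w]) (Suc (length e)) = v"
    "rho (e @ [u, v, w]) (Suc (Suc (length e))) = w"
  by (simp_all add: rho_def nth_append)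

lemma rho_upd:
  "(rho (e @ [v]))(length e := w) = rho (e @ [w])"
  "(rho (e @ [u, v]))(length e := w) = rho (e @ [w, v])"
  "(rho (e @ [u, v]))(Suc (length e) := w) = rho (e @ [u, w])"
  "(rho (e @ [u, v, y]))(length e := w) = rho (e @ [w, v, y])"
  "(rho (e @ [u, v, y]))(Suc (length e) := w) = rho (e @ [u, w, y])"
  "(rho (e @ [u, v, y]))(Suc (Suc (length e)) := w) = rho (e @ [u, v, w])"
  by (auto simp: rho_def fun_eq_iff nth_append nth_Cons' not_less Suc_diff_le less_Suc_eq le_less)

lemma rho_zeros: "rho (e @ [u, 0]) = rho (e @ [u])" "rho (e @ [u, v, 0]) = rho (e @ [u, v])"
  using rho_snoc_0[of "e @ [u]"] rho_snoc_0[of "e @ [u, v]"] by simp_all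

section \<open>Compilation of terms\<close>

primrec incs :: "nat \<Rightarrow> nat \<Rightarrow> com" where
  "incs r 0 = Nop"
| "incs r (Suc c) = inc r ;; incs r c"

lemma runs_incs: "runs c (incs r c) (mk a b m \<rho>) (mk a b m (\<rho>(r := \<rho> r + c)))"
proof (induction c arbitrary: \<rho>)
  case 0
  then show ?case using runs_Nop by simp
next
  case (Suc c)
  have "(\<rho>(r := Suc (\<rho> r)))(r := (\<rho>(r := Suc (\<rho> r))) r + c) = \<rho>(r := \<rho> r + Suc c)" by simp
  then show ?case using runs_Comp[OF runs_inc[of r a b m \<rho>] Suc[of "\<rho>(r := Suc (\<rho> r))"]]
    by (simp only: incs.simps plus_1_eq_Suc)
qed

text \<open>The variables occupy registers \<open>0, \<dots>, n - 1\<close>; the registers from \<open>d\<close> on are zero before, and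
  after the computation the value is in register \<open>d\<close>.\<close>

primrec ct :: "nat \<Rightarrow> nat \<Rightarrow> trm \<Rightarrow> com" where
  "ct n d (V i) = (if i < n then copy i d (d + 1) else Nop)"
| "ct n d (Cst c) = incs d c"
| "ct n d (Plus t u) = ct n d t ;; ct n (d + 1) u ;; move_add (d + 1) d"
| "ct n d (Times t u) = ct n d t ;; ct n (d + 1) u ;;
     whilenz d (dec d ;; copy (d + 1) (d + 2) (d + 3)) ;; clear (d + 1) ;; move_add (d + 2) d"

text \<open>The list \<open>es\<close> stands for intermediate results of enclosing computations,
  kept between the variables and the target register \<open>d\<close>; the term itself refers to
  \<open>e\<close> only. This is the generality that the second operand of \<open>Plus\<close> and
  \<open>Times\<close> requires.\<close>

lemma runs_ct:
  assumes "\<And>v. v \<in> set e \<Longrightarrow> v \<le> N" "d = length (e @ es)"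
  shows "runs (tb t N) (ct (length e) d t) (mk a b m (rho (e @ es))) (mk a b m (rho (e @ es @ [evalt e t])))"
  using assms(2)
proof (induction t arbitrary: d es)
  case (V i)
  have sn: "(rho (e @ es))(d := v) = rho (e @ es @ [v])" for v
    using rho_snoc[of "e @ es" v] V by simp
  show ?case
  proof (cases "i < length e")
    case True
    have "runs (9 * rho (e @ es) i + 2) (copy i d (d + 1)) (mk a b m (rho (e @ es)))
        (mk a b m ((rho (e @ es))(d := rho (e @ es) d + rho (e @ es) i)))"
      by (rule runs_copy) (use True V in auto)
    moreover have "rho (e @ es) d = 0" using V by simp
    ultimately have "runs (9 * rho e i + 2) (copy i d (d + 1)) (mk a b m (rho (e @ es)))
        (mk a b m (rho (e @ es @ [rho e i])))" using True sn by simp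
    then have "runs (9 * N + 2) (copy i d (d + 1)) (mk a b m (rho (e @ es)))
        (mk a b m (rho (e @ es @ [rho e i])))"
      by (rule runs_mono) (use rho_le[of e N i] assms(1) in simp)
    then show ?thesis using True by simp
  next
    case False
    then have "rho (e @ es @ [evalt e (V i)]) = rho (e @ es)" using rho_snoc_0[of "e @ es"] by simp
    then show ?thesis using False by (simp add: runs_mono[OF runs_Nop])
  qed
next
  case (Cst c)
  have "rho (e @ es) d = 0" using Cst by simp
  moreover have "(rho (e @ es))(d := c) = rho (e @ es @ [c])"
    using rho_snoc[of "e @ es" c] Cst by simp
  ultimately show ?case using runs_incs[of c d a b m "rho (e @ es)"] by simp
next
  case (Plus t u)
  have ev: "evalt e t \<le> vb t N" for t by (rule evalt_le) (rule assms(1))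
  let ?v = "evalt e t" and ?w = "evalt e u"
  define l where "l = e @ es"
  have d: "d = length l" using Plus.prems by (simp add: l_def)
  have 1: "runs (tb t N) (ct (length e) d t) (mk a b m (rho l)) (mk a b m (rho (l @ [?v])))"
    using Plus.IH(1)[of d es] Plus.prems by (simp add: l_def)
  have 2: "runs (tb u N) (ct (length e) (d + 1) u) (mk a b m (rho (l @ [?v]))) (mk a b m (rho (l @ [?v, ?w])))"
    using Plus.IH(2)[of "d + 1" "es @ [?v]"] Plus.prems by (simp add: l_def)
  have Z: "rho (l @ [?v, ?w]) (d + 1) = ?w" "rho (l @ [?v, ?w]) d = ?v"
    using d by simp_all
  have "(rho (l @ [?v, ?w]))(d + 1 := 0, d := ?v + ?w) = rho (l @ [?v + ?w])"
    using d by (simp add: rho_upd rho_zeros)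
  then have "runs (4 * ?w + 1) (move_add (d + 1) d) (mk a b m (rho (l @ [?v, ?w]))) (mk a b m (rho (l @ [?v + ?w])))"
    using runs_move_add[of "d + 1" d "rho (l @ [?v, ?w])" a b m] by (simp only: Z)
  then have 3: "runs (4 * vb u N + 1) (move_add (d + 1) d) (mk a b m (rho (l @ [?v, ?w]))) (mk a b m (rho (l @ [?v + ?w])))"
    by (rule runs_mono) (use ev[of u] in simp)
  show ?case using runs_Comp[OF 1 runs_Comp[OF 2 3]] by (simp add: add.assoc l_def)
next
  case (Times t u)
  have ev: "evalt e t \<le> vb t N" for t by (rule evalt_le) (rule assms(1))
  let ?v = "evalt e t" and ?w = "evalt e u"
  define l where "l = e @ es"
  have d: "d = length l" using Times.prems by (simp add: l_def)
  have 1: "runs (tb t N) (ct (length e) d t) (mk a b m (rho l)) (mk a b m (rho (l @ [?v])))"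
    using Times.IH(1)[of d es] Times.prems by (simp add: l_def)
  have 2: "runs (tb u N) (ct (length e) (d + 1) u) (mk a b m (rho (l @ [?v]))) (mk a b m (rho (l @ [?v, ?w])))"
    using Times.IH(2)[of "d + 1" "es @ [?v]"] Times.prems by (simp add: l_def)
  \<comment> \<open>Invariant of multiplication by repeated addition: with \<open>i\<close> rounds
    to go, the registers hold \<open>i\<close>, the second factor and the sum of the multiples added
    so far.\<close>
  let ?R = "\<lambda>i. rho (l @ [i, ?w, (?v - i) * ?w])"
  have 3: "runs ((1 + (9 * ?w + 2) + 2) * ?v + 1) (whilenz d (dec d ;; copy (d + 1) (d + 2) (d + 3)))
     (mk a b m (?R ?v)) (mk a b m (?R 0))"
  proof (rule runs_whilenz[of ?v ?R d "1 + (9 * ?w + 2)" _ "\<lambda>_. a" b "\<lambda>_. m"])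
    show "?R i d = i" for i using d by simp
  next
    fix i assume i: "i < ?v"
    let ?S = "rho (l @ [i, ?w, (?v - Suc i) * ?w])"
    have 1: "runs 1 (dec d) (mk a b m (?R (Suc i))) (mk a b m ?S)"
      using runs_dec[of d a b m "?R (Suc i)"] d by (simp add: rho_upd)
    have S: "?S (d + 1) = ?w" "?S (d + 2) = (?v - Suc i) * ?w" "?S (d + 3) = 0"
      using d by simp_all
    have e: "(?v - Suc i) * ?w + ?w = (?v - i) * ?w"
      using i by (metis Suc_diff_Suc add.commute mult_Suc)
    have u: "?S(d + 2 := (?v - i) * ?w) = ?R i"
      using d by (simp add: rho_upd)
    have "runs (9 * ?S (d + 1) + 2) (copy (d + 1) (d + 2) (d + 3)) (mk a b m ?S)
        (mk a b m (?S(d + 2 := ?S (d + 2) + ?S (d + 1))))"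
      by (rule runs_copy) (use S in simp_all)
    then have 2: "runs (9 * ?w + 2) (copy (d + 1) (d + 2) (d + 3)) (mk a b m ?S) (mk a b m (?R i))"
      by (simp only: S e u)
    show "runs (1 + (9 * ?w + 2)) (dec d ;; copy (d + 1) (d + 2) (d + 3)) (mk a b m (?R (Suc i))) (mk a b m (?R i))"
      by (rule runs_Comp[OF 1 2])
  qed
  have R: "?R ?v = rho (l @ [?v, ?w])"
    using rho_zeros(2)[of l ?v ?w] by simp
  have 4: "runs (3 * ?w + 1) (clear (d + 1)) (mk a b m (?R 0)) (mk a b m (rho (l @ [0, 0, ?v * ?w])))"
    using runs_clear[of "?R 0" "d + 1" a b m] d by (simp add: rho_upd)
  have Z: "rho (l @ [0, 0, ?v * ?w]) (d + 2) = ?v * ?w" "rho (l @ [0, 0, ?v * ?w]) d = 0"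
    using d by simp_all
  have "(rho (l @ [0, 0, ?v * ?w]))(d + 2 := 0, d := 0 + ?v * ?w) = rho (l @ [?v * ?w])"
    using d by (simp add: rho_upd rho_zeros)
  then have 5: "runs (4 * (?v * ?w) + 1) (move_add (d + 2) d) (mk a b m (rho (l @ [0, 0, ?v * ?w])))
     (mk a b m (rho (l @ [?v * ?w])))"
    using runs_move_add[of "d + 2" d "rho (l @ [0, 0, ?v * ?w])" a b m] by (simp only: Z)
  have "runs (tb t N + (tb u N + (((1 + (9 * ?w + 2) + 2) * ?v + 1) + ((3 * ?w + 1) + (4 * (?v * ?w) + 1)))))
     (ct (length e) d (Times t u)) (mk a b m (rho l)) (mk a b m (rho (l @ [?v * ?w])))"
    unfolding ct.simps by (intro runs_Comp[OF 1] runs_Comp[OF 2] runs_Comp[OF 3[unfolded R]] runs_Comp[OF 4] 5)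
  moreover have "((1 + (9 * ?w + 2) + 2) * ?v + 1) + ((3 * ?w + 1) + (4 * (?v * ?w) + 1))
     \<le> ((9 * vb u N + 5) * vb t N + 1) + ((3 * vb u N + 1) + (4 * (vb t N * vb u N) + 1))"
  proof -
    have "(1 + (9 * ?w + 2) + 2) * ?v \<le> (9 * vb u N + 5) * vb t N"
      by (rule mult_mono) (use ev[of t] ev[of u] in simp_all)
    moreover have "?v * ?w \<le> vb t N * vb u N"
      by (rule mult_mono) (use ev[of t] ev[of u] in simp_all)
    ultimately show ?thesis using ev[of u] by linarith
  qed
  then have "tb t N + (tb u N + (((1 + (9 * ?w + 2) + 2) * ?v + 1) + ((3 * ?w + 1) + (4 * (?v * ?w) + 1))))
     \<le> tb (Times t u) N" by simp
  ultimately have "runs (tb (Times t u) N) (ct (length e) d (Times t u)) (mk a b m (rho l)) (mk a b m (rho (l @ [?v * ?w])))"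
    using runs_mono by blast
  then show ?case by (simp add: l_def)
qed

section \<open>Comparison of registers and access to single bits\<close>

definition cmp :: "nat \<Rightarrow> com" where
  "cmp d = whilenz d (dec d ;; dec (d + 1)) ;; ifz (d + 1) Nop (inc d ;; clear (d + 1))"

text \<open>Decrementing both registers \<open>v\<close> times leaves \<open>w - v\<close> in the
  second one by truncated subtraction, which is nonzero exactly if \<open>v < w\<close>.\<close>

lemma runs_cmp:
  assumes "d = length l"
  shows "runs (cmpb v w) (cmp d) (mk a b m (rho (l @ [v, w]))) (mk a b m (rho (l @ [of_bool (v < w)])))"
proof -
  let ?R = "\<lambda>i. rho (l @ [i, w - (v - i)])"
  have 1: "runs ((1 + 1 + 2) * v + 1) (whilenz d (dec d ;; dec (d + 1))) (mk a b m (?R v)) (mk a b m (?R 0))"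
  proof (rule runs_whilenz[of v ?R d "1 + 1" _ "\<lambda>_. a" b "\<lambda>_. m"])
    fix i assume i: "i < v"
    have e: "w - (v - Suc i) - 1 = w - (v - i)" using i by linarith
    have 1: "runs 1 (dec d) (mk a b m (?R (Suc i))) (mk a b m (rho (l @ [i, w - (v - Suc i)])))"
      using runs_dec[of d a b m "?R (Suc i)"] assms by (simp add: rho_upd)
    have 2: "runs 1 (dec (d + 1)) (mk a b m (rho (l @ [i, w - (v - Suc i)]))) (mk a b m (?R i))"
      using runs_dec[of "d + 1" a b m "rho (l @ [i, w - (v - Suc i)])"] assms e by (simp add: rho_upd)
    show "runs (1 + 1) (dec d ;; dec (d + 1)) (mk a b m (?R (Suc i))) (mk a b m (?R i))"
      by (rule runs_Comp[OF 1 2])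
  qed (use assms in simp)
  have 2: "runs (1 + (3 * w + 1) + 2) (ifz (d + 1) Nop (inc d ;; clear (d + 1))) (mk a b m (?R 0))
      (mk a b m (rho (l @ [of_bool (v < w)])))"
  proof (rule runs_ifz)
    assume "?R 0 (d + 1) = 0"
    then have "\<not> v < w" "?R 0 = rho (l @ [0])" using assms by (simp_all add: rho_zeros)
    then show "runs (1 + (3 * w + 1)) Nop (mk a b m (?R 0)) (mk a b m (rho (l @ [of_bool (v < w)])))"
      using runs_mono[OF runs_Nop] by simp
  next
    assume "?R 0 (d + 1) \<noteq> 0"
    then have vw: "v < w" using assms by simp
    have 1: "runs 1 (inc d) (mk a b m (?R 0)) (mk a b m (rho (l @ [1, w - v])))"
      using runs_inc[of d a b m "?R 0"] assms by (simp add: rho_upd)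
    have "runs (3 * (w - v) + 1) (clear (d + 1)) (mk a b m (rho (l @ [1, w - v]))) (mk a b m (rho (l @ [1])))"
      using runs_clear[of "rho (l @ [1, w - v])" "d + 1" a b m] assms by (simp add: rho_upd rho_zeros)
    then have 2: "runs (3 * w + 1) (clear (d + 1)) (mk a b m (rho (l @ [1, w - v]))) (mk a b m (rho (l @ [1])))"
      by (rule runs_mono) simp
    show "runs (1 + (3 * w + 1)) (inc d ;; clear (d + 1)) (mk a b m (?R 0)) (mk a b m (rho (l @ [of_bool (v < w)])))"
      using runs_Comp[OF 1 2] vw by simp
  qed
  have "?R v = rho (l @ [v, w])" by simp
  then have "runs (((1 + 1 + 2) * v + 1) + (1 + (3 * w + 1) + 2)) (cmp d) (mk a b m (rho (l @ [v, w])))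
      (mk a b m (rho (l @ [of_bool (v < w)])))"
    unfolding cmp_def using runs_Comp[OF 1 2] by (simp only:)
  then show ?thesis by (rule runs_mono) (simp add: cmpb_def)
qed

text \<open>Bit \<open>i\<close> is stored in cell \<open>i + 1\<close>, hence the additional move
  to the right. A blank cell beyond the end is read as a false bit, in accordance with
  \<open>bitat\<close>.\<close>

definition fetch :: "nat \<Rightarrow> nat \<Rightarrow> com" where
  "fetch k d = Go k Move_Right ;; whilenz d (dec d ;; Go k Move_Right) ;;
     Branch k 3 (inc d) Nop ;; Until k 1 (Go k Move_Left)"

text \<open>\<open>F\<close> abstracts from the place of the scanned tape in the state, so that one
  proof serves both the input tape 0 and the memory tape 2.\<close>

lemma runs_fetch_gen:
  assumes d: "d = length l"
    and F: "\<And>T \<rho>. F T \<rho> k = T" "\<And>T \<rho> T'. (F T \<rho>)(k := T') = F T' \<rho>"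
      "\<And>T \<rho> r. F T \<rho> (r + 3) = (cont [], \<rho> r)"
      "\<And>T \<rho> r v. (F T \<rho>)(r + 3 := (cont [], v)) = F T (\<rho>(r := v))"
  shows "runs (8 * v + 10) (fetch k d) (F (tape_of y) (rho (l @ [v])))
     (F (tape_of y) (rho (l @ [of_bool (bitat y v)])))"
proof -
  have 1: "runs 1 (Go k Move_Right) (F (tape_of y) (rho (l @ [v]))) (F (cont y, Suc 0) (rho (l @ [v])))"
    by (rule runs_Go) (simp add: F tape_of_eq)
  let ?S = "\<lambda>i. F (cont y, Suc (v - i)) (rho (l @ [i]))"
  have 2: "runs ((1 + 1 + 2) * v + 1) (Until (d + 3) 1 (dec d ;; Go k Move_Right)) (?S v) (?S 0)"
  proof (rule runs_countdown[of v ?S])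
    show "scanned (?S i (d + 3)) = 1 \<longleftrightarrow> i = 0" if "i \<le> v" for i
      using d by (simp only: F scanned_def fst_conv snd_conv) simp
  next
    fix i assume i: "i < v"
    have 1: "runs 1 (dec d) (?S (Suc i)) (F (cont y, Suc (v - Suc i)) (rho (l @ [i])))"
      unfolding dec_def by (rule runs_Go) (use d in \<open>simp add: F rho_upd\<close>)
    have 2: "runs 1 (Go k Move_Right) (F (cont y, Suc (v - Suc i)) (rho (l @ [i]))) (?S i)"
      by (rule runs_Go) (use i in \<open>simp add: F Suc_diff_Suc\<close>)
    show "runs (1 + 1) (dec d ;; Go k Move_Right) (?S (Suc i)) (?S i)"
      by (rule runs_Comp[OF 1 2])
  qed
  have 3: "runs (1 + 2) (Branch k 3 (inc d) Nop) (?S 0) (F (cont y, Suc v) (rho (l @ [of_bool (bitat y v)])))"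
  proof (rule runs_Branch)
    assume "scanned (?S 0 k) = 3"
    then have "bitat y v" by (simp add: F scanned_def cont_eq_3 bitat_def)
    then show "runs 1 (inc d) (?S 0) (F (cont y, Suc v) (rho (l @ [of_bool (bitat y v)])))"
      unfolding inc_def by (intro runs_Go) (use d in \<open>simp add: F rho_upd\<close>)
  next
    assume "scanned (?S 0 k) \<noteq> 3"
    then have "\<not> bitat y v" by (simp add: F scanned_def cont_eq_3 bitat_def)
    then show "runs 1 Nop (?S 0) (F (cont y, Suc v) (rho (l @ [of_bool (bitat y v)])))"
      using runs_mono[OF runs_Nop] by simp
  qed
  have 4: "runs (3 * Suc v + 1) (Until k 1 (Go k Move_Left)) (F (cont y, Suc v) (rho (l @ [of_bool (bitat y v)])))
      (F (tape_of y) (rho (l @ [of_bool (bitat y v)])))"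
    using runs_rewind[of "F (cont y, Suc v) (rho (l @ [of_bool (bitat y v)]))" k "cont y" "Suc v"]
    by (simp add: F tape_of_eq)
  have Sv: "F (cont y, Suc (v - v)) (rho (l @ [v])) = F (cont y, Suc 0) (rho (l @ [v]))" by simp
  show ?thesis unfolding fetch_def whilenz_def
    by (rule runs_mono[OF runs_Comp[OF 1 runs_Comp[OF 2[unfolded Sv] runs_Comp[OF 3 4]]]]) simp
qed

lemma runs_fetch:
  assumes "d = length l"
  shows "runs (8 * v + 10) (fetch 0 d) (mk (tape_of y) b m (rho (l @ [v])))
     (mk (tape_of y) b m (rho (l @ [of_bool (bitat y v)])))"
    and "runs (8 * v + 10) (fetch 2 d) (mk a b (tape_of y) (rho (l @ [v])))
     (mk a b (tape_of y) (rho (l @ [of_bool (bitat y v)])))"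
  using runs_fetch_gen[OF assms, of "\<lambda>T. mk T b m" 0] runs_fetch_gen[OF assms, of "\<lambda>T. mk a b T" 2] by simp_all

section \<open>Compilation of formulas\<close>

lemma runs_whilenz_done: "\<rho> r = 0 \<Longrightarrow> runs 1 (whilenz r c) (mk a b m \<rho>) (mk a b m \<rho>)"
  unfolding whilenz_def by (rule runs_Until_done) (simp only: scanned_reg)

lemma runs_whilenz_step:
  assumes "\<rho> r \<noteq> 0" "runs T1 c (mk a b m \<rho>) s1" "runs T2 (whilenz r c) s1 s2"
  shows "runs (T1 + 2 + T2) (whilenz r c) (mk a b m \<rho>) s2"
  using assms unfolding whilenz_def
  by (intro runs_Until_step) (simp_all only: scanned_reg not_False_eq_True)

text \<open>In \<open>Ex\<close> the loop counter doubles as the bound variable: after the decrement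
  it holds the value to be tried, so candidates are tried downwards. A hit clears the counter, which
  ends the loop and leaves the 1 in register \<open>n + 1\<close>.\<close>

primrec cf :: "nat \<Rightarrow> fm \<Rightarrow> com" where
  "cf n (Less t u) = ct n n t ;; ct n (n + 1) u ;; cmp n"
| "cf n (InBit t) = ct n n t ;; fetch 0 n"
| "cf n (MemBit t) = ct n n t ;; fetch 2 n"
| "cf n (Neg f) = cf n f ;; ifz n (inc n) (dec n)"
| "cf n (And f g) = cf n f ;; ifz n Nop (dec n ;; cf n g)"
| "cf n (Ex t f) = ct n n t ;; whilenz n (dec n ;; cf (n + 1) f ;; ifz (n + 1) Nop (clear n)) ;;
     move_add (n + 1) n"

lemma cmpb_mono: "v \<le> v' \<Longrightarrow> w \<le> w' \<Longrightarrow> cmpb v w \<le> cmpb v' w'"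
  by (simp add: cmpb_def)

lemma runs_cf:
  assumes "\<And>v. v \<in> set e \<Longrightarrow> v \<le> N"
  shows "runs (fb f N) (cf (length e) f) (mk (tape_of x) b (tape_of m) (rho e))
    (mk (tape_of x) b (tape_of m) (rho (e @ [of_bool (evalf x m e f)])))"
  using assms
proof (induction f arbitrary: e N)
  case (Less t u)
  let ?v = "evalt e t" and ?w = "evalt e u" and ?n = "length e"
  have ev: "evalt e t \<le> vb t N" for t by (rule evalt_le) (rule Less)
  have 1: "runs (tb t N) (ct ?n ?n t) (mk (tape_of x) b (tape_of m) (rho e)) (mk (tape_of x) b (tape_of m) (rho (e @ [?v])))"
    using runs_ct[of e N ?n "[]" t "tape_of x" b "tape_of m"] Less by simp
  have 2: "runs (tb u N) (ct ?n (?n + 1) u) (mk (tape_of x) b (tape_of m) (rho (e @ [?v]))) (mk (tape_of x) b (tape_of m) (rho (e @ [?v, ?w])))"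
    using runs_ct[of e N "?n + 1" "[?v]" u "tape_of x" b "tape_of m"] Less by simp
  have 3: "runs (cmpb (vb t N) (vb u N)) (cmp ?n) (mk (tape_of x) b (tape_of m) (rho (e @ [?v, ?w])))
     (mk (tape_of x) b (tape_of m) (rho (e @ [of_bool (?v < ?w)])))"
    by (rule runs_mono[OF runs_cmp cmpb_mono]) (simp_all add: ev)
  show ?case using runs_Comp[OF 1 runs_Comp[OF 2 3]] by (simp add: add.assoc)
next
  case (InBit t)
  have ev: "evalt e t \<le> vb t N" by (rule evalt_le) (rule InBit)
  have 1: "runs (tb t N) (ct (length e) (length e) t) (mk (tape_of x) b (tape_of m) (rho e)) (mk (tape_of x) b (tape_of m) (rho (e @ [evalt e t])))"
    using runs_ct[of e N "length e" "[]" t "tape_of x" b "tape_of m"] InBit by simp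
  have 2: "runs (8 * vb t N + 10) (fetch 0 (length e)) (mk (tape_of x) b (tape_of m) (rho (e @ [evalt e t])))
     (mk (tape_of x) b (tape_of m) (rho (e @ [of_bool (bitat x (evalt e t))])))"
    by (rule runs_mono[OF runs_fetch(1)]) (use ev in simp_all)
  show ?case using runs_Comp[OF 1 2] by simp
next
  case (MemBit t)
  have ev: "evalt e t \<le> vb t N" by (rule evalt_le) (rule MemBit)
  have 1: "runs (tb t N) (ct (length e) (length e) t) (mk (tape_of x) b (tape_of m) (rho e)) (mk (tape_of x) b (tape_of m) (rho (e @ [evalt e t])))"
    using runs_ct[of e N "length e" "[]" t "tape_of x" b "tape_of m"] MemBit by simp
  have 2: "runs (8 * vb t N + 10) (fetch 2 (length e)) (mk (tape_of x) b (tape_of m) (rho (e @ [evalt e t])))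
     (mk (tape_of x) b (tape_of m) (rho (e @ [of_bool (bitat m (evalt e t))])))"
    by (rule runs_mono[OF runs_fetch(2)]) (use ev in simp_all)
  show ?case using runs_Comp[OF 1 2] by simp
next
  case (Neg f)
  let ?n = "length e"
  let ?r = "rho (e @ [of_bool (evalf x m e f)])"
  have 2: "runs (1 + 2) (ifz ?n (inc ?n) (dec ?n)) (mk (tape_of x) b (tape_of m) ?r)
     (mk (tape_of x) b (tape_of m) (rho (e @ [of_bool (\<not> evalf x m e f)])))"
  proof (rule runs_ifz)
    assume "?r ?n = 0"
    then have "\<not> evalf x m e f" by simp
    then show "runs 1 (inc ?n) (mk (tape_of x) b (tape_of m) ?r) (mk (tape_of x) b (tape_of m) (rho (e @ [of_bool (\<not> evalf x m e f)])))"
      using runs_inc[of ?n "tape_of x" b "tape_of m" ?r] by (simp add: rho_upd)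
  next
    assume "?r ?n \<noteq> 0"
    then have "evalf x m e f" by simp
    then show "runs 1 (dec ?n) (mk (tape_of x) b (tape_of m) ?r) (mk (tape_of x) b (tape_of m) (rho (e @ [of_bool (\<not> evalf x m e f)])))"
      using runs_dec[of ?n "tape_of x" b "tape_of m" ?r] by (simp add: rho_upd)
  qed
  have "runs (fb f N + (1 + 2)) (cf ?n (Neg f)) (mk (tape_of x) b (tape_of m) (rho e))
     (mk (tape_of x) b (tape_of m) (rho (e @ [of_bool (evalf x m e (Neg f))])))"
    unfolding cf.simps evalf.simps by (rule runs_Comp[OF Neg.IH[OF Neg.prems] 2])
  then show ?case by (rule runs_mono) simp
next
  case (And f g)
  let ?n = "length e"
  let ?r = "rho (e @ [of_bool (evalf x m e f)])"
  let ?q = "mk (tape_of x) b (tape_of m) (rho (e @ [of_bool (evalf x m e (And f g))]))"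
  have "runs (1 + fb g N + 2) (ifz ?n Nop (dec ?n ;; cf ?n g)) (mk (tape_of x) b (tape_of m) ?r) ?q"
  proof (rule runs_ifz)
    assume "?r ?n = 0"
    then have "\<not> evalf x m e f" by simp
    then show "runs (1 + fb g N) Nop (mk (tape_of x) b (tape_of m) ?r) ?q"
      using runs_mono[OF runs_Nop] by simp
  next
    assume "?r ?n \<noteq> 0"
    then have f: "evalf x m e f" by simp
    have "runs 1 (dec ?n) (mk (tape_of x) b (tape_of m) ?r) (mk (tape_of x) b (tape_of m) (rho e))"
      using runs_dec[of ?n "tape_of x" b "tape_of m" ?r] f by (simp add: rho_upd rho_snoc_0)
    from runs_Comp[OF this And.IH(2)[OF And.prems]] f
    show "runs (1 + fb g N) (dec ?n ;; cf ?n g) (mk (tape_of x) b (tape_of m) ?r) ?q" by simp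
  qed
  then have 2: "runs (1 + fb g N + 2) (ifz ?n Nop (dec ?n ;; cf ?n g)) (mk (tape_of x) b (tape_of m) ?r) ?q" .
  have "runs (fb f N + (1 + fb g N + 2)) (cf ?n (And f g)) (mk (tape_of x) b (tape_of m) (rho e)) ?q"
    unfolding cf.simps by (rule runs_Comp[OF And.IH(1)[OF And.prems] 2])
  then show ?case by (rule runs_mono) simp
next
  case (Ex t f)
  let ?n = "length e" and ?V = "vb t N"
  let ?M = "\<lambda>\<rho>. mk (tape_of x) b (tape_of m) \<rho>"
  let ?P = "\<lambda>v. evalf x m (e @ [v]) f"
  let ?body = "dec ?n ;; cf (?n + 1) f ;; ifz (?n + 1) Nop (clear ?n)"
  let ?T = "fb f (N + ?V) + 3 * ?V + 6"
  have ev: "evalt e t \<le> ?V" by (rule evalt_le) (rule Ex)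
  have loop: "runs (?T * k + 1) (whilenz ?n ?body) (?M (rho (e @ [k]))) (?M (rho (e @ [0, of_bool (\<exists>v<k. ?P v)])))"
    if "k \<le> ?V" for k
    using that
  proof (induction k)
    case 0
    show ?case using runs_whilenz_done[of "rho (e @ [0])" ?n] by (simp add: rho_zeros)
  next
    case (Suc k)
    have 1: "runs 1 (dec ?n) (?M (rho (e @ [Suc k]))) (?M (rho (e @ [k])))"
      using runs_dec[of ?n "tape_of x" b "tape_of m" "rho (e @ [Suc k])"] by (simp add: rho_upd)
    have "runs (fb f (N + ?V)) (cf (length (e @ [k])) f) (?M (rho (e @ [k]))) (?M (rho ((e @ [k]) @ [of_bool (?P k)])))"
    proof (rule Ex.IH)
      show "v \<le> N + ?V" if "v \<in> set (e @ [k])" for v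
        using that Ex.prems[of v] Suc.prems by auto
    qed
    then have 2: "runs (fb f (N + ?V)) (cf (?n + 1) f) (?M (rho (e @ [k]))) (?M (rho (e @ [k, of_bool (?P k)])))"
      by simp
    let ?k = "if ?P k then 0 else k"
    have 3: "runs (3 * ?V + 1 + 2) (ifz (?n + 1) Nop (clear ?n)) (?M (rho (e @ [k, of_bool (?P k)]))) (?M (rho (e @ [?k, of_bool (?P k)])))"
    proof (rule runs_ifz)
      assume "rho (e @ [k, of_bool (?P k)]) (?n + 1) = 0"
      then have "\<not> ?P k" by simp
      then show "runs (3 * ?V + 1) Nop (?M (rho (e @ [k, of_bool (?P k)]))) (?M (rho (e @ [?k, of_bool (?P k)])))"
        using runs_mono[OF runs_Nop] by simp
    next
      assume "rho (e @ [k, of_bool (?P k)]) (?n + 1) \<noteq> 0"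
      then have P: "?P k" by simp
      have "runs (3 * k + 1) (clear ?n) (?M (rho (e @ [k, of_bool (?P k)]))) (?M (rho (e @ [0, of_bool (?P k)])))"
        using runs_clear[of "rho (e @ [k, of_bool (?P k)])" ?n "tape_of x" b "tape_of m"] by (simp add: rho_upd)
      then have "runs (3 * ?V + 1) (clear ?n) (?M (rho (e @ [k, of_bool (?P k)]))) (?M (rho (e @ [0, of_bool (?P k)])))"
        by (rule runs_mono) (use Suc.prems in simp)
      then show "runs (3 * ?V + 1) (clear ?n) (?M (rho (e @ [k, of_bool (?P k)]))) (?M (rho (e @ [?k, of_bool (?P k)])))"
        using P by simp
    qed
    have body: "runs (1 + (fb f (N + ?V) + (3 * ?V + 1 + 2))) ?body (?M (rho (e @ [Suc k]))) (?M (rho (e @ [?k, of_bool (?P k)])))"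
      by (rule runs_Comp[OF 1 runs_Comp[OF 2 3]])
    have rest: "runs (?T * k + 1) (whilenz ?n ?body) (?M (rho (e @ [?k, of_bool (?P k)]))) (?M (rho (e @ [0, of_bool (\<exists>v<Suc k. ?P v)])))"
    proof (cases "?P k")
      case True
      then have "(\<exists>v<Suc k. ?P v) = True" by auto
      then have eq: "rho (e @ [?k, of_bool (?P k)]) = rho (e @ [0, of_bool (\<exists>v<Suc k. ?P v)])"
        using True by simp
      have "runs 1 (whilenz ?n ?body) (?M (rho (e @ [0, of_bool (\<exists>v<Suc k. ?P v)]))) (?M (rho (e @ [0, of_bool (\<exists>v<Suc k. ?P v)])))"
        by (rule runs_whilenz_done) simp
      then show ?thesis unfolding eq by (rule runs_mono) simp
    next
      case False
      then have "(\<exists>v<Suc k. ?P v) = (\<exists>v<k. ?P v)" by (auto simp: less_Suc_eq)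
      moreover have "rho (e @ [?k, of_bool (?P k)]) = rho (e @ [k])"
        using False by (simp add: rho_zeros)
      ultimately show ?thesis using Suc by simp
    qed
    have "runs ((1 + (fb f (N + ?V) + (3 * ?V + 1 + 2))) + 2 + (?T * k + 1)) (whilenz ?n ?body) (?M (rho (e @ [Suc k])))
      (?M (rho (e @ [0, of_bool (\<exists>v<Suc k. ?P v)])))"
      by (rule runs_whilenz_step[OF _ body rest]) simp
    then show ?case by (rule runs_mono) simp
  qed
  let ?R = "rho (e @ [0, of_bool (\<exists>v<evalt e t. ?P v)])"
  have 1: "runs (tb t N) (ct ?n ?n t) (?M (rho e)) (?M (rho (e @ [evalt e t])))"
    using runs_ct[of e N ?n "[]" t "tape_of x" b "tape_of m"] Ex.prems by simp
  have "runs (4 * ?R (?n + 1) + 1) (move_add (?n + 1) ?n) (?M ?R) (?M (?R(?n + 1 := 0, ?n := ?R ?n + ?R (?n + 1))))"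
    by (rule runs_move_add) simp
  moreover have "?R(?n + 1 := 0, ?n := ?R ?n + ?R (?n + 1)) = rho (e @ [of_bool (\<exists>v<evalt e t. ?P v)])"
    by (simp add: rho_upd rho_zeros)
  ultimately have "runs (4 * ?R (?n + 1) + 1) (move_add (?n + 1) ?n) (?M ?R) (?M (rho (e @ [of_bool (\<exists>v<evalt e t. ?P v)])))"
    by (simp only:)
  then have 3: "runs 5 (move_add (?n + 1) ?n) (?M ?R) (?M (rho (e @ [of_bool (\<exists>v<evalt e t. ?P v)])))"
    by (rule runs_mono) simp
  have "runs (tb t N + ((?T * evalt e t + 1) + 5)) (cf ?n (Ex t f)) (?M (rho e)) (?M (rho (e @ [of_bool (evalf x m e (Ex t f))])))"
    unfolding cf.simps evalf.simps by (rule runs_Comp[OF 1 runs_Comp[OF loop[OF ev] 3]])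
  moreover have "?T * evalt e t \<le> ?T * ?V" using ev by (rule mult_le_mono2)
  then have "tb t N + ((?T * evalt e t + 1) + 5) \<le> fb (Ex t f) N" unfolding fb.simps by linarith
  ultimately show ?case by (rule runs_mono)
qed

section \<open>Compilation of generators\<close>

definition ltest :: "nat \<Rightarrow> trm \<Rightarrow> com" where
  "ltest n t = ct (n + 1) (n + 1) (V n) ;; ct n (n + 2) t ;; cmp (n + 1)"

text \<open>The order of the emitted bits matters, so a loop counts upwards here, unlike the search
  in \<open>cf\<close>. The bound is recomputed before each round instead of being stored, because
  the body works with the registers from \<open>n + 1\<close> on.\<close>

primrec cg :: "nat \<Rightarrow> gen \<Rightarrow> com" where
  "cg n (Emit f) = cf n f ;; ifz n (Put 1 2) (Put 1 3 ;; dec n) ;; Go 1 Move_Right"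
| "cg n (Loop t g) = ltest n t ;;
     whilenz (n + 1) (dec (n + 1) ;; cg (n + 1) g ;; inc n ;; ltest n t) ;; clear n"
| "cg n (App g h) = cg n g ;; cg n h"
| "cg n (Guard f g) = cf n f ;; ifz n Nop (dec n ;; cg n g)"

definition otape :: "bool list \<Rightarrow> tape" where
  "otape bs = (cont bs, Suc (length bs))"

lemma runs_ltest:
  assumes "\<And>v. v \<in> set e \<Longrightarrow> v \<le> N" "v \<le> vb t N" "n = length e"
  defines "M \<equiv> N + vb t N"
  shows "runs (tb (V 0) M + tb t N + cmpb M (vb t N)) (ltest n t) (mk a b m (rho (e @ [v])))
    (mk a b m (rho (e @ [v, of_bool (v < evalt e t)])))"
proof -
  let ?w = "evalt e t"
  have ev: "?w \<le> vb t N" by (rule evalt_le) (rule assms(1))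
  have "v' \<le> M" if "v' \<in> set (e @ [v])" for v'
    using that assms(1)[of v'] assms(2) by (auto simp: M_def)
  then have 1: "runs (tb (V 0) M) (ct (n + 1) (n + 1) (V n)) (mk a b m (rho (e @ [v]))) (mk a b m (rho (e @ [v, v])))"
    using runs_ct[of "e @ [v]" M "n + 1" "[]" "V n" a b m] assms(3) by simp
  have 2: "runs (tb t N) (ct n (n + 2) t) (mk a b m (rho (e @ [v, v]))) (mk a b m (rho (e @ [v, v, ?w])))"
    using runs_ct[of e N "n + 2" "[v, v]" t a b m] assms(1,3) by simp
  have 3: "runs (cmpb M (vb t N)) (cmp (n + 1)) (mk a b m (rho (e @ [v, v, ?w]))) (mk a b m (rho (e @ [v, of_bool (v < ?w)])))"
    using runs_mono[OF runs_cmp[of "n + 1" "e @ [v]" v ?w a b m] cmpb_mono[of v M ?w "vb t N"]] ev assms(2,3)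
    by (simp add: M_def)
  show ?thesis unfolding ltest_def using runs_Comp[OF 1 runs_Comp[OF 2 3]] by (simp only: add.assoc)
qed

lemma runs_cg:
  assumes "\<And>v. v \<in> set e \<Longrightarrow> v \<le> N"
  shows "runs (gb g N) (cg (length e) g) (mk (tape_of x) (otape bs) (tape_of m) (rho e))
    (mk (tape_of x) (otape (bs @ outs x m e g)) (tape_of m) (rho e))"
  using assms
proof (induction g arbitrary: e N bs)
  case (Emit f)
  let ?n = "length e" and ?v = "evalf x m e f"
  let ?o' = "((cont bs)(Suc (length bs) := bit_sym ?v), Suc (length bs))"
  have 2: "runs (1 + 1 + 2) (ifz ?n (Put 1 2) (Put 1 3 ;; dec ?n)) (mk (tape_of x) (otape bs) (tape_of m) (rho (e @ [of_bool ?v])))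
     (mk (tape_of x) ?o' (tape_of m) (rho e))"
  proof (rule runs_ifz)
    assume "rho (e @ [of_bool ?v]) ?n = 0"
    then have v: "\<not> ?v" by simp
    have "runs 1 (Put 1 2) (mk (tape_of x) (otape bs) (tape_of m) (rho (e @ [of_bool ?v]))) (mk (tape_of x) ?o' (tape_of m) (rho e))"
      by (rule runs_Put) (use v in \<open>simp add: otape_def bit_sym_def rho_snoc_0\<close>)
    then show "runs (1 + 1) (Put 1 2) (mk (tape_of x) (otape bs) (tape_of m) (rho (e @ [of_bool ?v]))) (mk (tape_of x) ?o' (tape_of m) (rho e))"
      by (rule runs_mono) simp
  next
    assume "rho (e @ [of_bool ?v]) ?n \<noteq> 0"
    then have v: "?v" by simp
    have 1: "runs 1 (Put 1 3) (mk (tape_of x) (otape bs) (tape_of m) (rho (e @ [of_bool ?v]))) (mk (tape_of x) ?o' (tape_of m) (rho (e @ [1])))"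
      by (rule runs_Put) (use v in \<open>simp add: otape_def bit_sym_def\<close>)
    have 2: "runs 1 (dec ?n) (mk (tape_of x) ?o' (tape_of m) (rho (e @ [1]))) (mk (tape_of x) ?o' (tape_of m) (rho e))"
      using runs_dec[of ?n "tape_of x" ?o' "tape_of m" "rho (e @ [1])"] by (simp add: rho_upd rho_snoc_0)
    show "runs (1 + 1) (Put 1 3 ;; dec ?n) (mk (tape_of x) (otape bs) (tape_of m) (rho (e @ [of_bool ?v]))) (mk (tape_of x) ?o' (tape_of m) (rho e))"
      by (rule runs_Comp[OF 1 2])
  qed
  have 3: "runs 1 (Go 1 Move_Right) (mk (tape_of x) ?o' (tape_of m) (rho e)) (mk (tape_of x) (otape (bs @ [?v])) (tape_of m) (rho e))"
    by (rule runs_Go) (simp add: otape_def cont_snoc)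
  have "runs (fb f N + ((1 + 1 + 2) + 1)) (cg ?n (Emit f)) (mk (tape_of x) (otape bs) (tape_of m) (rho e))
    (mk (tape_of x) (otape (bs @ [?v])) (tape_of m) (rho e))"
    unfolding cg.simps by (rule runs_Comp[OF runs_cf[OF Emit] runs_Comp[OF 2 3]])
  then show ?case unfolding outs.simps by (rule runs_mono) simp
next
  case (App g h)
  have 1: "runs (gb g N) (cg (length e) g) (mk (tape_of x) (otape bs) (tape_of m) (rho e))
    (mk (tape_of x) (otape (bs @ outs x m e g)) (tape_of m) (rho e))"
    by (rule App.IH(1)) (rule App.prems)
  have 2: "runs (gb h N) (cg (length e) h) (mk (tape_of x) (otape (bs @ outs x m e g)) (tape_of m) (rho e))
    (mk (tape_of x) (otape ((bs @ outs x m e g) @ outs x m e h)) (tape_of m) (rho e))"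
    by (rule App.IH(2)) (rule App.prems)
  show ?case using runs_Comp[OF 1 2] by simp
next
  case (Guard f g)
  let ?n = "length e"
  let ?r = "rho (e @ [of_bool (evalf x m e f)])"
  let ?q = "mk (tape_of x) (otape (bs @ outs x m e (Guard f g))) (tape_of m) (rho e)"
  have "runs (1 + gb g N + 2) (ifz ?n Nop (dec ?n ;; cg ?n g)) (mk (tape_of x) (otape bs) (tape_of m) ?r) ?q"
  proof (rule runs_ifz)
    assume "?r ?n = 0"
    then have "\<not> evalf x m e f" by simp
    then show "runs (1 + gb g N) Nop (mk (tape_of x) (otape bs) (tape_of m) ?r) ?q"
      using runs_mono[OF runs_Nop] by (simp add: rho_snoc_0)
  next
    assume "?r ?n \<noteq> 0"
    then have f: "evalf x m e f" by simp
    have "runs 1 (dec ?n) (mk (tape_of x) (otape bs) (tape_of m) ?r) (mk (tape_of x) (otape bs) (tape_of m) (rho e))"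
      using runs_dec[of ?n "tape_of x" "otape bs" "tape_of m" ?r] f by (simp add: rho_upd rho_snoc_0)
    from runs_Comp[OF this Guard.IH[OF Guard.prems]] f
    show "runs (1 + gb g N) (dec ?n ;; cg ?n g) (mk (tape_of x) (otape bs) (tape_of m) ?r) ?q" by simp
  qed
  then have 2: "runs (1 + gb g N + 2) (ifz ?n Nop (dec ?n ;; cg ?n g)) (mk (tape_of x) (otape bs) (tape_of m) ?r) ?q" .
  have "runs (fb f N + (1 + gb g N + 2)) (cg ?n (Guard f g)) (mk (tape_of x) (otape bs) (tape_of m) (rho e)) ?q"
    unfolding cg.simps by (rule runs_Comp[OF runs_cf[OF Guard.prems] 2])
  then show ?case by (rule runs_mono) simp
next
  case (Loop t g)
  let ?n = "length e" and ?V = "vb t N" and ?K = "evalt e t"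
  let ?M = "N + ?V"
  let ?T = "tb (V 0) ?M + tb t N + cmpb ?M ?V"
  let ?S = "\<lambda>bs e. mk (tape_of x) (otape bs) (tape_of m) (rho e)"
  let ?F = "\<lambda>v. outs x m (e @ [v]) g"
  let ?body = "dec (?n + 1) ;; cg (?n + 1) g ;; inc ?n ;; ltest ?n t"
  let ?X = "gb g ?M + ?T + 4"
  have ev: "?K \<le> ?V" by (rule evalt_le) (rule Loop)
  have test: "runs ?T (ltest ?n t) (?S bs (e @ [v])) (?S bs (e @ [v, of_bool (v < ?K)]))" if "v \<le> ?V" for v bs
    by (rule runs_ltest) (use Loop.prems that in auto)
  have loop: "runs (?X * (?K - v) + 1) (whilenz (?n + 1) ?body) (?S bs (e @ [v, of_bool (v < ?K)]))
     (?S (bs @ concat (map ?F [v..<?K])) (e @ [?K, 0]))" if "v \<le> ?K" for v bs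
    using that
  proof (induction "?K - v" arbitrary: v bs)
    case 0
    then have "v = ?K" by simp
    then show ?case using runs_whilenz_done[of "rho (e @ [?K, 0])" "?n + 1"] by simp
  next
    case (Suc k)
    then have v: "v < ?K" "k = ?K - Suc v" "Suc v \<le> ?K" by simp_all
    have 1: "runs 1 (dec (?n + 1)) (?S bs (e @ [v, 1])) (?S bs (e @ [v]))"
      using runs_dec[of "?n + 1" "tape_of x" "otape bs" "tape_of m" "rho (e @ [v, 1])"] by (simp add: rho_upd rho_zeros)
    have "runs (gb g ?M) (cg (length (e @ [v])) g) (?S bs (e @ [v])) (?S (bs @ ?F v) (e @ [v]))"
    proof (rule Loop.IH)
      show "u \<le> ?M" if "u \<in> set (e @ [v])" for u
        using that Loop.prems[of u] v ev by auto
    qed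
    then have 2: "runs (gb g ?M) (cg (?n + 1) g) (?S bs (e @ [v])) (?S (bs @ ?F v) (e @ [v]))" by simp
    have 3: "runs 1 (inc ?n) (?S (bs @ ?F v) (e @ [v])) (?S (bs @ ?F v) (e @ [Suc v]))"
      using runs_inc[of ?n "tape_of x" "otape (bs @ ?F v)" "tape_of m" "rho (e @ [v])"] by (simp add: rho_upd)
    have 4: "runs ?T (ltest ?n t) (?S (bs @ ?F v) (e @ [Suc v])) (?S (bs @ ?F v) (e @ [Suc v, of_bool (Suc v < ?K)]))"
      by (rule test) (use v ev in simp)
    have body: "runs (1 + (gb g ?M + (1 + ?T))) ?body (?S bs (e @ [v, 1])) (?S (bs @ ?F v) (e @ [Suc v, of_bool (Suc v < ?K)]))"
      by (rule runs_Comp[OF 1 runs_Comp[OF 2 runs_Comp[OF 3 4]]])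
    have "concat (map ?F [v..<?K]) = ?F v @ concat (map ?F [Suc v..<?K])"
      using v(1) by (simp add: upt_conv_Cons)
    then have rest: "runs (?X * (?K - Suc v) + 1) (whilenz (?n + 1) ?body) (?S (bs @ ?F v) (e @ [Suc v, of_bool (Suc v < ?K)]))
       (?S (bs @ concat (map ?F [v..<?K])) (e @ [?K, 0]))"
      using Suc.hyps(1)[OF v(2,3), of "bs @ ?F v"] by simp
    have "runs ((1 + (gb g ?M + (1 + ?T))) + 2 + (?X * (?K - Suc v) + 1)) (whilenz (?n + 1) ?body) (?S bs (e @ [v, 1]))
       (?S (bs @ concat (map ?F [v..<?K])) (e @ [?K, 0]))"
      by (rule runs_whilenz_step[OF _ body rest]) simp
    moreover have "(1 + (gb g ?M + (1 + ?T))) + 2 + (?X * (?K - Suc v) + 1) = ?X * (?K - v) + 1"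
    proof -
      have "?K - v = Suc (?K - Suc v)" using v(1) by simp
      then show ?thesis by simp
    qed
    ultimately show ?case using v(1) by simp
  qed
  have 1: "runs ?T (ltest ?n t) (?S bs e) (?S bs (e @ [0, of_bool (0 < ?K)]))"
    using test[of 0 bs] by (simp add: rho_snoc_0)
  have 2: "runs (?X * ?K + 1) (whilenz (?n + 1) ?body) (?S bs (e @ [0, of_bool (0 < ?K)]))
     (?S (bs @ outs x m e (Loop t g)) (e @ [?K]))"
    using loop[of 0 bs] by (simp add: rho_zeros)
  have 3: "runs (3 * ?K + 1) (clear ?n) (?S (bs @ outs x m e (Loop t g)) (e @ [?K])) (?S (bs @ outs x m e (Loop t g)) e)"
    using runs_clear[of "rho (e @ [?K])" ?n "tape_of x" "otape (bs @ outs x m e (Loop t g))" "tape_of m"]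
    by (simp add: rho_upd rho_snoc_0)
  have "runs (?T + ((?X * ?K + 1) + (3 * ?K + 1))) (cg ?n (Loop t g)) (?S bs e) (?S (bs @ outs x m e (Loop t g)) e)"
    unfolding cg.simps by (rule runs_Comp[OF 1 runs_Comp[OF 2 3]])
  moreover have "?X * ?K \<le> ?X * ?V" using ev by (rule mult_le_mono2)
  then have "?T + ((?X * ?K + 1) + (3 * ?K + 1)) \<le> gb (Loop t g) N"
    using ev unfolding gb.simps Let_def by linarith
  ultimately show ?case by (rule runs_mono)
qed

text \<open>Serves the space bound of iterated generators, whose memory is their own previous
  output. The bound depends on the environment only and not on the memory \<open>m\<close>.\<close>

lemma length_outs:
  assumes "\<And>v. v \<in> set e \<Longrightarrow> v \<le> N"
  shows "length (outs x m e g) \<le> gb g N"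
  using assms
proof (induction g arbitrary: e N)
  case (Loop t g)
  have ev: "evalt e t \<le> vb t N" by (rule evalt_le) (rule Loop)
  have le: "length (outs x m (e @ [v]) g) \<le> gb g (N + vb t N)" if "v < evalt e t" for v
  proof (rule Loop.IH)
    show "u \<le> N + vb t N" if "u \<in> set (e @ [v])" for u
      using that Loop.prems[of u] \<open>v < evalt e t\<close> ev by auto
  qed
  have "length (outs x m e (Loop t g)) = (\<Sum>v<evalt e t. length (outs x m (e @ [v]) g))"
    by (simp add: length_concat o_def interv_sum_list_conv_sum_set_nat lessThan_atLeast0)
  also have "\<dots> \<le> evalt e t * gb g (N + vb t N)"
    using sum_bounded_above[of "{..<evalt e t}" "\<lambda>v. length (outs x m (e @ [v]) g)" "gb g (N + vb t N)"] le by simp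
  also have "\<dots> \<le> vb t N * gb g (N + vb t N)" using ev by (rule mult_le_mono1)
  also have "\<dots> \<le> gb (Loop t g) N" by (simp add: Let_def algebra_simps)
  finally show ?case .
next
  case (App g h)
  have "length (outs x m e g) \<le> gb g N" by (rule App.IH(1)) (rule App.prems)
  moreover have "length (outs x m e h) \<le> gb h N" by (rule App.IH(2)) (rule App.prems)
  ultimately show ?case by simp
next
  case (Guard f g)
  have "length (outs x m e g) \<le> gb g N" by (rule Guard.IH) (rule Guard.prems)
  then show ?case by simp
qed simp

section \<open>Polynomial bounds\<close>

definition pbd :: "(nat \<Rightarrow> nat) \<Rightarrow> bool" where
  "pbd f \<longleftrightarrow> (\<exists>p :: nat poly. \<forall>n. f n \<le> poly p n)"

lemma poly_nat_mono: "x \<le> y \<Longrightarrow> poly (p :: nat poly) x \<le> poly p y"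
  by (induction p) (auto intro!: add_mono mult_mono)

lemma pbd_const: "pbd (\<lambda>_. c)"
  unfolding pbd_def by (rule exI[of _ "[:c:]"]) simp

lemma pbd_id: "pbd (\<lambda>n. n)"
  unfolding pbd_def by (rule exI[of _ "[:0, 1:]"]) simp

lemma pbd_add: "pbd f \<Longrightarrow> pbd g \<Longrightarrow> pbd (\<lambda>n. f n + g n)"
  unfolding pbd_def by (metis add_mono poly_add)

lemma pbd_mult: "pbd f \<Longrightarrow> pbd g \<Longrightarrow> pbd (\<lambda>n. f n * g n)"
  unfolding pbd_def by (metis mult_le_mono poly_mult)

text \<open>Polynomials with natural coefficients are monotone. Composition occurs in the bounds of
  \<open>Ex\<close> and \<open>Loop\<close>, where the environment is extended by a value of size up
  to \<open>vb t N\<close>.\<close>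

lemma pbd_comp: "pbd f \<Longrightarrow> pbd g \<Longrightarrow> pbd (\<lambda>n. f (g n))"
  unfolding pbd_def
proof (elim exE)
  fix p q :: "nat poly" assume p: "\<forall>n. f n \<le> poly p n" and q: "\<forall>n. g n \<le> poly q n"
  have "f (g n) \<le> poly (pcompose p q) n" for n
  proof -
    have "f (g n) \<le> poly p (g n)" using p by blast
    also have "\<dots> \<le> poly p (poly q n)" by (rule poly_nat_mono) (use q in blast)
    finally show ?thesis by (simp add: poly_pcompose)
  qed
  then show "\<exists>p. \<forall>n. f (g n) \<le> poly p n" by blast
qed

lemma pbd_Suc: "pbd f \<Longrightarrow> pbd (\<lambda>n. Suc (f n))"
  using pbd_add[OF pbd_const[of 1]] by simp

lemmas pbd_intros = pbd_const pbd_id pbd_add pbd_mult pbd_Suc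

lemma pbd_vb: "pbd (vb t)"
  by (induction t) (auto intro!: pbd_intros)

lemma pbd_tb: "pbd (tb t)"
  by (induction t) (auto intro!: pbd_intros pbd_vb)

lemma pbd_fb: "pbd (fb f)"
proof (induction f)
  case (Ex t f)
  have "pbd (\<lambda>N. fb f (N + vb t N))"
    by (rule pbd_comp[OF Ex]) (intro pbd_intros pbd_vb)
  then show ?case by (simp add: pbd_intros pbd_vb pbd_tb)
qed (simp_all add: pbd_intros pbd_vb pbd_tb cmpb_def)

lemma pbd_gb: "pbd (gb g)"
proof (induction g)
  case (Loop t g)
  have "pbd (\<lambda>N. gb g (N + vb t N))"
    by (rule pbd_comp[OF Loop]) (intro pbd_intros pbd_vb)
  then show ?case by (simp add: Let_def cmpb_def pbd_intros pbd_vb pbd_tb)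
qed (simp_all add: pbd_intros pbd_fb)

section \<open>From generators to machines\<close>

text \<open>The part of \<open>wf_com\<close> that does not mention the number of tapes; a
  sufficient number of tapes is chosen afterwards, since \<open>wf_com\<close> is monotone in
  it.\<close>

primrec puts_ok :: "com \<Rightarrow> bool" where
  "puts_ok Nop = True"
| "puts_ok (Go k d) = True"
| "puts_ok (Put k a) = (a < 4)"
| "puts_ok (c1 ;; c2) = (puts_ok c1 \<and> puts_ok c2)"
| "puts_ok (Branch k a c1 c2) = (puts_ok c1 \<and> puts_ok c2)"
| "puts_ok (Until k a c) = puts_ok c"

lemma ex_wf_com: "puts_ok c \<Longrightarrow> \<exists>K. wf_com K c"
proof (induction c)
  case (Comp c1 c2)
  then obtain K1 K2 where "wf_com K1 c1" "wf_com K2 c2" by auto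
  then have "wf_com (max K1 K2) (c1 ;; c2)" by (auto intro: wf_com_mono)
  then show ?case by blast
next
  case (Branch k a c1 c2)
  then obtain K1 K2 where "wf_com K1 c1" "wf_com K2 c2" by auto
  then have "wf_com (max (Suc k) (max K1 K2)) (Branch k a c1 c2)" by (auto intro: wf_com_mono)
  then show ?case by blast
next
  case (Until k a c)
  then obtain K where "wf_com K c" by auto
  then have "wf_com (max (Suc k) K) (Until k a c)" by (auto intro: wf_com_mono)
  then show ?case by blast
qed (auto intro: exI[of _ "Suc _"])

lemma ex_wf_com_ge:
  assumes "puts_ok c"
  obtains K where "K0 \<le> K" "wf_com K c"
proof -
  obtain K where "wf_com K c" using ex_wf_com[OF assms] by blast
  then have "wf_com (max K0 K) c" by (auto intro: wf_com_mono)
  then show thesis using that[of "max K0 K"] by simp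
qed

lemma puts_ok_regs [simp]: "puts_ok (inc r)" "puts_ok (dec r)" "puts_ok (whilenz r c) = puts_ok c"
  "puts_ok (ifz r c c') = (puts_ok c \<and> puts_ok c')" "puts_ok (clear r)" "puts_ok (move_add r d)"
  "puts_ok (copy r d e)" "puts_ok (cmp r)" "puts_ok (fetch r d)"
  by (simp_all add: inc_def dec_def whilenz_def ifz_def clear_def move_add_def copy_def cmp_def fetch_def)

lemma puts_ok_incs [simp]: "puts_ok (incs r c)"
  by (induction c) auto

lemma puts_ok_ct [simp]: "puts_ok (ct n d t)"
  by (induction t arbitrary: d) auto

lemma puts_ok_cf [simp]: "puts_ok (cf n f)"
  by (induction f arbitrary: n) auto

lemma puts_ok_cg [simp]: "puts_ok (cg n g)"
  by (induction g arbitrary: n) (auto simp: ltest_def)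

section \<open>Functions computable in polynomial time\<close>

definition count :: com where
  "count = Go 0 Move_Right ;; Until 0 0 (inc 0 ;; Go 0 Move_Right) ;; Until 0 1 (Go 0 Move_Left)"

text \<open>Puts the length of the word into register 0, which yields the environment
  \<open>[length x]\<close> in which generators and formulas are started.\<close>

lemma runs_count: "runs (7 * length x + 6) count (mk (tape_of x) b m (rho [])) (mk (tape_of x) b m (rho [length x]))"
proof -
  let ?n = "length x"
  let ?S = "\<lambda>i. mk (cont x, Suc (?n - i)) b m (rho [?n - i])"
  have 1: "runs 1 (Go 0 Move_Right) (mk (tape_of x) b m (rho [])) (?S ?n)"
    by (rule runs_Go) (use rho_snoc_0[of "[]"] in \<open>simp add: tape_of_eq\<close>)
  have 2: "runs ((1 + 1 + 2) * ?n + 1) (Until 0 0 (inc 0 ;; Go 0 Move_Right)) (?S ?n) (?S 0)"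
  proof (rule runs_countdown[of ?n ?S])
    show "scanned (?S i 0) = 0 \<longleftrightarrow> i = 0" if "i \<le> ?n" for i
      using that by (auto simp: scanned_def)
  next
    fix i assume i: "i < ?n"
    then have e: "Suc (?n - Suc i) = ?n - i" by simp
    have 1: "runs 1 (inc 0) (?S (Suc i)) (mk (cont x, ?n - i) b m (rho [?n - i]))"
      using runs_inc[of 0 "(cont x, Suc (?n - Suc i))" b m "rho [?n - Suc i]"] rho_upd(1)[of "[]"] rho_last[of "[]"]
      by (simp add: e)
    have 2: "runs 1 (Go 0 Move_Right) (mk (cont x, ?n - i) b m (rho [?n - i])) (?S i)"
      by (rule runs_Go) simp
    show "runs (1 + 1) (inc 0 ;; Go 0 Move_Right) (?S (Suc i)) (?S i)" by (rule runs_Comp[OF 1 2])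
  qed
  have 3: "runs (3 * Suc ?n + 1) (Until 0 1 (Go 0 Move_Left)) (?S 0) (mk (tape_of x) b m (rho [?n]))"
    using runs_rewind[of "?S 0" 0 "cont x" "Suc ?n"] by (simp add: tape_of_eq)
  show ?thesis unfolding count_def by (rule runs_mono[OF runs_Comp[OF 1 runs_Comp[OF 2 3]]]) simp
qed

lemma puts_ok_count [simp]: "puts_ok count"
  by (simp add: count_def)

theorem poly_time_outs: "poly_time_computable (\<lambda>x. outs x [] [length x] g)"
proof -
  let ?c = "count ;; Go 1 Move_Right ;; cg 1 g"
  obtain K where K: "2 \<le> K" "wf_com K ?c" by (rule ex_wf_com_ge[of ?c 2]) auto
  \<comment> \<open>Either halting state is admissible when a function is computed, so any final
    test will do.\<close>
  let ?M = "tm_of_com K ?c 0 0"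
  \<comment> \<open>Counting the input, moving to the first output cell, generating, and the two
    steps of \<open>tm_of_com_run\<close>.\<close>
  have "pbd (\<lambda>n. (7 * n + 6) + (1 + gb g n) + 2)" by (intro pbd_intros pbd_gb)
  then obtain p where p: "\<And>n. (7 * n + 6) + (1 + gb g n) + 2 \<le> poly p n" unfolding pbd_def by blast
  have "computes_in_time ?M (\<lambda>x. outs x [] [length x] g) (poly p)"
    unfolding computes_in_time_def
  proof
    fix x :: "bool list"
    let ?n = "length x" and ?y = "outs x [] [length x] g"
    let ?s = "mk (tape_of x) (otape ?y) (tape_of []) (rho [?n])"
    have 1: "runs (7 * ?n + 6) count (initial x) (mk (tape_of x) (tape_of []) (tape_of []) (rho [?n]))"
      using runs_count[of x "tape_of []" "tape_of []"] by (simp add: initial_mk rho_Nil)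
    have 2: "runs 1 (Go 1 Move_Right) (mk (tape_of x) (tape_of []) (tape_of []) (rho [?n]))
        (mk (tape_of x) (otape []) (tape_of []) (rho [?n]))"
      by (rule runs_Go) (simp add: tape_of_eq otape_def)
    have 3: "runs (gb g ?n) (cg 1 g) (mk (tape_of x) (otape []) (tape_of []) (rho [?n])) ?s"
      using runs_cg[of "[?n]" ?n g x "[]" "[]"] by simp
    obtain t where t: "t \<le> (7 * ?n + 6) + (1 + gb g ?n)" "exec (\<lambda>_. True) ?c (initial x) t ?s"
      using runs_Comp[OF 1 runs_Comp[OF 2 3]] unfolding runs_def by blast
    have run: "run ?M x (t + 2) = (if scanned (?s 0) = 0 then accept_state else reject_state, lay K ?s)"
      by (rule tm_of_com_run(1)[OF t(2) K(2)]) (use K(1) in auto)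
    have "last (lay K ?s) = lay K ?s ! (K - 1)"
      using K(1) length_lay[of K ?s] by (subst last_conv_nth) (auto simp del: length_lay)
    also have "\<dots> = otape ?y" using K(1) by (simp add: lay_def pos_def)
    finally have "has_output (run ?M x (t + 2)) ?y"
      unfolding run by (simp add: has_output_def otape_def cont_Suc blank_sym_def)
    moreover have "halted (run ?M x (t + 2))" unfolding run by (simp add: halted_def)
    moreover have "t + 2 \<le> poly p ?n" using t(1) p[of ?n] by linarith
    ultimately show "\<exists>t\<le>poly p ?n. halted (run ?M x t) \<and> has_output (run ?M x t) ?y" by blast
  qed
  moreover have "wf_tm ?M" using wf_tm_of_com[OF K(2)] K(1) by simp
  ultimately show ?thesis unfolding poly_time_computable_def by blast
qed

section \<open>Computations in bounded space\<close>

definition spaced :: "nat \<Rightarrow> com \<Rightarrow> tapes \<Rightarrow> tapes \<Rightarrow> bool" where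
  "spaced B c s s' \<longleftrightarrow> (\<exists>t. exec (\<lambda>h. h < B) c s t s')"

text \<open>Pieces with a time bound are turned into pieces with a space bound;
  \<open>spaced\<close> itself leaves the number of steps open, so that such pieces can be repeated
  exponentially often.\<close>

lemma spaced_runs:
  assumes "runs T c s s'" "\<And>k. snd (s k) < A" "A + T \<le> B"
  shows "spaced B c s s'"
proof -
  obtain t where t: "t \<le> T" "exec (\<lambda>_. True) c s t s'" using assms(1) unfolding runs_def by blast
  have "exec (\<lambda>h. h < A + t) c s t s'" using exec_heads_lt[OF t(2), of A] assms(2) by blast
  then have "exec (\<lambda>h. h < B) c s t s'" by (rule exec_mono) (use t(1) assms(3) in linarith)
  then show ?thesis unfolding spaced_def by blast
qed

lemma spaced_mono: "spaced B c s s' \<Longrightarrow> B \<le> B' \<Longrightarrow> spaced B' c s s'"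
  unfolding spaced_def by (meson exec_mono less_le_trans)

lemma spaced_Comp: "spaced B c1 s s1 \<Longrightarrow> spaced B c2 s1 s2 \<Longrightarrow> spaced B (c1 ;; c2) s s2"
  unfolding spaced_def using exec.Comp by blast

lemma spaced_ifz:
  assumes "\<rho> r = 0 \<Longrightarrow> spaced B c1 (mk a b m \<rho>) s'" "\<rho> r \<noteq> 0 \<Longrightarrow> spaced B c2 (mk a b m \<rho>) s'"
  shows "spaced B (ifz r c1 c2) (mk a b m \<rho>) s'"
proof (cases "\<rho> r = 0")
  case True
  then have s: "scanned (mk a b m \<rho> (r + 3)) = 1" by (simp only: scanned_reg)
  show ?thesis using assms(1)[OF True] exec.BranchT[of "mk a b m \<rho>" "r + 3" 1, OF s] unfolding spaced_def ifz_def by blast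
next
  case False
  then have s: "scanned (mk a b m \<rho> (r + 3)) \<noteq> 1" by (simp only: scanned_reg not_False_eq_True)
  show ?thesis using assms(2)[OF False] exec.BranchF[of "mk a b m \<rho>" "r + 3" 1, OF s] unfolding spaced_def ifz_def by blast
qed

lemma spaced_whilenz_done:
  assumes "\<rho> r = 0"
  shows "spaced B (whilenz r c) (mk a b m \<rho>) (mk a b m \<rho>)"
proof -
  have s: "scanned (mk a b m \<rho> (r + 3)) = 1" using assms by (simp only: scanned_reg)
  show ?thesis using exec.UntilT[of "mk a b m \<rho>" "r + 3" 1, OF s] unfolding spaced_def whilenz_def by blast
qed

lemma spaced_whilenz_step:
  assumes "\<rho> r \<noteq> 0" "spaced B c (mk a b m \<rho>) s1" "spaced B (whilenz r c) s1 s2"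
  shows "spaced B (whilenz r c) (mk a b m \<rho>) s2"
proof -
  have s: "scanned (mk a b m \<rho> (r + 3)) \<noteq> 1" using assms(1) by (simp only: scanned_reg not_False_eq_True)
  show ?thesis using exec.UntilF[of "mk a b m \<rho>" "r + 3" 1, OF s] assms(2,3) unfolding spaced_def whilenz_def by blast
qed

text \<open>Erasure proceeds from left to right, up to the first cell that is already blank. The
  start symbol in cell 0 survives and stops the way back.\<close>

definition blanked :: "nat \<Rightarrow> bool list \<Rightarrow> nat \<Rightarrow> nat" where
  "blanked i x = (\<lambda>j. if 1 \<le> j \<and> j \<le> i then 0 else cont x j)"

lemma blanked_0 [simp]: "blanked 0 x = cont x"
  by (auto simp: blanked_def fun_eq_iff)

lemma blanked_length: "blanked (length x) x = cont []"
  by (auto simp: blanked_def fun_eq_iff cont_def tape_of_def blank_sym_def)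

lemma blanked_Suc: "(blanked i x)(Suc i := 0) = blanked (Suc i) x"
  by (auto simp: blanked_def fun_eq_iff)

lemma blanked_at [simp]: "blanked i x (Suc i) = cont x (Suc i)"
  by (simp add: blanked_def)

definition wipe :: com where
  "wipe = Go 2 Move_Right ;; Until 2 0 (Put 2 0 ;; Go 2 Move_Right) ;; Until 2 1 (Go 2 Move_Left)"

lemma runs_wipe: "runs (7 * length m + 6) wipe (mk a b (tape_of m) \<rho>) (mk a b (tape_of []) \<rho>)"
proof -
  let ?n = "length m"
  let ?S = "\<lambda>i. mk a b (blanked (?n - i) m, Suc (?n - i)) \<rho>"
  have 1: "runs 1 (Go 2 Move_Right) (mk a b (tape_of m) \<rho>) (?S ?n)"
    by (rule runs_Go) (simp add: tape_of_eq)
  have 2: "runs ((1 + 1 + 2) * ?n + 1) (Until 2 0 (Put 2 0 ;; Go 2 Move_Right)) (?S ?n) (?S 0)"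
  proof (rule runs_countdown[of ?n ?S])
    show "scanned (?S i 2) = 0 \<longleftrightarrow> i = 0" if "i \<le> ?n" for i
      using that by (auto simp: scanned_def)
  next
    fix i assume i: "i < ?n"
    then have e: "Suc (?n - Suc i) = ?n - i" by simp
    have 1: "runs 1 (Put 2 0) (?S (Suc i)) (mk a b (blanked (?n - i) m, ?n - i) \<rho>)"
      by (rule runs_Put) (use blanked_Suc[of "?n - Suc i" m] e in simp)
    have 2: "runs 1 (Go 2 Move_Right) (mk a b (blanked (?n - i) m, ?n - i) \<rho>) (?S i)"
      by (rule runs_Go) simp
    show "runs (1 + 1) (Put 2 0 ;; Go 2 Move_Right) (?S (Suc i)) (?S i)" by (rule runs_Comp[OF 1 2])
  qed
  have 3: "runs (3 * Suc ?n + 1) (Until 2 1 (Go 2 Move_Left)) (?S 0) (mk a b (tape_of []) \<rho>)"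
    using runs_rewind[of "?S 0" 2 "cont []" "Suc ?n"] by (simp add: tape_of_eq blanked_length)
  show ?thesis unfolding wipe_def by (rule runs_mono[OF runs_Comp[OF 1 runs_Comp[OF 2 3]]]) simp
qed

text \<open>Makes the output the new memory and leaves an empty output tape for the next round. The
  old memory is wiped first, since it may be longer than the new one.\<close>

definition transfer :: com where
  "transfer = wipe ;; Until 1 1 (Go 1 Move_Left) ;; Go 1 Move_Right ;; Go 2 Move_Right ;;
     Until 1 0 (Branch 1 3 (Put 2 3) (Put 2 2) ;; Put 1 0 ;; Go 1 Move_Right ;; Go 2 Move_Right) ;;
     Until 1 1 (Go 1 Move_Left) ;; Until 2 1 (Go 2 Move_Left)"

lemma runs_transfer:
  "runs (7 * length m + 17 * length bs + 30) transfer (mk a (otape bs) (tape_of m) \<rho>) (mk a (tape_of []) (tape_of bs) \<rho>)"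
proof -
  let ?n = "length bs"
  let ?S = "\<lambda>i. mk a (blanked (?n - i) bs, Suc (?n - i)) (otape (take (?n - i) bs)) \<rho>"
  have 1: "runs (3 * Suc ?n + 1) (Until 1 1 (Go 1 Move_Left)) (mk a (otape bs) (tape_of []) \<rho>) (mk a (tape_of bs) (tape_of []) \<rho>)"
    using runs_rewind[of "mk a (otape bs) (tape_of []) \<rho>" 1 "cont bs" "Suc ?n"] by (simp add: tape_of_eq otape_def)
  have 2: "runs 1 (Go 1 Move_Right) (mk a (tape_of bs) (tape_of []) \<rho>) (mk a (cont bs, Suc 0) (tape_of []) \<rho>)"
    by (rule runs_Go) (simp add: tape_of_eq)
  have 3: "runs 1 (Go 2 Move_Right) (mk a (cont bs, Suc 0) (tape_of []) \<rho>) (?S ?n)"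
    by (rule runs_Go) (simp add: tape_of_eq otape_def)
  have 4: "runs ((3 + (1 + (1 + 1)) + 2) * ?n + 1)
      (Until 1 0 (Branch 1 3 (Put 2 3) (Put 2 2) ;; Put 1 0 ;; Go 1 Move_Right ;; Go 2 Move_Right)) (?S ?n) (?S 0)"
  proof (rule runs_countdown[of ?n ?S])
    show "scanned (?S i 1) = 0 \<longleftrightarrow> i = 0" if "i \<le> ?n" for i
      using that by (auto simp: scanned_def)
  next
    fix i assume i: "i < ?n"
    define j where "j = ?n - Suc i"
    have j: "?n - i = Suc j" "j < ?n" using i by (simp_all add: j_def)
    let ?m = "(cont (take (Suc j) bs), Suc j)"
    have m: "((cont (take j bs))(Suc j := bit_sym (bs ! j)), Suc j) = ?m"
      using cont_snoc[of "take j bs" "bs ! j"] j(2) by (simp add: take_Suc_conv_app_nth)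
    have sc: "cont bs (Suc j) = 3 \<longleftrightarrow> bs ! j" using j(2) by (simp add: cont_eq_3)
    have 1: "runs (1 + 2) (Branch 1 3 (Put 2 3) (Put 2 2)) (mk a (blanked j bs, Suc j) (otape (take j bs)) \<rho>)
        (mk a (blanked j bs, Suc j) ?m \<rho>)"
    proof (rule runs_Branch)
      assume "scanned (mk a (blanked j bs, Suc j) (otape (take j bs)) \<rho> 1) = 3"
      then have "bs ! j" using sc by (simp add: scanned_def)
      then show "runs 1 (Put 2 3) (mk a (blanked j bs, Suc j) (otape (take j bs)) \<rho>) (mk a (blanked j bs, Suc j) ?m \<rho>)"
        by (intro runs_Put) (use m j(2) in \<open>simp add: otape_def bit_sym_def\<close>)
    next
      assume "scanned (mk a (blanked j bs, Suc j) (otape (take j bs)) \<rho> 1) \<noteq> 3"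
      then have "\<not> bs ! j" using sc by (simp add: scanned_def)
      then show "runs 1 (Put 2 2) (mk a (blanked j bs, Suc j) (otape (take j bs)) \<rho>) (mk a (blanked j bs, Suc j) ?m \<rho>)"
        by (intro runs_Put) (use m j(2) in \<open>simp add: otape_def bit_sym_def\<close>)
    qed
    have 2: "runs 1 (Put 1 0) (mk a (blanked j bs, Suc j) ?m \<rho>) (mk a (blanked (Suc j) bs, Suc j) ?m \<rho>)"
      by (rule runs_Put) (simp add: blanked_Suc)
    have 3: "runs 1 (Go 1 Move_Right) (mk a (blanked (Suc j) bs, Suc j) ?m \<rho>) (mk a (blanked (Suc j) bs, Suc (Suc j)) ?m \<rho>)"
      by (rule runs_Go) simp
    have 4: "runs 1 (Go 2 Move_Right) (mk a (blanked (Suc j) bs, Suc (Suc j)) ?m \<rho>) (mk a (blanked (Suc j) bs, Suc (Suc j)) (otape (take (Suc j) bs)) \<rho>)"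
      by (rule runs_Go) (use j(2) in \<open>simp add: otape_def\<close>)
    have "runs ((1 + 2) + (1 + (1 + 1))) (Branch 1 3 (Put 2 3) (Put 2 2) ;; Put 1 0 ;; Go 1 Move_Right ;; Go 2 Move_Right)
      (mk a (blanked j bs, Suc j) (otape (take j bs)) \<rho>) (mk a (blanked (Suc j) bs, Suc (Suc j)) (otape (take (Suc j) bs)) \<rho>)"
      by (rule runs_Comp[OF 1 runs_Comp[OF 2 runs_Comp[OF 3 4]]])
    then show "runs (3 + (1 + (1 + 1))) (Branch 1 3 (Put 2 3) (Put 2 2) ;; Put 1 0 ;; Go 1 Move_Right ;; Go 2 Move_Right) (?S (Suc i)) (?S i)"
      unfolding j(1) j_def[symmetric] by (rule runs_mono) simp
  qed
  have 5: "runs (3 * Suc ?n + 1) (Until 1 1 (Go 1 Move_Left)) (?S 0) (mk a (tape_of []) (otape bs) \<rho>)"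
    using runs_rewind[of "?S 0" 1 "cont []" "Suc ?n"] by (simp add: tape_of_eq blanked_length)
  have 6: "runs (3 * Suc ?n + 1) (Until 2 1 (Go 2 Move_Left)) (mk a (tape_of []) (otape bs) \<rho>) (mk a (tape_of []) (tape_of bs) \<rho>)"
    using runs_rewind[of "mk a (tape_of []) (otape bs) \<rho>" 2 "cont bs" "Suc ?n"] by (simp add: tape_of_eq otape_def)
  show ?thesis unfolding transfer_def
    by (rule runs_mono[OF runs_Comp[OF runs_wipe runs_Comp[OF 1 runs_Comp[OF 2 runs_Comp[OF 3 runs_Comp[OF 4 runs_Comp[OF 5 6]]]]]]]) simp
qed

lemma puts_ok_transfer [simp]: "puts_ok wipe" "puts_ok transfer"
  by (simp_all add: wipe_def transfer_def)

definition stt :: "bool list \<Rightarrow> bool list \<Rightarrow> nat list \<Rightarrow> tapes" where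
  "stt x m e = mk (tape_of x) (tape_of []) (tape_of m) (rho e)"

lemma heads_mk: "snd a < A \<Longrightarrow> snd b < A \<Longrightarrow> snd m < A \<Longrightarrow> (\<And>v. v \<in> set e \<Longrightarrow> v < A) \<Longrightarrow> snd (mk a b m (rho e) k) < A"
  by (auto simp: mk_def rho_def)

text \<open>Membership in \<open>D\<close> is a promise: nothing is said about other words, not even
  termination. Output and memory are empty again at the end, so that deciders can be run one after
  the other.\<close>

definition decidable_on :: "language \<Rightarrow> language \<Rightarrow> bool" where
  "decidable_on D L \<longleftrightarrow> (\<exists>c B. puts_ok c \<and> pbd B \<and>
     (\<forall>x \<in> D. spaced (B (length x)) c (stt x [] [length x]) (stt x [] [length x, of_bool (x \<in> L)])))"

lemma spaced_cf:
  assumes "n + 2 + fb f n \<le> B" "length x = n"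
  shows "spaced B (cf 1 f) (stt x m [n]) (stt x m [n, of_bool (evalf x m [n] f)])"
proof -
  have "runs (fb f n) (cf 1 f) (stt x m [n]) (stt x m [n, of_bool (evalf x m [n] f)])"
    using runs_cf[of "[n]" n f x "tape_of []" m] by (simp add: stt_def)
  then show ?thesis by (rule spaced_runs[where A = "n + 2"]) (use assms(1) in \<open>auto simp: stt_def tape_of_eq intro!: heads_mk\<close>)
qed

lemma decidable_on_fm:
  assumes "\<And>x. x \<in> D \<Longrightarrow> evalf x [] [length x] f \<longleftrightarrow> x \<in> L"
  shows "decidable_on D L"
  unfolding decidable_on_def
proof (intro exI conjI ballI)
  show "puts_ok (cf 1 f)" by simp
  show "pbd (\<lambda>n. n + 2 + fb f n)" by (intro pbd_intros pbd_fb)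
  fix x assume "x \<in> D"
  then show "spaced (length x + 2 + fb f (length x)) (cf 1 f) (stt x [] [length x]) (stt x [] [length x, of_bool (x \<in> L)])"
    using spaced_cf[of "length x" f _ x "[]"] assms[of x] by simp
qed

text \<open>The second decider is started only after the first one has accepted, so it may rely on
  the first property as a promise.\<close>

lemma decidable_on_Int:
  assumes "decidable_on D L1" "decidable_on (D \<inter> L1) L2"
  shows "decidable_on D (L1 \<inter> L2)"
proof -
  obtain c1 B1 where 1: "puts_ok c1" "pbd B1"
    "\<And>x. x \<in> D \<Longrightarrow> spaced (B1 (length x)) c1 (stt x [] [length x]) (stt x [] [length x, of_bool (x \<in> L1)])"
    using assms(1) unfolding decidable_on_def by blast
  obtain c2 B2 where 2: "puts_ok c2" "pbd B2"
    "\<And>x. x \<in> D \<inter> L1 \<Longrightarrow> spaced (B2 (length x)) c2 (stt x [] [length x]) (stt x [] [length x, of_bool (x \<in> L2)])"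
    using assms(2) unfolding decidable_on_def by blast
  show ?thesis unfolding decidable_on_def
  proof (intro exI conjI ballI)
    show "puts_ok (c1 ;; ifz 1 Nop (dec 1 ;; c2))" using 1 2 by simp
    show "pbd (\<lambda>n. B1 n + B2 n + n + 5)" using 1(2) 2(2) by (intro pbd_intros)
    fix x assume x: "x \<in> D"
    let ?n = "length x" and ?B = "B1 (length x) + B2 (length x) + length x + 5"
    have "spaced ?B (ifz 1 Nop (dec 1 ;; c2)) (stt x [] [?n, of_bool (x \<in> L1)]) (stt x [] [?n, of_bool (x \<in> L1 \<inter> L2)])"
      unfolding stt_def
    proof (rule spaced_ifz)
      assume "rho [?n, of_bool (x \<in> L1)] 1 = 0"
      then have "x \<notin> L1" by (simp add: rho_def)
      then show "spaced ?B Nop (mk (tape_of x) (tape_of []) (tape_of []) (rho [?n, of_bool (x \<in> L1)]))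
         (mk (tape_of x) (tape_of []) (tape_of []) (rho [?n, of_bool (x \<in> L1 \<inter> L2)]))"
        using exec.Nop by (auto simp: spaced_def)
    next
      assume "rho [?n, of_bool (x \<in> L1)] 1 \<noteq> 0"
      then have x1: "x \<in> L1" by (simp add: rho_def split: if_splits)
      have "runs 1 (dec 1) (stt x [] [?n, 1]) (stt x [] [?n])"
        using runs_dec[of 1 "tape_of x" "tape_of []" "tape_of []" "rho [?n, 1]"] rho_upd(1)[of "[?n]" 1 0] rho_snoc_0[of "[?n]"] rho_last[of "[?n]" 1]
        by (simp add: stt_def)
      then have "spaced ?B (dec 1) (stt x [] [?n, 1]) (stt x [] [?n])"
        by (rule spaced_runs[where A = "?n + 2"]) (auto simp: stt_def tape_of_eq intro!: heads_mk)
      moreover have "spaced ?B c2 (stt x [] [?n]) (stt x [] [?n, of_bool (x \<in> L2)])"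
        by (rule spaced_mono[OF 2(3)]) (use x x1 in auto)
      ultimately show "spaced ?B (dec 1 ;; c2) (mk (tape_of x) (tape_of []) (tape_of []) (rho [?n, of_bool (x \<in> L1)]))
         (mk (tape_of x) (tape_of []) (tape_of []) (rho [?n, of_bool (x \<in> L1 \<inter> L2)]))"
        using spaced_Comp x1 by (fastforce simp: stt_def)
    qed
    moreover have "spaced ?B c1 (stt x [] [?n]) (stt x [] [?n, of_bool (x \<in> L1)])"
      by (rule spaced_mono[OF 1(3)[OF x]]) simp
    ultimately show "spaced ?B (c1 ;; ifz 1 Nop (dec 1 ;; c2)) (stt x [] [?n]) (stt x [] [?n, of_bool (x \<in> L1 \<inter> L2)])"
      using spaced_Comp by blast
  qed
qed

definition mem_at :: "bool list \<Rightarrow> gen \<Rightarrow> nat \<Rightarrow> bool list" where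
  "mem_at x g i = ((\<lambda>m. outs x m [length x] g) ^^ i) []"

lemma mem_at_simps [simp]: "mem_at x g 0 = []" "mem_at x g (Suc i) = outs x (mem_at x g i) [length x] g"
  by (simp_all add: mem_at_def)

text \<open>No bound on the number \<open>k\<close> of rounds is required. Every memory is an output
  of \<open>g\<close> in the fixed environment \<open>[length x]\<close>, hence of polynomial
  length, and each round takes polynomial time, hence polynomial space.\<close>

lemma decidable_on_iterate:
  assumes "\<And>x. x \<in> D \<Longrightarrow> \<exists>k. evalf x (mem_at x g k) [length x] H \<and>
     (\<forall>i<k. \<not> evalf x (mem_at x g i) [length x] H) \<and> (evalf x (mem_at x g k) [length x] A \<longleftrightarrow> x \<in> L)"
  shows "decidable_on D L"
proof -
  \<comment> \<open>Register 1 carries the truth value of \<open>Neg H\<close>: the loop runs while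
    it is nonzero, and \<open>dec 1\<close> clears it. The move on tape 1 puts the head on the first
    output cell.\<close>
  let ?body = "dec 1 ;; Go 1 Move_Right ;; cg 1 g ;; transfer ;; cf 1 (Neg H)"
  let ?c = "cf 1 (Neg H) ;; whilenz 1 ?body ;; cf 1 A ;; wipe"
  \<comment> \<open>Generously rounded: a round spends \<open>gb g n\<close> on generating and, by
    \<open>runs_transfer\<close>, at most \<open>24 * gb g n + 30\<close> on the transfer.\<close>
  let ?B = "\<lambda>n. n + 3 + fb (Neg H) n + fb A n + 26 * gb g n + 40"
  show ?thesis unfolding decidable_on_def
  proof (intro exI conjI ballI)
    show "puts_ok ?c" by simp
    show "pbd ?B" by (intro pbd_intros pbd_fb pbd_gb)
    fix x assume "x \<in> D"
    let ?n = "length x" and ?m = "mem_at x g"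
    from assms[OF \<open>x \<in> D\<close>] obtain k where k: "evalf x (?m k) [?n] H"
      "\<And>i. i < k \<Longrightarrow> \<not> evalf x (?m i) [?n] H" "evalf x (?m k) [?n] A \<longleftrightarrow> x \<in> L" by blast
    have len: "length (?m i) \<le> gb g ?n" for i
      by (cases i) (auto intro!: length_outs)
    have test: "spaced (?B ?n) (cf 1 (Neg H)) (stt x (?m i) [?n]) (stt x (?m i) [?n, of_bool (\<not> evalf x (?m i) [?n] H)])" for i
      using spaced_cf[of ?n "Neg H" "?B ?n" x "?m i"] by simp
    have loop: "spaced (?B ?n) (whilenz 1 ?body) (stt x (?m i) [?n, of_bool (\<not> evalf x (?m i) [?n] H)]) (stt x (?m k) [?n])"
      if "i \<le> k" for i
      using that
    proof (induction "k - i" arbitrary: i)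
      case 0
      then have "i = k" by simp
      then have e: "stt x (?m i) [?n, of_bool (\<not> evalf x (?m i) [?n] H)] = stt x (?m k) [?n]"
        using k(1) rho_snoc_0[of "[?n]"] by (simp add: stt_def)
      show ?case unfolding e unfolding stt_def by (rule spaced_whilenz_done) (simp add: rho_def)
    next
      case (Suc d)
      then have i: "i < k" "d = k - Suc i" "Suc i \<le> k" by simp_all
      have e: "stt x (?m i) [?n, of_bool (\<not> evalf x (?m i) [?n] H)] = stt x (?m i) [?n, 1]"
        using k(2)[OF i(1)] by simp
      have 1: "runs 1 (dec 1) (stt x (?m i) [?n, 1]) (stt x (?m i) [?n])"
        using runs_dec[of 1 "tape_of x" "tape_of []" "tape_of (?m i)" "rho [?n, 1]"] rho_upd(1)[of "[?n]" 1 0] rho_snoc_0[of "[?n]"] rho_last[of "[?n]" 1]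
        by (simp add: stt_def)
      have 2: "runs 1 (Go 1 Move_Right) (stt x (?m i) [?n]) (mk (tape_of x) (otape []) (tape_of (?m i)) (rho [?n]))"
        unfolding stt_def by (rule runs_Go) (simp add: tape_of_eq otape_def)
      have 3: "runs (gb g ?n) (cg 1 g) (mk (tape_of x) (otape []) (tape_of (?m i)) (rho [?n]))
          (mk (tape_of x) (otape (?m (Suc i))) (tape_of (?m i)) (rho [?n]))"
        using runs_cg[of "[?n]" ?n g x "[]" "?m i"] by simp
      have 4: "runs (7 * length (?m i) + 17 * length (?m (Suc i)) + 30) transfer
          (mk (tape_of x) (otape (?m (Suc i))) (tape_of (?m i)) (rho [?n])) (stt x (?m (Suc i)) [?n])"
        unfolding stt_def by (rule runs_transfer)
      have 5: "runs (fb (Neg H) ?n) (cf 1 (Neg H)) (stt x (?m (Suc i)) [?n]) (stt x (?m (Suc i)) [?n, of_bool (\<not> evalf x (?m (Suc i)) [?n] H)])"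
        using runs_cf[of "[?n]" ?n "Neg H" x "tape_of []" "?m (Suc i)"] by (simp add: stt_def)
      have "spaced (?B ?n) ?body (stt x (?m i) [?n, 1]) (stt x (?m (Suc i)) [?n, of_bool (\<not> evalf x (?m (Suc i)) [?n] H)])"
      proof (rule spaced_runs[where A = "?n + 2"])
        show "runs (1 + (1 + (gb g ?n + ((7 * length (?m i) + 17 * length (?m (Suc i)) + 30) + fb (Neg H) ?n)))) ?body
          (stt x (?m i) [?n, 1]) (stt x (?m (Suc i)) [?n, of_bool (\<not> evalf x (?m (Suc i)) [?n] H)])"
          by (rule runs_Comp[OF 1 runs_Comp[OF 2 runs_Comp[OF 3 runs_Comp[OF 4 5]]]])
        show "snd (stt x (?m i) [?n, 1] j) < ?n + 2" for j
          by (auto simp: stt_def tape_of_eq intro!: heads_mk)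
        show "?n + 2 + (1 + (1 + (gb g ?n + ((7 * length (?m i) + 17 * length (?m (Suc i)) + 30) + fb (Neg H) ?n)))) \<le> ?B ?n"
          using len[of i] len[of "Suc i"] by linarith
      qed
      then show ?case unfolding e using Suc.hyps(1)[OF i(2,3)]
        unfolding stt_def by (intro spaced_whilenz_step) (auto simp: rho_def)
    qed
    have 3: "spaced (?B ?n) (cf 1 A) (stt x (?m k) [?n]) (stt x (?m k) [?n, of_bool (x \<in> L)])"
      using spaced_cf[of ?n A "?B ?n" x "?m k"] k(3) by simp
    have 4: "spaced (?B ?n) wipe (stt x (?m k) [?n, of_bool (x \<in> L)]) (stt x [] [?n, of_bool (x \<in> L)])"
    proof (rule spaced_runs[where A = "?n + 2"])
      show "runs (7 * length (?m k) + 6) wipe (stt x (?m k) [?n, of_bool (x \<in> L)]) (stt x [] [?n, of_bool (x \<in> L)])"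
        unfolding stt_def by (rule runs_wipe)
      show "snd (stt x (?m k) [?n, of_bool (x \<in> L)] j) < ?n + 2" for j
        by (auto simp: stt_def tape_of_eq intro!: heads_mk)
    qed (use len[of k] in linarith)
    show "spaced (?B ?n) ?c (stt x [] [?n]) (stt x [] [?n, of_bool (x \<in> L)])"
      using spaced_Comp[OF test[of 0] spaced_Comp[OF loop[of 0] spaced_Comp[OF 3 4]]] by simp
  qed
qed

theorem decidable_on_UNIV_PSPACE:
  assumes "decidable_on UNIV L"
  shows "L \<in> PSPACE"
proof -
  obtain c B where c: "puts_ok c" "pbd B"
    "\<And>x. spaced (B (length x)) c (stt x [] [length x]) (stt x [] [length x, of_bool (x \<in> L)])"
    using assms unfolding decidable_on_def by blast
  obtain K where K: "5 \<le> K" "wf_com K (count ;; c)" by (rule ex_wf_com_ge[of "count ;; c" 5]) (use c in auto)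
  have "pbd (\<lambda>n. B n + (1 + (7 * n + 6)))" using c(2) by (intro pbd_intros)
  then obtain p where p: "\<And>n. B n + (1 + (7 * n + 6)) \<le> poly p n" unfolding pbd_def by blast
  \<comment> \<open>Register 1 is tape 4. Its head scans the blank cell 1 if the answer is 1, and
    the start symbol of cell 0 otherwise.\<close>
  let ?M = "tm_of_com K (count ;; c) 4 0"
  have *: "\<exists>t. exec (\<lambda>h. h < poly p (length x)) (count ;; c) (initial x) t (stt x [] [length x, of_bool (x \<in> L)])" for x
  proof -
    have "runs (7 * length x + 6) count (initial x) (stt x [] [length x])"
      using runs_count[of x "tape_of []" "tape_of []"] by (simp add: initial_mk rho_Nil stt_def)
    then have "spaced (poly p (length x)) count (initial x) (stt x [] [length x])"
      by (rule spaced_runs[where A = 1]) (use p[of "length x"] in \<open>auto simp: initial_def tape_of_eq\<close>)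
    moreover have "spaced (poly p (length x)) c (stt x [] [length x]) (stt x [] [length x, of_bool (x \<in> L)])"
      by (rule spaced_mono[OF c(3)]) (use p[of "length x"] in linarith)
    ultimately show ?thesis using spaced_Comp unfolding spaced_def by blast
  qed
  have pos: "0 < poly p n" for n using p[of n] by simp
  have "decides ?M L" unfolding decides_def
  proof
    fix x
    obtain t where t: "exec (\<lambda>h. h < poly p (length x)) (count ;; c) (initial x) t (stt x [] [length x, of_bool (x \<in> L)])"
      using * by blast
    have "scanned (stt x [] [length x, of_bool (x \<in> L)] 4) = 0 \<longleftrightarrow> x \<in> L"
      by (auto simp: stt_def mk_def scanned_def rho_def)
    then have "fst (run ?M x (t + 2)) = (if x \<in> L then accept_state else reject_state)"
      using tm_of_com_run(1)[OF t K(2), of 4 ?M 0] K(1) pos by simp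
    then show "\<exists>t. fst (run ?M x t) = (if x \<in> L then accept_state else reject_state)" by blast
  qed
  moreover have "runs_in_space ?M (poly p)" unfolding runs_in_space_def
  proof (intro allI ballI)
    fix x t T assume "T \<in> set (snd (run ?M x t))"
    then show "snd T < poly p (length x)"
      using * [of x] tm_of_com_run(2)[OF _ K(2), of "\<lambda>h. h < poly p (length x)" x _ _ 4 ?M 0 T t] K(1) pos by auto
  qed
  moreover have "wf_tm ?M" using wf_tm_of_com[OF K(2)] K(1) by simp
  ultimately show ?thesis unfolding PSPACE_def by blast
qed

section \<open>Hitting sets as distance dominating sets of chordal graphs\<close>

text \<open>The infimum of a nonempty set of extended naturals is attained, and that of the empty
  set is infinite.\<close>

lemma enat_Inf_le_iff: "Inf A \<le> enat k \<longleftrightarrow> (\<exists>a \<in> A. a \<le> enat k)"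
proof
  assume *: "Inf A \<le> enat k"
  then have "A \<noteq> {}" by (auto simp: Inf_enat_def)
  then have "Inf A \<in> A" using wellorder_InfI by blast
  then show "\<exists>a \<in> A. a \<le> enat k" using * by blast
next
  assume "\<exists>a \<in> A. a \<le> enat k"
  then show "Inf A \<le> enat k" using Inf_lower2 by blast
qed

lemma graph_dist_le_iff: "graph_dist G u v \<le> enat k \<longleftrightarrow> (\<exists>w. is_walk G u w v \<and> length w \<le> Suc k)"
  unfolding graph_dist_def enat_Inf_le_iff by auto

text \<open>Elements are the numbers below \<open>U\<close> and form a clique; the vertices \<open>U + c * r, \<dots>,
  U + c * r + r - 1\<close> form a path hanging from the clique at the elements of \<open>A c\<close>.
  The end of this path is within distance \<open>r\<close> only of the path and of \<open>A c\<close>.\<close>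

definition hs_adj :: "nat \<Rightarrow> nat \<Rightarrow> nat \<Rightarrow> (nat \<Rightarrow> nat set) \<Rightarrow> nat \<Rightarrow> nat \<Rightarrow> bool" where
  "hs_adj U C r A i j \<longleftrightarrow> (i < j \<and> j < U) \<or> (\<exists>c<C. i \<in> A c \<and> j = U + c * r) \<or>
     (\<exists>c<C. \<exists>k. Suc k < r \<and> i = U + c * r + k \<and> j = U + c * r + Suc k)"

definition hs_graph :: "nat \<Rightarrow> nat \<Rightarrow> nat \<Rightarrow> (nat \<Rightarrow> nat set) \<Rightarrow> nat ugraph" where
  "hs_graph U C r A = \<lparr> verts = {..<U + C * r}, edges = {{i, j} | i j. hs_adj U C r A i j} \<rparr>"

locale hs =
  fixes U C r :: nat and A :: "nat \<Rightarrow> nat set"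
  assumes r: "1 \<le> r" and C: "0 < C" and A: "\<And>c. c < C \<Longrightarrow> A c \<subseteq> {..<U}"
begin

abbreviation "G \<equiv> hs_graph U C r A"

lemma path_vertex_lt: "c < C \<Longrightarrow> k < r \<Longrightarrow> U + c * r + k < U + C * r"
proof -
  assume "c < C" "k < r"
  then have "c * r + k < Suc c * r" by simp
  also have "\<dots> \<le> C * r" using \<open>c < C\<close> by (intro mult_le_mono1) simp
  finally show ?thesis by simp
qed

lemma path_vertex_inj: "k < r \<Longrightarrow> k' < r \<Longrightarrow> U + c * r + k = U + c' * r + k' \<longleftrightarrow> c = c' \<and> k = k'"
  using r by (metis add.assoc add_left_imp_eq div_mult_self3 div_less mod_less mod_mult_self3 not_one_le_zero add.right_neutral)

lemma path_vertex_cases: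
  assumes "U \<le> v" "v < U + C * r"
  obtains c k where "c < C" "k < r" "v = U + c * r + k"
proof
  show "(v - U) div r < C" using assms by (simp add: less_mult_imp_div_less)
  show "(v - U) mod r < r" using r by simp
  show "v = U + (v - U) div r * r + (v - U) mod r" using assms(1) by simp
qed

lemma hs_adj_lt: "hs_adj U C r A i j \<Longrightarrow> i < j \<and> j < U + C * r"
  using A path_vertex_lt r unfolding hs_adj_def by fastforce

lemma edge_iff: "{i, j} \<in> edges G \<longleftrightarrow> hs_adj U C r A i j \<or> hs_adj U C r A j i"
  by (auto simp: hs_graph_def doubleton_eq_iff)

lemma verts_G [simp]: "verts G = {..<U + C * r}"
  by (simp add: hs_graph_def)

lemma simple_G: "simple_graph G"
  unfolding simple_graph_def
proof (intro conjI ballI)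
  fix e assume "e \<in> edges G"
  then obtain i j where "hs_adj U C r A i j" "e = {i, j}" by (auto simp: hs_graph_def)
  then show "\<exists>u v. u \<in> verts G \<and> v \<in> verts G \<and> u \<noteq> v \<and> e = {u, v}"
    using hs_adj_lt[of i j] by (intro exI[of _ i] exI[of _ j]) auto
qed simp

text \<open>The two neighbours of the largest vertex of a cycle lie in the clique.\<close>

lemma chordal_G: "chordal G"
  unfolding chordal_def
proof (intro conjI allI impI)
  fix c assume "is_cycle G c \<and> 4 \<le> length c"
  then have c: "distinct c" "set c \<subseteq> verts G" "cycle_edges c \<subseteq> edges G" "4 \<le> length c"
    by (auto simp: is_cycle_def)
  let ?L = "length c"
  define nx where "nx i = (if Suc i = ?L then 0 else Suc i)" for i
  have nx: "(i + 1) mod ?L = nx i" "nx i < ?L" if "i < ?L" for i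
    using that by (auto simp: nx_def mod_if)
  have ce: "cycle_edges c = {{c ! i, c ! nx i} | i. i < ?L}"
    unfolding cycle_edges_def using nx by metis
  have "Max (set c) \<in> set c" using c(4) by (intro Max_in) auto
  then obtain i where i: "i < ?L" "c ! i = Max (set c)" by (metis in_set_conv_nth)
  define pr where "pr = (if i = 0 then ?L - 1 else i - 1)"
  have pr: "pr < ?L" "nx pr = i" using i(1) c(4) by (auto simp: pr_def nx_def)
  let ?p = "c ! i" and ?a = "c ! pr" and ?b = "c ! nx i"
  have ne: "pr \<noteq> nx i" "pr \<noteq> i" "nx i \<noteq> i" using i(1) c(4) by (auto simp: pr_def nx_def split: if_splits)
  have dist: "c ! j = c ! k \<longleftrightarrow> j = k" if "j < ?L" "k < ?L" for j k
    using c(1) that by (simp add: nth_eq_iff_index_eq)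
  have "v \<le> ?p" if "v \<in> set c" for v using that i(2) by simp
  then have lt: "?a < ?p" "?b < ?p"
    using dist[of pr i] dist[of "nx i" i] ne pr nx[OF i(1)] i(1) by (auto simp: order.strict_iff_order)
  have "{?a, ?p} \<in> edges G" using c(3) pr unfolding ce by blast
  then have ea: "hs_adj U C r A ?a ?p" using lt hs_adj_lt[of ?p ?a] by (auto simp: edge_iff)
  have "{?b, ?p} \<in> edges G" using c(3) i(1) unfolding ce by (auto simp: insert_commute)
  then have eb: "hs_adj U C r A ?b ?p" using lt hs_adj_lt[of ?p ?b] by (auto simp: edge_iff)
  have ab: "?a \<noteq> ?b" using dist[of pr "nx i"] pr(1) nx[OF i(1)] ne by simp
  have "?a < U \<and> ?b < U"
  proof (cases "?p < U")
    case True
    then show ?thesis using lt by simp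
  next
    case False
    have "v < U \<or> v = ?p - 1 \<and> (\<exists>d<C. \<exists>k. Suc k < r \<and> ?p = U + d * r + Suc k)" if "hs_adj U C r A v ?p" for v
      using that False A unfolding hs_adj_def by fastforce
    then have a: "?a < U \<or> ?a = ?p - 1 \<and> (\<exists>d<C. \<exists>k. Suc k < r \<and> ?p = U + d * r + Suc k)"
      and b: "?b < U \<or> ?b = ?p - 1 \<and> (\<exists>d<C. \<exists>k. Suc k < r \<and> ?p = U + d * r + Suc k)" using ea eb by blast+
    \<comment> \<open>A path vertex after the first one is not attached to the clique, because its
      address differs from the start of every path. Its only smaller neighbour is its predecessor,
      so \<open>a\<close> and \<open>b\<close> would coincide.\<close>
    have no: "\<not> (v < U \<and> hs_adj U C r A v ?p)" if "d < C" "Suc k < r" "?p = U + d * r + Suc k" for v d k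
    proof
      assume v: "v < U \<and> hs_adj U C r A v ?p"
      have "\<not> (\<exists>d k. v = U + d * r + k)" using v by auto
      then obtain d' where "?p = U + d' * r" using v False unfolding hs_adj_def by blast
      then have "U + d * r + Suc k = U + d' * r + 0" using that by simp
      then show False using path_vertex_inj[of "Suc k" 0 d d'] that(2) r by linarith
    qed
    show ?thesis using a b ab no ea eb by metis
  qed
  then have e: "{?a, ?b} \<in> edges G" using ab by (auto simp: edge_iff hs_adj_def)
  \<comment> \<open>The positions \<open>pr\<close> and \<open>nx i\<close> are two steps apart, and
    on a cycle of length at least 4 they are not consecutive in the other direction either.\<close>
  have "{?a, ?b} \<notin> cycle_edges c"
  proof
    assume "{?a, ?b} \<in> cycle_edges c"
    then obtain j where j: "j < ?L" "{?a, ?b} = {c ! j, c ! nx j}" unfolding ce by blast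
    then have "(pr = j \<and> nx i = nx j) \<or> (pr = nx j \<and> nx i = j)"
      using dist pr(1) nx(2) i(1) by (auto simp: doubleton_eq_iff)
    then show False using i(1) c(4) j(1) by (auto simp: pr_def nx_def split: if_splits)
  qed
  then show "has_chord G c" unfolding has_chord_def using e pr(1) nx(2)[OF i(1)]
    by (intro bexI[of _ "{?a, ?b}"]) auto
qed (rule simple_G)

section \<open>Domination in the constructed graph\<close>

lemma is_walk_Cons:
  "is_walk H v w t \<Longrightarrow> u \<in> verts H \<Longrightarrow> {u, v} \<in> edges H \<Longrightarrow> is_walk H u (u # w) t"
  unfolding is_walk_def by (cases w) auto

lemma walk_in_path:
  assumes "c < C" "k < r" "j \<le> k"
  shows "is_walk G (U + c * r + j) (map (\<lambda>i. U + c * r + i) [j..<Suc k]) (U + c * r + k)"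
  using assms(3)
proof (induction "k - j" arbitrary: j)
  case 0
  then have "j = k" by simp
  then show ?case using path_vertex_lt[OF assms(1,2)] by (simp add: is_walk_def)
next
  case (Suc d)
  then have j: "Suc j \<le> k" "j < Suc k" "d = k - Suc j" by simp_all
  have "is_walk G (U + c * r + j) ((U + c * r + j) # map (\<lambda>i. U + c * r + i) [Suc j..<Suc k]) (U + c * r + k)"
  proof (rule is_walk_Cons[OF Suc.hyps(1)[OF j(3,1)]])
    show "U + c * r + j \<in> verts G" using path_vertex_lt[of c j] assms j by simp
    have "hs_adj U C r A (U + c * r + j) (U + c * r + Suc j)"
      unfolding hs_adj_def using assms(1,2) j(1) by (metis le_less_trans)
    then show "{U + c * r + j, U + c * r + Suc j} \<in> edges G" by (simp only: edge_iff simp_thms)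
  qed
  then show ?case using j(2) upt_conv_Cons[of j "Suc k"] by simp
qed

lemma walk_from_element:
  assumes "c < C" "k < r" "u \<in> A c"
  shows "is_walk G u (u # map (\<lambda>i. U + c * r + i) [0..<Suc k]) (U + c * r + k)"
proof (rule is_walk_Cons)
  show "is_walk G (U + c * r + 0) (map (\<lambda>i. U + c * r + i) [0..<Suc k]) (U + c * r + k)"
    by (rule walk_in_path) (use assms in auto)
  show "u \<in> verts G" using A assms by (auto intro: trans_less_add1)
  show "{u, U + c * r + 0} \<in> edges G" using assms by (auto simp: edge_iff hs_adj_def)
qed

text \<open>Any token dominates the whole clique, as \<open>r\<close> is at least 1. The vertex
  number \<open>k\<close> of a path is reached in \<open>k + 1\<close> steps from the elements of
  its set, and \<open>k + 1\<close> is at most \<open>r\<close>.\<close>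

lemma dominating_hitting:
  assumes D: "D \<subseteq> {..<U}" and hit: "\<And>c. c < C \<Longrightarrow> D \<inter> A c \<noteq> {}"
  shows "dist_dominating r G D"
  unfolding dist_dominating_def
proof (intro conjI ballI)
  show "D \<subseteq> verts G" using D by auto
  fix v assume v: "v \<in> verts G"
  obtain d where d: "d \<in> D" "d < U" using hit[OF C] D by blast
  show "\<exists>u\<in>D. graph_dist G u v \<le> enat r"
  proof (cases "v < U")
    case True
    have "is_walk G d (if d = v then [d] else [d, v]) v"
      using d True v by (auto simp: is_walk_def edge_iff hs_adj_def)
    then show ?thesis using d(1) r unfolding graph_dist_le_iff by (intro bexI[of _ d] exI conjI) auto
  next
    case False
    then have "U \<le> v" by simp
    then obtain c k where c: "c < C" "k < r" "v = U + c * r + k"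
      by (rule path_vertex_cases) (use v in auto)
    obtain u where "u \<in> D" "u \<in> A c" using hit[OF c(1)] by blast
    then show ?thesis using walk_from_element[OF c(1,2)] c(2,3) unfolding graph_dist_le_iff
      by (intro bexI[of _ u] exI conjI) auto
  qed
qed

text \<open>The potential \<open>f\<close> changes by at most one along an edge and vanishes at the
  end of path \<open>c\<close>. It is \<open>r\<close> on \<open>A c\<close> and
  \<open>r + 1\<close> at all other vertices off the path, which are therefore too far away to
  dominate the end.\<close>

lemma hits_if_dominating:
  assumes "dist_dominating r G D" and c: "c < C"
  obtains u where "u \<in> D" "u \<in> A c" | k where "k < r" "U + c * r + k \<in> D"
proof -
  define f where "f v = (if v \<in> A c then r else if \<exists>k<r. v = U + c * r + k then U + c * r + r - 1 - v else r + 1)" for v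
  have fp: "f (U + c * r + k) = r - 1 - k" if "k < r" for k
    using that A[OF c] by (auto simp: f_def)
  have f1: "f v \<le> r + 1" for v by (auto simp: f_def)
  have fU: "f v \<ge> r" if "v < U" for v using that by (auto simp: f_def)
  have fo: "f (U + d * r + k) = r + 1" if "d \<noteq> c" "k < r" for d k
  proof -
    have "U + d * r + k \<notin> A c" using A[OF c] by auto
    then show ?thesis using path_vertex_inj[of k _ d c] that by (auto simp: f_def)
  qed
  have lip: "f i \<le> f j + 1 \<and> f j \<le> f i + 1" if "hs_adj U C r A i j" for i j
    using that unfolding hs_adj_def
  proof (elim disjE exE conjE)
    assume "i < j" "j < U"
    then show ?thesis using f1[of i] f1[of j] fU[of i] fU[of j] by auto
  next
    fix d assume d: "d < C" "i \<in> A d" "j = U + d * r"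
    then have iU: "i < U" using A by auto
    show ?thesis
    proof (cases "d = c")
      case True
      then have "f j = r - 1" "f i = r" using d fp[of 0] r by (auto simp: f_def)
      then show ?thesis by auto
    next
      case False
      then have "f j = r + 1" using d(3) fo[of d 0] r by simp
      then show ?thesis using f1[of i] fU[OF iU] by auto
    qed
  next
    fix d k assume d: "d < C" "Suc k < r" "i = U + d * r + k" "j = U + d * r + Suc k"
    show ?thesis
    proof (cases "d = c")
      case True
      then show ?thesis using d fp[of k] fp[of "Suc k"] by auto
    next
      case False
      then show ?thesis using d fo[of d k] fo[of d "Suc k"] by auto
    qed
  qed
  then have lip': "f i \<le> f j + 1" if "{i, j} \<in> edges G" for i j using that by (auto simp: edge_iff)
  have walk: "f (hd w) < f (last w) + length w" if "w \<noteq> []" "successively (\<lambda>a b. {a, b} \<in> edges G) w" for w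
    using that
  proof (induction w)
    case (Cons a w)
    show ?case
    proof (cases w)
      case (Cons b w')
      then have "f a \<le> f b + 1" "f b < f (last w) + length w" using Cons.IH Cons.prems lip' by auto
      then show ?thesis using Cons by simp
    qed simp
  qed simp
  let ?t = "U + c * r + (r - 1)"
  have "?t \<in> verts G" using path_vertex_lt[OF c, of "r - 1"] r by simp
  then obtain u w where u: "u \<in> D" "is_walk G u w ?t" "length w \<le> Suc r"
    using assms(1) unfolding dist_dominating_def graph_dist_le_iff by blast
  then have "f u < f ?t + Suc r" using walk[of w] by (auto simp: is_walk_def)
  then have "f u < Suc r" using fp[of "r - 1"] r by simp
  then have "u \<in> A c \<or> (\<exists>k<r. u = U + c * r + k)" by (auto simp: f_def split: if_splits)
  then show thesis using that u(1) by blast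
qed

section \<open>Moves between hitting sets\<close>

definition hits :: "nat set \<Rightarrow> bool" where
  "hits Q \<longleftrightarrow> Q \<subseteq> {..<U} \<and> (\<forall>c<C. Q \<inter> A c \<noteq> {})"

definition swap :: "nat set \<Rightarrow> nat set \<Rightarrow> bool" where
  "swap Q Q' \<longleftrightarrow> hits Q \<and> hits Q' \<and> (\<exists>x y. Q - Q' = {x} \<and> Q' - Q = {y})"

lemma dominating_if_hits: "hits Q \<Longrightarrow> dist_dominating r G Q"
  unfolding hits_def using dominating_hitting by blast

lemma reconf_if_swaps:
  assumes "swap\<^sup>*\<^sup>* Q Q'" "hits Q"
  shows "\<exists>S. is_reconf_sequence R r G Q S Q'"
  using assms
proof (induction rule: rtranclp_induct)
  case base
  then show ?case using dominating_if_hits by (intro exI[of _ "[Q]"]) (simp add: is_reconf_sequence_def)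
next
  case (step Q1 Q2)
  then obtain S where S: "is_reconf_sequence R r G Q S Q1" by blast
  obtain x y where xy: "Q1 - Q2 = {x}" "Q2 - Q1 = {y}" and h: "hits Q1" "hits Q2"
    using step(2) unfolding swap_def by blast
  then have "x \<noteq> y" "x < U" "y < U" unfolding hits_def by auto
  then have "{x, y} \<in> edges G" by (auto simp: edge_iff hs_adj_def)
  then have "reconf_move R G Q1 Q2" unfolding reconf_move_def using xy by blast
  then have "is_reconf_sequence R r G Q (S @ [Q2]) Q2"
    using S h(2) dominating_if_hits by (auto simp: is_reconf_sequence_def successively_append_iff)
  then show ?case by blast
qed

text \<open>Tokens on a path are projected to an arbitrary element of the corresponding set. As the
  number of tokens is the least possible, the projection is injective on dominating sets.\<close>

lemma swaps_if_reconf: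
  assumes S: "is_reconf_sequence R r G Ds S Dt" and sub: "Ds \<subseteq> {..<U}" "Dt \<subseteq> {..<U}"
    and ne: "\<And>c. c < C \<Longrightarrow> A c \<noteq> {}"
    and J: "J \<subseteq> {..<C}" "card J = card Ds" "\<And>i j. i \<in> J \<Longrightarrow> j \<in> J \<Longrightarrow> i \<noteq> j \<Longrightarrow> A i \<inter> A j = {}"
    and inv: "\<And>Q Q'. swap Q Q' \<Longrightarrow> card Q = card Ds \<Longrightarrow> card Q' = card Ds \<Longrightarrow> P Q \<longleftrightarrow> P Q'"
  shows "P Ds \<longleftrightarrow> P Dt"
proof -
  define \<rho> where "\<rho> v = (if v < U then v else (SOME u. u \<in> A ((v - U) div r)))" for v
  have \<rho>U: "\<rho> ` D = D" if "D \<subseteq> {..<U}" for D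
    using that by (force simp: \<rho>_def)
  have \<rho>p: "\<rho> (U + c * r + k) \<in> A c" if "c < C" "k < r" for c k
  proof -
    have "(U + c * r + k - U) div r = c" using that by simp
    moreover have "(SOME u. u \<in> A c) \<in> A c" using ne[OF that(1)] some_in_eq by blast
    ultimately show ?thesis by (simp add: \<rho>_def)
  qed
  have hit: "hits (\<rho> ` D)" if D: "dist_dominating r G D" for D
  proof -
    have "\<rho> v < U" if "v \<in> D" for v
    proof (cases "v < U")
      case False
      moreover have "v < U + C * r" using that D by (auto simp: dist_dominating_def)
      ultimately obtain c k where "c < C" "k < r" "v = U + c * r + k"
        using path_vertex_cases[of v] by auto
      then show ?thesis using \<rho>p A by blast
    qed (simp add: \<rho>_def)
    moreover have "\<rho> ` D \<inter> A c \<noteq> {}" if c: "c < C" for c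
    proof (rule hits_if_dominating[OF D c])
      fix u assume "u \<in> D" "u \<in> A c"
      then have "\<rho> u = u" using A[OF c] by (auto simp: \<rho>_def)
      then show ?thesis using \<open>u \<in> D\<close> \<open>u \<in> A c\<close> by force
    next
      fix k assume "k < r" "U + c * r + k \<in> D"
      then show ?thesis using \<rho>p[OF c] by blast
    qed
    ultimately show ?thesis unfolding hits_def by blast
  qed
  \<comment> \<open>The sets indexed by \<open>J\<close> are pairwise disjoint, so a hitting set
    contains a different element for each of them.\<close>
  have lower: "card J \<le> card Q" if Q: "hits Q" for Q
  proof -
    have fin: "finite Q" using Q unfolding hits_def using finite_subset by blast
    have "\<forall>j\<in>J. \<exists>u. u \<in> Q \<inter> A j" using Q J(1) unfolding hits_def by blast
    then obtain f where f: "\<And>j. j \<in> J \<Longrightarrow> f j \<in> Q \<inter> A j" by metis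
    then have "inj_on f J" using J(3) by (intro inj_onI) (metis Int_iff disjoint_iff)
    moreover have "f ` J \<subseteq> Q" using f by blast
    ultimately show ?thesis using fin card_inj_on_le by blast
  qed
  have fin: "finite D" if "dist_dominating r G D" for D
    using that finite_subset by (fastforce simp: dist_dominating_def)
  have inj: "inj_on \<rho> D \<and> card (\<rho> ` D) = card Ds" if D: "dist_dominating r G D" "card D = card Ds" for D
  proof -
    have "card (\<rho> ` D) \<le> card D" by (rule card_image_le[OF fin[OF D(1)]])
    moreover have "card D \<le> card (\<rho> ` D)" using lower[OF hit[OF D(1)]] J(2) D(2) by simp
    ultimately have "card (\<rho> ` D) = card D" by simp
    then show ?thesis using eq_card_imp_inj_on[OF fin[OF D(1)]] D(2) by simp
  qed
  have move: "card D' = card Ds \<and> (P (\<rho> ` D) \<longleftrightarrow> P (\<rho> ` D'))"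
    if D: "dist_dominating r G D" "dist_dominating r G D'" "card D = card Ds" "reconf_move R G D D'" for D D'
  proof -
    obtain x y where xy: "D - D' = {x}" "D' - D = {y}" using D(4) unfolding reconf_move_def by blast
    have "card (D - D') = card (D' - D)" using xy by simp
    then have card: "card D' = card Ds"
      using card_Int_Diff[OF fin[OF D(1)], of D'] card_Int_Diff[OF fin[OF D(2)], of D] D(3) by (simp add: Int_commute)
    note i = inj[OF D(1,3)] inj[OF D(2) card]
    have D': "insert x (D \<inter> D') = D" "insert y (D \<inter> D') = D'" "x \<in> D" "y \<in> D'" "x \<notin> D'" "y \<notin> D" using xy by auto
    let ?I = "\<rho> ` (D \<inter> D')"
    have "\<rho> x \<notin> ?I"
    proof
      assume "\<rho> x \<in> ?I"
      then obtain z where "z \<in> D" "z \<in> D'" "\<rho> x = \<rho> z" by blast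
      then show False using inj_onD[OF conjunct1[OF i(1)]] D'(3,5) by blast
    qed
    moreover have "\<rho> y \<notin> ?I"
    proof
      assume "\<rho> y \<in> ?I"
      then obtain z where "z \<in> D" "z \<in> D'" "\<rho> y = \<rho> z" by blast
      then show False using inj_onD[OF conjunct1[OF i(2)]] D'(4,6) by blast
    qed
    moreover have im: "\<rho> ` D = insert (\<rho> x) ?I" "\<rho> ` D' = insert (\<rho> y) ?I"
      using arg_cong[OF D'(1), of "image \<rho>"] arg_cong[OF D'(2), of "image \<rho>"] unfolding image_insert by (simp_all only:)
    \<comment> \<open>If both ends of the move have the same projection, the projected set does not
      change; otherwise the projection is a swap.\<close>
    ultimately have "\<rho> x = \<rho> y \<or> (\<rho> ` D - \<rho> ` D' = {\<rho> x} \<and> \<rho> ` D' - \<rho> ` D = {\<rho> y})" by auto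
    then show ?thesis
    proof
      assume "\<rho> x = \<rho> y"
      then show ?thesis using card im by simp
    next
      assume "\<rho> ` D - \<rho> ` D' = {\<rho> x} \<and> \<rho> ` D' - \<rho> ` D = {\<rho> y}"
      then have "swap (\<rho> ` D) (\<rho> ` D')" using hit D(1,2) unfolding swap_def by blast
      then show ?thesis using inv i card by blast
    qed
  qed
  have "card (last T) = card Ds \<and> (P (\<rho> ` hd T) \<longleftrightarrow> P (\<rho> ` last T))"
    if "T \<noteq> []" "card (hd T) = card Ds" "\<forall>D\<in>set T. dist_dominating r G D" "successively (reconf_move R G) T" for T
    using that
  proof (induction T)
    case (Cons D T)
    show ?case
    proof (cases T)
      case (Cons D' T')
      then have "card D' = card Ds \<and> (P (\<rho> ` D) \<longleftrightarrow> P (\<rho> ` D'))" using Cons.prems move by auto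
      then show ?thesis using Cons.IH Cons.prems Cons by auto
    qed (use Cons.prems in simp)
  qed simp
  from this[of S] have "P (\<rho> ` Ds) \<longleftrightarrow> P (\<rho> ` Dt)"
    using S by (auto simp: is_reconf_sequence_def)
  then show ?thesis using \<rho>U sub by simp
qed

end

section \<open>Space-bounded computations as hitting set reconfiguration\<close>

text \<open>One coding by four digits to the base \<open>S\<close> serves two purposes: an element
  consists of a copy, a component, an index and a value, and a set is addressed by a schema number
  and three parameters. Hence there are equally many elements and sets.\<close>

definition el :: "nat \<Rightarrow> nat \<Rightarrow> nat \<Rightarrow> nat \<Rightarrow> nat \<Rightarrow> nat" where
  "el S c t i a = ((c * S + t) * S + i) * S + a"

lemma digit_inj:
  assumes "(a::nat) < S" "b < S"
  shows "x * S + a = y * S + b \<longleftrightarrow> x = y \<and> a = b"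
  using assms by (metis add.commute div_mult_self1 div_less mod_less mod_mult_self1 add.left_neutral not_less_zero)

lemma el_inj:
  assumes "t < S" "i < S" "a < S" "t' < S" "i' < S" "a' < S"
  shows "el S c t i a = el S c' t' i' a' \<longleftrightarrow> c = c' \<and> t = t' \<and> i = i' \<and> a = a'"
  unfolding el_def using assms by (simp add: digit_inj)

lemma digit_lt: "x < B \<Longrightarrow> a < S \<Longrightarrow> x * S + a < B * (S::nat)"
  by (metis Suc_leI add.commute add_less_cancel_left less_le_trans mult_Suc mult_le_mono1)

lemma el_lt: "c < S \<Longrightarrow> t < S \<Longrightarrow> i < S \<Longrightarrow> a < S \<Longrightarrow> el S c t i a < S * S * S * S"
  unfolding el_def by (intro digit_lt)

lemma el_cases:
  assumes "u < S * S * S * S"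
  shows "\<exists>c<S. \<exists>t<S. \<exists>i<S. \<exists>a<S. u = el S c t i a"
proof -
  have S: "0 < S" using assms by (cases S) auto
  have "u div S < S * S * S" using assms by (simp add: less_mult_imp_div_less)
  then have "u div S div S < S * S" by (simp add: less_mult_imp_div_less)
  then have "u div S div S div S < S" by (simp add: less_mult_imp_div_less)
  moreover have "u = el S (u div S div S div S) (u div S div S mod S) (u div S mod S) (u mod S)"
    by (simp add: el_def)
  ultimately show ?thesis using S by (metis mod_less_divisor)
qed

text \<open>Clause schemas: under a guard, the conjunction of the premises \<open>f c t i = a\<close> implies the
  conclusion, which is of the same form. Arguments may refer to three parameters.\<close>

datatype arg = AC nat | AP nat | AS | AAdd arg arg
datatype grd = GLess arg arg | GNot grd | GAnd grd grd

type_synonym quad = "arg \<times> arg \<times> arg \<times> arg"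
type_synonym schema = "grd \<times> quad list \<times> quad"
type_synonym asg = "nat \<Rightarrow> nat \<Rightarrow> nat \<Rightarrow> nat"
type_synonym cfg = "nat \<Rightarrow> nat \<Rightarrow> nat"

primrec eva :: "nat \<Rightarrow> (nat \<Rightarrow> nat) \<Rightarrow> arg \<Rightarrow> nat" where
  "eva S p (AC c) = c"
| "eva S p (AP j) = p j"
| "eva S p AS = S"
| "eva S p (AAdd a b) = eva S p a + eva S p b"

primrec evg :: "nat \<Rightarrow> (nat \<Rightarrow> nat) \<Rightarrow> grd \<Rightarrow> bool" where
  "evg S p (GLess a b) \<longleftrightarrow> eva S p a < eva S p b"
| "evg S p (GNot g) \<longleftrightarrow> \<not> evg S p g"
| "evg S p (GAnd g h) \<longleftrightarrow> evg S p g \<and> evg S p h"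

definition GTrue :: grd where "GTrue = GLess (AC 0) (AC 1)"
definition GOr :: "grd \<Rightarrow> grd \<Rightarrow> grd" where "GOr g h = GNot (GAnd (GNot g) (GNot h))"
definition GEq :: "arg \<Rightarrow> arg \<Rightarrow> grd" where "GEq a b = GAnd (GNot (GLess a b)) (GNot (GLess b a))"

lemma evg_simps [simp]: "evg S p GTrue" "evg S p (GOr g h) \<longleftrightarrow> evg S p g \<or> evg S p h"
  "evg S p (GEq a b) \<longleftrightarrow> eva S p a = eva S p b"
  by (auto simp: GTrue_def GOr_def GEq_def)

fun holds :: "nat \<Rightarrow> (nat \<Rightarrow> nat) \<Rightarrow> asg \<Rightarrow> quad \<Rightarrow> bool" where
  "holds S p f (c, t, i, a) \<longleftrightarrow> f (eva S p c) (eva S p t) (eva S p i) = eva S p a"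

text \<open>Mirrors \<open>step\<close>, which freezes halted configurations: in a halting state the
  scanned symbols are written back and no head moves.\<close>

definition delta :: "tm \<Rightarrow> nat \<Rightarrow> nat list \<Rightarrow> nat \<times> (nat \<times> head_move) list" where
  "delta M q ss = (if q = accept_state \<or> q = reject_state then (q, map (\<lambda>s. (s, Stay)) ss) else tm_trans M q ss)"

text \<open>A configuration is described by the components \<open>(t, i)\<close>: the state \<open>(0, 0)\<close>, the symbol
  scanned on tape \<open>k\<close> at \<open>(1 + k, 0)\<close>, its head position at \<open>(1 + K + k, 0)\<close> and cell \<open>i\<close> of
  this tape at \<open>(1 + 2 * K + k, i)\<close>.\<close>

definition isvar :: "tm \<Rightarrow> nat \<Rightarrow> nat \<Rightarrow> nat \<Rightarrow> bool" where
  "isvar M S t i \<longleftrightarrow> t \<le> 2 * tm_tapes M \<and> i = 0 \<or> 2 * tm_tapes M < t \<and> t \<le> 3 * tm_tapes M \<and> i < S"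

definition dm :: "tm \<Rightarrow> nat \<Rightarrow> nat \<Rightarrow> nat" where
  "dm M S t = (if t = 0 then tm_states M else if t \<le> tm_tapes M then tm_symbols M
     else if t \<le> 2 * tm_tapes M then S else tm_symbols M)"

definition Gvar :: "tm \<Rightarrow> grd" where
  "Gvar M = GOr (GAnd (GLess (AP 0) (AC (2 * tm_tapes M + 1))) (GEq (AP 1) (AC 0)))
     (GAnd (GLess (AC (2 * tm_tapes M)) (AP 0)) (GLess (AP 0) (AC (3 * tm_tapes M + 1))))"

lemma evg_Gvar: "p 1 < S \<Longrightarrow> evg S p (Gvar M) \<longleftrightarrow> isvar M S (p 0) (p 1)"
  by (auto simp: Gvar_def isvar_def)

text \<open>The truncation at \<open>S\<close> keeps the successor of an arbitrary configuration
  within the domains. It does not come into effect in a run whose heads stay below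
  \<open>S\<close>.\<close>

fun mvc :: "nat \<Rightarrow> head_move \<Rightarrow> nat \<Rightarrow> nat" where
  "mvc S Move_Left h = h - 1"
| "mvc S Stay h = h"
| "mvc S Move_Right h = (if h + 1 < S then h + 1 else h)"

fun Gmove :: "head_move \<Rightarrow> grd" where
  "Gmove Move_Left = GOr (GAnd (GEq (AP 0) (AC 0)) (GEq (AP 1) (AC 0))) (GEq (AAdd (AP 1) (AC 1)) (AP 0))"
| "Gmove Stay = GEq (AP 1) (AP 0)"
| "Gmove Move_Right = GOr (GAnd (GLess (AAdd (AP 0) (AC 1)) AS) (GEq (AP 1) (AAdd (AP 0) (AC 1))))
     (GAnd (GNot (GLess (AAdd (AP 0) (AC 1)) AS)) (GEq (AP 1) (AP 0)))"

lemma evg_Gmove: "evg S p (Gmove d) \<longleftrightarrow> p 1 = mvc S d (p 0)"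
  by (cases d) auto

text \<open>The phase is the variable \<open>(3, 0, 0)\<close>; the premises select phase 1 and one
  line of the transition table. Since the scanned symbols are variables of their own, a transition
  reads a fixed number of variables, wherever the heads are.\<close>

definition base_prems :: "nat \<Rightarrow> nat list \<Rightarrow> quad list" where
  "base_prems q ss = (AC 3, AC 0, AC 0, AC 1) # (AC 0, AC 0, AC 0, AC q) #
     map (\<lambda>k. (AC 0, AC (1 + k), AC 0, AC (ss ! k))) [0..<length ss]"

fun step_schemas :: "tm \<Rightarrow> nat \<times> nat list \<Rightarrow> schema list" where
  "step_schemas M (q, ss) = (let K = tm_tapes M; (q', as) = delta M q ss; B = base_prems q ss in
     (GTrue, B, (AC 2, AC 0, AC 0, AC q')) #
     map (\<lambda>k. (Gmove (snd (as ! k)), (AC 0, AC (1 + K + k), AC 0, AP 0) # B, (AC 2, AC (1 + K + k), AC 0, AP 1))) [0..<K] @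
     map (\<lambda>k. (GTrue, (AC 0, AC (1 + K + k), AC 0, AP 0) # B, (AC 2, AC (1 + 2 * K + k), AP 0, AC (fst (as ! k))))) [0..<K])"

lemma set_step_schemas:
  assumes "delta M q ss = (q', as)"
  shows "set (step_schemas M (q, ss)) = insert (GTrue, base_prems q ss, (AC 2, AC 0, AC 0, AC q'))
     ((\<lambda>k. (Gmove (snd (as ! k)), (AC 0, AC (1 + tm_tapes M + k), AC 0, AP 0) # base_prems q ss,
        (AC 2, AC (1 + tm_tapes M + k), AC 0, AP 1))) ` {..<tm_tapes M} \<union>
      (\<lambda>k. (GTrue, (AC 0, AC (1 + tm_tapes M + k), AC 0, AP 0) # base_prems q ss,
        (AC 2, AC (1 + 2 * tm_tapes M + k), AP 0, AC (fst (as ! k))))) ` {..<tm_tapes M})"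
  using assms by (simp add: Let_def atLeast0LessThan)

text \<open>The first schema is the frame condition for cells away from the head. The second one
  makes the scanned symbol of the successor agree with the successor's own head and tape.\<close>

definition tape_schemas :: "tm \<Rightarrow> nat \<Rightarrow> schema list" where
  "tape_schemas M k = (let K = tm_tapes M in
     [(GNot (GEq (AP 0) (AP 1)),
       [(AC 3, AC 0, AC 0, AC 1), (AC 0, AC (1 + K + k), AC 0, AP 0), (AC 0, AC (1 + 2 * K + k), AP 1, AP 2)],
       (AC 2, AC (1 + 2 * K + k), AP 1, AP 2)),
      (GTrue,
       [(AC 3, AC 0, AC 0, AC 1), (AC 2, AC (1 + K + k), AC 0, AP 0), (AC 2, AC (1 + 2 * K + k), AP 0, AP 2)],
       (AC 2, AC (1 + k), AC 0, AP 2))])"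

text \<open>Phase 3 fixes no more than two state variables, so that from an accepting configuration
  everything else can be rewritten into a goal that is independent of the computation.\<close>

definition phase_schemas :: "tm \<Rightarrow> schema list" where
  "phase_schemas M =
     [(Gvar M, [(AC 3, AC 0, AC 0, AC 0), (AC 0, AP 0, AP 1, AP 2)], (AC 1, AP 0, AP 1, AP 2)),
      (Gvar M, [(AC 3, AC 0, AC 0, AC 2), (AC 1, AP 0, AP 1, AP 2)], (AC 2, AP 0, AP 1, AP 2)),
      (GTrue, [(AC 3, AC 0, AC 0, AC 3)], (AC 0, AC 0, AC 0, AC 1)),
      (GTrue, [(AC 3, AC 0, AC 0, AC 3)], (AC 2, AC 0, AC 0, AC 1))]"

definition table :: "tm \<Rightarrow> (nat \<times> nat list) list" where
  "table M = concat (map (\<lambda>q. map (Pair q) (List.n_lists (tm_tapes M) [0..<tm_symbols M])) [0..<tm_states M])"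

text \<open>The list depends on the machine alone. The reduction can therefore treat every schema
  separately, by its position.\<close>

definition schemas :: "tm \<Rightarrow> schema list" where
  "schemas M = phase_schemas M @ concat (map (tape_schemas M) [0..<tm_tapes M]) @ concat (map (step_schemas M) (table M))"

lemma schemas_cases:
  assumes "x \<in> set (schemas M)"
  obtains "x \<in> set (phase_schemas M)" | k where "k < tm_tapes M" "x \<in> set (tape_schemas M k)"
    | q ss where "(q, ss) \<in> set (table M)" "x \<in> set (step_schemas M (q, ss))"
proof -
  from assms have "x \<in> set (phase_schemas M) \<or> (\<exists>k<tm_tapes M. x \<in> set (tape_schemas M k)) \<or>
     (\<exists>z\<in>set (table M). x \<in> set (step_schemas M z))"
    unfolding schemas_def by (simp only: set_append set_concat set_map set_upt Un_iff UN_iff image_iff) fastforce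
  then show thesis using that by (metis surj_pair)
qed

lemma set_table: "set (table M) = {(q, ss). q < tm_states M \<and> length ss = tm_tapes M \<and> (\<forall>s \<in> set ss. s < tm_symbols M)}"
  by (force simp: table_def set_n_lists subset_iff)

text \<open>\<open>S\<close> exceeds the numbers of states, symbols, components and schemas, so that
  copies, components, values and schema numbers are all digits to the base \<open>S\<close>. The
  space bound of the machine enters through the choice of \<open>S\<close>.\<close>

locale sim =
  fixes M :: tm and S :: nat
  assumes wf: "wf_tm M"
    and S: "tm_states M < S" "tm_symbols M < S" "4 < S" "3 * tm_tapes M + 1 < S" "length (schemas M) + 1 < S"
begin

abbreviation "K \<equiv> tm_tapes M"

lemma sizes: "0 < K" "3 \<le> tm_states M" "4 \<le> tm_symbols M"
  using wf by (auto simp: wf_tm_def)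

lemma delta_wf:
  assumes "q < tm_states M" "length ss = K" "\<forall>s \<in> set ss. s < tm_symbols M" "delta M q ss = (q', as)"
  shows "q' < tm_states M" "length as = K" "k < K \<Longrightarrow> fst (as ! k) < tm_symbols M"
proof -
  have "case delta M q ss of (q', as) \<Rightarrow> q' < tm_states M \<and> length as = K \<and> (\<forall>(s, d) \<in> set as. s < tm_symbols M)"
  proof (cases "q = accept_state \<or> q = reject_state")
    case True
    then show ?thesis using assms by (auto simp: delta_def)
  next
    case False
    have "case tm_trans M q ss of (q', as) \<Rightarrow> q' < tm_states M \<and> length as = K \<and> (\<forall>(s, d) \<in> set as. s < tm_symbols M)"
    proof -
      have w: "\<forall>q < tm_states M. \<forall>ss. length ss = K \<and> (\<forall>s \<in> set ss. s < tm_symbols M) \<longrightarrow>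
        (case tm_trans M q ss of (q', as) \<Rightarrow> q' < tm_states M \<and> length as = K \<and> (\<forall>(s, d) \<in> set as. s < tm_symbols M))"
        using wf unfolding wf_tm_def by (elim conjE)
      show ?thesis by (rule mp[OF spec[OF mp[OF spec[OF w, of q] assms(1)], of ss] conjI[OF assms(2,3)]])
    qed
    then show ?thesis using False by (simp add: delta_def)
  qed
  then have *: "q' < tm_states M" "length as = K" "\<forall>(s, d) \<in> set as. s < tm_symbols M"
    using assms(4) by auto
  show "q' < tm_states M" "length as = K" by fact+
  show "k < K \<Longrightarrow> fst (as ! k) < tm_symbols M" using bspec[OF *(3) nth_mem[of k as]] *(2) by (simp add: case_prod_unfold)
qed

definition var :: "nat \<Rightarrow> nat \<Rightarrow> nat \<Rightarrow> bool" where
  "var c t i \<longleftrightarrow> c < 3 \<and> isvar M S t i \<or> c = 3 \<and> t = 0 \<and> i = 0"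

definition vsize :: "nat \<Rightarrow> nat \<Rightarrow> nat" where
  "vsize c t = (if c < 3 then dm M S t else 4)"

text \<open>Triples that are not variables get the default value 0, so that assignments with the
  same tokens are equal as functions.\<close>

definition is_asg :: "asg \<Rightarrow> bool" where
  "is_asg f \<longleftrightarrow> (\<forall>c t i. if var c t i then f c t i < vsize c t else f c t i = 0)"

definition is_cfg :: "cfg \<Rightarrow> bool" where
  "is_cfg X \<longleftrightarrow> (\<forall>t i. if isvar M S t i then X t i < dm M S t else X t i = 0)"

lemma var_lt: "var c t i \<Longrightarrow> c < S \<and> t < S \<and> i < S"
  using S by (auto simp: var_def isvar_def)

lemma vsize_le: "vsize c t < S + 1" "0 < vsize c t"
  using S sizes by (auto simp: vsize_def dm_def)

lemma asg_lt: "is_asg f \<Longrightarrow> f c t i < S"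
proof -
  assume "is_asg f"
  then have "if var c t i then f c t i < vsize c t else f c t i = 0" unfolding is_asg_def by blast
  then show ?thesis using vsize_le(1)[of c t] S(3) by (simp split: if_splits)
qed

definition pf :: "nat \<Rightarrow> nat \<Rightarrow> nat \<Rightarrow> nat \<Rightarrow> nat" where
  "pf a b c = (\<lambda>j. if j = 0 then a else if j = 1 then b else c)"

lemma pf_simps [simp]: "pf a b c 0 = a" "pf a b c (Suc 0) = b" "pf a b c 2 = c"
  by (simp_all add: pf_def)

lemma pf_lt: "a < S \<Longrightarrow> b < S \<Longrightarrow> c < S \<Longrightarrow> pf a b c j < S"
  by (simp add: pf_def)

fun csat :: "(nat \<Rightarrow> nat) \<Rightarrow> asg \<Rightarrow> schema \<Rightarrow> bool" where
  "csat p f (g, ps, cn) \<longleftrightarrow> (evg S p g \<longrightarrow> (\<forall>q \<in> set ps. holds S p f q) \<longrightarrow> holds S p f cn)"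

definition all_sat :: "asg \<Rightarrow> bool" where
  "all_sat f \<longleftrightarrow> (\<forall>x \<in> set (schemas M). \<forall>a<S. \<forall>b<S. \<forall>c<S. csat (pf a b c) f x)"

definition nstep :: "cfg \<Rightarrow> nat \<times> (nat \<times> head_move) list" where
  "nstep X = delta M (X 0 0) (map (\<lambda>k. X (1 + k) 0) [0..<K])"

definition nhead :: "cfg \<Rightarrow> nat \<Rightarrow> nat" where
  "nhead X k = mvc S (snd (snd (nstep X) ! k)) (X (1 + K + k) 0)"

definition ncell :: "cfg \<Rightarrow> nat \<Rightarrow> nat \<Rightarrow> nat" where
  "ncell X k i = (if i = X (1 + K + k) 0 then fst (snd (nstep X) ! k) else X (1 + 2 * K + k) i)"

text \<open>Defined for arbitrary values, also if the stored scanned symbols contradict the tapes: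
  the transition uses the stored symbols, and the new ones are read off the new tapes. Thus copy 2
  is a function of copy 0 in phase 1, even for assignments that encode no configuration of a
  machine.\<close>

definition next_cfg :: "cfg \<Rightarrow> cfg" where
  "next_cfg X = (\<lambda>t i. if \<not> isvar M S t i then 0 else if t = 0 then fst (nstep X)
     else if t \<le> K then ncell X (t - 1) (nhead X (t - 1))
     else if t \<le> 2 * K then nhead X (t - 1 - K)
     else ncell X (t - 1 - 2 * K) i)"

lemma isvar_cases:
  assumes "isvar M S t i"
  obtains "t = 0" "i = 0" | k where "k < K" "t = 1 + k" "i = 0"
    | k where "k < K" "t = 1 + K + k" "i = 0" | k where "k < K" "t = 1 + 2 * K + k" "i < S"
proof -
  show thesis using assms unfolding isvar_def
  proof (elim disjE conjE)
    assume t: "t \<le> 2 * K" "i = 0"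
    consider "t = 0" | "0 < t" "t \<le> K" | "K < t" by linarith
    then show thesis
    proof cases
      case 1
      then show thesis using that(1) t(2) by simp
    next
      case 2
      then show thesis using that(2)[of "t - 1"] t(2) by simp
    next
      case 3
      then show thesis using that(3)[of "t - 1 - K"] t by simp
    qed
  next
    assume "2 * K < t" "t \<le> 3 * K" "i < S"
    then show thesis using that(4)[of "t - 1 - 2 * K"] by simp
  qed
qed

lemma isvar_simps [simp]: "isvar M S 0 0" "k < K \<Longrightarrow> isvar M S (Suc k) 0" "k < K \<Longrightarrow> isvar M S (Suc (K + k)) 0"
  "k < K \<Longrightarrow> isvar M S (Suc (2 * K + k)) i \<longleftrightarrow> i < S"
  by (auto simp: isvar_def)

lemma dm_simps: "dm M S 0 = tm_states M" "k < K \<Longrightarrow> dm M S (1 + k) = tm_symbols M" "k < K \<Longrightarrow> dm M S (1 + K + k) = S"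
  "k < K \<Longrightarrow> dm M S (1 + 2 * K + k) = tm_symbols M"
  by (auto simp: dm_def)

lemma next_cfg_simps: "next_cfg X 0 0 = fst (nstep X)"
  "k < K \<Longrightarrow> next_cfg X (1 + k) 0 = ncell X k (nhead X k)"
  "k < K \<Longrightarrow> next_cfg X (1 + K + k) 0 = nhead X k"
  "k < K \<Longrightarrow> i < S \<Longrightarrow> next_cfg X (1 + 2 * K + k) i = ncell X k i"
  by (simp_all add: next_cfg_def)

lemma next_cfg_novar: "\<not> isvar M S t i \<Longrightarrow> next_cfg X t i = 0"
  by (simp add: next_cfg_def)

lemma mvc_lt: "h < S \<Longrightarrow> mvc S d h < S"
  by (cases d) auto

lemma cfg_bounds:
  assumes "is_cfg X"
  shows "X 0 0 < tm_states M" "k < K \<Longrightarrow> X (1 + k) 0 < tm_symbols M" "k < K \<Longrightarrow> X (1 + K + k) 0 < S"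
    "k < K \<Longrightarrow> i < S \<Longrightarrow> X (1 + 2 * K + k) i < tm_symbols M"
proof -
  have b: "X t i < dm M S t" if "isvar M S t i" for t i
    using assms that unfolding is_cfg_def by presburger
  show "X 0 0 < tm_states M" using b[of 0 0] dm_simps(1) by simp
  show "k < K \<Longrightarrow> X (1 + k) 0 < tm_symbols M" using b[of "1 + k" 0] dm_simps(2)[of k] by simp
  show "k < K \<Longrightarrow> X (1 + K + k) 0 < S" using b[of "1 + K + k" 0] dm_simps(3)[of k] by simp
  show "k < K \<Longrightarrow> i < S \<Longrightarrow> X (1 + 2 * K + k) i < tm_symbols M"
    using b[of "1 + 2 * K + k" i] dm_simps(4)[of k] by simp
qed

lemma nstep_wf:
  assumes "is_cfg X"
  shows "fst (nstep X) < tm_states M" "k < K \<Longrightarrow> fst (snd (nstep X) ! k) < tm_symbols M" "length (snd (nstep X)) = K"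
proof -
  let ?ss = "map (\<lambda>k. X (1 + k) 0) [0..<K]"
  have 1: "length ?ss = K" "\<forall>s \<in> set ?ss. s < tm_symbols M" using cfg_bounds[OF assms] by auto
  have 2: "delta M (X 0 0) ?ss = (fst (nstep X), snd (nstep X))" by (simp add: nstep_def)
  show "fst (nstep X) < tm_states M" "k < K \<Longrightarrow> fst (snd (nstep X) ! k) < tm_symbols M" "length (snd (nstep X)) = K"
    using delta_wf[OF cfg_bounds(1)[OF assms] 1 2] by auto
qed

lemma is_cfg_next:
  assumes "is_cfg X"
  shows "is_cfg (next_cfg X)"
  unfolding is_cfg_def
proof (intro allI)
  fix t i
  have c: "ncell X k j < tm_symbols M" if "k < K" "j < S" for k j
    using nstep_wf(2)[OF assms that(1)] cfg_bounds(4)[OF assms that] by (simp add: ncell_def)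
  have h: "nhead X k < S" if "k < K" for k
    unfolding nhead_def by (rule mvc_lt[OF cfg_bounds(3)[OF assms that]])
  show "if isvar M S t i then next_cfg X t i < dm M S t else next_cfg X t i = 0"
  proof (cases "isvar M S t i")
    case True
    then have "next_cfg X t i < dm M S t"
    proof (cases rule: isvar_cases)
      case 1
      then show ?thesis using nstep_wf(1)[OF assms] dm_simps(1) next_cfg_simps(1) by simp
    next
      case (2 k)
      then show ?thesis using c[OF 2(1) h[OF 2(1)]] dm_simps(2) next_cfg_simps(2) by metis
    next
      case (3 k)
      then show ?thesis using h[OF 3(1)] dm_simps(3) next_cfg_simps(3) by metis
    next
      case (4 k)
      then show ?thesis using c[OF 4(1,3)] dm_simps(4) next_cfg_simps(4) by metis
    qed
    then show ?thesis using True by simp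
  qed (simp add: next_cfg_novar)
qed

section \<open>Clauses and phase conditions\<close>

definition phase_ok :: "nat \<Rightarrow> cfg \<Rightarrow> cfg \<Rightarrow> cfg \<Rightarrow> bool" where
  "phase_ok ph X Y Z \<longleftrightarrow> (ph = 0 \<longrightarrow> X = Y) \<and> (ph = 1 \<longrightarrow> Z = next_cfg X) \<and> (ph = 2 \<longrightarrow> Y = Z) \<and>
     (ph = 3 \<longrightarrow> X 0 0 = accept_state \<and> Z 0 0 = accept_state)"

lemma asg_cfg: "is_asg f \<Longrightarrow> c < 3 \<Longrightarrow> is_cfg (f c)"
  unfolding is_cfg_def
proof (intro allI)
  fix t i assume "is_asg f" "c < 3"
  then have "if var c t i then f c t i < vsize c t else f c t i = 0" unfolding is_asg_def by blast
  then show "if isvar M S t i then f c t i < dm M S t else f c t i = 0"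
    using \<open>c < 3\<close> by (simp add: var_def vsize_def split: if_splits)
qed

lemma all_satD:
  assumes "all_sat f" "(g, ps, cn) \<in> set (schemas M)" "a < S" "b < S" "c < S" "evg S (pf a b c) g"
    "\<And>q. q \<in> set ps \<Longrightarrow> holds S (pf a b c) f q"
  shows "holds S (pf a b c) f cn"
proof -
  have "csat (pf a b c) f (g, ps, cn)" using assms(1-5) unfolding all_sat_def by blast
  then show ?thesis using assms(6,7) by simp
qed

lemma base_prems_hold:
  "(\<forall>q' \<in> set (base_prems q ss). holds S p f q') \<longleftrightarrow>
     f 3 0 0 = 1 \<and> f 0 0 0 = q \<and> (\<forall>k<length ss. f 0 (1 + k) 0 = ss ! k)"
  by (auto simp: base_prems_def)

text \<open>Every component to be determined is the conclusion of a schema whose premises become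
  true when the parameters are instantiated by the actual values. In phase 1 heads and cells come
  first, since the new scanned symbol is read at the new head position.\<close>

lemma phase_ok_if_sat:
  assumes f: "is_asg f" and sat: "all_sat f"
  shows "phase_ok (f 3 0 0) (f 0) (f 1) (f 2)"
  unfolding phase_ok_def
proof (intro conjI impI)
  note cfg = asg_cfg[OF f]
  have copy: "f c = f c'" if "c < 3" "c' < 3" "f 3 0 0 = ph"
    "(Gvar M, [(AC 3, AC 0, AC 0, AC ph), (AC c, AP 0, AP 1, AP 2)], (AC c', AP 0, AP 1, AP 2)) \<in> set (schemas M)" for c c' ph
  proof (intro ext)
    fix t i
    show "f c t i = f c' t i"
    proof (cases "isvar M S t i")
      case True
      then have lt: "t < S" "i < S" using S by (auto simp: isvar_def)
      have "holds S (pf t i (f c t i)) f (AC c', AP 0, AP 1, AP 2)"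
        by (rule all_satD[OF sat that(4) lt asg_lt[OF f]]) (use True lt that(3) in \<open>auto simp: evg_Gvar\<close>)
      then show ?thesis by simp
    next
      case False
      then show ?thesis using cfg[OF that(1)] cfg[OF that(2)] by (simp add: is_cfg_def)
    qed
  qed
  show "f 0 = f 1" if "f 3 0 0 = 0"
    by (rule copy[of 0 1 0]) (use that in \<open>auto simp: schemas_def phase_schemas_def\<close>)
  show "f 1 = f 2" if "f 3 0 0 = 2"
    by (rule copy[of 1 2 2]) (use that in \<open>auto simp: schemas_def phase_schemas_def\<close>)
  have S0: "0 < S" using S by simp
  show "f 0 0 0 = accept_state" if "f 3 0 0 = 3"
    using all_satD[OF sat, of GTrue "[(AC 3, AC 0, AC 0, AC 3)]" "(AC 0, AC 0, AC 0, AC 1)" 0 0 0] that S0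
    by (auto simp: schemas_def phase_schemas_def)
  show "f 2 0 0 = accept_state" if "f 3 0 0 = 3"
    using all_satD[OF sat, of GTrue "[(AC 3, AC 0, AC 0, AC 3)]" "(AC 2, AC 0, AC 0, AC 1)" 0 0 0] that S0
    by (auto simp: schemas_def phase_schemas_def)
  show "f 2 = next_cfg (f 0)" if ph: "f 3 0 0 = 1"
  proof (intro ext)
    fix t i
    let ?X = "f 0"
    let ?ss = "map (\<lambda>k. ?X (1 + k) 0) [0..<K]" and ?q = "?X 0 0"
    let ?B = "base_prems ?q ?ss"
    note b = cfg_bounds[OF cfg[of 0, simplified]]
    have tab: "(?q, ?ss) \<in> set (table M)" unfolding set_table using b by auto
    obtain q1 as where nx: "nstep ?X = (q1, as)" by (cases "nstep ?X")
    then have ns: "delta M ?q ?ss = (q1, as)" by (simp add: nstep_def)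
    have mem: "s \<in> set (schemas M)" if "s \<in> set (step_schemas M (?q, ?ss))" for s
      using that tab unfolding schemas_def by fastforce
    have memt: "s \<in> set (schemas M)" if "s \<in> set (tape_schemas M k)" "k < K" for s k
      using that unfolding schemas_def by fastforce
    have hB: "q' \<in> set ?B \<Longrightarrow> holds S p f q'" for q' p
      using base_prems_hold[of ?q ?ss p f] ph by auto
    have hq: "holds S p f q'" if "q' \<in> set (x # ?B)" "holds S p f x" for p q' x
    proof (cases "q' \<in> set ?B")
      case False
      then have "q' = x" using that(1) by simp
      then show ?thesis using that(2) by simp
    qed (rule hB)
    have head: "f 2 (1 + K + k) 0 = nhead ?X k" if k: "k < K" for k
    proof -
      let ?h = "?X (1 + K + k) 0"
      have "holds S (pf ?h (nhead ?X k) 0) f (AC 2, AC (1 + K + k), AC 0, AP 1)"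
      proof (rule all_satD[OF sat])
        show "(Gmove (snd (as ! k)), (AC 0, AC (1 + K + k), AC 0, AP 0) # ?B, (AC 2, AC (1 + K + k), AC 0, AP 1)) \<in> set (schemas M)"
          by (rule mem) (unfold set_step_schemas[OF ns], use k in blast)
        show "?h < S" "nhead ?X k < S" "0 < S" using b(3)[OF k] mvc_lt S0 by (auto simp: nhead_def)
        show "evg S (pf ?h (nhead ?X k) 0) (Gmove (snd (as ! k)))" by (simp add: evg_Gmove nhead_def nx)
        show "holds S (pf ?h (nhead ?X k) 0) f q" if "q \<in> set ((AC 0, AC (1 + K + k), AC 0, AP 0) # ?B)" for q
          by (rule hq[OF that]) simp
      qed
      then show ?thesis by simp
    qed
    have cell: "f 2 (1 + 2 * K + k) j = ncell ?X k j" if k: "k < K" "j < S" for k j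
    proof (cases "j = ?X (1 + K + k) 0")
      case True
      have "holds S (pf j 0 0) f (AC 2, AC (1 + 2 * K + k), AP 0, AC (fst (as ! k)))"
      proof (rule all_satD[OF sat])
        show "(GTrue, (AC 0, AC (1 + K + k), AC 0, AP 0) # ?B, (AC 2, AC (1 + 2 * K + k), AP 0, AC (fst (as ! k)))) \<in> set (schemas M)"
          by (rule mem) (unfold set_step_schemas[OF ns], use k in blast)
        show "holds S (pf j 0 0) f q" if "q \<in> set ((AC 0, AC (1 + K + k), AC 0, AP 0) # ?B)" for q
          by (rule hq[OF that]) (simp add: True)
      qed (use k S0 in auto)
      then show ?thesis using True by (simp add: ncell_def nx)
    next
      case False
      let ?h = "?X (1 + K + k) 0"
      have "holds S (pf ?h j (?X (1 + 2 * K + k) j)) f (AC 2, AC (1 + 2 * K + k), AP 1, AP 2)"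
      proof (rule all_satD[OF sat])
        show "(GNot (GEq (AP 0) (AP 1)),
         [(AC 3, AC 0, AC 0, AC 1), (AC 0, AC (1 + K + k), AC 0, AP 0), (AC 0, AC (1 + 2 * K + k), AP 1, AP 2)],
         (AC 2, AC (1 + 2 * K + k), AP 1, AP 2)) \<in> set (schemas M)"
          by (rule memt[OF _ k(1)]) (simp add: tape_schemas_def Let_def)
      qed (use k False ph b(3)[OF k(1)] asg_lt[OF f] in auto)
      then show ?thesis using False by (simp add: ncell_def nx)
    qed
    have scan: "f 2 (1 + k) 0 = ncell ?X k (nhead ?X k)" if k: "k < K" for k
    proof -
      have h: "nhead ?X k < S" unfolding nhead_def by (rule mvc_lt[OF b(3)[OF k]])
      have "holds S (pf (nhead ?X k) 0 (ncell ?X k (nhead ?X k))) f (AC 2, AC (1 + k), AC 0, AP 2)"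
      proof (rule all_satD[OF sat])
        show "(GTrue,
         [(AC 3, AC 0, AC 0, AC 1), (AC 2, AC (1 + K + k), AC 0, AP 0), (AC 2, AC (1 + 2 * K + k), AP 0, AP 2)],
         (AC 2, AC (1 + k), AC 0, AP 2)) \<in> set (schemas M)"
          by (rule memt[OF _ k]) (simp add: tape_schemas_def Let_def)
        show "ncell ?X k (nhead ?X k) < S" using cell[OF k h] asg_lt[OF f] by metis
        show "holds S (pf (nhead ?X k) 0 (ncell ?X k (nhead ?X k))) f q"
          if "q \<in> set [(AC 3, AC 0, AC 0, AC 1), (AC 2, AC (1 + K + k), AC 0, AP 0), (AC 2, AC (1 + 2 * K + k), AP 0, AP 2)]" for q
          using that ph head[OF k] cell[OF k h] by auto
      qed (use h S0 in auto)
      then show ?thesis by simp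
    qed
    show "f 2 t i = next_cfg ?X t i"
    proof (cases "isvar M S t i")
      case True
      then show ?thesis
      proof (cases rule: isvar_cases)
        case 1
        have "holds S (pf 0 0 0) f (AC 2, AC 0, AC 0, AC (q1))"
        proof (rule all_satD[OF sat])
          show "(GTrue, ?B, (AC 2, AC 0, AC 0, AC (q1))) \<in> set (schemas M)"
            by (rule mem) (unfold set_step_schemas[OF ns], blast)
          show "\<And>q. q \<in> set ?B \<Longrightarrow> holds S (pf 0 0 0) f q" by (rule hB)
        qed (use S0 in simp_all)
        then show ?thesis using 1 next_cfg_simps(1) nx by simp
      next
        case (2 k)
        then show ?thesis using scan next_cfg_simps(2) by metis
      next
        case (3 k)
        then show ?thesis using head next_cfg_simps(3) by metis
      next
        case (4 k)
        then show ?thesis using cell next_cfg_simps(4) by metis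
      qed
    next
      case False
      then show ?thesis using cfg[of 2] by (simp add: is_cfg_def next_cfg_novar)
    qed
  qed
qed

lemma sat_if_phase_ok:
  assumes f: "is_asg f" and ok: "phase_ok (f 3 0 0) (f 0) (f 1) (f 2)"
  shows "all_sat f"
  unfolding all_sat_def
proof (intro ballI allI impI)
  fix x u v w assume x: "x \<in> set (schemas M)" and uvw: "u < S" "v < S" "w < S"
  define p where "p = pf u v w"
  have p: "\<forall>j. p j < S" unfolding p_def using pf_lt[OF uvw] by blast
  obtain g ps c t i a where xe: "x = (g, ps, c, t, i, a)" by (cases x)
  have "holds S p f (c, t, i, a)" if g: "evg S p g" and h: "\<forall>q\<in>set ps. holds S p f q"
  proof -
  have s: "(g, ps, c, t, i, a) \<in> set (schemas M)" using x xe by simp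
  let ?X = "f 0"
  from s show "holds S p f (c, t, i, a)"
  proof (cases rule: schemas_cases)
    case 1
    then consider "ps = [(AC 3, AC 0, AC 0, AC 0), (AC 0, AP 0, AP 1, AP 2)]" "(c, t, i, a) = (AC 1, AP 0, AP 1, AP 2)"
      | "ps = [(AC 3, AC 0, AC 0, AC 2), (AC 1, AP 0, AP 1, AP 2)]" "(c, t, i, a) = (AC 2, AP 0, AP 1, AP 2)"
      | "ps = [(AC 3, AC 0, AC 0, AC 3)]" "(c, t, i, a) = (AC 0, AC 0, AC 0, AC 1)"
      | "ps = [(AC 3, AC 0, AC 0, AC 3)]" "(c, t, i, a) = (AC 2, AC 0, AC 0, AC 1)"
      by (simp add: phase_schemas_def del: One_nat_def) blast
    then show ?thesis using h ok unfolding phase_ok_def by cases simp_all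
  next
    case (2 k)
    then have ph: "f 3 0 0 = 1" using h by (auto simp: tape_schemas_def Let_def)
    then have F: "f 2 = next_cfg ?X" using ok by (simp add: phase_ok_def)
    from 2(2) consider
       "g = GNot (GEq (AP 0) (AP 1))" "ps = [(AC 3, AC 0, AC 0, AC 1), (AC 0, AC (1 + K + k), AC 0, AP 0), (AC 0, AC (1 + 2 * K + k), AP 1, AP 2)]"
       "(c, t, i, a) = (AC 2, AC (1 + 2 * K + k), AP 1, AP 2)"
     | "ps = [(AC 3, AC 0, AC 0, AC 1), (AC 2, AC (1 + K + k), AC 0, AP 0), (AC 2, AC (1 + 2 * K + k), AP 0, AP 2)]"
       "(c, t, i, a) = (AC 2, AC (1 + k), AC 0, AP 2)"
      by (simp add: tape_schemas_def Let_def del: One_nat_def) blast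
    then show ?thesis
    proof cases
      case 1
      have "f 2 (1 + 2 * K + k) (p 1) = ncell ?X k (p 1)" unfolding F using 2(1) p by (simp only: next_cfg_simps)
      then show ?thesis using 1 h g by (auto simp: ncell_def)
    next
      case 2
      have "f 2 (1 + 2 * K + k) (p 0) = ncell ?X k (p 0)" unfolding F using \<open>k < K\<close> p by (simp only: next_cfg_simps)
      moreover have "f 2 (1 + K + k) 0 = nhead ?X k" unfolding F using \<open>k < K\<close> by (simp only: next_cfg_simps)
      moreover have "f 2 (1 + k) 0 = ncell ?X k (nhead ?X k)" unfolding F using \<open>k < K\<close> by (simp only: next_cfg_simps)
      ultimately show ?thesis using 2 h by auto
    qed
  next
    case (3 q ss)
    have l: "length ss = K" using 3(1) by (simp add: set_table)
    obtain q' as where d: "delta M q ss = (q', as)" by fastforce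
    from 3(2) have "set (base_prems q ss) \<subseteq> set ps" unfolding set_step_schemas[OF d] by auto
    then have "\<forall>q'\<in>set (base_prems q ss). holds S p f q'" using h by blast
    then have b: "f 3 0 0 = 1" "?X 0 0 = q" "\<forall>k<K. ?X (1 + k) 0 = ss ! k"
      unfolding base_prems_hold by (simp_all add: l)
    then have F: "f 2 = next_cfg ?X" using ok by (simp add: phase_ok_def)
    have "map (\<lambda>k. ?X (1 + k) 0) [0..<K] = ss" using b(3) l by (intro nth_equalityI) auto
    then have ns: "nstep ?X = (q', as)" using b(2) d by (simp add: nstep_def)
    from 3(2) consider "(c, t, i, a) = (AC 2, AC 0, AC 0, AC q')"
     | k where "k < K" "g = Gmove (snd (as ! k))" "ps = (AC 0, AC (1 + K + k), AC 0, AP 0) # base_prems q ss"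
        "(c, t, i, a) = (AC 2, AC (1 + K + k), AC 0, AP 1)"
     | k where "k < K" "ps = (AC 0, AC (1 + K + k), AC 0, AP 0) # base_prems q ss"
        "(c, t, i, a) = (AC 2, AC (1 + 2 * K + k), AP 0, AC (fst (as ! k)))"
      unfolding set_step_schemas[OF d] by blast
    then show ?thesis
    proof cases
      case 1
      then show ?thesis using F ns next_cfg_simps(1)[of ?X] by simp
    next
      case (2 k)
      have "f 2 (1 + K + k) 0 = nhead ?X k" unfolding F using 2(1) by (simp only: next_cfg_simps)
      then show ?thesis using 2 h g ns by (auto simp: nhead_def evg_Gmove)
    next
      case (3 k)
      have "f 2 (1 + 2 * K + k) (p 0) = ncell ?X k (p 0)" unfolding F using 3(1) p by (simp only: next_cfg_simps)
      then show ?thesis using 3 h ns by (auto simp: ncell_def)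
    qed
  qed
  qed
  then show "csat (pf u v w) f x" unfolding xe p_def by simp
qed

end

section \<open>The hitting set instance of the clauses\<close>

locale sim_graph = sim +
  fixes r :: nat
  assumes r1: "1 \<le> r"
begin

text \<open>A negated equation is represented by all elements of its variable with a different
  value: the variable has exactly one token, so the equation fails exactly if this token is one of
  them.\<close>

fun lit :: "(nat \<Rightarrow> nat) \<Rightarrow> nat \<Rightarrow> nat \<Rightarrow> nat \<Rightarrow> nat \<Rightarrow> bool \<Rightarrow> quad \<Rightarrow> bool" where
  "lit p c t i a b (c', t', i', a') \<longleftrightarrow> c = eva S p c' \<and> t = eva S p t' \<and> i = eva S p i' \<and> (a = eva S p a' \<longleftrightarrow> b)"

fun in_clause :: "(nat \<Rightarrow> nat) \<Rightarrow> nat \<Rightarrow> nat \<Rightarrow> nat \<Rightarrow> nat \<Rightarrow> schema \<Rightarrow> bool" where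
  "in_clause p c t i a (g, ps, cn) \<longleftrightarrow>
     (evg S p g \<longrightarrow> (\<exists>q \<in> set ps. lit p c t i a False q) \<or> lit p c t i a True cn)"

text \<open>Number 0 is reserved for the sets of admissible values of the variables. An address that
  names neither a variable nor a schema, or a schema whose guard fails, gets all elements and thus
  imposes no condition.\<close>

definition in_set :: "nat \<Rightarrow> (nat \<Rightarrow> nat) \<Rightarrow> nat \<Rightarrow> nat \<Rightarrow> nat \<Rightarrow> nat \<Rightarrow> bool" where
  "in_set y p c t i a \<longleftrightarrow>
     (if y = 0 then var (p 0) (p 1) (p 2) \<longrightarrow> c = p 0 \<and> t = p 1 \<and> i = p 2 \<and> a < vsize c t
      else y \<le> length (schemas M) \<longrightarrow> in_clause p c t i a (schemas M ! (y - 1)))"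

definition elems :: "nat \<Rightarrow> nat set" where
  "elems k = {u. \<exists>y<S. \<exists>p0<S. \<exists>p1<S. \<exists>p2<S. \<exists>c<S. \<exists>t<S. \<exists>i<S. \<exists>a<S.
     k = el S y p0 p1 p2 \<and> u = el S c t i a \<and> in_set y (pf p0 p1 p2) c t i a}"

sublocale hs "S * S * S * S" "S * S * S * S" r elems
proof
  show "0 < S * S * S * S" using S by simp
  show "elems c \<subseteq> {..<S * S * S * S}" for c
    by (rule subsetI) (unfold elems_def lessThan_iff, elim CollectE exE conjE, simp only: el_lt)
qed (rule r1)

definition tok :: "asg \<Rightarrow> nat set" where
  "tok f = {el S c t i (f c t i) | c t i. var c t i}"

lemma elems_el:
  assumes "y < S" "p0 < S" "p1 < S" "p2 < S" "c < S" "t < S" "i < S" "a < S"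
  shows "el S c t i a \<in> elems (el S y p0 p1 p2) \<longleftrightarrow> in_set y (pf p0 p1 p2) c t i a"
proof
  assume "el S c t i a \<in> elems (el S y p0 p1 p2)"
  then show "in_set y (pf p0 p1 p2) c t i a" unfolding elems_def
  proof (elim CollectE exE conjE)
    fix y' q0 q1 q2 c' t' i' a'
    assume *: "q0 < S" "q1 < S" "q2 < S" "t' < S" "i' < S" "a' < S" "in_set y' (pf q0 q1 q2) c' t' i' a'"
      and e: "el S y p0 p1 p2 = el S y' q0 q1 q2" "el S c t i a = el S c' t' i' a'"
    have "y = y' \<and> p0 = q0 \<and> p1 = q1 \<and> p2 = q2"
      by (rule iffD1[OF el_inj[OF assms(2-4) *(1-3)] e(1)])
    moreover have "c = c' \<and> t = t' \<and> i = i' \<and> a = a'"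
      by (rule iffD1[OF el_inj[OF assms(6-8) *(4-6)] e(2)])
    ultimately show ?thesis using *(7) by simp
  qed
next
  assume h: "in_set y (pf p0 p1 p2) c t i a"
  show "el S c t i a \<in> elems (el S y p0 p1 p2)" unfolding elems_def
    by (rule CollectI, rule exI[of _ y], rule conjI, rule assms(1), rule exI[of _ p0], rule conjI, rule assms(2), rule exI[of _ p1], rule conjI, rule assms(3), rule exI[of _ p2], rule conjI, rule assms(4),
      rule exI[of _ c], rule conjI, rule assms(5), rule exI[of _ t], rule conjI, rule assms(6), rule exI[of _ i], rule conjI, rule assms(7), rule exI[of _ a], rule conjI, rule assms(8), intro conjI refl, rule h)
qed

lemma tok_hit_iff:
  assumes f: "is_asg f" and y: "y < S" "p0 < S" "p1 < S" "p2 < S"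
  shows "tok f \<inter> elems (el S y p0 p1 p2) \<noteq> {} \<longleftrightarrow> (\<exists>c t i. var c t i \<and> in_set y (pf p0 p1 p2) c t i (f c t i))"
proof -
  have "el S c t i (f c t i) \<in> elems (el S y p0 p1 p2) \<longleftrightarrow> in_set y (pf p0 p1 p2) c t i (f c t i)" if "var c t i" for c t i
    using elems_el[OF y] var_lt[OF that] asg_lt[OF f] by simp
  then show ?thesis unfolding tok_def by blast
qed

lemma var_simps [simp]: "var 3 0 0" "var 0 t i = isvar M S t i" "var (Suc 0) t i = isvar M S t i" "var 2 t i = isvar M S t i"
  by (simp_all add: var_def)

text \<open>Ensures that each equation of a clause has a token which can make its literal true; an
  equation about a triple that is no variable would leave no token for this purpose.\<close>

lemma schema_vars:
  assumes x: "(g, ps, cn) \<in> set (schemas M)" and p: "\<And>j. p j < S" and g: "evg S p g"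
    and q: "(c, t, i, a) \<in> insert cn (set ps)"
  shows "var (eva S p c) (eva S p t) (eva S p i)"
  using x
proof (cases rule: schemas_cases)
  case 1
  then show ?thesis using q g evg_Gvar[of p S M] p by (auto simp: phase_schemas_def)
next
  case (2 k)
  then show ?thesis using q p by (auto simp: tape_schemas_def Let_def)
next
  case (3 q' ss)
  obtain q1 as where d: "delta M q' ss = (q1, as)" by fastforce
  have l: "length ss = K" using 3(1) by (simp add: set_table)
  have b: "var (eva S p c) (eva S p t) (eva S p i)" if "(c, t, i, a) \<in> set (base_prems q' ss)"
    using that l by (auto simp: base_prems_def)
  from 3(2) consider "ps = base_prems q' ss" "cn = (AC 2, AC 0, AC 0, AC q1)"
    | k where "k < K" "ps = (AC 0, AC (1 + K + k), AC 0, AP 0) # base_prems q' ss" "cn = (AC 2, AC (1 + K + k), AC 0, AP 1)"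
    | k where "k < K" "ps = (AC 0, AC (1 + K + k), AC 0, AP 0) # base_prems q' ss"
        "cn = (AC 2, AC (1 + 2 * K + k), AP 0, AC (fst (as ! k)))"
    unfolding set_step_schemas[OF d] by blast
  then show ?thesis
  proof cases
    case 1
    then show ?thesis using q b by auto
  next
    case (2 k)
    then show ?thesis using q b by auto
  next
    case (3 k)
    then show ?thesis using q b p by auto
  qed
qed

lemma lit_holds: "lit p c t i (f c t i) True q \<Longrightarrow> holds S p f q" "lit p c t i (f c t i) False q \<Longrightarrow> \<not> holds S p f q"
  by (cases q; auto)+

definition good :: "asg \<Rightarrow> bool" where
  "good f \<longleftrightarrow> is_asg f \<and> all_sat f"

lemma good_iff: "good f \<longleftrightarrow> is_asg f \<and> phase_ok (f 3 0 0) (f 0) (f 1) (f 2)"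
  unfolding good_def using phase_ok_if_sat sat_if_phase_ok by blast

lemma tok_lt: "is_asg f \<Longrightarrow> tok f \<subseteq> {..<S * S * S * S}"
  unfolding tok_def using el_lt var_lt asg_lt by auto

text \<open>The token of a variable hits a clause exactly if the clause contains a literal that the
  value of the variable makes true.\<close>

lemma hits_tok_iff:
  assumes f: "is_asg f"
  shows "hits (tok f) \<longleftrightarrow> all_sat f"
proof
  assume h: "hits (tok f)"
  show "all_sat f" unfolding all_sat_def
  proof (intro ballI allI impI)
    fix x a b c assume x: "x \<in> set (schemas M)" and abc: "a < S" "b < S" "c < S"
    obtain z where z: "z < length (schemas M)" "x = schemas M ! z" using x by (metis in_set_conv_nth)
    obtain g ps cn where xe: "x = (g, ps, cn)" by (cases x)
    have y: "Suc z < S" using z(1) S by simp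
    have "tok f \<inter> elems (el S (Suc z) a b c) \<noteq> {}" using h el_lt[OF y abc] unfolding hits_def by blast
    then obtain c' t i where v: "var c' t i" "in_set (Suc z) (pf a b c) c' t i (f c' t i)"
      using tok_hit_iff[OF f y abc] by blast
    then have "in_clause (pf a b c) c' t i (f c' t i) x" using z by (simp add: in_set_def)
    then show "csat (pf a b c) f x" unfolding xe using lit_holds by (simp only: in_clause.simps csat.simps) blast
  qed
next
  assume s: "all_sat f"
  show "hits (tok f)" unfolding hits_def
  proof (intro conjI allI impI)
    show "tok f \<subseteq> {..<S * S * S * S}" by (rule tok_lt[OF f])
    fix k assume "k < S * S * S * S"
    then obtain y p0 p1 p2 where y: "y < S" "p0 < S" "p1 < S" "p2 < S" "k = el S y p0 p1 p2"
      using el_cases by blast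
    let ?p = "pf p0 p1 p2"
    have "\<exists>c t i. var c t i \<and> in_set y ?p c t i (f c t i)"
    proof (cases "y = 0")
      case True
      show ?thesis
      proof (cases "var p0 p1 p2")
        case v: True
        then have "f p0 p1 p2 < vsize p0 p1" using f unfolding is_asg_def by presburger
        then show ?thesis using True v by (intro exI[of _ p0] exI[of _ p1] exI[of _ p2]) (simp add: in_set_def)
      next
        case False
        \<comment> \<open>A set of all elements is hit by the token of the phase variable, which is
          present in every assignment.\<close>
        then show ?thesis using True by (intro exI[of _ 3] exI[of _ 0]) (simp add: in_set_def)
      qed
    next
      case False
      then obtain z where z: "y = Suc z" by (cases y) auto
      show ?thesis
      proof (cases "z < length (schemas M)")
        case True
        obtain g ps cn where x: "schemas M ! z = (g, ps, cn)" by (cases "schemas M ! z")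
        have xs: "(g, ps, cn) \<in> set (schemas M)" using True x nth_mem by metis
        have cs: "csat ?p f (g, ps, cn)" using s xs y unfolding all_sat_def by blast
        show ?thesis
        proof (cases "evg S ?p g")
          case g: True
          have w: "\<exists>c t i. var c t i \<and> lit ?p c t i (f c t i) b q" if q: "q \<in> insert cn (set ps)" "holds S ?p f q = b" for q b
          proof -
            obtain c t i a where qe: "q = (c, t, i, a)" by (cases q)
            have "var (eva S ?p c) (eva S ?p t) (eva S ?p i)"
              using schema_vars[OF xs pf_lt[OF y(2-4)] g] q(1) qe by blast
            then show ?thesis using q(2) qe by auto
          qed
          show ?thesis
          proof (cases "\<forall>q \<in> set ps. holds S ?p f q")
            case True
            then have "holds S ?p f cn" using cs g by simp
            then obtain c t i where "var c t i" "lit ?p c t i (f c t i) True cn" using w[of cn] by blast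
            then show ?thesis using z x by (auto simp: in_set_def)
          next
            case False
            then obtain q where "q \<in> set ps" "\<not> holds S ?p f q" by blast
            then obtain c t i where "var c t i" "lit ?p c t i (f c t i) False q" using w[of q False] by blast
            then have "in_clause ?p c t i (f c t i) (g, ps, cn)" using \<open>q \<in> set ps\<close> by auto
            then show ?thesis using z x \<open>var c t i\<close> by (auto simp: in_set_def)
          qed
        next
          case False
          then show ?thesis using z x by (intro exI[of _ 3] exI[of _ 0]) (simp add: in_set_def)
        qed
      next
        case False
        then show ?thesis using z by (intro exI[of _ 3] exI[of _ 0]) (simp add: in_set_def)
      qed
    qed
    then show "tok f \<inter> elems k \<noteq> {}" using tok_hit_iff[OF f y(1-4)] y(5) by simp
  qed
qed

section \<open>Token sets of minimum size as assignments\<close>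

definition vars :: "(nat \<times> nat \<times> nat) set" where
  "vars = {(c, t, i). var c t i}"

lemma finite_vars: "finite vars"
  by (rule finite_subset[of _ "{..<S} \<times> {..<S} \<times> {..<S}"]) (use var_lt in \<open>auto simp: vars_def\<close>)

lemma tok_eq: "tok f = (\<lambda>(c, t, i). el S c t i (f c t i)) ` vars"
  by (force simp: tok_def vars_def)

lemma card_tok: "is_asg f \<Longrightarrow> card (tok f) = card vars"
proof -
  assume f: "is_asg f"
  have "inj_on (\<lambda>(c, t, i). el S c t i (f c t i)) vars"
  proof (rule inj_onI)
    fix v w
    assume vw: "v \<in> vars" "w \<in> vars" "(case v of (c, t, i) \<Rightarrow> el S c t i (f c t i)) = (case w of (c, t, i) \<Rightarrow> el S c t i (f c t i))"
    obtain c t i c' t' i' where e: "v = (c, t, i)" "w = (c', t', i')" by (cases v, cases w)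
    show "v = w" using vw unfolding e
      using el_inj[of t S i "f c t i" t' i' "f c' t' i'" c c'] var_lt[of c t i] var_lt[of c' t' i'] asg_lt[OF f]
      by (simp add: vars_def)
  qed
  then show ?thesis unfolding tok_eq by (rule card_image)
qed

lemma tok_mem_iff:
  assumes "is_asg f" "var c t i" "a < S"
  shows "el S c t i a \<in> tok f \<longleftrightarrow> f c t i = a"
proof
  assume "el S c t i a \<in> tok f"
  then obtain c' t' i' where "var c' t' i'" "el S c t i a = el S c' t' i' (f c' t' i')" unfolding tok_def by blast
  then show "f c t i = a" using el_inj[of t S i a t' i' "f c' t' i'" c c'] var_lt assms asg_lt[OF assms(1)] by auto
qed (use assms tok_def in auto)

definition value_sets :: "nat set" where
  "value_sets = (\<lambda>(c, t, i). el S 0 c t i) ` vars"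

lemma elems_value_set:
  assumes "var c t i"
  shows "elems (el S 0 c t i) = {el S c t i a | a. a < vsize c t}"
proof -
  have S0: "0 < S" using S by simp
  note l = var_lt[OF assms]
  have "u \<in> elems (el S 0 c t i) \<longleftrightarrow> (\<exists>a<vsize c t. u = el S c t i a)" for u
  proof
    assume u: "u \<in> elems (el S 0 c t i)"
    obtain c' t' i' a where *: "c' < S" "t' < S" "i' < S" "a < S" "u = el S c' t' i' a"
      using u unfolding elems_def by (elim CollectE exE conjE)
    then have "in_set 0 (pf c t i) c' t' i' a" using elems_el[of 0 c t i c' t' i' a] S0 l u by simp
    then show "\<exists>a<vsize c t. u = el S c t i a" using assms * by (auto simp: in_set_def)
  next
    assume "\<exists>a<vsize c t. u = el S c t i a"
    then obtain a where a: "a < vsize c t" "u = el S c t i a" by blast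
    moreover have "a < S" using a(1) vsize_le[of c t] by simp
    moreover have "in_set 0 (pf c t i) c t i a" using a(1) by (simp add: in_set_def)
    ultimately show "u \<in> elems (el S 0 c t i)" using elems_el[of 0 c t i c t i a] S0 l by simp
  qed
  then show ?thesis by blast
qed

text \<open>The family of disjoint sets that \<open>swaps_if_reconf\<close> asks for; having one set
  for each token, it shows that the number of tokens is the least possible.\<close>

lemma value_sets_props:
  shows "value_sets \<subseteq> {..<S * S * S * S}" "card value_sets = card vars"
    and "j \<in> value_sets \<Longrightarrow> k \<in> value_sets \<Longrightarrow> j \<noteq> k \<Longrightarrow> elems j \<inter> elems k = {}"
proof -
  have S0: "0 < S" using S by simp
  show "value_sets \<subseteq> {..<S * S * S * S}" unfolding value_sets_def vars_def using el_lt var_lt S0 by auto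
  show "card value_sets = card vars" unfolding value_sets_def
  proof (rule card_image, rule inj_onI)
    fix v w
    assume vw: "v \<in> vars" "w \<in> vars" "(case v of (c, t, i) \<Rightarrow> el S 0 c t i) = (case w of (c, t, i) \<Rightarrow> el S 0 c t i)"
    obtain c t i c' t' i' where e: "v = (c, t, i)" "w = (c', t', i')" by (cases v, cases w)
    show "v = w" using vw unfolding e
      using el_inj[of c S t i c' t' i' 0 0] var_lt[of c t i] var_lt[of c' t' i'] by (simp add: vars_def)
  qed
  assume "j \<in> value_sets" "k \<in> value_sets" "j \<noteq> k"
  then obtain c t i c' t' i' where v: "var c t i" "j = el S 0 c t i" "var c' t' i'" "k = el S 0 c' t' i'"
    unfolding value_sets_def vars_def by auto
  then have ne: "(c, t, i) \<noteq> (c', t', i')" using \<open>j \<noteq> k\<close> by auto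
  have lt: "a < S" if "a < vsize d s" for a d s using that vsize_le[of d s] by simp
  have "el S c t i a \<noteq> el S c' t' i' a'" if "a < vsize c t" "a' < vsize c' t'" for a a'
    using el_inj[of t S i a t' i' a' c c'] var_lt[OF v(1)] var_lt[OF v(3)] lt[OF that(1)] lt[OF that(2)] ne by auto
  then show "elems j \<inter> elems k = {}" using elems_value_set[OF v(1)] elems_value_set[OF v(3)] v(2,4) by auto
qed

text \<open>Each value set contains an element of \<open>Q\<close>, and there are as many value sets
  as elements of \<open>Q\<close>. Hence nothing else belongs to \<open>Q\<close>, and it can be
  read as an assignment.\<close>

lemma tok_of_hits:
  assumes h: "hits Q" and card: "card Q = card vars"
  shows "\<exists>f. good f \<and> Q = tok f"
proof -
  have S0: "0 < S" using S by simp
  have "\<exists>a. a < vsize c t \<and> el S c t i a \<in> Q" if "var c t i" for c t i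
  proof -
    have "el S 0 c t i < S * S * S * S" using el_lt var_lt[OF that] S0 by blast
    then have "Q \<inter> elems (el S 0 c t i) \<noteq> {}" using h unfolding hits_def by blast
    then show ?thesis unfolding elems_value_set[OF that] by blast
  qed
  then obtain F where F: "\<And>c t i. var c t i \<Longrightarrow> F c t i < vsize c t \<and> el S c t i (F c t i) \<in> Q" by metis
  define f where "f c t i = (if var c t i then F c t i else 0)" for c t i
  have f: "is_asg f" unfolding is_asg_def f_def using F by simp
  have sub: "tok f \<subseteq> Q" unfolding tok_def f_def using F by auto
  have "finite Q" using h finite_subset unfolding hits_def by blast
  then have "tok f = Q" using sub card card_tok[OF f] by (metis card_subset_eq)
  then show ?thesis using h hits_tok_iff[OF f] f unfolding good_def by blast
qed

definition one_diff :: "asg \<Rightarrow> asg \<Rightarrow> bool" where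
  "one_diff f f' \<longleftrightarrow> (\<exists>c t i. f c t i \<noteq> f' c t i \<and> (\<forall>c' t' i'. (c', t', i') \<noteq> (c, t, i) \<longrightarrow> f c' t' i' = f' c' t' i'))"

lemma asg_novar: "is_asg f \<Longrightarrow> \<not> var c t i \<Longrightarrow> f c t i = 0"
proof -
  assume "is_asg f" "\<not> var c t i"
  then have "if var c t i then f c t i < vsize c t else f c t i = 0" unfolding is_asg_def by blast
  then show ?thesis using \<open>\<not> var c t i\<close> by simp
qed

lemma asg_var: "is_asg f \<Longrightarrow> is_asg f' \<Longrightarrow> f c t i \<noteq> f' c t i \<Longrightarrow> var c t i"
  using asg_novar[of f c t i] asg_novar[of f' c t i] by (cases "var c t i") simp_all

lemma tok_diff:
  assumes "is_asg f" "is_asg f'"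
  shows "tok f - tok f' = {el S c t i (f c t i) | c t i. f c t i \<noteq> f' c t i}"
proof -
  have v: "var c t i" if "f c t i \<noteq> f' c t i" for c t i by (rule asg_var[OF assms that])
  have n: "el S c t i (f c t i) \<notin> tok f' \<longleftrightarrow> f c t i \<noteq> f' c t i" if "var c t i" for c t i
    unfolding tok_mem_iff[OF assms(2) that asg_lt[OF assms(1)]] by (rule arg_cong[of _ _ Not]) (rule eq_commute)
  show ?thesis
  proof (intro subset_antisym subsetI)
    fix x assume x: "x \<in> tok f - tok f'"
    then have "x \<in> tok f" by (rule DiffD1)
    then obtain c t i where c: "var c t i" "x = el S c t i (f c t i)" unfolding tok_def by blast
    have "x \<notin> tok f'" using x by blast
    then have "f c t i \<noteq> f' c t i" unfolding c(2) n[OF c(1)] .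
    then show "x \<in> {el S c t i (f c t i) | c t i. f c t i \<noteq> f' c t i}" using c(2) by blast
  next
    fix x assume "x \<in> {el S c t i (f c t i) | c t i. f c t i \<noteq> f' c t i}"
    then obtain c t i where c: "f c t i \<noteq> f' c t i" "x = el S c t i (f c t i)" by blast
    have "x \<notin> tok f'" unfolding c(2) n[OF v[OF c(1)]] by (rule c(1))
    moreover have "x \<in> tok f" unfolding c(2) tok_def using v[OF c(1)] by blast
    ultimately show "x \<in> tok f - tok f'" by blast
  qed
qed

lemma swap_if_one_diff:
  assumes "good f" "good f'" "one_diff f f'"
  shows "swap (tok f) (tok f')"
proof -
  have a: "is_asg f" "is_asg f'" using assms by (auto simp: good_def)
  obtain c t i where d: "f c t i \<noteq> f' c t i" "\<And>c' t' i'. (c', t', i') \<noteq> (c, t, i) \<Longrightarrow> f c' t' i' = f' c' t' i'"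
    using assms(3) unfolding one_diff_def by blast
  have *: "f c' t' i' \<noteq> f' c' t' i' \<longleftrightarrow> c' = c \<and> t' = t \<and> i' = i" for c' t' i' using d by blast
  have **: "f' c' t' i' \<noteq> f c' t' i' \<longleftrightarrow> c' = c \<and> t' = t \<and> i' = i" for c' t' i'
    unfolding *[symmetric] by (rule arg_cong[of _ _ Not]) (rule eq_commute)
  have 1: "tok f - tok f' = {el S c t i (f c t i)}" unfolding tok_diff[OF a] * by simp
  have 2: "tok f' - tok f = {el S c t i (f' c t i)}" unfolding tok_diff[OF a(2,1)] ** by simp
  have "hits (tok f)" "hits (tok f')"
    using hits_tok_iff[OF a(1)] hits_tok_iff[OF a(2)] assms(1,2) by (simp_all only: good_def)
  then show ?thesis using 1 2 unfolding swap_def by blast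
qed

lemma one_diff_if_swap:
  assumes "good f" "good f'" "swap (tok f) (tok f')"
  shows "one_diff f f'"
proof -
  have a: "is_asg f" "is_asg f'" using assms by (auto simp: good_def)
  obtain x where x: "tok f - tok f' = {x}" using assms(3) unfolding swap_def by blast
  then have "x \<in> tok f - tok f'" by blast
  then obtain c t i where d: "f c t i \<noteq> f' c t i" "x = el S c t i (f c t i)" unfolding tok_diff[OF a] by blast
  have "f c' t' i' = f' c' t' i'" if "(c', t', i') \<noteq> (c, t, i)" for c' t' i'
  proof (rule ccontr)
    assume ne: "f c' t' i' \<noteq> f' c' t' i'"
    then have "el S c' t' i' (f c' t' i') \<in> tok f - tok f'" unfolding tok_diff[OF a] by blast
    then have "el S c' t' i' (f c' t' i') = el S c t i (f c t i)" unfolding x d(2) by (rule singletonD)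
    then show False using that el_inj[of t' S i' "f c' t' i'" t i "f c t i" c' c]
      var_lt[OF asg_var[OF a d(1)]] var_lt[OF asg_var[OF a ne]] asg_lt[OF a(1)] by simp
  qed
  then show ?thesis using d(1) unfolding one_diff_def by blast
qed

section \<open>Acceptance as an invariant of moves\<close>

definition accepting :: "cfg \<Rightarrow> bool" where
  "accepting X \<longleftrightarrow> (\<exists>n. (next_cfg ^^ n) X 0 0 = accept_state)"

lemma next_cfg_accept: "X 0 0 = accept_state \<Longrightarrow> next_cfg X 0 0 = accept_state"
  unfolding next_cfg_simps nstep_def delta_def by simp

text \<open>Acceptance is absorbing, so an accepting run can be prolonged at its end before its
  first step is dropped.\<close>

lemma accepting_next: "accepting (next_cfg X) \<longleftrightarrow> accepting X"
proof
  assume "accepting (next_cfg X)"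
  then obtain n where "(next_cfg ^^ n) (next_cfg X) 0 0 = accept_state" unfolding accepting_def by blast
  then have "(next_cfg ^^ Suc n) X 0 0 = accept_state" by (simp add: funpow_swap1)
  then show "accepting X" unfolding accepting_def by blast
next
  assume "accepting X"
  then obtain n where n: "(next_cfg ^^ n) X 0 0 = accept_state" unfolding accepting_def by blast
  then have "(next_cfg ^^ n) (next_cfg X) 0 0 = accept_state"
    using next_cfg_accept[of "(next_cfg ^^ n) X"] by (simp add: funpow_swap1)
  then show "accepting (next_cfg X)" unfolding accepting_def by blast
qed

lemma accepting_now: "X 0 0 = accept_state \<Longrightarrow> accepting X"
  unfolding accepting_def by (rule exI[of _ 0]) simp

text \<open>The simulated configuration is read from copy 0 in phase 0 and from copy 2 otherwise.
  Phase 3 counts as success outright, as the goal belongs to it.\<close>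

definition succeeds :: "asg \<Rightarrow> bool" where
  "succeeds f \<longleftrightarrow> f 3 0 0 = 3 \<or> accepting (if f 3 0 0 = 0 then f 0 else f 2)"

text \<open>Handles a move that alters the phase only, where both phase conditions hold for the same
  copies. Together with phase 0, phase 1 makes Z the successor of X, phase 2 makes all copies equal,
  and phase 3 makes X and Z accepting.\<close>

lemma phase_accepting:
  assumes n: "phase_ok n X Y Z" "n < 4" and m: "phase_ok m X Y Z" "m < 4"
  shows "n = 3 \<or> accepting (if n = 0 then X else Z) \<longleftrightarrow> m = 3 \<or> accepting (if m = 0 then X else Z)"
proof -
  have v: "k = 3 \<or> accepting (if k = 0 then X else Z) \<longleftrightarrow> accepting (if k = 0 then X else Z)" if "phase_ok k X Y Z" for k
    using that accepting_now[of Z] unfolding phase_ok_def by auto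
  have w: "accepting X \<longleftrightarrow> accepting Z" if "phase_ok 0 X Y Z" "phase_ok k X Y Z" "k < 4" "k \<noteq> 0" for k
  proof -
    have "k = 1 \<or> k = 2 \<or> k = 3" using that(3,4) by linarith
    then show ?thesis
    proof (elim disjE)
      assume "k = 1"
      then have "Z = next_cfg X" using that(2) by (simp add: phase_ok_def)
      then show ?thesis by (simp only: accepting_next)
    next
      assume "k = 2"
      then have "Y = Z" using that(2) by (simp add: phase_ok_def)
      moreover have "X = Y" using that(1) by (simp add: phase_ok_def)
      ultimately show ?thesis by simp
    next
      assume "k = 3"
      then show ?thesis using that(2) accepting_now[of X] accepting_now[of Z] by (simp add: phase_ok_def)
    qed
  qed
  show ?thesis unfolding v[OF n(1)] v[OF m(1)] using w[OF _ m] w[OF _ n] n(1) m(1)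
    by (cases "n = 0"; cases "m = 0") simp_all
qed

text \<open>In every phase the copy from which the simulated configuration is read cannot be changed
  by altering a single variable.\<close>

lemma succeeds_invariant:
  assumes g: "good f" "good f'" and d: "one_diff f f'"
  shows "succeeds f \<longleftrightarrow> succeeds f'"
proof -
  obtain c t i where d: "\<And>c' t' i'. (c', t', i') \<noteq> (c, t, i) \<Longrightarrow> f c' t' i' = f' c' t' i'"
    using d unfolding one_diff_def by blast
  have eq: "f c' = f' c'" if "c' \<noteq> c" for c' using d that by (intro ext) simp
  have ok: "phase_ok (f 3 0 0) (f 0) (f 1) (f 2)" "phase_ok (f' 3 0 0) (f' 0) (f' 1) (f' 2)"
    "is_asg f" "is_asg f'" using g by (simp_all add: good_iff)
  have lt: "f 3 0 0 < 4" "f' 3 0 0 < 4"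
  proof -
    have "if var 3 0 0 then h 3 0 0 < vsize 3 0 else h 3 0 0 = 0" if "is_asg h" for h
      using that unfolding is_asg_def by blast
    then show "f 3 0 0 < 4" "f' 3 0 0 < 4" using ok(3,4) by (simp_all add: vsize_def)
  qed
  have ph: "n = 0 \<or> n = 1 \<or> n = 2 \<or> n = 3" if "n < 4" for n :: nat using that by linarith
  show ?thesis
  proof (cases "c = 3")
    case True
    then have e: "f 0 = f' 0" "f 1 = f' 1" "f 2 = f' 2" using eq by auto
    show ?thesis unfolding succeeds_def e[symmetric]
      by (rule phase_accepting[OF ok(1) lt(1) _ lt(2)]) (use ok(2) in \<open>simp only: e\<close>)
  next
    case False
    then have e3: "f 3 = f' 3" using eq by auto
    from ph[OF lt(1)] show ?thesis
    proof (elim disjE)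
      assume 0: "f 3 0 0 = 0"
      then have xy: "f 0 = f 1" "f' 0 = f' 1" using ok(1,2) e3 unfolding phase_ok_def by simp_all
      \<comment> \<open>Copies 0 and 1 coincide before and after the move, and at least one of them
        is untouched.\<close>
      have "f 0 = f' 0" using xy eq[of 0] eq[of 1] by (cases "c = 0") auto
      then show ?thesis using 0 e3 by (simp add: succeeds_def)
    next
      assume 1: "f 3 0 0 = 1"
      then have xy: "f 2 = next_cfg (f 0)" "f' 2 = next_cfg (f' 0)" using ok(1,2) e3 unfolding phase_ok_def by simp_all
      \<comment> \<open>Copy 2 is determined by copy 0, so it cannot be the copy that changes. Copy
        0 may change, as long as its successor remains the same.\<close>
      have "f 2 = f' 2" using xy eq[of 0] eq[of 2] by (cases "c = 2") auto
      then show ?thesis using 1 e3 by (simp add: succeeds_def)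
    next
      assume 2: "f 3 0 0 = 2"
      then have xy: "f 1 = f 2" "f' 1 = f' 2" using ok(1,2) e3 unfolding phase_ok_def by simp_all
      have "f 2 = f' 2" using xy eq[of 1] eq[of 2] by (cases "c = 2") auto
      then show ?thesis using 2 e3 by (simp add: succeeds_def)
    next
      assume "f 3 0 0 = 3"
      then show ?thesis using e3 by (simp add: succeeds_def)
    qed
  qed
qed

section \<open>Simulation of a run by moves\<close>

definition move1 :: "asg \<Rightarrow> asg \<Rightarrow> bool" where
  "move1 f f' \<longleftrightarrow> good f \<and> good f' \<and> one_diff f f'"

text \<open>If every mixture of \<open>f\<close> and \<open>g\<close> is good, the variables on
  which they differ can be altered one after the other in any order.\<close>

lemma moves_free:
  assumes "is_asg f" "is_asg g" "\<And>h. is_asg h \<Longrightarrow> (\<forall>c t i. h c t i = f c t i \<or> h c t i = g c t i) \<Longrightarrow> good h"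
  shows "move1\<^sup>*\<^sup>* f g"
  using assms
proof (induction "card {(c, t, i). f c t i \<noteq> g c t i}" arbitrary: f)
  case 0
  have "finite {(c, t, i). f c t i \<noteq> g c t i}"
    by (rule finite_subset[OF _ finite_vars]) (use asg_var[OF 0(2,3)] in \<open>auto simp: vars_def\<close>)
  then have "{(c, t, i). f c t i \<noteq> g c t i} = {}" using 0(1) by simp
  then have "f = g" by (intro ext) auto
  then show ?case by simp
next
  case (Suc n)
  let ?D = "\<lambda>f. {(c, t, i). f c t i \<noteq> g c t i}"
  have "?D f \<noteq> {}" using Suc(2) by (metis card.empty nat.distinct(1))
  then obtain c t i where cti: "f c t i \<noteq> g c t i" by blast
  define f' where "f' = (\<lambda>c' t' i'. if (c', t', i') = (c, t, i) then g c t i else f c' t' i')"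
  have f': "is_asg f'" using Suc.prems(1,2) unfolding is_asg_def f'_def by auto
  have "?D f' = ?D f - {(c, t, i)}" using cti by (auto simp: f'_def)
  then have "card (?D f') = n" using Suc(2) cti by simp
  moreover have "good h" if "is_asg h" "\<forall>c t i. h c t i = f' c t i \<or> h c t i = g c t i" for h
    by (rule Suc.prems(3)[OF that(1)]) (use that(2) in \<open>auto simp: f'_def split: if_splits\<close>)
  ultimately have "move1\<^sup>*\<^sup>* f' g" using Suc.hyps(1)[of f'] f' Suc.prems(2) by blast
  moreover have "good f" "good f'" using Suc.prems(3)[of f] Suc.prems(1) Suc.prems(3)[of f'] f'
    by (auto simp: f'_def)
  then have "move1 f f'" using cti unfolding move1_def one_diff_def f'_def by auto
  ultimately show ?case by simp
qed

definition mkasg :: "nat \<Rightarrow> cfg \<Rightarrow> cfg \<Rightarrow> cfg \<Rightarrow> asg" where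
  "mkasg ph X Y Z = (\<lambda>c. if c = 0 then X else if c = 1 then Y else if c = 2 then Z
     else if c = 3 then (\<lambda>t i. if t = 0 \<and> i = 0 then ph else 0) else (\<lambda>_ _. 0))"

lemma mkasg_simps [simp]: "mkasg ph X Y Z 0 = X" "mkasg ph X Y Z (Suc 0) = Y" "mkasg ph X Y Z 2 = Z"
  "mkasg ph X Y Z 3 0 0 = ph"
  by (simp_all add: mkasg_def)

lemma is_asg_mkasg:
  assumes "is_cfg X" "is_cfg Y" "is_cfg Z" "ph < 4"
  shows "is_asg (mkasg ph X Y Z)"
  unfolding is_asg_def
proof (intro allI)
  fix c t i
  have *: "if isvar M S t i then W t i < dm M S t else W t i = 0" if "is_cfg W" for W
    using that unfolding is_cfg_def by blast
  show "if var c t i then mkasg ph X Y Z c t i < vsize c t else mkasg ph X Y Z c t i = 0"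
    using *[OF assms(1)] *[OF assms(2)] *[OF assms(3)] assms(4)
    by (auto simp: mkasg_def var_def vsize_def split: if_splits)
qed

lemma move_phase:
  assumes "is_cfg X" "is_cfg Y" "is_cfg Z" "ph < 4" "ph' < 4" "ph \<noteq> ph'" "phase_ok ph X Y Z" "phase_ok ph' X Y Z"
  shows "move1\<^sup>*\<^sup>* (mkasg ph X Y Z) (mkasg ph' X Y Z)"
proof -
  have "one_diff (mkasg ph X Y Z) (mkasg ph' X Y Z)"
    unfolding one_diff_def by (rule exI[of _ 3], rule exI[of _ 0], rule exI[of _ 0]) (use assms(6) in \<open>auto simp: mkasg_def\<close>)
  then have "move1 (mkasg ph X Y Z) (mkasg ph' X Y Z)"
    unfolding move1_def good_iff using is_asg_mkasg assms by simp
  then show ?thesis by simp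
qed

lemma moves_within:
  assumes "is_cfg X" "is_cfg Y" "is_cfg Z" "is_cfg X'" "is_cfg Y'" "is_cfg Z'" "ph < 4"
    "\<And>X1 Y1 Z1. (\<forall>t i. X1 t i = X t i \<or> X1 t i = X' t i) \<Longrightarrow> (\<forall>t i. Y1 t i = Y t i \<or> Y1 t i = Y' t i) \<Longrightarrow>
       (\<forall>t i. Z1 t i = Z t i \<or> Z1 t i = Z' t i) \<Longrightarrow> phase_ok ph X1 Y1 Z1"
  shows "move1\<^sup>*\<^sup>* (mkasg ph X Y Z) (mkasg ph X' Y' Z')"
proof (rule moves_free)
  show "is_asg (mkasg ph X Y Z)" "is_asg (mkasg ph X' Y' Z')" using is_asg_mkasg assms by blast+
  fix h assume h: "is_asg h" "\<forall>c t i. h c t i = mkasg ph X Y Z c t i \<or> h c t i = mkasg ph X' Y' Z' c t i"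
  have "h 3 0 0 = ph" using h(2)[rule_format, of 3 0 0] by simp
  moreover have "phase_ok ph (h 0) (h 1) (h 2)"
  proof (rule assms(8))
    show "\<forall>t i. h 0 t i = X t i \<or> h 0 t i = X' t i" using h(2)[rule_format, of 0] by simp
    show "\<forall>t i. h 1 t i = Y t i \<or> h 1 t i = Y' t i" using h(2)[rule_format, of 1] by simp
    show "\<forall>t i. h 2 t i = Z t i \<or> h 2 t i = Z' t i" using h(2)[rule_format, of 2] by simp
  qed
  ultimately show "good h" using h(1) by (simp add: good_iff)
qed

lemma cfg_between_eq: "\<forall>t i. (X1 :: cfg) t i = X t i \<or> X1 t i = X t i \<Longrightarrow> X1 = X"
  by (intro ext) blast

definition start_asg :: "cfg \<Rightarrow> asg" where
  "start_asg X = mkasg 0 X X X"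

definition goal_cfg :: cfg where
  "goal_cfg = (\<lambda>t i. if t = 0 \<and> i = 0 then accept_state else 0)"

definition goal_asg :: asg where
  "goal_asg = mkasg 3 goal_cfg goal_cfg goal_cfg"

lemma is_cfg_goal: "is_cfg goal_cfg"
proof -
  have "0 < dm M S t" for t using S sizes by (simp add: dm_def)
  moreover have "1 < dm M S 0" using sizes by (simp add: dm_def)
  moreover have "isvar M S 0 0" by simp
  ultimately show ?thesis unfolding is_cfg_def goal_cfg_def by auto
qed

lemma good_start: "is_cfg X \<Longrightarrow> good (start_asg X)"
  unfolding good_iff start_asg_def using is_asg_mkasg by (simp add: phase_ok_def)

lemma good_goal: "good goal_asg"
  unfolding good_iff goal_asg_def using is_asg_mkasg is_cfg_goal by (simp add: phase_ok_def goal_cfg_def)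

text \<open>One cycle of phases: Z is rewritten in phase 0, Y in phase 1 and X in phase 2, each
  while the other two copies are tied. The changes of phase in between are possible because the
  conditions of both phases hold.\<close>

lemma moves_step:
  assumes X: "is_cfg X"
  shows "move1\<^sup>*\<^sup>* (start_asg X) (start_asg (next_cfg X))"
proof -
  let ?F = "next_cfg X"
  note F = is_cfg_next[OF X]
  have 1: "move1\<^sup>*\<^sup>* (mkasg 0 X X X) (mkasg 0 X X ?F)"
  proof (rule moves_within)
    fix X1 Y1 Z1
    assume "\<forall>t i. X1 t i = X t i \<or> X1 t i = X t i" "\<forall>t i. Y1 t i = X t i \<or> Y1 t i = X t i"
    from this[THEN cfg_between_eq] show "phase_ok 0 X1 Y1 Z1" by (simp add: phase_ok_def)
  qed (use X F in simp_all)
  have 2: "move1\<^sup>*\<^sup>* (mkasg 0 X X ?F) (mkasg 1 X X ?F)"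
    by (rule move_phase) (use X F in \<open>simp_all add: phase_ok_def\<close>)
  have 3: "move1\<^sup>*\<^sup>* (mkasg 1 X X ?F) (mkasg 1 X ?F ?F)"
  proof (rule moves_within)
    fix X1 Y1 Z1
    assume "\<forall>t i. X1 t i = X t i \<or> X1 t i = X t i" "\<forall>t i. Z1 t i = ?F t i \<or> Z1 t i = ?F t i"
    from this[THEN cfg_between_eq] show "phase_ok 1 X1 Y1 Z1" by (simp add: phase_ok_def)
  qed (use X F in simp_all)
  have 4: "move1\<^sup>*\<^sup>* (mkasg 1 X ?F ?F) (mkasg 2 X ?F ?F)"
    by (rule move_phase) (use X F in \<open>simp_all add: phase_ok_def\<close>)
  have 5: "move1\<^sup>*\<^sup>* (mkasg 2 X ?F ?F) (mkasg 2 ?F ?F ?F)"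
  proof (rule moves_within)
    fix X1 Y1 Z1
    assume "\<forall>t i. Y1 t i = ?F t i \<or> Y1 t i = ?F t i" "\<forall>t i. Z1 t i = ?F t i \<or> Z1 t i = ?F t i"
    from this[THEN cfg_between_eq] show "phase_ok 2 X1 Y1 Z1" by (simp add: phase_ok_def)
  qed (use X F in simp_all)
  have 6: "move1\<^sup>*\<^sup>* (mkasg 2 ?F ?F ?F) (mkasg 0 ?F ?F ?F)"
    by (rule move_phase) (use X F in \<open>simp_all add: phase_ok_def\<close>)
  show ?thesis unfolding start_asg_def
    by (rule rtranclp_trans[OF 1 rtranclp_trans[OF 2 rtranclp_trans[OF 3 rtranclp_trans[OF 4 rtranclp_trans[OF 5 6]]]]])
qed

lemma moves_accept:
  assumes X: "is_cfg X" "X 0 0 = accept_state"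
  shows "move1\<^sup>*\<^sup>* (start_asg X) goal_asg"
proof -
  have 1: "move1\<^sup>*\<^sup>* (mkasg 0 X X X) (mkasg 3 X X X)"
    by (rule move_phase) (use X in \<open>auto simp: phase_ok_def\<close>)
  have 2: "move1\<^sup>*\<^sup>* (mkasg 3 X X X) (mkasg 3 goal_cfg goal_cfg goal_cfg)"
  proof (rule moves_within)
    fix X1 Y1 Z1
    assume "\<forall>t i. X1 t i = X t i \<or> X1 t i = goal_cfg t i" "\<forall>t i. Z1 t i = X t i \<or> Z1 t i = goal_cfg t i"
    \<comment> \<open>Both ends have the accepting state in the component \<open>(0, 0)\<close>,
      hence so does every mixture of them.\<close>
    then have "X1 0 0 = X 0 0 \<or> X1 0 0 = goal_cfg 0 0" "Z1 0 0 = X 0 0 \<or> Z1 0 0 = goal_cfg 0 0" by blast+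
    then have "X1 0 0 = accept_state" "Z1 0 0 = accept_state" using X(2) by (auto simp: goal_cfg_def)
    then show "phase_ok 3 X1 Y1 Z1" by (simp add: phase_ok_def)
  qed (use X is_cfg_goal in auto)
  show ?thesis unfolding start_asg_def goal_asg_def by (rule rtranclp_trans[OF 1 2])
qed

theorem reconf_iff_accepting:
  assumes X: "is_cfg X"
  shows "(\<exists>T. is_reconf_sequence R r G (tok (start_asg X)) T (tok goal_asg)) \<longleftrightarrow> accepting X"
proof
  assume "\<exists>T. is_reconf_sequence R r G (tok (start_asg X)) T (tok goal_asg)"
  then obtain T where T: "is_reconf_sequence R r G (tok (start_asg X)) T (tok goal_asg)" by blast
  note gs = good_start[OF X] good_goal
  have as: "is_asg (start_asg X)" "is_asg goal_asg" using gs by (simp_all add: good_def)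
  \<comment> \<open>The invariant \<open>succeeds\<close> in terms of token sets; it is well defined
    because \<open>tok\<close> is injective on good assignments.\<close>
  define P where "P Q \<longleftrightarrow> (\<exists>f. good f \<and> Q = tok f \<and> succeeds f)" for Q
  have inj: "f = f'" if "good f" "good f'" "tok f = tok f'" for f f'
  proof -
    have a: "is_asg f" "is_asg f'" using that by (simp_all add: good_def)
    have "tok f - tok f' = {}" using that(3) by blast
    then show ?thesis unfolding tok_diff[OF a] by (intro ext) blast
  qed
  have Pt: "P (tok f) \<longleftrightarrow> succeeds f" if "good f" for f using inj that unfolding P_def by blast
  \<comment> \<open>The tokens of the goal hit every set.\<close>
  have ne: "elems k \<noteq> {}" if "k < S * S * S * S" for k
    using gs(2) that hits_tok_iff[OF as(2)] unfolding good_def hits_def by blast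
  have cs: "card vars = card (tok (start_asg X))" by (rule card_tok[OF as(1), symmetric])
  have "P (tok (start_asg X)) \<longleftrightarrow> P (tok goal_asg)"
  proof (rule swaps_if_reconf[OF T tok_lt[OF as(1)] tok_lt[OF as(2)] ne value_sets_props(1) _ value_sets_props(3)])
    show "card value_sets = card (tok (start_asg X))" using value_sets_props(2) cs by simp
    fix Q Q' assume *: "swap Q Q'" "card Q = card (tok (start_asg X))" "card Q' = card (tok (start_asg X))"
    then obtain f f' where f: "good f" "Q = tok f" "good f'" "Q' = tok f'"
      using tok_of_hits[of Q] tok_of_hits[of Q'] cs unfolding swap_def by auto
    then have "one_diff f f'" using one_diff_if_swap *(1) by simp
    then show "P Q \<longleftrightarrow> P Q'" using succeeds_invariant f Pt by simp
  qed
  moreover have "succeeds goal_asg" by (simp add: succeeds_def goal_asg_def)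
  ultimately have "succeeds (start_asg X)" using Pt gs by simp
  then show "accepting X" by (simp add: succeeds_def start_asg_def)
next
  assume "accepting X"
  then obtain n where n: "(next_cfg ^^ n) X 0 0 = accept_state" unfolding accepting_def by blast
  have "is_cfg ((next_cfg ^^ m) X) \<and> move1\<^sup>*\<^sup>* (start_asg X) (start_asg ((next_cfg ^^ m) X))" for m
  proof (induction m)
    case (Suc m)
    then show ?case using moves_step[of "(next_cfg ^^ m) X"] is_cfg_next by auto
  qed (use X in simp)
  then have "move1\<^sup>*\<^sup>* (start_asg X) goal_asg"
    using moves_accept[of "(next_cfg ^^ n) X"] n by (meson rtranclp_trans)
  then have "swap\<^sup>*\<^sup>* (tok (start_asg X)) (tok goal_asg)"
  proof (induction rule: rtranclp_induct)
    case (step f f')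
    then have "swap (tok f) (tok f')" using swap_if_one_diff unfolding move1_def by blast
    then show ?case using step by simp
  qed simp
  moreover have "hits (tok (start_asg X))" using good_start[OF X] hits_tok_iff unfolding good_def by blast
  ultimately show "\<exists>T. is_reconf_sequence R r G (tok (start_asg X)) T (tok goal_asg)"
    by (rule reconf_if_swaps)
qed

end

section \<open>Configurations of the machine as values of the variables\<close>

context sim
begin

definition enc :: "config \<Rightarrow> cfg" where
  "enc c = (\<lambda>t i. if \<not> isvar M S t i then 0 else if t = 0 then fst c
     else if t \<le> K then scanned (snd c ! (t - 1)) else if t \<le> 2 * K then snd (snd c ! (t - 1 - K))
     else fst (snd c ! (t - 1 - 2 * K)) i)"

lemma enc_simps: "enc c 0 0 = fst c" "k < K \<Longrightarrow> enc c (1 + k) 0 = scanned (snd c ! k)"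
  "k < K \<Longrightarrow> enc c (1 + K + k) 0 = snd (snd c ! k)" "k < K \<Longrightarrow> i < S \<Longrightarrow> enc c (1 + 2 * K + k) i = fst (snd c ! k) i"
  "\<not> isvar M S t i \<Longrightarrow> enc c t i = 0"
  by (simp_all add: enc_def)

definition conf_ok :: "config \<Rightarrow> bool" where
  "conf_ok c \<longleftrightarrow> fst c < tm_states M \<and> length (snd c) = K \<and> (\<forall>k<K. \<forall>i. fst (snd c ! k) i < tm_symbols M)"

lemma step_eq_delta:
  assumes "length (snd c) = K"
  shows "step M c = (case delta M (fst c) (map scanned (snd c)) of (q, as) \<Rightarrow> (q, map2 act as (snd c)))"
proof -
  have st: "map2 act (map (\<lambda>\<sigma>. (\<sigma>, Stay)) (map scanned Ts)) Ts = Ts" for Ts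
    by (induction Ts) auto
  show ?thesis
  proof (cases "halted c")
    case True
    then have "delta M (fst c) (map scanned (snd c)) = (fst c, map (\<lambda>\<sigma>. (\<sigma>, Stay)) (map scanned (snd c)))"
      by (simp add: delta_def halted_def)
    then show ?thesis using True by (simp only: step_def st prod.case if_True prod.collapse)
  next
    case False
    then show ?thesis by (simp add: step_def delta_def halted_def)
  qed
qed

lemma conf_ok_step:
  assumes c: "conf_ok c"
  shows "conf_ok (step M c)"
proof -
  obtain q Ts where ce: "c = (q, Ts)" by (cases c)
  have l: "length Ts = K" and q: "q < tm_states M" and sy: "\<And>k i. k < K \<Longrightarrow> fst (Ts ! k) i < tm_symbols M"
    using c ce by (auto simp: conf_ok_def)
  let ?ss = "map scanned Ts"
  obtain q' as where d: "delta M q ?ss = (q', as)" by fastforce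
  have ss: "length ?ss = K" "\<forall>s\<in>set ?ss. s < tm_symbols M"
  proof -
    show "length ?ss = K" using l by simp
    show "\<forall>s\<in>set ?ss. s < tm_symbols M"
    proof
      fix s assume "s \<in> set ?ss"
      then obtain k where "k < K" "s = scanned (Ts ! k)" using l by (auto simp: in_set_conv_nth)
      then show "s < tm_symbols M" using sy[of k "snd (Ts ! k)"] by (simp add: scanned_def)
    qed
  qed
  note w = delta_wf[OF q ss d]
  have st: "step M c = (q', map2 act as Ts)" using step_eq_delta[of c] l d by (simp add: ce)
  have nth: "map2 act as Ts ! k = act (as ! k) (Ts ! k)" if "k < K" for k using that l w(2) by simp
  have "fst (act (as ! k) (Ts ! k)) i < tm_symbols M" if "k < K" for k i
    using w(3)[OF that] sy[OF that] by (simp add: act_def)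
  then show ?thesis unfolding conf_ok_def st using w(1,2) l nth by simp
qed

text \<open>While the heads stay below \<open>S\<close> before and after the step, the truncation in
  \<open>mvc\<close> is never applied, and the cells that are read or written are variables.\<close>

lemma enc_step:
  assumes c: "conf_ok c" and h: "\<forall>k<K. snd (snd c ! k) < S \<and> snd (snd (step M c) ! k) < S"
  shows "enc (step M c) = next_cfg (enc c)"
proof -
  obtain q Ts where ce: "c = (q, Ts)" by (cases c)
  have l: "length Ts = K" and q: "q < tm_states M" and sy: "\<And>k i. k < K \<Longrightarrow> fst (Ts ! k) i < tm_symbols M"
    using c ce by (auto simp: conf_ok_def)
  let ?ss = "map scanned Ts"
  obtain q' as where d: "delta M q ?ss = (q', as)" by fastforce
  have ss: "length ?ss = K" "\<forall>s\<in>set ?ss. s < tm_symbols M"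
  proof -
    show "length ?ss = K" using l by simp
    show "\<forall>s\<in>set ?ss. s < tm_symbols M"
    proof
      fix s assume "s \<in> set ?ss"
      then obtain k where "k < K" "s = scanned (Ts ! k)" using l by (auto simp: in_set_conv_nth)
      then show "s < tm_symbols M" using sy[of k "snd (Ts ! k)"] by (simp add: scanned_def)
    qed
  qed
  note w = delta_wf[OF q ss d]
  have st: "step M c = (q', map2 act as Ts)" using step_eq_delta[of c] l d by (simp add: ce)
  have nth: "map2 act as Ts ! k = act (as ! k) (Ts ! k)" if "k < K" for k using that l w(2) by simp
  have "enc c (1 + k) 0 = scanned (Ts ! k)" if "k < K" for k
    unfolding enc_simps(2)[OF that] by (simp add: ce)
  then have "map (\<lambda>k. enc c (1 + k) 0) [0..<K] = ?ss"
    using l by (intro nth_equalityI) simp_all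
  then have ns: "nstep (enc c) = (q', as)" unfolding nstep_def using d enc_simps(1)[of c] ce by simp
  have hd: "nhead (enc c) k = snd (act (as ! k) (Ts ! k))" if k: "k < K" for k
  proof -
    have "snd (act (as ! k) (Ts ! k)) < S" "snd (Ts ! k) < S" using h k ce st nth[OF k] by auto
    then have "mvc S (snd (as ! k)) (snd (Ts ! k)) = move_head (snd (as ! k)) (snd (Ts ! k))"
      by (cases "snd (as ! k)") (auto simp: act_def)
    then show ?thesis unfolding nhead_def ns enc_simps(3)[OF k] using ce by (simp add: act_def)
  qed
  have cl: "ncell (enc c) k i = fst (act (as ! k) (Ts ! k)) i" if k: "k < K" "i < S" for k i
    unfolding ncell_def ns enc_simps(3)[OF k(1)] enc_simps(4)[OF k] using ce by (simp add: act_def)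
  have snd_st: "snd (step M c) ! k = act (as ! k) (Ts ! k)" if "k < K" for k using st nth[OF that] by simp
  show "enc (step M c) = next_cfg (enc c)"
  proof (intro ext)
    fix t i
    show "enc (step M c) t i = next_cfg (enc c) t i"
    proof (cases "isvar M S t i")
      case True
      then show ?thesis
      proof (cases rule: isvar_cases)
        case 1
        then show ?thesis using ns st by (simp add: enc_simps(1) next_cfg_simps(1))
      next
        case (2 k)
        have "snd (act (as ! k) (Ts ! k)) < S" using h 2(1) snd_st by auto
        then show ?thesis unfolding 2(2,3) enc_simps(2)[OF 2(1)] next_cfg_simps(2)[OF 2(1)] hd[OF 2(1)] snd_st[OF 2(1)]
          using cl[OF 2(1)] by (simp add: scanned_def)
      next
        case (3 k)
        show ?thesis unfolding 3(2,3) enc_simps(3)[OF 3(1)] next_cfg_simps(3)[OF 3(1)] hd[OF 3(1)] snd_st[OF 3(1)] ..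
      next
        case (4 k)
        show ?thesis unfolding 4(2) enc_simps(4)[OF 4(1,3)] next_cfg_simps(4)[OF 4(1,3)] cl[OF 4(1,3)] snd_st[OF 4(1)] ..
      qed
    qed (simp add: enc_simps(5) next_cfg_novar)
  qed
qed

lemma conf_ok_init: "conf_ok (init_config M x)"
proof -
  have "fst (tape_of y) i < tm_symbols M" for y i
    using sizes(3) by (auto simp: tape_of_def start_sym_def blank_sym_def bit_sym_def)
  then have "fst (snd (init_config M x) ! k) i < tm_symbols M" if "k < K" for k i
    using that by (cases k) (simp_all add: init_config_def)
  moreover have "length (snd (init_config M x)) = K" "fst (init_config M x) < tm_states M"
    using sizes by (simp_all add: init_config_def)
  ultimately show ?thesis unfolding conf_ok_def by blast
qed

lemma run_Suc: "run M x (Suc n) = step M (run M x n)"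
  by (simp add: run_def)

lemma conf_ok_run: "conf_ok (run M x n)"
proof (induction n)
  case 0
  show ?case using conf_ok_init by (simp add: run_def)
next
  case (Suc n)
  then show ?case unfolding run_Suc by (rule conf_ok_step)
qed

lemma is_cfg_enc:
  assumes c: "conf_ok c" and h: "\<forall>k<K. snd (snd c ! k) < S"
  shows "is_cfg (enc c)"
  unfolding is_cfg_def
proof (intro allI)
  fix t i
  have cs1: "fst c < tm_states M" using c by (simp add: conf_ok_def)
  have cs: "fst (snd c ! k) j < tm_symbols M" if "k < K" for k j using c that by (simp add: conf_ok_def)
  have "enc c t i < dm M S t" if "isvar M S t i"
    using that
  proof (cases rule: isvar_cases)
    case 1
    then show ?thesis using cs1 dm_simps(1) enc_simps(1) by simp
  next
    case (2 k)
    show ?thesis unfolding 2(2,3) enc_simps(2)[OF 2(1)] dm_simps(2)[OF 2(1)] scanned_def by (rule cs[OF 2(1)])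
  next
    case (3 k)
    show ?thesis unfolding 3(2,3) enc_simps(3)[OF 3(1)] dm_simps(3)[OF 3(1)] using h 3(1) by blast
  next
    case (4 k)
    show ?thesis unfolding 4(2) enc_simps(4)[OF 4(1,3)] dm_simps(4)[OF 4(1)] by (rule cs[OF 4(1)])
  qed
  then show "if isvar M S t i then enc c t i < dm M S t else enc c t i = 0" using enc_simps(5) by simp
qed

lemma enc_run:
  assumes h: "\<And>n T. T \<in> set (snd (run M x n)) \<Longrightarrow> snd T < S"
  shows "(next_cfg ^^ n) (enc (init_config M x)) = enc (run M x n)" "is_cfg (enc (init_config M x))"
proof -
  have hk: "\<forall>k<K. snd (snd (run M x n) ! k) < S" for n
    using h[OF nth_mem] conf_ok_run[of x n] by (simp add: conf_ok_def)
  show "(next_cfg ^^ n) (enc (init_config M x)) = enc (run M x n)"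
  proof (induction n)
    case 0
    show ?case by (simp add: run_def)
  next
    case (Suc n)
    have "enc (step M (run M x n)) = next_cfg (enc (run M x n))"
      by (rule enc_step[OF conf_ok_run]) (use hk[of n] hk[of "Suc n"] in \<open>simp add: run_Suc\<close>)
    then show ?case using Suc by (simp add: run_Suc)
  qed
  show "is_cfg (enc (init_config M x))"
    using is_cfg_enc[OF conf_ok_init, of x] hk[of 0] by (simp add: run_def)
qed

lemma run_halted:
  assumes "halted (run M x n)"
  shows "run M x (n + m) = run M x n"
proof (induction m)
  case (Suc m)
  then show ?case using assms by (simp add: run_Suc step_def)
qed simp

lemma accepts_iff:
  assumes "decides M L" "\<And>n T. T \<in> set (snd (run M x n)) \<Longrightarrow> snd T < S"
  shows "(\<exists>n. (next_cfg ^^ n) (enc (init_config M x)) 0 0 = accept_state) \<longleftrightarrow> x \<in> L"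
proof -
  have d: "\<exists>t. fst (run M x t) = (if x \<in> L then accept_state else reject_state)"
    using assms(1) unfolding decides_def by blast
  have "(\<exists>n. fst (run M x n) = accept_state) \<longleftrightarrow> x \<in> L"
  proof
    assume "\<exists>n. fst (run M x n) = accept_state"
    then obtain n where n: "fst (run M x n) = accept_state" by blast
    show "x \<in> L"
    proof (rule ccontr)
      assume "x \<notin> L"
      then obtain m where m: "fst (run M x m) = reject_state" using d by auto
      have "run M x (n + m) = run M x n" by (rule run_halted) (simp add: halted_def n)
      moreover have "run M x (m + n) = run M x m" by (rule run_halted) (simp add: halted_def m)
      ultimately have "run M x n = run M x m" by (simp add: add.commute)
      then show False using n m by simp
    qed
  next
    assume "x \<in> L"
    then show "\<exists>n. fst (run M x n) = accept_state" using d by simp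
  qed
  moreover have "(next_cfg ^^ n) (enc (init_config M x)) 0 0 = fst (run M x n)" for n
  proof -
    have "(next_cfg ^^ n) (enc (init_config M x)) = enc (run M x n)" by (rule enc_run(1)) (rule assms(2))
    then show ?thesis by (simp add: enc_simps(1))
  qed
  ultimately show ?thesis by simp
qed

end

section \<open>The reduction as a generator\<close>

definition FTrue :: fm where "FTrue = Less (Cst 0) (Cst 1)"
definition FOr :: "fm \<Rightarrow> fm \<Rightarrow> fm" where "FOr f g = Neg (And (Neg f) (Neg g))"
definition FImp :: "fm \<Rightarrow> fm \<Rightarrow> fm" where "FImp f g = Neg (And f (Neg g))"
definition FEq :: "trm \<Rightarrow> trm \<Rightarrow> fm" where "FEq t u = And (Neg (Less t u)) (Neg (Less u t))"
definition FAll :: "trm \<Rightarrow> fm \<Rightarrow> fm" where "FAll t f = Neg (Ex t (Neg f))"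
definition FConj :: "fm list \<Rightarrow> fm" where "FConj fs = foldr And fs FTrue"
definition FDisj :: "fm list \<Rightarrow> fm" where "FDisj fs = foldr FOr fs (Neg FTrue)"

lemma evalf_derived [simp]:
  "evalf x m e FTrue"
  "evalf x m e (FOr f g) \<longleftrightarrow> evalf x m e f \<or> evalf x m e g"
  "evalf x m e (FImp f g) \<longleftrightarrow> (evalf x m e f \<longrightarrow> evalf x m e g)"
  "evalf x m e (FEq t u) \<longleftrightarrow> evalt e t = evalt e u"
  "evalf x m e (FAll t f) \<longleftrightarrow> (\<forall>v < evalt e t. evalf x m (e @ [v]) f)"
  by (auto simp: FTrue_def FOr_def FImp_def FEq_def FAll_def)

lemma evalf_FConj [simp]: "evalf x m e (FConj fs) \<longleftrightarrow> (\<forall>f \<in> set fs. evalf x m e f)"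
  by (induction fs) (auto simp: FConj_def)

lemma evalf_FDisj [simp]: "evalf x m e (FDisj fs) \<longleftrightarrow> (\<exists>f \<in> set fs. evalf x m e f)"
  by (induction fs) (auto simp: FDisj_def)

lemma rho_Cons [simp]: "rho (a # e) 0 = a" "rho (a # e) (Suc i) = rho e i"
  "rho (a # e) (numeral k) = rho e (pred_numeral k)"
  by (simp_all add: rho_def numeral_eq_Suc)

text \<open>A let construct: the guard admits only the round in which the loop variable equals
  \<open>t\<close>. It adds a computed value to the environment, here \<open>S\<close> as variable 1
  and the number of vertices as variable 2.\<close>

definition bind_gen :: "nat \<Rightarrow> trm \<Rightarrow> gen \<Rightarrow> gen" where
  "bind_gen d t g = Loop (Plus t (Cst 1)) (Guard (FEq (V d) t) g)"

lemma outs_bind_gen: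
  assumes "d = length e" "\<And>v. evalt (e @ [v]) t = evalt e t"
  shows "outs x m e (bind_gen d t g) = outs x m (e @ [evalt e t]) g"
proof -
  have "concat (map (\<lambda>v. if v = k then F v else []) [0..<k]) = []" for k and F :: "nat \<Rightarrow> bool list"
    by (simp add: concat_eq_Nil_conv)
  then show ?thesis using assms by (simp add: bind_gen_def)
qed

text \<open>Horner's scheme, with the input length as variable 0.\<close>

lemma ex_poly_trm: "\<exists>t. \<forall>e. evalt e t = poly (p :: nat poly) (rho e 0)"
proof (induction p)
  case 0
  show ?case by (rule exI[of _ "Cst 0"]) simp
next
  case (pCons a p)
  then obtain t where "\<forall>e. evalt e t = poly p (rho e 0)" by blast
  then show ?case by (intro exI[of _ "Plus (Cst a) (Times (V 0) t)"]) simp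
qed

definition elT :: "trm \<Rightarrow> trm \<Rightarrow> trm \<Rightarrow> trm \<Rightarrow> trm" where
  "elT c t i a = Plus (Times (Plus (Times (Plus (Times c (V 1)) t) (V 1)) i) (V 1)) a"

lemma evalt_elT [simp]: "evalt e (elT c t i a) = el (rho e (Suc 0)) (evalt e c) (evalt e t) (evalt e i) (evalt e a)"
  by (simp add: elT_def el_def)

definition UT :: trm where "UT = Times (Times (Times (V 1) (V 1)) (V 1)) (V 1)"

lemma evalt_UT [simp]: "evalt e UT = rho e (Suc 0) * rho e (Suc 0) * rho e (Suc 0) * rho e (Suc 0)"
  by (simp add: UT_def)

text \<open>The environment consists of the input length, the base \<open>S\<close>, the number of vertices, two
  vertices, the digits of a set index and the digits of an element.\<close>

primrec argT :: "arg \<Rightarrow> trm" where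
  "argT (AC c) = Cst c"
| "argT (AP j) = V (if j = 0 then 6 else if j = 1 then 7 else 8)"
| "argT AS = V 1"
| "argT (AAdd a b) = Plus (argT a) (argT b)"

primrec grdF :: "grd \<Rightarrow> fm" where
  "grdF (GLess a b) = Less (argT a) (argT b)"
| "grdF (GNot g) = Neg (grdF g)"
| "grdF (GAnd g h) = And (grdF g) (grdF h)"

fun litF :: "bool \<Rightarrow> quad \<Rightarrow> fm" where
  "litF b (c, t, i, a) = FConj [FEq (V 9) (argT c), FEq (V 10) (argT t), FEq (V 11) (argT i),
     (if b then FEq (V 12) (argT a) else Neg (FEq (V 12) (argT a)))]"

fun clauseF :: "schema \<Rightarrow> fm" where
  "clauseF (g, ps, cn) = FImp (grdF g) (FOr (FDisj (map (litF False) ps)) (litF True cn))"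

definition varF :: "tm \<Rightarrow> trm \<Rightarrow> trm \<Rightarrow> trm \<Rightarrow> fm" where
  "varF M c t i = (let K = tm_tapes M in
     FOr (And (Less c (Cst 3)) (FOr (And (Less t (Cst (2 * K + 1))) (FEq i (Cst 0)))
            (FConj [Less (Cst (2 * K)) t, Less t (Cst (3 * K + 1)), Less i (V 1)])))
         (FConj [FEq c (Cst 3), FEq t (Cst 0), FEq i (Cst 0)]))"

definition sizeF :: "tm \<Rightarrow> trm \<Rightarrow> trm \<Rightarrow> trm \<Rightarrow> fm" where
  "sizeF M c t a = (let K = tm_tapes M in
     FConj [FImp (Neg (Less c (Cst 3))) (Less a (Cst 4)),
       FImp (Less c (Cst 3)) (FConj
         [FImp (FEq t (Cst 0)) (Less a (Cst (tm_states M))),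
          FImp (And (Less (Cst 0) t) (Less t (Cst (K + 1)))) (Less a (Cst (tm_symbols M))),
          FImp (And (Less (Cst K) t) (Less t (Cst (2 * K + 1)))) (Less a (V 1)),
          FImp (Less (Cst (2 * K)) t) (Less a (Cst (tm_symbols M)))])])"

definition in_setF :: "tm \<Rightarrow> fm" where
  "in_setF M = And
     (FImp (FEq (V 5) (Cst 0)) (FImp (varF M (V 6) (V 7) (V 8))
        (FConj [FEq (V 9) (V 6), FEq (V 10) (V 7), FEq (V 11) (V 8), sizeF M (V 9) (V 10) (V 12)])))
     (FConj (map (\<lambda>z. FImp (FEq (V 5) (Cst (Suc z))) (clauseF (schemas M ! z))) [0..<length (schemas M)]))"

abbreviation Ex4 :: "fm \<Rightarrow> fm" where
  "Ex4 f \<equiv> Ex (V 1) (Ex (V 1) (Ex (V 1) (Ex (V 1) f)))"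

text \<open>Follows \<open>hs_adj\<close> disjunct by disjunct. Like \<open>hs_adj\<close> it is
  directed, so the adjacency matrix uses it in both directions.\<close>

definition dadjF :: "tm \<Rightarrow> nat \<Rightarrow> trm \<Rightarrow> trm \<Rightarrow> fm" where
  "dadjF M r u v = FDisj
     [And (Less u v) (Less v UT),
      Ex4 (And (FEq v (Plus UT (Times (elT (V 5) (V 6) (V 7) (V 8)) (Cst r))))
        (Ex4 (And (FEq u (elT (V 9) (V 10) (V 11) (V 12))) (in_setF M)))),
      Ex UT (Ex (Cst r) (FConj [Less (Plus (V 6) (Cst 1)) (Cst r), FEq u (Plus (Plus UT (Times (V 5) (Cst r))) (V 6)),
        FEq v (Plus (Plus UT (Times (V 5) (Cst r))) (Plus (V 6) (Cst 1)))]))]"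

text \<open>The constants are those of the initial configuration: state and head positions are 0,
  every scanned symbol and every cell 0 is the start symbol 1, and component
  \<open>2 * K + 1\<close> is the input tape, with the bits coded as 2 and 3 and shifted by one
  cell.\<close>

definition startF :: "tm \<Rightarrow> fm" where
  "startF M = (let K = tm_tapes M; a = (\<lambda>c. FEq (V 7) (Cst c)) in
     Ex4 (FConj [FEq (V 3) (elT (V 4) (V 5) (V 6) (V 7)), varF M (V 4) (V 5) (V 6),
       FImp (FEq (V 4) (Cst 3)) (a 0),
       FImp (Less (V 4) (Cst 3)) (FConj
         [FImp (FEq (V 5) (Cst 0)) (a 0),
          FImp (And (Less (Cst 0) (V 5)) (Less (V 5) (Cst (K + 1)))) (a 1),
          FImp (And (Less (Cst K) (V 5)) (Less (V 5) (Cst (2 * K + 1)))) (a 0),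
          FImp (And (Less (Cst (2 * K)) (V 5)) (FEq (V 6) (Cst 0))) (a 1),
          FImp (And (FEq (V 5) (Cst (2 * K + 1))) (Less (Cst 0) (V 6)))
            (FOr (And (Less (V 0) (V 6)) (a 0))
              (Ex (V 0) (And (FEq (V 6) (Plus (V 8) (Cst 1)))
                 (FOr (And (InBit (V 8)) (a 3)) (And (Neg (InBit (V 8))) (a 2)))))),
          FImp (And (Less (Cst (2 * K + 1)) (V 5)) (Less (Cst 0) (V 6))) (a 0)])]))"

definition goalF :: "tm \<Rightarrow> fm" where
  "goalF M = Ex4 (FConj [FEq (V 3) (elT (V 4) (V 5) (V 6) (V 7)), varF M (V 4) (V 5) (V 6),
       FImp (FEq (V 4) (Cst 3)) (FEq (V 7) (Cst 3)),
       FImp (Less (V 4) (Cst 3)) (And (FImp (FEq (V 5) (Cst 0)) (FEq (V 7) (Cst 1)))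
          (FImp (Less (Cst 0) (V 5)) (FEq (V 7) (Cst 0))))])"

definition reduction :: "tm \<Rightarrow> nat \<Rightarrow> trm \<Rightarrow> gen" where
  "reduction M r St = bind_gen 1 St (bind_gen 2 (Plus UT (Times UT (Cst r)))
     (App (Loop (V 2) (Emit FTrue)) (App (Emit (Neg FTrue))
       (App (Loop (V 2) (Loop (V 2) (Emit (FOr (dadjF M r (V 3) (V 4)) (dadjF M r (V 4) (V 3))))))
         (App (Loop (V 2) (Emit (startF M))) (Loop (V 2) (Emit (goalF M))))))))"

lemma concat_map_single: "concat (map (\<lambda>v. [f v]) xs) = map f xs"
  by (induction xs) auto

section \<open>Correctness of the generated instance\<close>

context sim_graph
begin

lemma evalt_argT:
  assumes "length e = 5" "rho e (Suc 0) = S"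
  shows "evalt (e @ [y, p0, p1, p2, c, t, i, a]) (argT z) = eva S (pf p0 p1 p2) z"
proof -
  obtain e0 e1 e2 e3 e4 where e: "e = [e0, e1, e2, e3, e4]"
    using assms(1) by (auto simp: eval_nat_numeral length_Suc_conv)
  show ?thesis using assms(2) unfolding e by (induction z) (auto simp: pf_def)
qed

lemma evalf_grdF:
  assumes "length e = 5" "rho e (Suc 0) = S"
  shows "evalf x m (e @ [y, p0, p1, p2, c, t, i, a]) (grdF g) \<longleftrightarrow> evg S (pf p0 p1 p2) g"
  by (induction g) (simp_all add: evalt_argT[OF assms])

lemma evalf_varF: "rho e (Suc 0) = S \<Longrightarrow> evalf x m e (varF M c t i) \<longleftrightarrow> var (evalt e c) (evalt e t) (evalt e i)"
  by (auto simp: varF_def Let_def var_def isvar_def)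

lemma evalf_sizeF: "rho e (Suc 0) = S \<Longrightarrow> evalf x m e (sizeF M c t a) \<longleftrightarrow> evalt e a < vsize (evalt e c) (evalt e t)"
  by (auto simp: sizeF_def Let_def vsize_def dm_def)

lemma evalf_clauseF:
  assumes "length e = 5" "rho e (Suc 0) = S"
  shows "evalf x m (e @ [y, p0, p1, p2, c, t, i, a]) (clauseF s) \<longleftrightarrow> in_clause (pf p0 p1 p2) c t i a s"
proof -
  let ?e = "e @ [y, p0, p1, p2, c, t, i, a]"
  have V: "rho ?e 9 = c" "rho ?e 10 = t" "rho ?e 11 = i" "rho ?e 12 = a"
    using assms(1) by (simp_all add: rho_def nth_append)
  have l: "evalf x m ?e (litF b q) \<longleftrightarrow> lit (pf p0 p1 p2) c t i a b q" for b q
    by (cases q) (simp add: evalt_argT[OF assms] V del: rho_Cons)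
  obtain g ps cn where s: "s = (g, ps, cn)" by (rule prod_cases3)
  show ?thesis unfolding s by (simp add: evalf_grdF[OF assms] l del: litF.simps lit.simps)
qed

lemma evalf_in_setF:
  assumes "length e = 5" "rho e (Suc 0) = S"
  shows "evalf x m (e @ [y, p0, p1, p2, c, t, i, a]) (in_setF M) \<longleftrightarrow> in_set y (pf p0 p1 p2) c t i a"
proof -
  have app: "rho (e @ es) i = rho es (i - 5)" if "5 \<le> i" for es i
    using that assms(1) by (auto simp: rho_def nth_append)
  have "(\<forall>z\<in>{0..<length (schemas M)}. y = Suc z \<longrightarrow> in_clause (pf p0 p1 p2) c t i a (schemas M ! z)) \<longleftrightarrow>
     (y \<noteq> 0 \<longrightarrow> y \<le> length (schemas M) \<longrightarrow> in_clause (pf p0 p1 p2) c t i a (schemas M ! (y - 1)))"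
    by (cases y) auto
  then show ?thesis unfolding in_setF_def in_set_def
    by (simp add: app assms evalf_varF evalf_sizeF evalf_clauseF[OF assms])
qed

lemma evalf_dadjF:
  assumes e: "e = [N, S, n, i, j]" and u: "u \<in> {V 3, V 4}" and v: "v \<in> {V 3, V 4}"
  shows "evalf x m e (dadjF M r u v) \<longleftrightarrow> hs_adj (S * S * S * S) (S * S * S * S) r elems (evalt e u) (evalt e v)"
proof -
  have l: "length e = 5" "rho e (Suc 0) = S" by (simp_all add: e)
  have uv: "evalt (e @ es) u = evalt e u" "evalt (e @ es) v = evalt e v" for es
    using u v by (auto simp: e)
  have es: "evalf x m (e @ [y, p0, p1, p2]) (Ex4 (And (FEq u (elT (V 9) (V 10) (V 11) (V 12))) (in_setF M))) \<longleftrightarrow>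
      evalt e u \<in> elems (el S y p0 p1 p2)" if y: "y < S" "p0 < S" "p1 < S" "p2 < S" for y p0 p1 p2
  proof -
    have "evalf x m (e @ [y, p0, p1, p2]) (Ex4 (And (FEq u (elT (V 9) (V 10) (V 11) (V 12))) (in_setF M))) \<longleftrightarrow>
      (\<exists>c<S. \<exists>t<S. \<exists>i<S. \<exists>a<S. evalt e u = el S c t i a \<and> in_set y (pf p0 p1 p2) c t i a)"
      by (simp add: uv evalf_in_setF[OF l] del: rho_append) (simp add: e)
    also have "\<dots> \<longleftrightarrow> evalt e u \<in> elems (el S y p0 p1 p2)"
    proof
      assume "\<exists>c<S. \<exists>t<S. \<exists>i<S. \<exists>a<S. evalt e u = el S c t i a \<and> in_set y (pf p0 p1 p2) c t i a"
      then show "evalt e u \<in> elems (el S y p0 p1 p2)"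
        by (elim exE conjE) (simp add: elems_el[OF y])
    next
      assume u: "evalt e u \<in> elems (el S y p0 p1 p2)"
      moreover have "el S y p0 p1 p2 < S * S * S * S" by (rule el_lt[OF y])
      \<comment> \<open>The sets contain elements only, so \<open>u\<close> is a number with four
        digits to the base \<open>S\<close>.\<close>
      ultimately have "evalt e u < S * S * S * S" using A by auto
      then obtain c t i a where c: "c < S" "t < S" "i < S" "a < S" "evalt e u = el S c t i a" using el_cases by blast
      moreover have "in_set y (pf p0 p1 p2) c t i a" using elems_el[OF y c(1-4)] u c(5) by simp
      ultimately show "\<exists>c<S. \<exists>t<S. \<exists>i<S. \<exists>a<S. evalt e u = el S c t i a \<and> in_set y (pf p0 p1 p2) c t i a"
        by blast
    qed
    finally show ?thesis .
  qed
  have 2: "evalf x m e (Ex4 (And (FEq v (Plus UT (Times (elT (V 5) (V 6) (V 7) (V 8)) (Cst r))))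
        (Ex4 (And (FEq u (elT (V 9) (V 10) (V 11) (V 12))) (in_setF M))))) \<longleftrightarrow>
      (\<exists>c<S * S * S * S. evalt e u \<in> elems c \<and> evalt e v = S * S * S * S + c * r)"
  proof -
    let ?g = "Ex4 (And (FEq u (elT (V 9) (V 10) (V 11) (V 12))) (in_setF M))"
    have "evalf x m e (Ex4 (And (FEq v (Plus UT (Times (elT (V 5) (V 6) (V 7) (V 8)) (Cst r)))) g)) \<longleftrightarrow>
      (\<exists>y<S. \<exists>p0<S. \<exists>p1<S. \<exists>p2<S. evalt e v = S * S * S * S + el S y p0 p1 p2 * r \<and> evalf x m (e @ [y, p0, p1, p2]) g)" for g
      by (simp add: uv del: rho_append) (simp add: e)
    from this[of ?g] have "evalf x m e (Ex4 (And (FEq v (Plus UT (Times (elT (V 5) (V 6) (V 7) (V 8)) (Cst r)))) ?g)) \<longleftrightarrow>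
      (\<exists>y<S. \<exists>p0<S. \<exists>p1<S. \<exists>p2<S. evalt e v = S * S * S * S + el S y p0 p1 p2 * r \<and> evalt e u \<in> elems (el S y p0 p1 p2))"
      by (simp only: es cong: conj_cong)
    also have "\<dots> \<longleftrightarrow> (\<exists>c<S * S * S * S. evalt e u \<in> elems c \<and> evalt e v = S * S * S * S + c * r)"
    proof
      assume "\<exists>c<S * S * S * S. evalt e u \<in> elems c \<and> evalt e v = S * S * S * S + c * r"
      then obtain c where c: "c < S * S * S * S" "evalt e u \<in> elems c" "evalt e v = S * S * S * S + c * r" by blast
      obtain y p0 p1 p2 where "y < S" "p0 < S" "p1 < S" "p2 < S" "c = el S y p0 p1 p2" using el_cases[OF c(1)] by blast
      then show "\<exists>y<S. \<exists>p0<S. \<exists>p1<S. \<exists>p2<S. evalt e v = S * S * S * S + el S y p0 p1 p2 * r \<and> evalt e u \<in> elems (el S y p0 p1 p2)"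
        using c by (metis (no_types, lifting))
    next
      assume "\<exists>y<S. \<exists>p0<S. \<exists>p1<S. \<exists>p2<S. evalt e v = S * S * S * S + el S y p0 p1 p2 * r \<and> evalt e u \<in> elems (el S y p0 p1 p2)"
      then show "\<exists>c<S * S * S * S. evalt e u \<in> elems c \<and> evalt e v = S * S * S * S + c * r"
        using el_lt by (metis (no_types, lifting))
    qed
    finally show ?thesis .
  qed
  have 3: "evalf x m e (Ex UT (Ex (Cst r) (FConj [Less (Plus (V 6) (Cst 1)) (Cst r), FEq u (Plus (Plus UT (Times (V 5) (Cst r))) (V 6)),
        FEq v (Plus (Plus UT (Times (V 5) (Cst r))) (Plus (V 6) (Cst 1)))]))) \<longleftrightarrow>
      (\<exists>c<S * S * S * S. \<exists>k. Suc k < r \<and> evalt e u = S * S * S * S + c * r + k \<and> evalt e v = S * S * S * S + c * r + Suc k)"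
  proof -
    have "evalf x m e (Ex UT (Ex (Cst r) (FConj [Less (Plus (V 6) (Cst 1)) (Cst r), FEq u (Plus (Plus UT (Times (V 5) (Cst r))) (V 6)),
        FEq v (Plus (Plus UT (Times (V 5) (Cst r))) (Plus (V 6) (Cst 1)))]))) \<longleftrightarrow>
      (\<exists>c<S * S * S * S. \<exists>k<r. Suc k < r \<and> evalt e u = S * S * S * S + c * r + k \<and> evalt e v = S * S * S * S + c * r + Suc k)"
      by (simp add: uv del: rho_append) (simp add: e)
    then show ?thesis using Suc_lessD by blast
  qed
  have 1: "evalf x m e (And (Less u v) (Less v UT)) \<longleftrightarrow> evalt e u < evalt e v \<and> evalt e v < S * S * S * S"
    by (simp add: e)
  show ?thesis unfolding dadjF_def hs_adj_def evalf_FDisj list.set(2) list.set(1) bex_simps(5,7) 1 2 3 by blast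
qed

text \<open>The common core of \<open>startF\<close> and \<open>goalF\<close>. Quantifiers bounded
  by \<open>S\<close> find every token, since all four digits of a token are below
  \<open>S\<close>.\<close>

lemma evalf_quads:
  assumes "e = [N, S, n, v]"
    and f: "is_asg f"
    and F: "\<And>c t i a. var c t i \<Longrightarrow> a < S \<Longrightarrow> evalf x m [N, S, n, v, c, t, i, a] F \<longleftrightarrow> a = f c t i"
  shows "evalf x m e (Ex4 (And (FEq (V 3) (elT (V 4) (V 5) (V 6) (V 7))) (And (varF M (V 4) (V 5) (V 6)) F))) \<longleftrightarrow> v \<in> tok f"
proof -
  have "evalf x m e (Ex4 (And (FEq (V 3) (elT (V 4) (V 5) (V 6) (V 7))) (And (varF M (V 4) (V 5) (V 6)) F))) \<longleftrightarrow>
    (\<exists>c<S. \<exists>t<S. \<exists>i<S. \<exists>a<S. v = el S c t i a \<and> var c t i \<and> evalf x m [N, S, n, v, c, t, i, a] F)"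
    by (simp add: assms(1) evalf_varF)
  also have "\<dots> \<longleftrightarrow> v \<in> tok f"
  proof
    assume "\<exists>c<S. \<exists>t<S. \<exists>i<S. \<exists>a<S. v = el S c t i a \<and> var c t i \<and> evalf x m [N, S, n, v, c, t, i, a] F"
    then show "v \<in> tok f" using F unfolding tok_def by blast
  next
    assume "v \<in> tok f"
    then obtain c t i where c: "var c t i" "v = el S c t i (f c t i)" unfolding tok_def by blast
    then have "evalf x m [N, S, n, v, c, t, i, f c t i] F" using F[OF c(1) asg_lt[OF f]] by simp
    moreover have "c < S" "t < S" "i < S" "f c t i < S" using var_lt[OF c(1)] asg_lt[OF f] by auto
    ultimately show "\<exists>c<S. \<exists>t<S. \<exists>i<S. \<exists>a<S. v = el S c t i a \<and> var c t i \<and> evalf x m [N, S, n, v, c, t, i, a] F"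
      using c by blast
  qed
  finally show ?thesis .
qed

lemma evalf_startF:
  assumes e: "e = [length x, S, n, v]" and X: "is_cfg (enc (init_config M x))"
  shows "evalf x m e (startF M) \<longleftrightarrow> v \<in> tok (start_asg (enc (init_config M x)))"
proof -
  let ?X = "enc (init_config M x)" and ?c = "init_config M x"
  have Ts: "snd ?c ! k = tape_of (if k = 0 then x else [])" if "k < K" for k
    using that by (cases k) (simp_all add: init_config_def)
  have X0: "?X 0 0 = 0" by (simp add: enc_simps(1) init_config_def)
  have X1: "?X t 0 = 1" if "0 < t" "t \<le> K" for t
    using that enc_simps(2)[of "t - 1" ?c] Ts[of "t - 1"] by (simp add: scanned_def tape_of_def start_sym_def)
  have X2: "?X t 0 = 0" if "K < t" "t \<le> 2 * K" for t
    using that enc_simps(3)[of "t - 1 - K" ?c] Ts[of "t - 1 - K"] by (simp add: tape_of_def)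
  have X3: "?X t i = cont (if t = 2 * K + 1 then x else []) i" if "2 * K < t" "t \<le> 3 * K" "i < S" for t i
    using that enc_simps(4)[of "t - 1 - 2 * K" i ?c] Ts[of "t - 1 - 2 * K"] by (simp add: cont_def split: if_splits)
  have c0: "cont y 0 = 1" for y by simp
  have bit: "a = cont x i \<longleftrightarrow> (length x < i \<and> a = 0 \<or>
      (\<exists>w<length x. i = w + 1 \<and> (bitat x w \<and> a = 3 \<or> \<not> bitat x w \<and> a = 2)))" if "0 < i" for a i
  proof -
    obtain w where w: "i = Suc w" using \<open>0 < i\<close> by (cases i) auto
    show ?thesis unfolding w by (auto simp: cont_Suc bitat_def bit_sym_def)
  qed
  have start: "start_asg ?X 3 0 0 = 0" "c < 3 \<Longrightarrow> start_asg ?X c t i = ?X t i" for c t i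
    by (auto simp: start_asg_def mkasg_def)
  have a: "is_asg (start_asg ?X)" using good_start[OF X] by (simp add: good_def)
  show ?thesis unfolding startF_def Let_def FConj_def list.map foldr_Cons o_apply foldr_Nil id_apply
  proof (rule evalf_quads[OF e a])
    fix c t i a assume v: "var c t i" and aS: "a < S"
    show "evalf x m [length x, S, n, v, c, t, i, a]
      (And (FImp (FEq (V 4) (Cst 3)) (FEq (V 7) (Cst 0)))
       (And (FImp (Less (V 4) (Cst 3))
         (And (FImp (FEq (V 5) (Cst 0)) (FEq (V 7) (Cst 0)))
         (And (FImp (And (Less (Cst 0) (V 5)) (Less (V 5) (Cst (K + 1)))) (FEq (V 7) (Cst 1)))
         (And (FImp (And (Less (Cst K) (V 5)) (Less (V 5) (Cst (2 * K + 1)))) (FEq (V 7) (Cst 0)))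
         (And (FImp (And (Less (Cst (2 * K)) (V 5)) (FEq (V 6) (Cst 0))) (FEq (V 7) (Cst 1)))
         (And (FImp (And (FEq (V 5) (Cst (2 * K + 1))) (Less (Cst 0) (V 6)))
            (FOr (And (Less (V 0) (V 6)) (FEq (V 7) (Cst 0)))
              (Ex (V 0) (And (FEq (V 6) (Plus (V 8) (Cst 1)))
                 (FOr (And (InBit (V 8)) (FEq (V 7) (Cst 3))) (And (Neg (InBit (V 8))) (FEq (V 7) (Cst 2))))))))
         (And (FImp (And (Less (Cst (2 * K + 1)) (V 5)) (Less (Cst 0) (V 6))) (FEq (V 7) (Cst 0))) FTrue)))))))
        FTrue)) \<longleftrightarrow> a = start_asg ?X c t i" (is "?L \<longleftrightarrow> _")
    proof (cases "c = 3")
      case True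
      then show ?thesis using v start(1) by (auto simp: var_def)
    next
      case False
      then have c: "c < 3" and iv: "isvar M S t i" using v by (auto simp: var_def)
      have L: "?L \<longleftrightarrow> (t = 0 \<longrightarrow> a = 0) \<and> (0 < t \<and> t < K + 1 \<longrightarrow> a = 1) \<and> (K < t \<and> t < 2 * K + 1 \<longrightarrow> a = 0) \<and>
          (2 * K < t \<and> i = 0 \<longrightarrow> a = 1) \<and> (t = 2 * K + 1 \<and> 0 < i \<longrightarrow> (length x < i \<and> a = 0 \<or>
      (\<exists>w<length x. i = w + 1 \<and> (bitat x w \<and> a = 3 \<or> \<not> bitat x w \<and> a = 2)))) \<and> (2 * K + 1 < t \<and> 0 < i \<longrightarrow> a = 0)"
        using c by simp
      show ?thesis unfolding L start(2)[OF c]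
      proof (cases "2 * K < t")
        case True
        then have t: "t \<le> 3 * K" "i < S" using iv by (auto simp: isvar_def)
        show "(t = 0 \<longrightarrow> a = 0) \<and> (0 < t \<and> t < K + 1 \<longrightarrow> a = 1) \<and> (K < t \<and> t < 2 * K + 1 \<longrightarrow> a = 0) \<and>
          (2 * K < t \<and> i = 0 \<longrightarrow> a = 1) \<and> (t = 2 * K + 1 \<and> 0 < i \<longrightarrow> (length x < i \<and> a = 0 \<or>
      (\<exists>w<length x. i = w + 1 \<and> (bitat x w \<and> a = 3 \<or> \<not> bitat x w \<and> a = 2)))) \<and> (2 * K + 1 < t \<and> 0 < i \<longrightarrow> a = 0)
          \<longleftrightarrow> a = ?X t i"
        proof (cases "i = 0")
          case True
          then show ?thesis using \<open>2 * K < t\<close> X3[OF \<open>2 * K < t\<close> t] c0 by simp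
        next
          case False
          have "cont [] i = 0" using False by simp
          show ?thesis
          proof (cases "t = 2 * K + 1")
            case True
            then show ?thesis using X3[OF \<open>2 * K < t\<close> t] False bit[of i a] by simp
          next
            case ne: False
            then show ?thesis using \<open>2 * K < t\<close> X3[OF \<open>2 * K < t\<close> t] False \<open>cont [] i = 0\<close> by simp
          qed
        qed
      next
        case False
        then have i: "i = 0" "t \<le> 2 * K" using iv by (auto simp: isvar_def)
        consider "t = 0" | "0 < t" "t \<le> K" | "K < t" by linarith
        then show "(t = 0 \<longrightarrow> a = 0) \<and> (0 < t \<and> t < K + 1 \<longrightarrow> a = 1) \<and> (K < t \<and> t < 2 * K + 1 \<longrightarrow> a = 0) \<and>
          (2 * K < t \<and> i = 0 \<longrightarrow> a = 1) \<and> (t = 2 * K + 1 \<and> 0 < i \<longrightarrow> (length x < i \<and> a = 0 \<or>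
      (\<exists>w<length x. i = w + 1 \<and> (bitat x w \<and> a = 3 \<or> \<not> bitat x w \<and> a = 2)))) \<and> (2 * K + 1 < t \<and> 0 < i \<longrightarrow> a = 0)
          \<longleftrightarrow> a = ?X t i"
        proof cases
          case 1
          then show ?thesis using X0 i by simp
        next
          case 2
          then show ?thesis using X1 i by simp
        next
          case 3
          then show ?thesis using X2 i by simp
        qed
      qed
    qed
  qed
qed

lemma evalf_goalF:
  assumes e: "e = [N, S, n, v]"
  shows "evalf x m e (goalF M) \<longleftrightarrow> v \<in> tok goal_asg"
proof -
  have a: "is_asg goal_asg" using good_goal by (simp add: good_def)
  show ?thesis unfolding goalF_def FConj_def foldr_Cons o_apply foldr_Nil id_apply
    by (rule evalf_quads[OF e a]) (auto simp: var_def isvar_def goal_asg_def mkasg_def goal_cfg_def)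
qed

lemma outs_reduction:
  assumes St: "\<And>e. rho e 0 = length x \<Longrightarrow> evalt e St = S" and X: "is_cfg (enc (init_config M x))"
  shows "outs x m [length x] (reduction M r St) =
    encode_instance (S * S * S * S + S * S * S * S * r) G (tok (start_asg (enc (init_config M x)))) (tok goal_asg)"
proof -
  let ?n = "S * S * S * S + S * S * S * S * r" and ?N = "length x"
  let ?g = "App (Loop (V 2) (Emit FTrue)) (App (Emit (Neg FTrue))
       (App (Loop (V 2) (Loop (V 2) (Emit (FOr (dadjF M r (V 3) (V 4)) (dadjF M r (V 4) (V 3))))))
         (App (Loop (V 2) (Emit (startF M))) (Loop (V 2) (Emit (goalF M))))))"
  have "outs x m [?N] (reduction M r St) = outs x m [?N, S] (bind_gen 2 (Plus UT (Times UT (Cst r))) ?g)"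
    unfolding reduction_def by (subst outs_bind_gen) (simp_all add: St)
  also have "\<dots> = outs x m [?N, S, ?n] ?g"
    by (subst outs_bind_gen) simp_all
  also have "\<dots> = encode_instance ?n G (tok (start_asg (enc (init_config M x)))) (tok goal_asg)"
    unfolding encode_instance_def
    by (simp add: concat_map_single evalf_dadjF[OF refl] evalf_startF[OF refl X] evalf_goalF[OF refl] edge_iff map_replicate_const)
  finally show ?thesis .
qed

end

theorem PSPACE_hard_DrDSR:
  assumes r: "1 \<le> r"
  shows "PSPACE_hard (DrDSR r R chordal)"
  unfolding PSPACE_hard_def
proof
  fix L assume "L \<in> PSPACE"
  then obtain M p where M: "wf_tm M" "decides M L" "runs_in_space M (poly p)" unfolding PSPACE_def by blast
  \<comment> \<open>Large enough for the assumptions of \<open>sim\<close>, whatever the polynomial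
    contributes to \<open>S\<close>.\<close>
  define b where "b = tm_states M + tm_symbols M + 3 * tm_tapes M + length (schemas M) + 6"
  obtain t where t: "\<forall>e. evalt e t = poly p (rho e 0)" using ex_poly_trm by blast
  let ?St = "Plus t (Cst b)"
  \<comment> \<open>For a fixed language \<open>M\<close>, \<open>r\<close> and \<open>p\<close> are
    constants, so one generator serves all words.\<close>
  let ?f = "\<lambda>x. outs x [] [length x] (reduction M r ?St)"
  have "x \<in> L \<longleftrightarrow> ?f x \<in> DrDSR r R chordal" for x
  proof -
    define S where "S = poly p (length x) + b"
    interpret sim_graph M S r
      by unfold_locales (use M(1) r in \<open>simp_all add: S_def b_def\<close>)
    have heads: "snd T < S" if "T \<in> set (snd (run M x n))" for T n
      using M(3) that unfolding runs_in_space_def S_def by (meson trans_less_add1)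
    let ?X = "enc (init_config M x)"
    have X: "is_cfg ?X" by (rule enc_run(2)) (rule heads)
    let ?n = "S * S * S * S + S * S * S * S * r"
    let ?Ds = "tok (start_asg ?X)" and ?Dt = "tok goal_asg"
    have f: "?f x = encode_instance ?n G ?Ds ?Dt"
      by (rule outs_reduction[OF _ X]) (simp add: t S_def)
    have "accepting ?X \<longleftrightarrow> x \<in> L"
      unfolding accepting_def by (rule accepts_iff[OF M(2)]) (rule heads)
    then have acc: "(\<exists>T. is_reconf_sequence R r G ?Ds T ?Dt) \<longleftrightarrow> x \<in> L"
      using reconf_iff_accepting[OF X] by simp
    have "hits ?Ds" "hits ?Dt" using good_start[OF X] good_goal hits_tok_iff unfolding good_def by blast+
    then have dom: "dist_dominating r G ?Ds" "dist_dominating r G ?Dt" using dominating_if_hits by blast+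
    have vG: "verts G = {..<?n}" by simp
    show ?thesis
    proof
      assume "x \<in> L"
      then show "?f x \<in> DrDSR r R chordal"
        unfolding DrDSR_def f using acc dom vG chordal_G simple_G by blast
    next
      assume "?f x \<in> DrDSR r R chordal"
      then obtain n' G' Ds' Dt' where *: "encode_instance ?n G ?Ds ?Dt = encode_instance n' G' Ds' Dt'"
        "simple_graph G'" "verts G' = {..<n'}" "dist_dominating r G' Ds'" "dist_dominating r G' Dt'"
        "\<exists>T. is_reconf_sequence R r G' Ds' T Dt'"
        unfolding DrDSR_def f by blast
      \<comment> \<open>A word determines its instance, so the one provided by membership is the one
        constructed.\<close>
      have "?n = n' \<and> G = G' \<and> ?Ds = Ds' \<and> ?Dt = Dt'"
        by (rule encode_instance_inj[OF *(1) simple_G vG _ _ *(2,3)])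
          (use dom *(4,5) in \<open>simp_all only: dist_dominating_def\<close>)
      then show "x \<in> L" using *(6) acc by simp
    qed
  qed
  then show "poly_time_reducible L (DrDSR r R chordal)"
    unfolding poly_time_reducible_def using poly_time_outs[of "reduction M r ?St"] by blast
qed

section \<open>A criterion for chordality\<close>

definition adjacent :: "'a ugraph \<Rightarrow> 'a \<Rightarrow> 'a \<Rightarrow> bool" where
  "adjacent G u v \<longleftrightarrow> {u, v} \<in> edges G"

lemma adjacent_sym: "adjacent G u v \<longleftrightarrow> adjacent G v u"
  by (simp add: adjacent_def insert_commute)

lemma adjacent_verts: "simple_graph G \<Longrightarrow> adjacent G u v \<Longrightarrow> u \<in> verts G \<and> v \<in> verts G \<and> u \<noteq> v"
  unfolding simple_graph_def adjacent_def by (fastforce simp: doubleton_eq_iff)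

text \<open>The vertices reached from \<open>a\<close> by walks that stay outside the closed neighbourhood of \<open>b\<close>
  after their first vertex.\<close>

inductive avoids :: "'a ugraph \<Rightarrow> 'a \<Rightarrow> 'a \<Rightarrow> 'a \<Rightarrow> bool" for G b a where
  first: "adjacent G a v \<Longrightarrow> v \<noteq> b \<Longrightarrow> \<not> adjacent G b v \<Longrightarrow> avoids G b a v"
| more: "avoids G b a u \<Longrightarrow> adjacent G u v \<Longrightarrow> v \<noteq> b \<Longrightarrow> \<not> adjacent G b v \<Longrightarrow> avoids G b a v"

definition hole_at :: "'a ugraph \<Rightarrow> 'a \<Rightarrow> 'a \<Rightarrow> 'a \<Rightarrow> 'a \<Rightarrow> bool" where
  "hole_at G b a c u \<longleftrightarrow> adjacent G b a \<and> adjacent G b c \<and> a \<noteq> c \<and> \<not> adjacent G a c \<and> avoids G b a u \<and> adjacent G u c"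

definition bypass :: "'a ugraph \<Rightarrow> 'a \<Rightarrow> 'a \<Rightarrow> 'a \<Rightarrow> 'a list \<Rightarrow> bool" where
  "bypass G b a c w \<longleftrightarrow> 2 \<le> length w \<and> hd w = a \<and> last w = c \<and>
     (\<forall>i. Suc i < length w \<longrightarrow> adjacent G (w ! i) (w ! Suc i)) \<and>
     (\<forall>i. 0 < i \<and> Suc i < length w \<longrightarrow> w ! i \<noteq> b \<and> \<not> adjacent G b (w ! i))"

lemma avoids_walk:
  assumes "avoids G b a u"
  shows "\<exists>w. w \<noteq> [] \<and> last w = u \<and> (\<forall>i. Suc i < length (a # w) \<longrightarrow> adjacent G ((a # w) ! i) ((a # w) ! Suc i)) \<and>
    (\<forall>v \<in> set w. v \<noteq> b \<and> \<not> adjacent G b v)"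
  using assms
proof (induction rule: avoids.induct)
  case (first v)
  then show ?case by (intro exI[of _ "[v]"]) simp
next
  case (more u v)
  then obtain w where w: "w \<noteq> []" "last w = u" "\<forall>i. Suc i < length (a # w) \<longrightarrow> adjacent G ((a # w) ! i) ((a # w) ! Suc i)"
    "\<forall>v \<in> set w. v \<noteq> b \<and> \<not> adjacent G b v" by blast
  have "adjacent G ((a # w @ [v]) ! i) ((a # w @ [v]) ! Suc i)" if "Suc i < length (a # w @ [v])" for i
  proof (cases "i = length w")
    case True
    then have "(a # w @ [v]) ! i = u" using w(1,2) by (cases i) (auto simp: nth_append last_conv_nth)
    then show ?thesis using True more(2) by simp
  next
    case False
    then have "i < length w" using that by simp
    then show ?thesis using w(3)[rule_format, of i] by (cases i) (auto simp: nth_append)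
  qed
  then show ?case using w more by (intro exI[of _ "w @ [v]"]) auto
qed

lemma bypass_if_hole:
  assumes "hole_at G b a c u"
  shows "\<exists>w. bypass G b a c w"
proof -
  obtain w where w: "w \<noteq> []" "last w = u" "\<And>i. Suc i < length (a # w) \<Longrightarrow> adjacent G ((a # w) ! i) ((a # w) ! Suc i)"
    "\<And>v. v \<in> set w \<Longrightarrow> v \<noteq> b \<and> \<not> adjacent G b v"
    using avoids_walk[of G b a u] assms unfolding hole_at_def by blast
  have 1: "adjacent G ((a # w @ [c]) ! i) ((a # w @ [c]) ! Suc i)" if "Suc i < length (a # w @ [c])" for i
  proof (cases "i = length w")
    case True
    then have "(a # w @ [c]) ! i = u" using w(1,2) by (cases i) (auto simp: nth_append last_conv_nth)
    then show ?thesis using True assms by (simp add: hole_at_def)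
  next
    case False
    then have "i < length w" using that by simp
    then show ?thesis using w(3)[of i] by (cases i) (auto simp: nth_append)
  qed
  have 2: "(a # w @ [c]) ! i \<in> set w" if "0 < i" "Suc i < length (a # w @ [c])" for i
    using that by (cases i) (auto simp: nth_append)
  have "bypass G b a c (a # w @ [c])"
    unfolding bypass_def using 1 w(4)[OF 2] by simp
  then show ?thesis by blast
qed

text \<open>Shortening along a chord of the walk; its inner vertices are inner vertices of the old
  walk and still avoid the closed neighbourhood of \<open>b\<close>.\<close>

lemma bypass_shortcut:
  assumes w: "bypass G b a c w" and ij: "i < j" "j < length w"
    and adj: "adjacent G (w ! i) (w ! j) \<and> Suc i < j"
  shows "bypass G b a c (take (Suc i) w @ drop j w)"
proof -
  let ?v = "take (Suc i) w @ drop j w"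
  have len: "length ?v = Suc i + (length w - j)" using ij by simp
  have nth: "?v ! k = (if k \<le> i then w ! k else w ! (k - Suc i + j))" if "k < length ?v" for k
    using that ij by (auto simp: nth_append add.commute)
  have w': "2 \<le> length w" "hd w = a" "last w = c" "\<And>i. Suc i < length w \<Longrightarrow> adjacent G (w ! i) (w ! Suc i)"
    "\<And>i. 0 < i \<Longrightarrow> Suc i < length w \<Longrightarrow> w ! i \<noteq> b \<and> \<not> adjacent G b (w ! i)"
    using w unfolding bypass_def by auto
  have "2 \<le> length ?v" using len ij by simp
  moreover have "hd ?v = a" using w'(1,2) by (cases w) auto
  moreover have "last ?v = c" using w'(3) ij by (simp add: last_append)
  moreover have "adjacent G (?v ! k) (?v ! Suc k)" if k: "Suc k < length ?v" for k
  proof -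
    consider "Suc k \<le> i" | "k = i" | "i < k" by linarith
    then show ?thesis
    proof cases
      case 1
      then show ?thesis using nth[of k] nth[of "Suc k"] k w'(4)[of k] ij by simp
    next
      case 2
      then show ?thesis using nth[of k] nth[of "Suc k"] k adj by simp
    next
      case 3
      then have "Suc (k - Suc i + j) < length w" using k len ij by linarith
      moreover have "Suc k - Suc i + j = Suc (k - Suc i + j)" using 3 by linarith
      ultimately show ?thesis using nth[of k] nth[of "Suc k"] k w'(4)[of "k - Suc i + j"] 3 by simp
    qed
  qed
  moreover have "?v ! k \<noteq> b \<and> \<not> adjacent G b (?v ! k)" if k: "0 < k" "Suc k < length ?v" for k
  proof (cases "k \<le> i")
    case True
    then show ?thesis using nth[of k] k w'(5)[of k] ij by simp
  next
    case False
    then have "Suc (k - Suc i + j) < length w" using k len ij by linarith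
    then show ?thesis using nth[of k] k w'(5)[of "k - Suc i + j"] False ij by simp
  qed
  ultimately show ?thesis unfolding bypass_def by blast
qed

text \<open>Shortening at a repeated vertex. The walk cannot collapse to a single vertex, because
  its ends are different.\<close>

lemma bypass_repeat:
  assumes w: "bypass G b a c w" and ij: "i < j" "j < length w" and eq: "w ! i = w ! j" and ac: "a \<noteq> c"
  shows "bypass G b a c (take i w @ drop j w)"
proof -
  let ?v = "take i w @ drop j w"
  have len: "length ?v = i + (length w - j)" using ij by simp
  have nth: "?v ! k = (if k \<le> i then w ! k else w ! (k - i + j))" if "k < length ?v" for k
    using that ij eq by (auto simp: nth_append add.commute)
  have w': "2 \<le> length w" "hd w = a" "last w = c" "\<And>i. Suc i < length w \<Longrightarrow> adjacent G (w ! i) (w ! Suc i)"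
    "\<And>i. 0 < i \<Longrightarrow> Suc i < length w \<Longrightarrow> w ! i \<noteq> b \<and> \<not> adjacent G b (w ! i)"
    using w unfolding bypass_def by auto
  have ne: "?v \<noteq> []" using ij by simp
  have hd: "hd ?v = a" using nth[of 0] ne w'(1,2) hd_conv_nth[OF ne] by (cases w) auto
  have last: "last ?v = c" using w'(3) ij by (simp add: last_append)
  have "length ?v \<noteq> 1"
  proof
    assume "length ?v = 1"
    then obtain z where "?v = [z]" by (metis One_nat_def length_0_conv length_Suc_conv)
    then show False using hd last ac by simp
  qed
  then have "2 \<le> length ?v" using len ij by linarith
  moreover have "adjacent G (?v ! k) (?v ! Suc k)" if k: "Suc k < length ?v" for k
  proof -
    consider "Suc k \<le> i" | "i \<le> k" by linarith
    then show ?thesis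
    proof cases
      case 1
      then show ?thesis using nth[of k] nth[of "Suc k"] k w'(4)[of k] ij by simp
    next
      case 2
      then have s: "Suc (k - i + j) < length w" "Suc k - i + j = Suc (k - i + j)" using k len ij by linarith+
      have "?v ! k = w ! (k - i + j)" using nth[of k] k 2 eq by (cases "k = i") auto
      then show ?thesis using nth[of "Suc k"] k w'(4)[OF s(1)] s(2) 2 by simp
    qed
  qed
  moreover have "?v ! k \<noteq> b \<and> \<not> adjacent G b (?v ! k)" if k: "0 < k" "Suc k < length ?v" for k
  proof (cases "k \<le> i")
    case True
    then show ?thesis using nth[of k] k w'(5)[of k] ij by simp
  next
    case False
    then have "Suc (k - i + j) < length w" using k len ij by linarith
    then show ?thesis using nth[of k] k w'(5)[of "k - i + j"] False ij by simp
  qed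
  ultimately show ?thesis unfolding bypass_def using hd last by blast
qed

text \<open>A shortest walk of this kind is an induced path from \<open>a\<close> to
  \<open>c\<close>, with an inner vertex since \<open>a\<close> and \<open>c\<close> are not
  adjacent. Together with \<open>b\<close> it forms a chordless cycle of length at least 4.\<close>

lemma not_chordal_if_hole:
  assumes G: "simple_graph G" and hole: "hole_at G b a c u"
  shows "\<not> chordal G"
proof -
  have bac: "adjacent G b a" "adjacent G b c" "a \<noteq> c" "\<not> adjacent G a c" using hole by (auto simp: hole_at_def)
  obtain w where w: "bypass G b a c w" and min: "\<And>v. bypass G b a c v \<Longrightarrow> length w \<le> length v"
    using bypass_if_hole[OF hole] arg_min_nat_lemma[of "bypass G b a c" _ length] by blast
  let ?m = "length w"
  have w': "2 \<le> ?m" "hd w = a" "last w = c" "\<And>i. Suc i < ?m \<Longrightarrow> adjacent G (w ! i) (w ! Suc i)"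
    "\<And>i. 0 < i \<Longrightarrow> Suc i < ?m \<Longrightarrow> w ! i \<noteq> b \<and> \<not> adjacent G b (w ! i)"
    using w unfolding bypass_def by auto
  have ne: "w \<noteq> []" using w'(1) by auto
  have ends: "w ! 0 = a" "w ! (?m - 1) = c" using w'(2,3) hd_conv_nth[OF ne] last_conv_nth[OF ne] by simp_all
  have m3: "3 \<le> ?m"
  proof (rule ccontr)
    assume "\<not> 3 \<le> ?m"
    then have "?m = 2" using w'(1) by linarith
    then show False using w'(4)[of 0] ends bac(4) by simp
  qed
  have noadj: "\<not> adjacent G (w ! i) (w ! j)" if "Suc i < j" "j < ?m" for i j
  proof
    assume "adjacent G (w ! i) (w ! j)"
    then have "bypass G b a c (take (Suc i) w @ drop j w)" using bypass_shortcut[OF w, of i j] that by simp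
    then show False using min[of "take (Suc i) w @ drop j w"] that by simp
  qed
  have dist: "w ! i \<noteq> w ! j" if "i < j" "j < ?m" for i j
  proof
    assume "w ! i = w ! j"
    then have "bypass G b a c (take i w @ drop j w)" using bypass_repeat[OF w that _ bac(3)] by simp
    then show False using min[of "take i w @ drop j w"] that by simp
  qed
  have bw: "w ! i \<noteq> b" if i: "i < ?m" for i
  proof -
    consider "i = 0" | "i = ?m - 1" | "0 < i" "Suc i < ?m" using i by linarith
    then show ?thesis using ends w'(5) adjacent_verts[OF G bac(1)] adjacent_verts[OF G bac(2)] by cases auto
  qed
  have bad: "i = 0 \<or> i = ?m - 1" if "adjacent G b (w ! i)" "i < ?m" for i
    using that w'(5)[of i] by linarith
  let ?c = "b # w"
  have cl: "length ?c = Suc ?m" by simp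
  have edge: "{?c ! i, ?c ! ((i + 1) mod length ?c)} \<in> edges G" if i: "i < length ?c" for i
  proof -
    consider "i = 0" | "0 < i" "i < ?m" | "i = ?m" using i cl by linarith
    then show ?thesis
    proof cases
      case 1
      then show ?thesis using bac(1) ends m3 ne by (simp add: adjacent_def)
    next
      case 2
      then show ?thesis using w'(4)[of "i - 1"] by (simp add: adjacent_def)
    next
      case 3
      then show ?thesis using bac(2) ends m3 ne by (simp add: adjacent_def insert_commute nth_Cons')
    qed
  qed
  have cyc: "is_cycle G ?c" unfolding is_cycle_def
  proof (intro conjI)
    have "distinct w" unfolding distinct_conv_nth using dist nat_neq_iff by metis
    then show "distinct ?c" using bw by (auto simp: in_set_conv_nth)
    have "?c ! i \<in> verts G" if "i < length ?c" for i
      using adjacent_verts[OF G, of "?c ! i" "?c ! ((i + 1) mod length ?c)"] edge[OF that] by (simp add: adjacent_def)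
    then show "set ?c \<subseteq> verts G" by (metis in_set_conv_nth subsetI)
    show "cycle_edges ?c \<subseteq> edges G" unfolding cycle_edges_def using edge by blast
  qed (use m3 in simp)
  have ce: "{?c ! i, ?c ! ((i + 1) mod length ?c)} \<in> cycle_edges ?c" if "i < length ?c" for i
    unfolding cycle_edges_def using that by blast
  have "\<not> has_chord G ?c"
  proof
    assume "has_chord G ?c"
    then obtain e where e: "e \<in> edges G" "e \<subseteq> set ?c" "e \<notin> cycle_edges ?c" unfolding has_chord_def by blast
    obtain y z where yz: "e = {y, z}" using e(1) G unfolding simple_graph_def by blast
    have ad: "adjacent G y z" "adjacent G z y" using e(1) yz by (auto simp: adjacent_def insert_commute)
    have bcase: False if bc: "{y', z'} = e" "y' = b" "adjacent G y' z'" for y' z'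
    proof -
      have "z' \<noteq> b" using adjacent_verts[OF G that(3)] that(2) by auto
      then have "z' \<in> set w" using that(1) e(2) by auto
      then obtain i where i: "i < ?m" "z' = w ! i" by (auto simp: in_set_conv_nth)
      then consider "i = 0" | "i = ?m - 1" using bad bc(2,3) by blast
      then show False
      proof cases
        case 1
        then have "e = {?c ! 0, ?c ! ((0 + 1) mod length ?c)}" using that i m3 by simp
        then show False using ce[of 0] e(3) by simp
      next
        case 2
        have "e = {?c ! ?m, ?c ! ((?m + 1) mod length ?c)}" using that(1,2) i 2 m3 by (auto simp: nth_Cons')
        then show False using ce[of ?m] e(3) cl by simp
      qed
    qed
    show False
    proof (cases "y = b \<or> z = b")
      case True
      then show False using bcase[of y z] bcase[of z y] yz ad by (auto simp: insert_commute)
    next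
      case False
      then obtain i j where ij: "i < ?m" "y = w ! i" "j < ?m" "z = w ! j" using e(2) yz by (auto simp: in_set_conv_nth)
      have "i \<noteq> j" using adjacent_verts[OF G ad(1)] ij by auto
      have cons: False if "Suc k < ?m" "e = {w ! k, w ! Suc k}" for k
        using ce[of "Suc k"] that e(3) by simp
      consider "j = Suc i" | "i = Suc j" | "Suc i < j" | "Suc j < i" using \<open>i \<noteq> j\<close> by linarith
      then show False
      proof cases
        case 1 then show False using cons[of i] ij yz by simp
      next
        case 2 then show False using cons[of j] ij yz by (simp add: insert_commute)
      next
        case 3 then show False using noadj[of i j] ij ad by simp
      next
        case 4 then show False using noadj[of j i] ij ad by simp
      qed
    qed
  qed
  moreover have "4 \<le> length ?c" using m3 by simp
  ultimately show ?thesis using cyc unfolding chordal_def by blast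
qed

text \<open>On a chordless cycle take the first vertex as \<open>b\<close>, its two neighbours as
  \<open>a\<close> and \<open>c\<close>, and the remaining vertices as the walk between
  them.\<close>

lemma hole_if_not_chordal:
  assumes G: "simple_graph G" and "\<not> chordal G"
  shows "\<exists>b a c u. hole_at G b a c u"
proof -
  obtain c where c: "is_cycle G c" "4 \<le> length c" "\<not> has_chord G c" using assms unfolding chordal_def by blast
  let ?L = "length c"
  have dist: "c ! i = c ! j \<longleftrightarrow> i = j" if "i < ?L" "j < ?L" for i j
    using c(1) that by (simp add: is_cycle_def nth_eq_iff_index_eq)
  have edge: "adjacent G (c ! i) (c ! ((i + 1) mod ?L))" if "i < ?L" for i
    using c(1) that unfolding is_cycle_def cycle_edges_def adjacent_def by blast
  \<comment> \<open>The last condition excludes the edge that closes the cycle, between the first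
    and the last position.\<close>
  have noedge: "\<not> adjacent G (c ! i) (c ! j)" if ij: "Suc i < j" "j < ?L" "0 < i \<or> Suc j < ?L" for i j
  proof
    assume "adjacent G (c ! i) (c ! j)"
    moreover have "{c ! i, c ! j} \<subseteq> set c" using ij by simp
    ultimately have "{c ! i, c ! j} \<in> cycle_edges c" using c(3) unfolding has_chord_def adjacent_def by blast
    then obtain k where k: "k < ?L" "{c ! i, c ! j} = {c ! k, c ! ((k + 1) mod ?L)}" unfolding cycle_edges_def by blast
    have "(k + 1) mod ?L < ?L" using k(1) by (intro mod_less_divisor) linarith
    then have "i = k \<and> j = (k + 1) mod ?L \<or> i = (k + 1) mod ?L \<and> j = k"
      using k dist ij by (auto simp: doubleton_eq_iff)
    moreover have "(k + 1) mod ?L = (if k + 1 = ?L then 0 else k + 1)" using k(1) by auto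
    ultimately show False using ij k(1) by (auto split: if_splits)
  qed
  have av: "avoids G (c ! 0) (c ! 1) (c ! i)" if "2 \<le> i" "Suc i < ?L" for i
    using that
  proof (induction i rule: dec_induct)
    case base
    have "adjacent G (c ! 1) (c ! 2)" using edge[of 1] c(2) by (simp add: numeral_2_eq_2)
    moreover have "c ! 2 \<noteq> c ! 0"
    proof -
      have "2 < ?L" "0 < ?L" using c(2) by linarith+
      then show ?thesis using dist[of 2 0] by simp
    qed
    ultimately show ?case using noedge[of 0 2] base by (intro avoids.first) (auto simp: numeral_2_eq_2)
  next
    case (step i)
    have "adjacent G (c ! i) (c ! Suc i)" using edge[of i] step by simp
    moreover have "c ! Suc i \<noteq> c ! 0"
    proof -
      have "Suc i < ?L" "0 < ?L" using step.prems by linarith+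
      then show ?thesis using dist[of "Suc i" 0] by simp
    qed
    moreover have "\<not> adjacent G (c ! 0) (c ! Suc i)" using noedge[of 0 "Suc i"] step by simp
    ultimately show ?case by (intro avoids.more[OF step.IH]) (use step.prems in auto)
  qed
  have "c \<noteq> []" using c(2) by auto
  then have "adjacent G (c ! 0) (c ! 1)" using edge[of 0] c(2) by simp
  moreover have "adjacent G (c ! (?L - 1)) (c ! 0)" using edge[of "?L - 1"] c(2) by (cases ?L) auto
  moreover have "c ! 1 \<noteq> c ! (?L - 1)" using dist[of 1 "?L - 1"] c(2) by simp
  moreover have "\<not> adjacent G (c ! 1) (c ! (?L - 1))" using noedge[of 1 "?L - 1"] c(2) by simp
  moreover have "adjacent G (c ! (?L - 2)) (c ! (?L - 1))" using edge[of "?L - 2"] c(2) by (simp add: Suc_diff_Suc numeral_2_eq_2)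
  ultimately have "hole_at G (c ! 0) (c ! 1) (c ! (?L - 1)) (c ! (?L - 2))"
    using av[of "?L - 2"] c(2) adjacent_sym[of G "c ! 0" "c ! (?L - 1)"] unfolding hole_at_def by auto
  then show ?thesis by blast
qed

lemma chordal_iff_no_hole: "simple_graph G \<Longrightarrow> chordal G \<longleftrightarrow> (\<forall>b a c u. \<not> hole_at G b a c u)"
  using not_chordal_if_hole[of G] hole_if_not_chordal[of G] by metis

section \<open>Distances and encoded instances\<close>

text \<open>Distance at most \<open>k\<close> in a form that unfolds to a formula of fixed size when
  \<open>k\<close> is the constant \<open>r\<close>.\<close>

primrec near :: "'a ugraph \<Rightarrow> nat \<Rightarrow> 'a \<Rightarrow> 'a \<Rightarrow> bool" where
  "near G 0 u v \<longleftrightarrow> u = v"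
| "near G (Suc k) u v \<longleftrightarrow> near G k u v \<or> (\<exists>w \<in> verts G. adjacent G u w \<and> near G k w v)"

lemma near_iff:
  assumes "u \<in> verts G" "v \<in> verts G"
  shows "near G k u v \<longleftrightarrow> graph_dist G u v \<le> enat k"
  unfolding graph_dist_le_iff using assms(1)
proof (induction k arbitrary: u)
  case 0
  have "u = v" if "is_walk G u w v" "length w \<le> Suc 0" for w
    using that by (cases w) (auto simp: is_walk_def)
  moreover have "is_walk G v [v] v" using assms(2) by (simp add: is_walk_def)
  ultimately show ?case by fastforce
next
  case (Suc k)
  show ?case
  proof
    assume "near G (Suc k) u v"
    then consider "near G k u v" | w where "w \<in> verts G" "adjacent G u w" "near G k w v" by auto
    then show "\<exists>w. is_walk G u w v \<and> length w \<le> Suc (Suc k)"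
    proof cases
      case 1
      then show ?thesis using Suc by (meson le_SucI)
    next
      case (2 w)
      then obtain p where p: "is_walk G w p v" "length p \<le> Suc k" using Suc.IH by blast
      have "is_walk G u (u # p) v" using p(1) 2(2) Suc.prems unfolding is_walk_def adjacent_def by (cases p) auto
      then show ?thesis using p(2) by (intro exI[of _ "u # p"]) simp
    qed
  next
    assume "\<exists>w. is_walk G u w v \<and> length w \<le> Suc (Suc k)"
    then obtain p where p: "is_walk G u p v" "length p \<le> Suc (Suc k)" by blast
    then obtain q where q: "p = u # q" by (cases p) (auto simp: is_walk_def)
    show "near G (Suc k) u v"
    proof (cases q)
      case Nil
      then have "is_walk G u [u] v" using p q by simp
      then have "near G k u v" unfolding Suc.IH[OF Suc.prems] by (intro exI[of _ "[u]"]) simp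
      then show ?thesis by simp
    next
      case (Cons w q')
      then have "is_walk G w q v" "adjacent G u w" "w \<in> verts G"
        using p q unfolding is_walk_def adjacent_def by auto
      then show ?thesis using Suc.IH[of w] p(2) q by auto
    qed
  qed
qed

text \<open>The offset \<open>n + 1\<close> skips the unary number and its terminator.\<close>

definition ibit :: "bool list \<Rightarrow> nat \<Rightarrow> nat \<Rightarrow> nat \<Rightarrow> bool" where
  "ibit x n i j \<longleftrightarrow> bitat x (n + 1 + (i * n + j))"

definition inst_graph :: "bool list \<Rightarrow> nat \<Rightarrow> nat ugraph" where
  "inst_graph x n = \<lparr> verts = {..<n}, edges = {{i, j} | i j. i < n \<and> j < n \<and> ibit x n i j} \<rparr>"

definition well_formed :: "bool list \<Rightarrow> nat \<Rightarrow> bool" where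
  "well_formed x n \<longleftrightarrow> (\<forall>i<n. bitat x i) \<and> \<not> bitat x n \<and> length x = n + 1 + n * n + 2 * n \<and>
     (\<forall>i<n. \<forall>j<n. ibit x n i j \<longrightarrow> ibit x n j i) \<and> (\<forall>i<n. \<not> ibit x n i i)"

text \<open>Rows \<open>n\<close> and \<open>n + 1\<close> below the adjacency matrix are the characteristic vectors.\<close>

definition inst_set :: "bool list \<Rightarrow> nat \<Rightarrow> nat \<Rightarrow> nat set" where
  "inst_set x n k = {i. i < n \<and> ibit x n (n + k) i}"

section \<open>Instances read off from words\<close>

lemma length_concat_upt: "length (concat (map (\<lambda>i. map (f i) [0..<n]) [0..<m])) = m * n"
  by (induction m) auto

lemma encode_as_matrix:
  "encode_instance n G Ds Dt = replicate n True @ [False] @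
     concat (map (\<lambda>i. map (\<lambda>j. if i < n then {i, j} \<in> edges G else if i = n then j \<in> Ds else j \<in> Dt) [0..<n]) [0..<n + 2])"
proof -
  have rows: "map (\<lambda>i. map (\<lambda>j. if i < n then {i, j} \<in> edges G else if i = n then j \<in> Ds else j \<in> Dt) [0..<n]) [0..<n]
      = map (\<lambda>i. map (\<lambda>j. {i, j} \<in> edges G) [0..<n]) [0..<n]"
    by (rule map_cong) auto
  have "[0..<n + 2] = [0..<n] @ [n, Suc n]" by simp
  then show ?thesis unfolding encode_instance_def by (simp only: map_append concat_append rows) simp
qed

lemma encode_bits:
  assumes x_def: "x = encode_instance n G Ds Dt"
  shows "length x = n + 1 + n * n + 2 * n" "i < n \<Longrightarrow> bitat x i" "\<not> bitat x n"
    "i < n + 2 \<Longrightarrow> j < n \<Longrightarrow> ibit x n i j = (if i < n then {i, j} \<in> edges G else if i = n then j \<in> Ds else j \<in> Dt)"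
proof -
  let ?f = "\<lambda>i j. if i < n then {i, j} \<in> edges G else if i = n then j \<in> Ds else j \<in> Dt"
  let ?m = "concat (map (\<lambda>i. map (?f i) [0..<n]) [0..<n + 2])"
  have x: "x = replicate n True @ [False] @ ?m" unfolding x_def encode_as_matrix ..
  have lm: "length ?m = (n + 2) * n" by (rule length_concat_upt)
  show "length x = n + 1 + n * n + 2 * n" unfolding x length_append lm by (simp add: algebra_simps)
  show "i < n \<Longrightarrow> bitat x i" unfolding x by (simp add: bitat_def nth_append)
  show "\<not> bitat x n" unfolding x by (simp add: bitat_def nth_append)
  assume ij: "i < n + 2" "j < n"
  have "x ! (n + 1 + (i * n + j)) = ?m ! (i * n + j)" unfolding x by (simp add: nth_append)
  also have "\<dots> = ?f i j" by (rule concat_map_upt_nth[OF ij(2,1)])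
  finally have nth: "x ! (n + 1 + (i * n + j)) = ?f i j" .
  have "i * n + j < (n + 2) * n" using digit_lt[OF ij] .
  then have "n + 1 + (i * n + j) < length x" unfolding x length_append lm by simp
  then show "ibit x n i j = ?f i j" using nth by (simp add: ibit_def bitat_def)
qed

lemma well_formed_encode:
  assumes G: "simple_graph G" "verts G = {..<n}" "Ds \<subseteq> {..<n}" "Dt \<subseteq> {..<n}"
    and x_def: "x = encode_instance n G Ds Dt"
  shows "well_formed x n" "inst_graph x n = G" "inst_set x n 0 = Ds" "inst_set x n 1 = Dt"
proof -
  note b = encode_bits[OF x_def]
  have e: "ibit x n i j \<longleftrightarrow> {i, j} \<in> edges G" if "i < n" "j < n" for i j using b(4)[of i j] that by simp
  show "well_formed x n" unfolding well_formed_def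
    using b(1-3) e G(1) unfolding simple_graph_def by (auto simp: insert_commute)
  have "edges G = {{i, j} | i j. i < n \<and> j < n \<and> ibit x n i j}"
    using e G(1,2) unfolding simple_graph_def by (fastforce simp: Bex_def)
  then show "inst_graph x n = G" using G(2) by (simp add: inst_graph_def)
  show "inst_set x n 0 = Ds" using b(4)[of n] G(3) by (auto simp: inst_set_def)
  show "inst_set x n 1 = Dt" using b(4)[of "n + 1"] G(4) by (auto simp: inst_set_def)
qed

lemma edge_inst_graph:
  assumes "well_formed x n"
  shows "{i, j} \<in> edges (inst_graph x n) \<longleftrightarrow> i < n \<and> j < n \<and> ibit x n i j"
  using assms unfolding well_formed_def inst_graph_def by (auto simp: doubleton_eq_iff)

lemma simple_inst_graph: "well_formed x n \<Longrightarrow> simple_graph (inst_graph x n)"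
  unfolding simple_graph_def well_formed_def inst_graph_def by fastforce

lemma encode_inst:
  assumes wf: "well_formed x n"
  shows "encode_instance n (inst_graph x n) (inst_set x n 0) (inst_set x n 1) = x"
proof (rule nth_equalityI)
  let ?y = "encode_instance n (inst_graph x n) (inst_set x n 0) (inst_set x n 1)"
  note b = encode_bits[of ?y n "inst_graph x n" "inst_set x n 0" "inst_set x n 1", OF refl]
  show len: "length ?y = length x" using b(1) wf by (simp add: well_formed_def)
  fix k assume k: "k < length ?y"
  consider "k < n" | "k = n" | "n < k" by linarith
  then show "?y ! k = x ! k"
  proof cases
    case 1
    then show ?thesis using b(2)[of k] wf by (simp add: well_formed_def bitat_def)
  next
    case 2
    then show ?thesis using b(3) wf k len by (simp add: well_formed_def bitat_def)
  next
    case 3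
    define q where "q = k - (n + 1)"
    have q: "k = n + 1 + q" "q < (n + 2) * n" using 3 k b(1) by (simp_all add: q_def algebra_simps)
    then have n: "0 < n" by (cases n) auto
    let ?i = "q div n" and ?j = "q mod n"
    have ij: "?i < n + 2" "?j < n" "k = n + 1 + (?i * n + ?j)" using q n by (simp_all add: less_mult_imp_div_less)
    have "ibit ?y n ?i ?j = ibit x n ?i ?j"
    proof (cases "?i < n")
      case True
      then show ?thesis using b(4)[OF ij(1,2)] edge_inst_graph[OF wf] ij(2) by simp
    next
      case False
      then have "?i = n \<or> ?i = n + 1" using ij(1) by linarith
      then show ?thesis using b(4)[OF ij(1,2)] ij(2) by (auto simp: inst_set_def)
    qed
    then show ?thesis using ij(3) k len by (simp add: ibit_def bitat_def)
  qed
qed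

text \<open>Replaces the quantification over graphs and sets by data that formulas can read off the
  word.\<close>

lemma DrDSR_iff:
  "x \<in> DrDSR r R \<C> \<longleftrightarrow> (\<exists>n. well_formed x n \<and> \<C> (inst_graph x n) \<and>
     dist_dominating r (inst_graph x n) (inst_set x n 0) \<and> dist_dominating r (inst_graph x n) (inst_set x n 1) \<and>
     (\<exists>T. is_reconf_sequence R r (inst_graph x n) (inst_set x n 0) T (inst_set x n 1)))"
proof
  assume "x \<in> DrDSR r R \<C>"
  then obtain n G Ds Dt where *: "x = encode_instance n G Ds Dt" "simple_graph G" "verts G = {..<n}" "\<C> G"
    "dist_dominating r G Ds" "dist_dominating r G Dt" "\<exists>T. is_reconf_sequence R r G Ds T Dt"
    unfolding DrDSR_def by blast
  have "Ds \<subseteq> {..<n}" "Dt \<subseteq> {..<n}" using *(3,5,6) by (auto simp: dist_dominating_def)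
  note w = well_formed_encode[OF *(2,3) this *(1)]
  show "\<exists>n. well_formed x n \<and> \<C> (inst_graph x n) \<and>
     dist_dominating r (inst_graph x n) (inst_set x n 0) \<and> dist_dominating r (inst_graph x n) (inst_set x n 1) \<and>
     (\<exists>T. is_reconf_sequence R r (inst_graph x n) (inst_set x n 0) T (inst_set x n 1))"
    by (rule exI[of _ n]) (unfold w(2-4), use w(1) *(4-7) in blast)
next
  assume "\<exists>n. well_formed x n \<and> \<C> (inst_graph x n) \<and>
     dist_dominating r (inst_graph x n) (inst_set x n 0) \<and> dist_dominating r (inst_graph x n) (inst_set x n 1) \<and>
     (\<exists>T. is_reconf_sequence R r (inst_graph x n) (inst_set x n 0) T (inst_set x n 1))"
  then obtain n where n: "well_formed x n" "\<C> (inst_graph x n)"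
     "dist_dominating r (inst_graph x n) (inst_set x n 0)" "dist_dominating r (inst_graph x n) (inst_set x n 1)"
     "\<exists>T. is_reconf_sequence R r (inst_graph x n) (inst_set x n 0) T (inst_set x n 1)" by blast
  have "verts (inst_graph x n) = {..<n}" by (simp add: inst_graph_def)
  then show "x \<in> DrDSR r R \<C>" unfolding DrDSR_def
    using n encode_inst[OF n(1), symmetric] simple_inst_graph[OF n(1)] by blast
qed

section \<open>Savitch's algorithm as an iteration\<close>

text \<open>\<open>SCall l\<close> asks whether the target is reachable from the source of level \<open>l\<close> in \<open>2 ^ l\<close>
  steps; \<open>SYes l\<close> and \<open>SNo l\<close> are the answers. Frame \<open>j > l\<close> stores the current midpoint \<open>W j\<close>
  and whether the second half is being examined (\<open>c j\<close>), so the two end points of level \<open>l\<close>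
  are determined by the frames above.\<close>

datatype signal = SCall | SYes | SNo

type_synonym sav = "(nat \<Rightarrow> nat \<Rightarrow> bool) \<times> (nat \<Rightarrow> bool) \<times> (signal \<times> nat) option"

text \<open>The carry rule of binary addition: a bit flips exactly if all lower bits are
  set.\<close>

lemma bit_Suc_nat: "bit (Suc m) i \<longleftrightarrow> (bit m i \<noteq> (\<forall>j<i. bit m j))"
proof (induction i arbitrary: m)
  case 0
  then show ?case by (simp add: bit_0)
next
  case (Suc i)
  have all: "(\<forall>j<Suc i. bit m j) \<longleftrightarrow> odd m \<and> (\<forall>j<i. bit (m div 2) j)"
    unfolding All_less_Suc2 by (simp add: bit_0 bit_Suc)
  show ?case
  proof (cases "odd m")
    case True
    then have "Suc m div 2 = Suc (m div 2)" by simp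
    then show ?thesis using Suc[of "m div 2"] True all by (simp add: bit_Suc)
  next
    case False
    then have "Suc m div 2 = m div 2" by simp
    then show ?thesis using False all by (simp add: bit_Suc)
  qed
qed

locale savitch =
  fixes n L :: nat and leaf :: "(nat \<Rightarrow> bool) \<Rightarrow> (nat \<Rightarrow> bool) \<Rightarrow> bool" and src tgt :: "nat \<Rightarrow> bool"
begin

definition bits :: "nat \<Rightarrow> nat \<Rightarrow> bool" where
  "bits m = (\<lambda>i. i < n \<and> bit m i)"

text \<open>Midpoints are enumerated as binary counters with \<open>n\<close> digits. Increment and
  the test for the last counter are given bit by bit, since formulas have to compute them from the
  memory.\<close>

definition binc :: "(nat \<Rightarrow> bool) \<Rightarrow> nat \<Rightarrow> bool" where
  "binc Z = (\<lambda>i. i < n \<and> Z i \<noteq> (\<forall>j<i. Z j))"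

definition ones :: "(nat \<Rightarrow> bool) \<Rightarrow> bool" where
  "ones Z \<longleftrightarrow> (\<forall>i<n. Z i)"

lemma binc_bits: "binc (bits m) = bits (Suc m)"
proof
  fix i
  have "(\<forall>j<i. bits m j) \<longleftrightarrow> (\<forall>j<i. bit m j)" if "i < n" using that by (auto simp: bits_def)
  then show "binc (bits m) i = bits (Suc m) i" by (auto simp: binc_def bit_Suc_nat bits_def)
qed

lemma ones_bits:
  assumes "m < 2 ^ n"
  shows "ones (bits m) \<longleftrightarrow> Suc m = 2 ^ n"
proof -
  have t: "take_bit n m = m" using assms by (simp add: take_bit_nat_eq_self)
  have "ones (bits m) \<longleftrightarrow> m = (mask n :: nat)"
  proof
    assume o: "ones (bits m)"
    show "m = (mask n :: nat)"
    proof (rule bit_eqI)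
      fix i
      have "bit m i \<longleftrightarrow> i < n \<and> bit m i" using t by (metis bit_take_bit_iff)
      then show "bit m i = bit (mask n :: nat) i" using o by (auto simp: ones_def bits_def bit_mask_iff)
    qed
  next
    assume "m = (mask n :: nat)"
    then show "ones (bits m)" by (simp add: ones_def bits_def bit_mask_iff)
  qed
  also have "\<dots> \<longleftrightarrow> Suc m = 2 ^ n" by (auto simp: mask_eq_exp_minus_1)
  finally show ?thesis .
qed

lemma bits_surj:
  assumes "\<And>i. X i \<Longrightarrow> i < n"
  shows "\<exists>m < 2 ^ n. X = bits m"
proof -
  let ?m = "horner_sum of_bool 2 (map X [0..<n]) :: nat"
  have "?m < 2 ^ n" using horner_sum_of_bool_2_less[of "map X [0..<n]"] by simp
  moreover have "X = bits ?m" using assms by (auto simp: bits_def bit_horner_sum_bit_iff fun_eq_iff)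
  ultimately show ?thesis by blast
qed

text \<open>Entering a second half replaces the source by the midpoint, entering a first half keeps
  it. So the source of level \<open>l\<close> is the midpoint of the nearest frame above that is in
  its second half, and \<open>src\<close> if there is none; dually for targets in
  \<open>bv\<close>.\<close>

definition av :: "(nat \<Rightarrow> nat \<Rightarrow> bool) \<Rightarrow> (nat \<Rightarrow> bool) \<Rightarrow> nat \<Rightarrow> nat \<Rightarrow> bool" where
  "av W c l i \<longleftrightarrow> (\<exists>j. l < j \<and> j \<le> L \<and> c j \<and> W j i \<and> (\<forall>k. l < k \<and> k < j \<longrightarrow> \<not> c k)) \<or>
     src i \<and> (\<forall>j. l < j \<and> j \<le> L \<longrightarrow> \<not> c j)"

definition bv :: "(nat \<Rightarrow> nat \<Rightarrow> bool) \<Rightarrow> (nat \<Rightarrow> bool) \<Rightarrow> nat \<Rightarrow> nat \<Rightarrow> bool" where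
  "bv W c l i \<longleftrightarrow> (\<exists>j. l < j \<and> j \<le> L \<and> \<not> c j \<and> W j i \<and> (\<forall>k. l < k \<and> k < j \<longrightarrow> c k)) \<or>
     tgt i \<and> (\<forall>j. l < j \<and> j \<le> L \<longrightarrow> c j)"

lemma av_top: "av W c L = src" "bv W c L = tgt"
  by (auto simp: av_def bv_def fun_eq_iff)

lemma ex_first_above:
  fixes l :: nat
  shows "(\<exists>j. l < j \<and> P j \<and> (\<forall>k. l < k \<and> k < j \<longrightarrow> N k)) \<longleftrightarrow>
    P (Suc l) \<or> N (Suc l) \<and> (\<exists>j. Suc l < j \<and> P j \<and> (\<forall>k. Suc l < k \<and> k < j \<longrightarrow> N k))"
proof -
  have 1: "(\<forall>k. l < k \<and> k < j \<longrightarrow> N k) \<longleftrightarrow> N (Suc l) \<and> (\<forall>k. Suc l < k \<and> k < j \<longrightarrow> N k)" if "Suc l < j" for j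
    using that by (metis Suc_lessD Suc_lessI lessI)
  have 2: "(\<exists>j. l < j \<and> Q j) \<longleftrightarrow> Q (Suc l) \<or> (\<exists>j. Suc l < j \<and> Q j)" for Q
    by (metis Suc_lessD Suc_lessI lessI)
  have 3: "(\<forall>k. l < k \<and> k < Suc l \<longrightarrow> N k) \<longleftrightarrow> True" by auto
  show ?thesis unfolding 2 3 using 1 by blast
qed

lemma all_above:
  assumes "l < (L::nat)"
  shows "(\<forall>j. l < j \<and> j \<le> L \<longrightarrow> N j) \<longleftrightarrow> N (Suc l) \<and> (\<forall>j. Suc l < j \<and> j \<le> L \<longrightarrow> N j)"
  using assms by (metis Suc_leI Suc_lessD Suc_lessI lessI)

lemma av_Suc:
  assumes "l < L"
  shows "av W c l = (if c (Suc l) then W (Suc l) else av W c (Suc l))"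
proof
  fix i
  show "av W c l i = (if c (Suc l) then W (Suc l) else av W c (Suc l)) i"
    using ex_first_above[of l "\<lambda>j. j \<le> L \<and> c j \<and> W j i" "\<lambda>k. \<not> c k"] all_above[OF assms, of "\<lambda>j. \<not> c j"] assms
    unfolding av_def conj_assoc by (cases "c (Suc l)") auto
qed

lemma bv_Suc:
  assumes "l < L"
  shows "bv W c l = (if c (Suc l) then bv W c (Suc l) else W (Suc l))"
proof
  fix i
  show "bv W c l i = (if c (Suc l) then bv W c (Suc l) else W (Suc l)) i"
    using ex_first_above[of l "\<lambda>j. j \<le> L \<and> \<not> c j \<and> W j i" c] all_above[OF assms, of c] assms
    unfolding bv_def conj_assoc by (cases "c (Suc l)") auto
qed

lemma av_cong: "(\<And>j. l < j \<Longrightarrow> W j = W' j \<and> c j = c' j) \<Longrightarrow> av W c l = av W' c' l \<and> bv W c l = bv W' c' l"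
  unfolding fun_eq_iff av_def bv_def by (simp cong: conj_cong)

text \<open>A call resets its frame to midpoint 0 and the first half. A positive answer sends the
  parent into its second half or completes it; a negative one sends it to the next midpoint or,
  after the last one, makes it fail. Answers of level \<open>L\<close> are final.\<close>

definition sstep :: "sav \<Rightarrow> sav" where
  "sstep s = (case s of (W, c, p) \<Rightarrow> (case p of
      None \<Rightarrow> (W, c, Some (SCall, L))
    | Some (z, l) \<Rightarrow> (case z of
        SCall \<Rightarrow> (W(l := \<lambda>_. False), c(l := False),
          Some (if l = 0 then (if leaf (av W c 0) (bv W c 0) then SYes else SNo, 0) else (SCall, l - 1)))
      | SYes \<Rightarrow> if L \<le> l then s else (W, c(Suc l := True), Some (if c (Suc l) then (SYes, Suc l) else (SCall, l)))
      | SNo \<Rightarrow> if L \<le> l then s else (W(Suc l := binc (W (Suc l))), c(Suc l := False),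
          Some (if ones (W (Suc l)) then (SNo, Suc l) else (SCall, l))))))"

section \<open>Correctness of the recursion\<close>

primrec reach :: "nat \<Rightarrow> (nat \<Rightarrow> bool) \<Rightarrow> (nat \<Rightarrow> bool) \<Rightarrow> bool" where
  "reach 0 X Y \<longleftrightarrow> leaf X Y"
| "reach (Suc l) X Y \<longleftrightarrow> (\<exists>m < 2 ^ n. reach l X (bits m) \<and> reach l (bits m) Y)"

definition yields :: "sav \<Rightarrow> sav \<Rightarrow> bool" where
  "yields s s' \<longleftrightarrow> (\<exists>k. (sstep ^^ k) s = s')"

lemma yields_trans: "yields s s' \<Longrightarrow> yields s' s'' \<Longrightarrow> yields s s''"
  unfolding yields_def
proof (elim exE)
  fix k l assume "(sstep ^^ k) s = s'" "(sstep ^^ l) s' = s''"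
  then have "(sstep ^^ (l + k)) s = s''" by (simp add: funpow_add)
  then show "\<exists>k. (sstep ^^ k) s = s''" by (rule exI)
qed

lemma yields_step: "sstep s = s' \<Longrightarrow> yields s s'"
  unfolding yields_def by (rule exI[of _ 1]) simp

abbreviation answer :: "bool \<Rightarrow> signal" where
  "answer b \<equiv> (if b then SYes else SNo)"

text \<open>The contract of a call: besides giving the right answer, it leaves the frames above its
  level intact, so that the end points of all enclosing calls are preserved.\<close>

definition answers :: "nat \<Rightarrow> bool" where
  "answers l \<longleftrightarrow> (\<forall>W c. \<exists>W' c'. yields (W, c, Some (SCall, l))
       (W', c', Some (answer (reach l (av W c l) (bv W c l)), l)) \<and> (\<forall>j>l. W' j = W j \<and> c' j = c j))"

text \<open>Induction on the number of midpoints still to be tried. Calls of level \<open>l\<close>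
  may destroy the frames up to \<open>l\<close>, but by their contract not the midpoint and the flag
  in frame \<open>Suc l\<close>.\<close>

lemma yields_loop:
  assumes IH: "answers l" and l: "l < L"
    and m: "m < 2 ^ n" and W: "W (Suc l) = bits m" "\<not> c (Suc l)"
    and a: "a = av W c (Suc l)" and b: "b = bv W c (Suc l)"
  shows "\<exists>W' c'. yields (W, c, Some (SCall, l))
       (W', c', Some (answer (\<exists>m'. m \<le> m' \<and> m' < 2 ^ n \<and> reach l a (bits m') \<and> reach l (bits m') b), Suc l)) \<and>
     (\<forall>j>Suc l. W' j = W j \<and> c' j = c j)"
  using m W a b
proof (induction "2 ^ n - m" arbitrary: m W c)
  case 0
  then show ?case by simp
next
  case (Suc d)
  note m = Suc.prems(1) and W = Suc.prems(2,3) and ab = Suc.prems(4,5)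
  define P where "P m' \<longleftrightarrow> m' < 2 ^ n \<and> reach l a (bits m') \<and> reach l (bits m') b" for m'
  have split: "(\<exists>m'. m \<le> m' \<and> P m') \<longleftrightarrow> P m \<or> (\<exists>m'. Suc m \<le> m' \<and> P m')"
  proof -
    have e: "m \<le> m' \<longleftrightarrow> m' = m \<or> Suc m \<le> m'" for m' by linarith
    show ?thesis unfolding e by blast
  qed
  \<comment> \<open>The common continuation after a negative answer for either half: the counter is
    increased and the flag reset, whatever the flag was.\<close>
  have fail: "\<exists>W' c'. yields (W2, c2, Some (SNo, l)) (W', c', Some (answer (\<exists>m'. m \<le> m' \<and> P m'), Suc l)) \<and>
      (\<forall>j>Suc l. W' j = W j \<and> c' j = c j)"
    if np: "\<not> P m" and W2: "W2 (Suc l) = bits m" "\<forall>j>Suc l. W2 j = W j \<and> c2 j = c j" for W2 c2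
  proof (cases "Suc m = 2 ^ n")
    case True
    then have "\<not> (\<exists>m'. Suc m \<le> m' \<and> P m')" by (auto simp: P_def)
    then have no: "(\<exists>m'. m \<le> m' \<and> P m') = False" using split np by simp
    have "sstep (W2, c2, Some (SNo, l)) = (W2(Suc l := bits (Suc m)), c2(Suc l := False), Some (SNo, Suc l))"
      using l W2(1) True ones_bits[OF m] by (simp add: sstep_def binc_bits)
    note step = yields_step[OF this]
    have "\<forall>j>Suc l. (W2(Suc l := bits (Suc m))) j = W j \<and> (c2(Suc l := False)) j = c j" using W2(2) by simp
    then show ?thesis unfolding no if_False using step by blast
  next
    case False
    then have m': "Suc m < 2 ^ n" using m by simp
    let ?W = "W2(Suc l := bits (Suc m))" and ?c = "c2(Suc l := False)"
    have "sstep (W2, c2, Some (SNo, l)) = (?W, ?c, Some (SCall, l))"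
      using l W2(1) False ones_bits[OF m] by (simp add: sstep_def binc_bits)
    note 1 = yields_step[OF this]
    have e: "(\<exists>m'. m \<le> m' \<and> P m') = (\<exists>m'. Suc m \<le> m' \<and> P m')" using split np by simp
    have "av W c (Suc l) = av ?W ?c (Suc l) \<and> bv W c (Suc l) = bv ?W ?c (Suc l)"
      by (rule av_cong) (use W2(2) in auto)
    then have ab': "a = av ?W ?c (Suc l)" "b = bv ?W ?c (Suc l)" using ab by simp_all
    have "d = 2 ^ n - Suc m" using Suc.hyps(2) by simp
    moreover have "?W (Suc l) = bits (Suc m)" "\<not> ?c (Suc l)" by simp_all
    ultimately obtain W' c' where
      2: "yields (?W, ?c, Some (SCall, l)) (W', c', Some (answer (\<exists>m'. Suc m \<le> m' \<and> P m'), Suc l))"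
        "\<forall>j>Suc l. W' j = ?W j \<and> c' j = ?c j"
      using Suc.hyps(1)[of "Suc m" ?W ?c, OF _ m' _ _ ab', folded P_def] by blast
    have "W' j = W j \<and> c' j = c j" if "Suc l < j" for j using 2(2) W2(2) that by simp
    then show ?thesis unfolding e using yields_trans[OF 1 2(1)] by blast
  qed
  obtain W2 c2 where 2: "yields (W, c, Some (SCall, l)) (W2, c2, Some (answer (reach l (av W c l) (bv W c l)), l))"
    "\<And>j. l < j \<Longrightarrow> W2 j = W j \<and> c2 j = c j" using IH[unfolded answers_def, rule_format, of W c] by blast
  have e2: "av W c l = a" "bv W c l = bits m" using av_Suc[OF l, of W c] bv_Suc[OF l, of W c] W ab by simp_all
  have "\<exists>W' c'. yields (W, c, Some (SCall, l)) (W', c', Some (answer (\<exists>m'. m \<le> m' \<and> P m'), Suc l)) \<and>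
      (\<forall>j>Suc l. W' j = W j \<and> c' j = c j)"
  proof (cases "reach l a (bits m)")
    case False
    then have "\<not> P m" by (simp add: P_def)
    have W2: "W2 (Suc l) = bits m" "\<forall>j>Suc l. W2 j = W j \<and> c2 j = c j" using 2(2) W by simp_all
    from fail[OF \<open>\<not> P m\<close> W2] obtain W' c' where 3: "yields (W2, c2, Some (SNo, l)) (W', c', Some (answer (\<exists>m'. m \<le> m' \<and> P m'), Suc l))"
      "\<forall>j>Suc l. W' j = W j \<and> c' j = c j" by blast
    have "yields (W, c, Some (SCall, l)) (W2, c2, Some (SNo, l))" using 2(1) False by (simp only: e2 if_False)
    from yields_trans[OF this 3(1)] 3(2)
    show "\<exists>W' c'. yields (W, c, Some (SCall, l)) (W', c', Some (answer (\<exists>m'. m \<le> m' \<and> P m'), Suc l)) \<and>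
      (\<forall>j>Suc l. W' j = W j \<and> c' j = c j)" by blast
  next
    case True
    let ?c = "c2(Suc l := True)"
    have "yields (W, c, Some (SCall, l)) (W2, c2, Some (SYes, l))" using 2(1) True by (simp only: e2 if_True)
    moreover have "sstep (W2, c2, Some (SYes, l)) = (W2, ?c, Some (SCall, l))"
      using l 2(2)[of "Suc l"] W by (simp add: sstep_def)
    ultimately have 3: "yields (W, c, Some (SCall, l)) (W2, ?c, Some (SCall, l))"
      by (rule yields_trans[OF _ yields_step])
    have "av W2 ?c l = bits m" using av_Suc[OF l, of W2 ?c] 2(2)[of "Suc l"] W by simp
    moreover have "bv W2 ?c l = b"
      using bv_Suc[OF l, of W2 ?c] av_cong[of "Suc l" W2 W ?c c] 2(2) ab by simp
    ultimately have "\<exists>W3 c3. yields (W2, ?c, Some (SCall, l)) (W3, c3, Some (answer (reach l (bits m) b), l)) \<and>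
      (\<forall>j>l. W3 j = W2 j \<and> c3 j = ?c j)" using IH[unfolded answers_def, rule_format, of W2 ?c] by (simp only:)
    then obtain W3 c3 where 4: "yields (W2, ?c, Some (SCall, l)) (W3, c3, Some (answer (reach l (bits m) b), l))"
      "\<And>j. l < j \<Longrightarrow> W3 j = W2 j \<and> c3 j = ?c j" by blast
    have W3: "W3 (Suc l) = bits m" "\<forall>j>Suc l. W3 j = W j \<and> c3 j = c j" using 4(2) 2(2) W by simp_all
    show "\<exists>W' c'. yields (W, c, Some (SCall, l)) (W', c', Some (answer (\<exists>m'. m \<le> m' \<and> P m'), Suc l)) \<and>
      (\<forall>j>Suc l. W' j = W j \<and> c' j = c j)"
    proof (cases "reach l (bits m) b")
      case False
      then have "\<not> P m" by (simp add: P_def)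
      from fail[OF this W3] obtain W' c' where 5: "yields (W3, c3, Some (SNo, l)) (W', c', Some (answer (\<exists>m'. m \<le> m' \<and> P m'), Suc l))"
        "\<forall>j>Suc l. W' j = W j \<and> c' j = c j" by blast
      have "yields (W2, ?c, Some (SCall, l)) (W3, c3, Some (SNo, l))" using 4(1) False by simp
      from yields_trans[OF yields_trans[OF 3 this] 5(1)] 5(2) show ?thesis by blast
    next
      case t: True
      have p: "(\<exists>m'. m \<le> m' \<and> P m') = True" using True t m by (auto simp: P_def)
      have "yields (W2, ?c, Some (SCall, l)) (W3, c3, Some (SYes, l))" using 4(1) t by simp
      moreover have "sstep (W3, c3, Some (SYes, l)) = (W3, c3(Suc l := True), Some (SYes, Suc l))"
        using l 4(2)[of "Suc l"] by (simp add: sstep_def)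
      ultimately have "yields (W, c, Some (SCall, l)) (W3, c3(Suc l := True), Some (SYes, Suc l))"
        by (intro yields_trans[OF 3 yields_trans[OF _ yields_step]])
      then show ?thesis unfolding p using W3(2) by (intro exI[of _ W3] exI[of _ "c3(Suc l := True)"]) auto
    qed
  qed
  then show ?case unfolding P_def .
qed

lemma answers: "l \<le> L \<Longrightarrow> answers l"
proof (induction l)
  case 0
  show ?case unfolding answers_def
  proof (intro allI)
    fix W c
    have "sstep (W, c, Some (SCall, 0)) = (W(0 := \<lambda>_. False), c(0 := False), Some (answer (leaf (av W c 0) (bv W c 0)), 0))"
      by (simp add: sstep_def)
    from yields_step[OF this]
    show "\<exists>W' c'. yields (W, c, Some (SCall, 0)) (W', c', Some (answer (reach 0 (av W c 0) (bv W c 0)), 0)) \<and>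
      (\<forall>j>0. W' j = W j \<and> c' j = c j)"
      by (intro exI[of _ "W(0 := \<lambda>_. False)"] exI[of _ "c(0 := False)"]) simp
  qed
next
  case (Suc l)
  then have l: "l < L" and IH: "answers l" by simp_all
  show ?case unfolding answers_def
  proof (intro allI)
    fix W c
    let ?W = "W(Suc l := bits 0)" and ?c = "c(Suc l := False)"
    have b0: "bits 0 = (\<lambda>_. False)" by (simp add: bits_def fun_eq_iff)
    have "sstep (W, c, Some (SCall, Suc l)) = (?W, ?c, Some (SCall, l))" unfolding b0 by (simp add: sstep_def)
    note 1 = yields_step[OF this]
    have "av W c (Suc l) = av ?W ?c (Suc l) \<and> bv W c (Suc l) = bv ?W ?c (Suc l)" by (rule av_cong) simp
    then have ab: "av W c (Suc l) = av ?W ?c (Suc l)" "bv W c (Suc l) = bv ?W ?c (Suc l)" by simp_all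
    obtain W' c' where 2: "yields (?W, ?c, Some (SCall, l)) (W', c', Some (answer (\<exists>m'. 0 \<le> m' \<and> m' < 2 ^ n \<and>
       reach l (av W c (Suc l)) (bits m') \<and> reach l (bits m') (bv W c (Suc l))), Suc l))"
      "\<forall>j>Suc l. W' j = ?W j \<and> c' j = ?c j"
      using yields_loop[of l 0 ?W ?c, OF IH l _ _ _ ab] by (simp only: zero_less_power zero_less_numeral fun_upd_same not_False_eq_True) blast
    have "yields (W, c, Some (SCall, Suc l)) (W', c', Some (answer (reach (Suc l) (av W c (Suc l)) (bv W c (Suc l))), Suc l))"
      using yields_trans[OF 1 2(1)] by (simp only: reach.simps le0 simp_thms)
    then show "\<exists>W' c'. yields (W, c, Some (SCall, Suc l)) (W', c', Some (answer (reach (Suc l) (av W c (Suc l)) (bv W c (Suc l))), Suc l)) \<and>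
      (\<forall>j>Suc l. W' j = W j \<and> c' j = c j)" using 2(2) by (intro exI[of _ W'] exI[of _ c']) simp
  qed
qed

section \<open>Halting states and the depth of the recursion\<close>

definition sinit :: sav where
  "sinit = (\<lambda>_ _. False, \<lambda>_. False, None)"

lemma yields_result: "\<exists>W c. yields sinit (W, c, Some (answer (reach L src tgt), L))"
proof -
  have "sstep sinit = (\<lambda>_ _. False, \<lambda>_. False, Some (SCall, L))" by (simp add: sinit_def sstep_def)
  note 1 = yields_step[OF this]
  obtain W c where "yields (\<lambda>_ _. False, \<lambda>_. False, Some (SCall, L)) (W, c, Some (answer (reach L src tgt), L))"
    using answers[of L] av_top unfolding answers_def by (metis order_refl)
  then show ?thesis using yields_trans[OF 1] by blast
qed

definition halting :: "sav \<Rightarrow> bool" where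
  "halting s \<longleftrightarrow> (case s of (W, c, p) \<Rightarrow> p = Some (SYes, L) \<or> p = Some (SNo, L))"

lemma sstep_halting: "halting s \<Longrightarrow> sstep s = s"
  by (auto simp: halting_def sstep_def split: prod.splits)

text \<open>An iteration stops at the first halting state. As halting states are fixed points, this
  is already the state that carries the result.\<close>

lemma first_halt:
  "\<exists>k W c. (sstep ^^ k) sinit = (W, c, Some (answer (reach L src tgt), L)) \<and> (\<forall>i<k. \<not> halting ((sstep ^^ i) sinit))"
proof -
  obtain k W c where k: "(sstep ^^ k) sinit = (W, c, Some (answer (reach L src tgt), L))"
    using yields_result unfolding yields_def by blast
  then have "halting ((sstep ^^ k) sinit)" by (simp add: halting_def)
  then obtain i where i: "halting ((sstep ^^ i) sinit)" "\<forall>j<i. \<not> halting ((sstep ^^ j) sinit)" "i \<le> k"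
    using LeastI[of "\<lambda>i. halting ((sstep ^^ i) sinit)" k] Least_le[of "\<lambda>i. halting ((sstep ^^ i) sinit)" k]
      not_less_Least[of _ "\<lambda>i. halting ((sstep ^^ i) sinit)"] by blast
  have "(sstep ^^ (d + i)) sinit = (sstep ^^ i) sinit" for d
    by (induction d) (use sstep_halting[OF i(1)] in simp_all)
  from this[of "k - i"] have "(sstep ^^ i) sinit = (sstep ^^ k) sinit" using i(3) by simp
  then show ?thesis using k i(2) by metis
qed

text \<open>Reflexivity of \<open>leaf\<close> turns paths of length exactly \<open>2 ^ L\<close>
  into paths of at most this length, and a finite relation needs no paths longer than its number of
  pairs, here at most \<open>4 ^ n\<close>.\<close>

lemma reach_iff:
  assumes refl: "\<And>X. leaf X X" and big: "4 ^ n \<le> (2::nat) ^ L"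
  shows "m < 2 ^ n \<Longrightarrow> m' < 2 ^ n \<Longrightarrow> reach L (bits m) (bits m') \<longleftrightarrow>
    (bits m, bits m') \<in> {(bits i, bits j) | i j. i < 2 ^ n \<and> j < 2 ^ n \<and> leaf (bits i) (bits j)}\<^sup>*"
proof -
  define S where "S = {(bits i, bits j) | i j. i < 2 ^ n \<and> j < 2 ^ n \<and> leaf (bits i) (bits j)}"
  have pow: "reach l (bits m) (bits m') \<longleftrightarrow> (bits m, bits m') \<in> S ^^ (2 ^ l)" if "m < 2 ^ n" "m' < 2 ^ n" for l m m'
    using that
  proof (induction l arbitrary: m m')
    case 0
    then show ?case by (auto simp: S_def)
  next
    case (Suc l)
    have "(2::nat) ^ Suc l = 2 ^ l + 2 ^ l" by simp
    then have "S ^^ (2 ^ Suc l) = S ^^ (2 ^ l) O S ^^ (2 ^ l)" by (simp only: relpow_add)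
    moreover have "\<exists>j<2 ^ n. z = bits j" if "(bits m, z) \<in> S ^^ (2 ^ l)" for z
    proof -
      have "(2::nat) ^ l \<noteq> 0" by simp
      then obtain k where k: "(2::nat) ^ l = Suc k" using not0_implies_Suc by blast
      have "(bits m, z) \<in> S ^^ Suc k" using that unfolding k .
      then show ?thesis by (auto simp: S_def)
    qed
    ultimately have "(bits m, bits m') \<in> S ^^ (2 ^ Suc l) \<longleftrightarrow>
        (\<exists>j<2 ^ n. (bits m, bits j) \<in> S ^^ (2 ^ l) \<and> (bits j, bits m') \<in> S ^^ (2 ^ l))" by blast
    then show ?case using Suc.IH Suc.prems by (simp cong: conj_cong)
  qed
  have fin: "finite S" unfolding S_def by (rule finite_subset[of _ "(\<lambda>(i, j). (bits i, bits j)) ` ({..<2 ^ n} \<times> {..<2 ^ n})"]) auto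
  have "card S \<le> card ((\<lambda>(i, j). (bits i, bits j)) ` ({..<2 ^ n} \<times> {..<2 ^ n}))" by (rule card_mono) (auto simp: S_def)
  also have "\<dots> \<le> card ({..<(2::nat) ^ n} \<times> {..<(2::nat) ^ n})" by (rule card_image_le) simp
  also have "\<dots> = 4 ^ n" by (simp add: power_mult_distrib[symmetric])
  finally have card: "card S \<le> 2 ^ L" using big by simp
  assume m: "m < 2 ^ n" "m' < 2 ^ n"
  show "reach L (bits m) (bits m') \<longleftrightarrow>
    (bits m, bits m') \<in> {(bits i, bits j) | i j. i < 2 ^ n \<and> j < 2 ^ n \<and> leaf (bits i) (bits j)}\<^sup>*"
    unfolding S_def[symmetric]
    unfolding pow[OF m]
  proof
    assume "(bits m, bits m') \<in> S ^^ (2 ^ L)"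
    then show "(bits m, bits m') \<in> S\<^sup>*" by (rule relpow_imp_rtrancl)
  next
    assume "(bits m, bits m') \<in> S\<^sup>*"
    then obtain k where k: "(bits m, bits m') \<in> S ^^ k" "k \<le> card S" using rtrancl_finite_eq_relpow[OF fin] by auto
    have "(bits m', bits m') \<in> S" using m refl unfolding S_def by blast
    then have "(bits m', bits m') \<in> S ^^ d" for d by (induction d) auto
    then have "(bits m, bits m') \<in> S ^^ (k + (2 ^ L - k))" using k(1) unfolding relpow_add by blast
    then show "(bits m, bits m') \<in> S ^^ (2 ^ L)" using k(2) card by simp
  qed
qed

text \<open>The matrix representation: row \<open>l\<close> holds \<open>W l\<close>, \<open>c l\<close> and three columns marking the
  current signal.\<close>

definition mat :: "sav \<Rightarrow> nat \<Rightarrow> nat \<Rightarrow> bool" where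
  "mat s l k = (case s of (W, c, p) \<Rightarrow> if k < n then W l k else if k = n then c l
     else if k = n + 1 then p = Some (SCall, l) else if k = n + 2 then p = Some (SYes, l) else p = Some (SNo, l))"

text \<open>The source at level 0, where \<open>leaf\<close> is evaluated, stated with bounded
  quantifiers over the matrix; column \<open>n\<close> holds the flags.\<close>

definition mav :: "(nat \<Rightarrow> nat \<Rightarrow> bool) \<Rightarrow> nat \<Rightarrow> bool" where
  "mav B i \<longleftrightarrow> (\<exists>j\<le>L. 0 < j \<and> B j n \<and> B j i \<and> (\<forall>k<j. 0 < k \<longrightarrow> \<not> B k n)) \<or> src i \<and> (\<forall>j\<le>L. 0 < j \<longrightarrow> \<not> B j n)"

definition mbv :: "(nat \<Rightarrow> nat \<Rightarrow> bool) \<Rightarrow> nat \<Rightarrow> bool" where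
  "mbv B i \<longleftrightarrow> (\<exists>j\<le>L. 0 < j \<and> \<not> B j n \<and> B j i \<and> (\<forall>k<j. 0 < k \<longrightarrow> B k n)) \<or> tgt i \<and> (\<forall>j\<le>L. 0 < j \<longrightarrow> B j n)"

text \<open>The absence of all signals stands for \<open>None\<close>. Hence the empty memory
  represents \<open>sinit\<close>, and the iteration needs no separate initialisation.\<close>

definition idle :: "(nat \<Rightarrow> nat \<Rightarrow> bool) \<Rightarrow> bool" where
  "idle B \<longleftrightarrow> (\<forall>l\<le>L. \<not> B l (n + 1) \<and> \<not> B l (n + 2) \<and> \<not> B l (n + 3))"

text \<open>The predecessor row is found by a bounded search, since terms have no
  subtraction.\<close>

definition pred_has :: "(nat \<Rightarrow> nat \<Rightarrow> bool) \<Rightarrow> nat \<Rightarrow> nat \<Rightarrow> bool" where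
  "pred_has B l k \<longleftrightarrow> (\<exists>j<l. l = Suc j \<and> B j k)"

text \<open>The effect of \<open>sstep\<close> seen from the entry to be written: what a signal in
  row \<open>l\<close> does to row \<open>Suc l\<close> appears as a condition on the predecessor
  row, and a call sent downwards as a condition on the row above.\<close>

definition next_mat :: "(nat \<Rightarrow> nat \<Rightarrow> bool) \<Rightarrow> nat \<Rightarrow> nat \<Rightarrow> bool" where
  "next_mat B l k =
    (if k < n then \<not> B l (n + 1) \<and> (B l k \<noteq> (pred_has B l (n + 3) \<and> (\<forall>i<k. B l i)))
     else if k = n then \<not> B l (n + 1) \<and> \<not> pred_has B l (n + 3) \<and> (pred_has B l (n + 2) \<or> B l n)
     else if k = n + 1 then l = L \<and> idle B \<or> l < L \<and> (B (Suc l) (n + 1) \<or> B l (n + 2) \<and> \<not> B (Suc l) n \<or>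
        B l (n + 3) \<and> \<not> (\<forall>i<n. B (Suc l) i))
     else if k = n + 2 then l = 0 \<and> B 0 (n + 1) \<and> leaf (mav B) (mbv B) \<or> pred_has B l (n + 2) \<and> B l n \<or> l = L \<and> B l (n + 2)
     else l = 0 \<and> B 0 (n + 1) \<and> \<not> leaf (mav B) (mbv B) \<or> pred_has B l (n + 3) \<and> (\<forall>i<n. B l i) \<or> l = L \<and> B l (n + 3))"

lemma mat_cols: "k < n \<Longrightarrow> mat (W, c, p) l k = W l k" "mat (W, c, p) l n = c l"
  "mat (W, c, p) l (n + 1) \<longleftrightarrow> p = Some (SCall, l)" "mat (W, c, p) l (n + 2) \<longleftrightarrow> p = Some (SYes, l)"
  "mat (W, c, p) l (n + 3) \<longleftrightarrow> p = Some (SNo, l)"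
  by (auto simp: mat_def)

definition bounded :: "sav \<Rightarrow> bool" where
  "bounded s \<longleftrightarrow> (case s of (W, c, p) \<Rightarrow> \<forall>z l. p = Some (z, l) \<longrightarrow> l \<le> L)"

lemma bounded_sstep: "bounded s \<Longrightarrow> bounded (sstep s)"
  by (auto simp: bounded_def sstep_def split: prod.splits option.splits signal.splits)

text \<open>\<open>mav\<close> and \<open>mbv\<close> agree with the end points only at indices
  below \<open>n\<close>, hence the congruence assumption on \<open>leaf\<close>. By
  \<open>bounded\<close>, each signal is visible in some row of the matrix, so that
  \<open>idle\<close> indeed means \<open>None\<close>.\<close>

lemma next_mat_sstep:
  assumes s: "bounded s" and l: "l \<le> L" and k: "k < n + 4"
    and leaf_cong: "\<And>X X' Y Y'. (\<And>i. i < n \<Longrightarrow> X i = X' i) \<Longrightarrow> (\<And>i. i < n \<Longrightarrow> Y i = Y' i) \<Longrightarrow> leaf X Y = leaf X' Y'"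
  shows "next_mat (mat s) l k = mat (sstep s) l k"
proof -
  obtain W c p where se: "s = (W, c, p)" by (cases s)
  let ?B = "mat (W, c, p)"
  have pr: "pred_has ?B l (n + 2) \<longleftrightarrow> 0 < l \<and> p = Some (SYes, l - 1)" "pred_has ?B l (n + 3) \<longleftrightarrow> 0 < l \<and> p = Some (SNo, l - 1)"
    unfolding pred_has_def mat_cols by (cases l; auto)+
  have idle: "idle ?B \<longleftrightarrow> p = None"
    using s unfolding idle_def mat_cols se bounded_def by (cases p) (auto, metis signal.exhaust)
  have "mav ?B i = av W c 0 i" if "i < n" for i using that by (auto simp: mav_def av_def mat_cols)
  moreover have "mbv ?B i = bv W c 0 i" if "i < n" for i using that by (auto simp: mbv_def bv_def mat_cols)
  ultimately have leaf: "leaf (mav ?B) (mbv ?B) = leaf (av W c 0) (bv W c 0)" by (intro leaf_cong)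
  have row: "(\<forall>i<k. ?B l i) \<longleftrightarrow> (\<forall>i<k. W l i)" if "k \<le> n" for k l using that by (auto simp: mat_cols)
  have ones: "(\<forall>i<n. W l i) \<longleftrightarrow> ones (W l)" for l by (simp add: ones_def)
  consider "k < n" | "k = n" | "k = n + 1" | "k = n + 2" | "k = n + 3" using k by linarith
  then show ?thesis unfolding se
  proof cases
    case 1
    have "next_mat ?B l k \<longleftrightarrow> p \<noteq> Some (SCall, l) \<and> (W l k \<noteq> ((0 < l \<and> p = Some (SNo, l - 1)) \<and> (\<forall>i<k. W l i)))"
      unfolding next_mat_def pr row[OF less_imp_le[OF 1]] mat_cols mat_cols(1)[OF 1] using 1 by simp
    also have "\<dots> \<longleftrightarrow> fst (sstep (W, c, p)) l k"
      using 1 l by (auto simp: sstep_def binc_def split: option.splits signal.splits)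
    also have "\<dots> \<longleftrightarrow> mat (sstep (W, c, p)) l k" using 1 by (cases "sstep (W, c, p)") (simp add: mat_cols)
    finally show "next_mat ?B l k = mat (sstep (W, c, p)) l k" .
  next
    case 2
    have "next_mat ?B l k \<longleftrightarrow> p \<noteq> Some (SCall, l) \<and> \<not> (0 < l \<and> p = Some (SNo, l - 1)) \<and> (0 < l \<and> p = Some (SYes, l - 1) \<or> c l)"
      unfolding next_mat_def pr mat_cols using 2 by simp
    also have "\<dots> \<longleftrightarrow> fst (snd (sstep (W, c, p))) l"
      using l by (auto simp: sstep_def split: option.splits signal.splits)
    also have "\<dots> \<longleftrightarrow> mat (sstep (W, c, p)) l k" using 2 by (cases "sstep (W, c, p)") (simp add: mat_cols)
    finally show "next_mat ?B l k = mat (sstep (W, c, p)) l k" .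
  next
    case 3
    have "next_mat ?B l k \<longleftrightarrow> l = L \<and> p = None \<or> l < L \<and> (p = Some (SCall, Suc l) \<or> p = Some (SYes, l) \<and> \<not> c (Suc l) \<or>
        p = Some (SNo, l) \<and> \<not> ones (W (Suc l)))"
      unfolding next_mat_def 3 idle row[OF le_refl] ones mat_cols by simp
    also have "\<dots> \<longleftrightarrow> snd (snd (sstep (W, c, p))) = Some (SCall, l)"
      using l s by (cases l; auto simp: sstep_def se bounded_def split: option.splits signal.splits)
    also have "\<dots> \<longleftrightarrow> mat (sstep (W, c, p)) l k" unfolding 3 by (cases "sstep (W, c, p)") (simp only: mat_cols snd_conv)
    finally show "next_mat ?B l k = mat (sstep (W, c, p)) l k" .
  next
    case 4
    have "next_mat ?B l k \<longleftrightarrow> l = 0 \<and> p = Some (SCall, 0) \<and> leaf (av W c 0) (bv W c 0) \<or>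
        (0 < l \<and> p = Some (SYes, l - 1)) \<and> c l \<or> l = L \<and> p = Some (SYes, l)"
      unfolding next_mat_def 4 pr leaf mat_cols by simp
    also have "\<dots> \<longleftrightarrow> snd (snd (sstep (W, c, p))) = Some (SYes, l)"
      using l s by (cases l; auto simp: sstep_def se bounded_def split: option.splits signal.splits)
    also have "\<dots> \<longleftrightarrow> mat (sstep (W, c, p)) l k" unfolding 4 by (cases "sstep (W, c, p)") (simp only: mat_cols snd_conv)
    finally show "next_mat ?B l k = mat (sstep (W, c, p)) l k" .
  next
    case 5
    have "next_mat ?B l k \<longleftrightarrow> l = 0 \<and> p = Some (SCall, 0) \<and> \<not> leaf (av W c 0) (bv W c 0) \<or>
        (0 < l \<and> p = Some (SNo, l - 1)) \<and> ones (W l) \<or> l = L \<and> p = Some (SNo, l)"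
      unfolding next_mat_def 5 pr leaf row[OF le_refl] ones mat_cols by simp
    also have "\<dots> \<longleftrightarrow> snd (snd (sstep (W, c, p))) = Some (SNo, l)"
      using l s by (cases l; auto simp: sstep_def se bounded_def split: option.splits signal.splits)
    also have "\<dots> \<longleftrightarrow> mat (sstep (W, c, p)) l k" unfolding 5 by (cases "sstep (W, c, p)") (simp only: mat_cols snd_conv)
    finally show "next_mat ?B l k = mat (sstep (W, c, p)) l k" .
  qed
qed

lemma mat_sinit: "\<not> mat sinit l k"
  by (simp add: mat_def sinit_def)

lemma bounded_iter: "bounded ((sstep ^^ i) sinit)"
  by (induction i) (auto simp: bounded_sstep, simp add: bounded_def sinit_def)

end

section \<open>Membership in PSPACE\<close>

text \<open>From here on, variable 0 is the input length and variable 1 the number of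
  vertices.\<close>

definition FEdge :: "nat \<Rightarrow> nat \<Rightarrow> fm" where
  "FEdge i j = InBit (Plus (Plus (V 1) (Cst 1)) (Plus (Times (V i) (V 1)) (V j)))"

definition FSet :: "nat \<Rightarrow> nat \<Rightarrow> fm" where
  "FSet k i = InBit (Plus (Plus (V 1) (Cst 1)) (Plus (Times (Plus (V 1) (Cst k)) (V 1)) (V i)))"

definition FIf :: "fm \<Rightarrow> fm \<Rightarrow> fm \<Rightarrow> fm" where
  "FIf c f g = FOr (And c f) (And (Neg c) g)"

definition FIff :: "fm \<Rightarrow> fm \<Rightarrow> fm" where
  "FIff f g = And (FImp f g) (FImp g f)"

lemma evalf_inst [simp]:
  "evalf x m (N # n # e) (FEdge i j) \<longleftrightarrow> ibit x n (rho (N # n # e) i) (rho (N # n # e) j)"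
  "evalf x m (N # n # e) (FSet k i) \<longleftrightarrow> ibit x n (n + k) (rho (N # n # e) i)"
  by (simp_all add: FEdge_def FSet_def ibit_def)

lemma evalf_FIf [simp]:
  "evalf x m e (FIf c f g) = (if evalf x m e c then evalf x m e f else evalf x m e g)"
  "evalf x m e (FIff f g) \<longleftrightarrow> (evalf x m e f \<longleftrightarrow> evalf x m e g)"
  by (auto simp: FIf_def FIff_def)

lemma rho_append_Cons [simp]:
  "rho (e @ v # es) (length e) = v" "rho (e @ v # es) (Suc (length e)) = rho es 0"
  "rho (e @ v # es) (Suc (Suc (length e))) = rho es 1"
  by (simp_all add: rho_def nth_append)

lemma rho_ext: "i < Suc (Suc (length e)) \<Longrightarrow> rho (N # n # e @ es) i = rho (N # n # e) i"
  by (cases i) (auto simp: rho_def nth_append nth_Cons split: nat.split)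

section \<open>Formulas for distances, domination and moves\<close>

lemma adjacent_inst: "well_formed x n \<Longrightarrow> adjacent (inst_graph x n) u v \<longleftrightarrow> u < n \<and> v < n \<and> ibit x n u v"
  by (simp add: adjacent_def edge_inst_graph)

lemma verts_inst [simp]: "verts (inst_graph x n) = {..<n}"
  by (simp add: inst_graph_def)

text \<open>The parameter \<open>d\<close> is the length of the environment and thus the level of
  the next bound variable.\<close>

primrec FNear :: "nat \<Rightarrow> nat \<Rightarrow> nat \<Rightarrow> nat \<Rightarrow> fm" where
  "FNear 0 d i j = FEq (V i) (V j)"
| "FNear (Suc k) d i j = FOr (FNear k d i j) (Ex (V 1) (And (FEdge i d) (FNear k (Suc d) d j)))"

lemma evalf_near:
  assumes "well_formed x n"
  shows "i < Suc (Suc (length e)) \<Longrightarrow> j < Suc (Suc (length e)) \<Longrightarrow> rho (N # n # e) i < n \<Longrightarrow> rho (N # n # e) j < n \<Longrightarrow>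
    evalf x m (N # n # e) (FNear k (Suc (Suc (length e))) i j) \<longleftrightarrow> near (inst_graph x n) k (rho (N # n # e) i) (rho (N # n # e) j)"
proof (induction k arbitrary: e i j)
  case 0
  then show ?case by simp
next
  case (Suc k)
  have "evalf x m (N # n # e @ [w]) (FNear k (Suc (Suc (Suc (length e)))) (Suc (Suc (length e))) j) \<longleftrightarrow>
      near (inst_graph x n) k w (rho (N # n # e) j)" if "w < n" for w
    using Suc.IH[of "Suc (Suc (length e))" "e @ [w]" j] Suc.prems that by (simp add: rho_ext)
  then show ?case using Suc.IH[OF Suc.prems] Suc.prems by (auto simp: adjacent_inst[OF assms] rho_ext)
qed

text \<open>A set of vertices is described by a formula that takes the length of the environment and
  the index of the variable denoting the vertex.\<close>

definition denotes :: "bool list \<Rightarrow> bool list \<Rightarrow> nat \<Rightarrow> nat \<Rightarrow> (nat \<Rightarrow> nat \<Rightarrow> fm) \<Rightarrow> (nat \<Rightarrow> bool) \<Rightarrow> bool" where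
  "denotes x m N n F P \<longleftrightarrow> (\<forall>e i. i < Suc (Suc (length e)) \<longrightarrow> rho (N # n # e) i < n \<longrightarrow>
     evalf x m (N # n # e) (F (Suc (Suc (length e))) i) = P (rho (N # n # e) i))"

lemma denotesD:
  "denotes x m N n F P \<Longrightarrow> i < Suc (Suc (length e)) \<Longrightarrow> rho (N # n # e) i < n \<Longrightarrow>
    evalf x m (N # n # e) (F (Suc (Suc (length e))) i) = P (rho (N # n # e) i)"
  unfolding denotes_def by blast

lemma denotes_last:
  assumes "denotes x m N n F P"
  shows "u < n \<Longrightarrow> evalf x m (N # n # e @ [u]) (F (Suc (Suc (Suc (length e)))) (Suc (Suc (length e)))) = P u"
    "u < n \<Longrightarrow> evalf x m (N # n # e @ [u, v]) (F (Suc (Suc (Suc (Suc (length e))))) (Suc (Suc (length e)))) = P u"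
    "v < n \<Longrightarrow> evalf x m (N # n # e @ [u, v]) (F (Suc (Suc (Suc (Suc (length e))))) (Suc (Suc (Suc (length e))))) = P v"
    "w < n \<Longrightarrow> evalf x m (N # n # e @ [u, v, w]) (F (Suc (Suc (Suc (Suc (Suc (length e)))))) (Suc (Suc (Suc (Suc (length e)))))) = P w"
  using denotesD[OF assms, of "Suc (Suc (length e))" "e @ [u]"] denotesD[OF assms, of "Suc (Suc (length e))" "e @ [u, v]"]
    denotesD[OF assms, of "Suc (Suc (Suc (length e)))" "e @ [u, v]"]
    denotesD[OF assms, of "Suc (Suc (Suc (Suc (length e))))" "e @ [u, v, w]"] by simp_all

definition FDom :: "nat \<Rightarrow> (nat \<Rightarrow> nat \<Rightarrow> fm) \<Rightarrow> nat \<Rightarrow> fm" where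
  "FDom r F d = FAll (V 1) (Ex (V 1) (And (F (Suc (Suc d)) (Suc d)) (FNear r (Suc (Suc d)) (Suc d) d)))"

lemma evalf_dom:
  assumes "well_formed x n" "denotes x m N n F P"
  shows "evalf x m (N # n # e) (FDom r F (Suc (Suc (length e)))) \<longleftrightarrow> dist_dominating r (inst_graph x n) {i. i < n \<and> P i}"
proof -
  have "evalf x m (N # n # e @ [v, u]) (FNear r (Suc (Suc (Suc (Suc (length e))))) (Suc (Suc (Suc (length e)))) (Suc (Suc (length e)))) \<longleftrightarrow>
      graph_dist (inst_graph x n) u v \<le> enat r" if "u < n" "v < n" for u v
    using evalf_near[OF assms(1), of "Suc (Suc (Suc (length e)))" "e @ [v, u]" "Suc (Suc (length e))" N m r]
      near_iff[of u "inst_graph x n" v r] that by simp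
  then have "evalf x m (N # n # e) (FDom r F (Suc (Suc (length e)))) \<longleftrightarrow>
      (\<forall>v<n. \<exists>u<n. P u \<and> graph_dist (inst_graph x n) u v \<le> enat r)"
    unfolding FDom_def by (simp add: denotes_last[OF assms(2)] cong: conj_cong)
  also have "\<dots> \<longleftrightarrow> dist_dominating r (inst_graph x n) {i. i < n \<and> P i}"
    unfolding dist_dominating_def by auto
  finally show ?thesis .
qed

definition FMove :: "reconf_rule \<Rightarrow> (nat \<Rightarrow> nat \<Rightarrow> fm) \<Rightarrow> (nat \<Rightarrow> nat \<Rightarrow> fm) \<Rightarrow> nat \<Rightarrow> fm" where
  "FMove R F F' d = Ex (V 1) (Ex (V 1) (FConj
     [F (Suc (Suc d)) d, Neg (F' (Suc (Suc d)) d), F' (Suc (Suc d)) (Suc d), Neg (F (Suc (Suc d)) (Suc d)),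
      if R = TS then FEdge d (Suc d) else FTrue,
      FAll (V 1) (FOr (FEq (V (Suc (Suc d))) (V d)) (FOr (FEq (V (Suc (Suc d))) (V (Suc d)))
        (FIff (F (Suc (Suc (Suc d))) (Suc (Suc d))) (F' (Suc (Suc (Suc d))) (Suc (Suc d))))))]))"

lemma evalf_move:
  assumes "well_formed x n" "denotes x m N n F P" "denotes x m N n F' P'"
  shows "evalf x m (N # n # e) (FMove R F F' (Suc (Suc (length e)))) \<longleftrightarrow>
    reconf_move R (inst_graph x n) {i. i < n \<and> P i} {i. i < n \<and> P' i}"
proof -
  have "evalf x m (N # n # e) (FMove R F F' (Suc (Suc (length e)))) \<longleftrightarrow>
    (\<exists>u<n. \<exists>v<n. P u \<and> \<not> P' u \<and> P' v \<and> \<not> P v \<and>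
      (R = TS \<longrightarrow> ibit x n u v) \<and> (\<forall>i<n. i = u \<or> i = v \<or> P i = P' i))"
    unfolding FMove_def by (simp add: denotes_last[OF assms(2)] denotes_last[OF assms(3)] cong: conj_cong)
  also have "\<dots> \<longleftrightarrow> (\<exists>u v. {i. i < n \<and> P i} - {i. i < n \<and> P' i} = {u} \<and> {i. i < n \<and> P' i} - {i. i < n \<and> P i} = {v} \<and>
      (R = TS \<longrightarrow> {u, v} \<in> edges (inst_graph x n)))" (is "?l = ?r")
  proof
    assume ?l
    then obtain u v where uv: "u < n" "v < n" "P u" "\<not> P' u" "P' v" "\<not> P v" "R = TS \<longrightarrow> ibit x n u v"
      and only: "\<forall>i<n. i = u \<or> i = v \<or> P i = P' i" by blast
    have "i \<in> {i. i < n \<and> P i} - {i. i < n \<and> P' i} \<longleftrightarrow> i = u" "i \<in> {i. i < n \<and> P' i} - {i. i < n \<and> P i} \<longleftrightarrow> i = v" for i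
      using uv only[rule_format, of i] by auto
    then have "{i. i < n \<and> P i} - {i. i < n \<and> P' i} = {u}" "{i. i < n \<and> P' i} - {i. i < n \<and> P i} = {v}"
      by (simp_all only: set_eq_iff singleton_iff simp_thms)
    moreover have "R = TS \<longrightarrow> {u, v} \<in> edges (inst_graph x n)" using uv by (simp add: edge_inst_graph[OF assms(1)])
    ultimately show ?r by blast
  next
    assume ?r
    then obtain u v where u: "{i. i < n \<and> P i} - {i. i < n \<and> P' i} = {u}" and v: "{i. i < n \<and> P' i} - {i. i < n \<and> P i} = {v}"
      and R: "R = TS \<longrightarrow> {u, v} \<in> edges (inst_graph x n)" by blast
    have u': "i < n \<and> P i \<and> \<not> P' i \<longleftrightarrow> i = u" for i using eqset_imp_iff[OF u, of i] by (simp cong: conj_cong)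
    have v': "i < n \<and> P' i \<and> \<not> P i \<longleftrightarrow> i = v" for i using eqset_imp_iff[OF v, of i] by (simp cong: conj_cong)
    have "u < n \<and> P u \<and> \<not> P' u" "v < n \<and> P' v \<and> \<not> P v" by (simp_all only: u' v')
    moreover have "i = u \<or> i = v \<or> P i = P' i" if "i < n" for i
      using u'[of i] v'[of i] that by metis
    moreover have "R = TS \<longrightarrow> ibit x n u v" using R by (simp add: edge_inst_graph[OF assms(1)])
    ultimately show ?l by blast
  qed
  finally show ?thesis unfolding reconf_move_def .
qed

text \<open>The first disjunct supplies the reflexivity on which \<open>reach_iff\<close>
  relies.\<close>

definition leaf_step :: "nat \<Rightarrow> reconf_rule \<Rightarrow> nat ugraph \<Rightarrow> nat \<Rightarrow> (nat \<Rightarrow> bool) \<Rightarrow> (nat \<Rightarrow> bool) \<Rightarrow> bool" where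
  "leaf_step r R G n P P' \<longleftrightarrow> (\<forall>i<n. P i = P' i) \<or> (dist_dominating r G {i. i < n \<and> P i} \<and>
     dist_dominating r G {i. i < n \<and> P' i} \<and> reconf_move R G {i. i < n \<and> P i} {i. i < n \<and> P' i})"

definition FLeaf :: "nat \<Rightarrow> reconf_rule \<Rightarrow> (nat \<Rightarrow> nat \<Rightarrow> fm) \<Rightarrow> (nat \<Rightarrow> nat \<Rightarrow> fm) \<Rightarrow> nat \<Rightarrow> fm" where
  "FLeaf r R F F' d = FOr (FAll (V 1) (FIff (F (Suc d) d) (F' (Suc d) d))) (FConj [FDom r F d, FDom r F' d, FMove R F F' d])"

lemma evalf_leaf:
  assumes "well_formed x n" "denotes x m N n F P" "denotes x m N n F' P'"
  shows "evalf x m (N # n # e) (FLeaf r R F F' (Suc (Suc (length e)))) \<longleftrightarrow> leaf_step r R (inst_graph x n) n P P'"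
  unfolding FLeaf_def leaf_step_def using evalf_dom[OF assms(1,2)] evalf_dom[OF assms(1,3)] evalf_move[OF assms]
  by (simp add: denotes_last[OF assms(2)] denotes_last[OF assms(3)])

subsection \<open>Reading the number of vertices\<close>

text \<open>The number of vertices is the position of the first false bit. The word determines it,
  so a bounded search can bind it as a variable.\<close>

definition FSize :: fm where
  "FSize = And (FAll (V 1) (InBit (V 2))) (Neg (InBit (V 1)))"

definition with_size :: "fm \<Rightarrow> fm" where
  "with_size f = Ex (V 0) (And FSize f)"

definition gen_with_size :: "gen \<Rightarrow> gen" where
  "gen_with_size g = Loop (V 0) (Guard FSize g)"

lemma evalf_FSize: "evalf x m [N, n] FSize \<longleftrightarrow> (\<forall>i<n. bitat x i) \<and> \<not> bitat x n"
  by (simp add: FSize_def)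

lemma size_unique:
  "(\<forall>i<n. bitat x i) \<and> \<not> bitat x n \<Longrightarrow> (\<forall>i<n'. bitat x i) \<and> \<not> bitat x n' \<Longrightarrow> n = n'"
  by (metis linorder_neqE_nat)

lemma well_formed_size: "well_formed x n \<Longrightarrow> (\<forall>i<n. bitat x i) \<and> \<not> bitat x n"
  by (simp add: well_formed_def)

lemma evalf_FSize_iff: "well_formed x n \<Longrightarrow> evalf x m [N, n'] FSize \<longleftrightarrow> n' = n"
  unfolding evalf_FSize using size_unique[of n x n'] well_formed_size[of x n] by blast

lemma well_formed_unique: "well_formed x n \<Longrightarrow> well_formed x n' \<Longrightarrow> n = n'"
  using size_unique[of n x n'] well_formed_size[of x n] well_formed_size[of x n'] by blast

lemma ex_well_formed:
  assumes "well_formed x n"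
  shows "(\<exists>n'. well_formed x n' \<and> P n') \<longleftrightarrow> P n"
proof
  assume "\<exists>n'. well_formed x n' \<and> P n'"
  then obtain n' where "well_formed x n'" "P n'" by (elim exE conjE)
  then show "P n" using well_formed_unique[OF assms, of n'] by simp
next
  assume "P n"
  then show "\<exists>n'. well_formed x n' \<and> P n'" using assms by (intro exI conjI)
qed

lemma size_less: "well_formed x n \<Longrightarrow> n < length x"
  by (simp add: well_formed_def)

lemma evalf_with_size: "well_formed x n \<Longrightarrow> evalf x m [length x] (with_size f) \<longleftrightarrow> evalf x m [length x, n] f"
  by (auto simp: with_size_def evalf_FSize_iff size_less)

lemma concat_map_if_eq: "concat (map (\<lambda>v. if v = n then z else []) [0..<N]) = (if n < N then z else [])"
  by (induction N) (auto simp: less_Suc_eq)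

lemma outs_with_size: "well_formed x n \<Longrightarrow> outs x m [length x] (gen_with_size g) = outs x m [length x, n] g"
proof -
  assume w: "well_formed x n"
  have "outs x m [length x] (gen_with_size g) = concat (map (\<lambda>v. if v = n then outs x m [length x, n] g else []) [0..<length x])"
    by (simp add: gen_with_size_def evalf_FSize_iff[OF w]) (rule arg_cong[of _ _ concat], auto)
  then show ?thesis using size_less[OF w] by (simp add: concat_map_if_eq)
qed

lemma bitat_matrix:
  assumes "i < m" "j < n"
  shows "bitat (concat (map (\<lambda>i. map (f i) [0..<n]) [0..<m])) (i * n + j) = f i j"
  using digit_lt[OF assms] concat_map_upt_nth[OF assms(2,1), of f] by (simp add: bitat_def length_concat_upt)

subsection \<open>Well-formed instances\<close>

definition FWell :: fm where
  "FWell = FConj [FAll (V 1) (InBit (V 2)), Neg (InBit (V 1)),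
     FEq (V 0) (Plus (Plus (V 1) (Cst 1)) (Plus (Times (V 1) (V 1)) (Times (Cst 2) (V 1)))),
     FAll (V 1) (FAll (V 1) (FImp (FEdge 2 3) (FEdge 3 2))), FAll (V 1) (Neg (FEdge 2 2))]"

lemma evalf_FWell: "evalf x m [length x, n] FWell \<longleftrightarrow> well_formed x n"
  by (auto simp: FWell_def well_formed_def)

text \<open>The part of the problem that a single formula decides. It is the promise under which the
  iterations for chordality and reachability are analysed.\<close>

definition instances :: "nat \<Rightarrow> language" where
  "instances r = {x. \<exists>n. well_formed x n \<and> dist_dominating r (inst_graph x n) (inst_set x n 0) \<and>
     dist_dominating r (inst_graph x n) (inst_set x n 1)}"

lemma denotes_FSet: "denotes x m N n (\<lambda>d. FSet k) (ibit x n (n + k))"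
  by (simp add: denotes_def)

lemma decidable_instances: "decidable_on UNIV (instances r)"
proof (rule decidable_on_fm)
  fix x
  let ?f = "FConj [FWell, FDom r (\<lambda>d. FSet 0) 2, FDom r (\<lambda>d. FSet 1) 2]"
  have dom: "evalf x [] [length x, n] (FDom r (\<lambda>d. FSet k) 2) \<longleftrightarrow> dist_dominating r (inst_graph x n) (inst_set x n k)"
    if "well_formed x n" for n k
    using evalf_dom[OF that denotes_FSet[of x "[]" "length x" n k], of "[]" r] by (simp add: inst_set_def numeral_2_eq_2)
  have "evalf x [] [length x] (Ex (V 0) ?f) \<longleftrightarrow> (\<exists>n<length x. well_formed x n \<and> evalf x [] [length x, n] (FDom r (\<lambda>d. FSet 0) 2) \<and>
      evalf x [] [length x, n] (FDom r (\<lambda>d. FSet 1) 2))"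
    by (simp add: evalf_FWell)
  also have "\<dots> \<longleftrightarrow> (\<exists>n<length x. well_formed x n \<and> dist_dominating r (inst_graph x n) (inst_set x n 0) \<and>
      dist_dominating r (inst_graph x n) (inst_set x n 1))" by (simp only: dom cong: conj_cong)
  also have "\<dots> \<longleftrightarrow> x \<in> instances r" unfolding instances_def using size_less[of x] by blast
  finally show "evalf x [] [length x] (Ex (V 0) ?f) \<longleftrightarrow> x \<in> instances r" .
qed

subsection \<open>Chordality\<close>

text \<open>The memory is a table of \<open>n * n * n\<close> bits, in which entry
  \<open>(b, a, v)\<close> approximates \<open>avoids G b a v\<close> from below.\<close>

definition FAv :: "nat \<Rightarrow> nat \<Rightarrow> nat \<Rightarrow> fm" where
  "FAv b a v = MemBit (Plus (Times (V b) (Times (V 1) (V 1))) (Plus (Times (V a) (V 1)) (V v)))"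

definition avb :: "bool list \<Rightarrow> nat \<Rightarrow> nat \<Rightarrow> nat \<Rightarrow> nat \<Rightarrow> bool" where
  "avb m n b a v \<longleftrightarrow> bitat m (b * (n * n) + (a * n + v))"

lemma evalf_FAv [simp]:
  "evalf x m (N # n # e) (FAv b a v) \<longleftrightarrow> avb m n (rho (N # n # e) b) (rho (N # n # e) a) (rho (N # n # e) v)"
  by (simp add: FAv_def avb_def)

definition avoid_step :: "bool list \<Rightarrow> nat \<Rightarrow> (nat \<Rightarrow> nat \<Rightarrow> nat \<Rightarrow> bool) \<Rightarrow> nat \<Rightarrow> nat \<Rightarrow> nat \<Rightarrow> bool" where
  "avoid_step x n Q b a v \<longleftrightarrow> Q b a v \<or> v \<noteq> b \<and> \<not> ibit x n b v \<and> (ibit x n a v \<or> (\<exists>u<n. Q b a u \<and> ibit x n u v))"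

definition FAvoid :: fm where
  "FAvoid = FOr (FAv 2 3 4) (FConj [Neg (FEq (V 4) (V 2)), Neg (FEdge 2 4),
     FOr (FEdge 3 4) (Ex (V 1) (And (FAv 2 3 5) (FEdge 5 4)))])"

lemma evalf_FAvoid: "evalf x m [N, n, b, a, v] FAvoid \<longleftrightarrow> avoid_step x n (avb m n) b a v"
  by (simp add: FAvoid_def avoid_step_def)

definition avoid_gen :: gen where
  "avoid_gen = gen_with_size (Loop (V 1) (Loop (V 1) (Loop (V 1) (Emit FAvoid))))"

text \<open>Merges two nested loops into one, so that a table with three indices can be addressed by
  the lemma for matrices.\<close>

lemma concat_upt_divmod:
  "concat (map (\<lambda>i. map (f i) [0..<n]) [0..<m]) = map (\<lambda>k. f (k div n) (k mod n)) [0..<m * n]"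
proof (rule nth_equalityI)
  fix k assume "k < length (concat (map (\<lambda>i. map (f i) [0..<n]) [0..<m]))"
  then have k: "k < m * n" by (simp add: length_concat_upt)
  then have "0 < n" by (cases n) auto
  then have "k div n < m" "k mod n < n" using k by (simp_all add: less_mult_imp_div_less)
  from concat_map_upt_nth[OF this(2,1), of f]
  show "concat (map (\<lambda>i. map (f i) [0..<n]) [0..<m]) ! k = map (\<lambda>k. f (k div n) (k mod n)) [0..<m * n] ! k"
    using k by simp
qed (simp add: length_concat_upt)

lemma avb_outs:
  assumes w: "well_formed x n" and "b < n" "a < n" "v < n"
  shows "avb (outs x m [length x] avoid_gen) n b a v \<longleftrightarrow> avoid_step x n (avb m n) b a v"
proof -
  let ?f = "\<lambda>b a v. avoid_step x n (avb m n) b a v"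
  have "outs x m [length x] avoid_gen =
      concat (map (\<lambda>b. concat (map (\<lambda>a. map (?f b a) [0..<n]) [0..<n])) [0..<n])"
    unfolding avoid_gen_def outs_with_size[OF w] by (simp add: evalf_FAvoid concat_map_single)
  also have "\<dots> = concat (map (\<lambda>b. map (\<lambda>k. ?f b (k div n) (k mod n)) [0..<n * n]) [0..<n])"
    by (simp only: concat_upt_divmod)
  finally have o: "outs x m [length x] avoid_gen = \<dots>" .
  have av: "avb Z n b a v \<longleftrightarrow> bitat Z (b * (n * n) + (a * n + v))" for Z by (simp add: avb_def)
  show ?thesis unfolding o av
    using bitat_matrix[OF assms(2) digit_lt[OF assms(3,4)], of "\<lambda>b k. ?f b (k div n) (k mod n)"] assms(4)
    by simp
qed

text \<open>Supplies a round at which the iteration stops: otherwise the sets would grow strictly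
  more often than \<open>F\<close> has elements.\<close>

lemma chain_stabilises:
  assumes fin: "finite F" and sub: "\<And>t::nat. S t \<subseteq> F" and mono: "\<And>t. S t \<subseteq> S (Suc t)"
  shows "\<exists>t. S (Suc t) = S t"
proof (rule ccontr)
  assume "\<not> ?thesis"
  then have psub: "S t \<subset> S (Suc t)" for t using mono by (metis psubsetI)
  have "t \<le> card (S t)" for t
  proof (induction t)
    case (Suc t)
    have "card (S t) < card (S (Suc t))" by (rule psubset_card_mono[OF finite_subset[OF sub fin] psub])
    then show ?case using Suc by simp
  qed simp
  then have "Suc (card F) \<le> card F" by (meson card_mono[OF fin sub] le_trans)
  then show False by simp
qed

definition FClosed :: fm where
  "FClosed = with_size (FAll (V 1) (FAll (V 1) (FAll (V 1) (FImp FAvoid (FAv 2 3 4)))))"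

definition FNoHole :: fm where
  "FNoHole = with_size (FAll (V 1) (FAll (V 1) (FAll (V 1) (FAll (V 1) (Neg (FConj
     [FEdge 2 3, FEdge 2 4, Neg (FEq (V 3) (V 4)), Neg (FEdge 3 4), FAv 2 3 5, FEdge 5 4]))))))"

lemma evalf_FClosed: "well_formed x n \<Longrightarrow> evalf x m [length x] FClosed \<longleftrightarrow>
    (\<forall>b<n. \<forall>a<n. \<forall>v<n. avoid_step x n (avb m n) b a v \<longrightarrow> avb m n b a v)"
  by (simp add: FClosed_def evalf_with_size evalf_FAvoid)

lemma evalf_FNoHole: "well_formed x n \<Longrightarrow> evalf x m [length x] FNoHole \<longleftrightarrow>
    (\<forall>b<n. \<forall>a<n. \<forall>c<n. \<forall>u<n. \<not> (ibit x n b a \<and> ibit x n b c \<and> a \<noteq> c \<and> \<not> ibit x n a c \<and> avb m n b a u \<and> ibit x n u c))"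
  by (simp add: FNoHole_def evalf_with_size)

definition chordal_words :: language where
  "chordal_words = {x. \<exists>n. well_formed x n \<and> chordal (inst_graph x n)}"

text \<open>Rounds only add triples, so a closed table is reached. In it soundness, by induction on
  the rounds, and completeness, by induction on \<open>avoids\<close>, meet, and the criterion for
  holes can be checked by a formula.\<close>

lemma decidable_chordal: "decidable_on (instances r) chordal_words"
proof (rule decidable_on_iterate[where g = avoid_gen and H = FClosed and A = FNoHole])
  fix x assume "x \<in> instances r"
  then obtain n where w: "well_formed x n" unfolding instances_def by blast
  let ?G = "inst_graph x n" and ?m = "mem_at x avoid_gen"
  define Q where "Q t = avb (?m t) n" for t
  have Q0: "\<not> Q 0 b a v" for b a v by (simp add: Q_def avb_def bitat_def)
  have QSuc: "Q (Suc t) b a v \<longleftrightarrow> avoid_step x n (Q t) b a v" if "b < n" "a < n" "v < n" for t b a v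
    unfolding Q_def mem_at_simps by (rule avb_outs[OF w that])
  have sound: "avoids ?G b a v" if "Q t b a v" "b < n" "a < n" "v < n" for t b a v
    using that
  proof (induction t arbitrary: v)
    case 0
    then show ?case using Q0 by blast
  next
    case (Suc t)
    then have "avoid_step x n (Q t) b a v" using QSuc by blast
    then consider "Q t b a v" | "v \<noteq> b" "\<not> ibit x n b v" "ibit x n a v" |
      u where "v \<noteq> b" "\<not> ibit x n b v" "u < n" "Q t b a u" "ibit x n u v" unfolding avoid_step_def by blast
    then show ?case
    proof cases
      case 1
      then show ?thesis using Suc by blast
    next
      case 2
      then show ?thesis using Suc.prems by (intro avoids.first) (auto simp: adjacent_inst[OF w])
    next
      case (3 u)
      then have "avoids ?G b a u" using Suc by blast
      then show ?thesis using 3 Suc.prems by (elim avoids.more) (auto simp: adjacent_inst[OF w])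
    qed
  qed
  define S where "S t = {(b, a, v). b < n \<and> a < n \<and> v < n \<and> Q t b a v}" for t
  have "\<exists>t. S (Suc t) = S t"
  proof (rule chain_stabilises)
    show "finite ({..<n} \<times> {..<n} \<times> {..<n})" by simp
    show "S t \<subseteq> {..<n} \<times> {..<n} \<times> {..<n}" for t by (auto simp: S_def)
    show "S t \<subseteq> S (Suc t)" for t by (auto simp: S_def QSuc avoid_step_def)
  qed
  then obtain t where t: "S (Suc t) = S t" by blast
  have "evalf x (?m t) [length x] FClosed" unfolding evalf_FClosed[OF w] Q_def[symmetric]
  proof (intro allI impI)
    fix b a v assume "b < n" "a < n" "v < n" "avoid_step x n (Q t) b a v"
    then have "(b, a, v) \<in> S (Suc t)" by (simp add: S_def QSuc)
    then show "Q t b a v" unfolding t by (simp add: S_def)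
  qed
  note closes = this
  define k where "k = (LEAST k. evalf x (?m k) [length x] FClosed)"
  have k: "evalf x (?m k) [length x] FClosed" "\<forall>i<k. \<not> evalf x (?m i) [length x] FClosed"
    unfolding k_def using LeastI[of "\<lambda>k. evalf x (?m k) [length x] FClosed", OF closes]
      not_less_Least[of _ "\<lambda>k. evalf x (?m k) [length x] FClosed"] by simp_all
  have closed: "Q k b a v" if "avoid_step x n (Q k) b a v" "b < n" "a < n" "v < n" for b a v
    using k(1) that unfolding evalf_FClosed[OF w] Q_def[symmetric] by blast
  have complete: "v < n \<and> Q k b a v" if "avoids ?G b a v" "b < n" "a < n" for b a v
    using that
  proof (induction rule: avoids.induct)
    case (first v)
    then have "v < n" "avoid_step x n (Q k) b a v" by (auto simp: adjacent_inst[OF w] avoid_step_def)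
    then show ?case using closed first by blast
  next
    case (more u v)
    then have "v < n" "avoid_step x n (Q k) b a v" by (auto simp: adjacent_inst[OF w] avoid_step_def)
    then show ?case using closed more by blast
  qed
  have "evalf x (?m k) [length x] FNoHole \<longleftrightarrow> (\<forall>b a c u. \<not> hole_at ?G b a c u)"
  proof
    assume no: "evalf x (?m k) [length x] FNoHole"
    show "\<forall>b a c u. \<not> hole_at ?G b a c u"
    proof (intro allI notI)
      fix b a c u assume "hole_at ?G b a c u"
      then have h: "b < n" "a < n" "c < n" "u < n" "ibit x n b a" "ibit x n b c" "a \<noteq> c" "\<not> ibit x n a c" "avoids ?G b a u" "ibit x n u c"
        by (auto simp: hole_at_def adjacent_inst[OF w])
      then have "Q k b a u" using complete by blast
      then show False using no h unfolding evalf_FNoHole[OF w] Q_def[symmetric] by blast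
    qed
  next
    assume no: "\<forall>b a c u. \<not> hole_at ?G b a c u"
    show "evalf x (?m k) [length x] FNoHole" unfolding evalf_FNoHole[OF w] Q_def[symmetric]
    proof (intro allI impI notI)
      fix b a c u assume h: "b < n" "a < n" "c < n" "u < n"
        "ibit x n b a \<and> ibit x n b c \<and> a \<noteq> c \<and> \<not> ibit x n a c \<and> Q k b a u \<and> ibit x n u c"
      then have "hole_at ?G b a c u" using sound[of k b a u] by (simp add: hole_at_def adjacent_inst[OF w])
      then show False using no by blast
    qed
  qed
  also have "\<dots> \<longleftrightarrow> chordal ?G" using chordal_iff_no_hole[OF simple_inst_graph[OF w]] by simp
  also have "\<dots> \<longleftrightarrow> x \<in> chordal_words" by (simp add: chordal_words_def ex_well_formed[OF w])
  finally have "evalf x (?m k) [length x] FNoHole \<longleftrightarrow> x \<in> chordal_words" .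
  then show "\<exists>k. evalf x (?m k) [length x] FClosed \<and> (\<forall>i<k. \<not> evalf x (?m i) [length x] FClosed) \<and>
      (evalf x (?m k) [length x] FNoHole \<longleftrightarrow> x \<in> chordal_words)" using k by blast
qed

subsection \<open>Reconfiguration\<close>

text \<open>A row has \<open>n + 4\<close> columns: the bits of a midpoint, the flag for the second
  half, and one column for each of the three signals.\<close>

definition FB :: "trm \<Rightarrow> trm \<Rightarrow> fm" where
  "FB l k = MemBit (Plus (Times l (Plus (V 1) (Cst 4))) k)"

definition memb :: "bool list \<Rightarrow> nat \<Rightarrow> nat \<Rightarrow> nat \<Rightarrow> bool" where
  "memb m n l k \<longleftrightarrow> bitat m (l * (n + 4) + k)"

lemma evalf_FB [simp]:
  "evalf x m (N # n # e) (FB l k) \<longleftrightarrow> memb m n (evalt (N # n # e) l) (evalt (N # n # e) k)"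
  by (simp add: FB_def memb_def)

abbreviation levels :: trm where "levels \<equiv> Plus (V 1) (V 1)"
abbreviation rows :: trm where "rows \<equiv> Plus levels (Cst 1)"
abbreviation col :: "nat \<Rightarrow> trm" where "col c \<equiv> Plus (V 1) (Cst c)"

definition FFrom :: "nat \<Rightarrow> nat \<Rightarrow> fm" where
  "FFrom d i = FOr (Ex rows (FConj [Less (Cst 0) (V d), FB (V d) (V 1), FB (V d) (V i),
       FAll (V d) (FImp (Less (Cst 0) (V (Suc d))) (Neg (FB (V (Suc d)) (V 1))))]))
     (And (FSet 0 i) (FAll rows (FImp (Less (Cst 0) (V d)) (Neg (FB (V d) (V 1))))))"

definition FTo :: "nat \<Rightarrow> nat \<Rightarrow> fm" where
  "FTo d i = FOr (Ex rows (FConj [Less (Cst 0) (V d), Neg (FB (V d) (V 1)), FB (V d) (V i),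
       FAll (V d) (FImp (Less (Cst 0) (V (Suc d))) (FB (V (Suc d)) (V 1)))]))
     (And (FSet 1 i) (FAll rows (FImp (Less (Cst 0) (V d)) (FB (V d) (V 1)))))"

lemma denotes_FFrom: "denotes x m N n FFrom (savitch.mav n (n + n) (ibit x n n) (memb m n))"
  unfolding denotes_def by (simp add: FFrom_def savitch.mav_def rho_ext less_Suc_eq_le)

lemma denotes_FTo: "denotes x m N n FTo (savitch.mbv n (n + n) (ibit x n (n + 1)) (memb m n))"
  unfolding denotes_def by (simp add: FTo_def savitch.mbv_def rho_ext less_Suc_eq_le)

definition FPred :: "nat \<Rightarrow> fm" where
  "FPred c = Ex (V 2) (And (FEq (V 2) (Plus (V 4) (Cst 1))) (FB (V 4) (col c)))"

definition FIdle :: fm where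
  "FIdle = FAll rows (FConj [Neg (FB (V 4) (col 1)), Neg (FB (V 4) (col 2)), Neg (FB (V 4) (col 3))])"

definition FEnds :: "nat \<Rightarrow> reconf_rule \<Rightarrow> fm" where
  "FEnds r R = FLeaf r R FFrom FTo (Suc (Suc (Suc (Suc 0))))"

text \<open>Follows \<open>next_mat\<close> case by case; variables 2 and 3 are the row and the
  column of the entry to be computed.\<close>

definition FNext :: "nat \<Rightarrow> reconf_rule \<Rightarrow> fm" where
  "FNext r R =
    FIf (Less (V 3) (V 1))
      (And (Neg (FB (V 2) (col 1))) (Neg (FIff (FB (V 2) (V 3)) (And (FPred 3) (FAll (V 3) (FB (V 2) (V 4)))))))
    (FIf (FEq (V 3) (V 1)) (FConj [Neg (FB (V 2) (col 1)), Neg (FPred 3), FOr (FPred 2) (FB (V 2) (V 1))])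
    (FIf (FEq (V 3) (col 1))
      (FOr (And (FEq (V 2) levels) FIdle) (And (Less (V 2) levels) (FOr (FB (Plus (V 2) (Cst 1)) (col 1))
        (FOr (And (FB (V 2) (col 2)) (Neg (FB (Plus (V 2) (Cst 1)) (V 1))))
           (And (FB (V 2) (col 3)) (Neg (FAll (V 1) (FB (Plus (V 2) (Cst 1)) (V 4)))))))))
    (FIf (FEq (V 3) (col 2))
      (FOr (FConj [FEq (V 2) (Cst 0), FB (Cst 0) (col 1), FEnds r R])
        (FOr (And (FPred 2) (FB (V 2) (V 1))) (And (FEq (V 2) levels) (FB (V 2) (col 2)))))
      (FOr (FConj [FEq (V 2) (Cst 0), FB (Cst 0) (col 1), Neg (FEnds r R)])
        (FOr (And (FPred 3) (FAll (V 1) (FB (V 2) (V 4)))) (And (FEq (V 2) levels) (FB (V 2) (col 3))))))))"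

lemma evalf_FNext:
  assumes w: "well_formed x n"
  shows "evalf x m [N, n, l, k] (FNext r R) \<longleftrightarrow> savitch.next_mat n (n + n) (leaf_step r R (inst_graph x n) n)
    (ibit x n n) (ibit x n (n + 1)) (memb m n) l k"
proof -
  have ends: "evalf x m [N, n, l, k'] (FEnds r R) \<longleftrightarrow> leaf_step r R (inst_graph x n) n
      (savitch.mav n (n + n) (ibit x n n) (memb m n)) (savitch.mbv n (n + n) (ibit x n (n + 1)) (memb m n))" for k'
    using evalf_leaf[OF w denotes_FFrom denotes_FTo, where e = "[l, k']" and m = m and N = N and r = r and R = R] by (simp add: FEnds_def)
  have pred: "evalf x m [N, n, l, k'] (FPred c) \<longleftrightarrow> savitch.pred_has (memb m n) l (n + c)" for c k'
    by (simp add: FPred_def savitch.pred_has_def)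
  have idle: "evalf x m [N, n, l, k'] FIdle \<longleftrightarrow> savitch.idle n (n + n) (memb m n)" for k'
    by (simp add: FIdle_def savitch.idle_def less_Suc_eq_le)
  show ?thesis unfolding FNext_def savitch.next_mat_def by (simp add: ends pred idle)
qed

text \<open>The memory represents the state only within the bounds of the table, and source and
  target bits are meaningful only below \<open>n\<close>; an entry of the next matrix looks at
  nothing else.\<close>

lemma next_mat_cong:
  assumes agree: "\<And>l k. l \<le> L \<Longrightarrow> k < n + 4 \<Longrightarrow> B l k = B' l k" and l: "l \<le> L" and k: "k < n + 4"
    and leaf_cong: "\<And>X X' Y Y'. (\<And>i. i < n \<Longrightarrow> X i = X' i) \<Longrightarrow> (\<And>i. i < n \<Longrightarrow> Y i = Y' i) \<Longrightarrow> leaf X Y = leaf X' Y'"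
    and src: "\<And>i. i < n \<Longrightarrow> src i = src' i" and tgt: "\<And>i. i < n \<Longrightarrow> tgt i = tgt' i"
  shows "savitch.next_mat n L leaf src tgt B l k = savitch.next_mat n L leaf src' tgt' B' l k"
proof -
  have "savitch.mav n L src B i = savitch.mav n L src' B' i" if "i < n" for i
    unfolding savitch.mav_def using that by (simp add: agree src cong: conj_cong)
  moreover have "savitch.mbv n L tgt B i = savitch.mbv n L tgt' B' i" if "i < n" for i
    unfolding savitch.mbv_def using that by (simp add: agree tgt cong: conj_cong)
  ultimately have ends: "leaf (savitch.mav n L src B) (savitch.mbv n L tgt B) =
      leaf (savitch.mav n L src' B') (savitch.mbv n L tgt' B')" by (rule leaf_cong)
  have idle: "savitch.idle n L B = savitch.idle n L B'"
    unfolding savitch.idle_def by (simp add: agree)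
  have pred: "savitch.pred_has B l c = savitch.pred_has B' l c" if "c < n + 4" for c
    unfolding savitch.pred_has_def using l that by (auto simp: agree)
  have row: "(\<forall>i<c. B j i) = (\<forall>i<c. B' j i)" if "j \<le> L" "c \<le> n" for j c
    using that by (simp add: agree)
  have suc: "B (Suc l) i = B' (Suc l) i" if "l < L" "i \<le> Suc n" for i using that by (simp add: agree)
  have p: "savitch.pred_has B l (n + 2) = savitch.pred_has B' l (n + 2)" "savitch.pred_has B l (n + 3) = savitch.pred_has B' l (n + 3)"
    by (simp_all add: pred)
  have c: "B l n = B' l n" "B l k = B' l k" "B l (n + 1) = B' l (n + 1)" "B l (n + 2) = B' l (n + 2)" "B l (n + 3) = B' l (n + 3)"
    "B 0 (n + 1) = B' 0 (n + 1)" using l k by (simp_all add: agree)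
  show ?thesis unfolding savitch.next_mat_def ends idle p c row[OF l le_refl]
    using row[OF l, of k] by (simp add: suc cong: conj_cong)
qed

lemma ex_reconf_sequence_iff:
  assumes "dist_dominating r G A"
  shows "(\<exists>T. is_reconf_sequence R r G A T B) \<longleftrightarrow>
    (A, B) \<in> {(C, D). dist_dominating r G C \<and> dist_dominating r G D \<and> reconf_move R G C D}\<^sup>*" (is "_ \<longleftrightarrow> _ \<in> ?S\<^sup>*")
proof
  have walk: "T \<noteq> [] \<Longrightarrow> \<forall>D\<in>set T. dist_dominating r G D \<Longrightarrow> successively (reconf_move R G) T \<Longrightarrow> (hd T, last T) \<in> ?S\<^sup>*" for T
  proof (induction T)
    case (Cons D T)
    show ?case
    proof (cases T)
      case (Cons E U)
      then have "(D, E) \<in> ?S" "(E, last T) \<in> ?S\<^sup>*" using Cons.IH Cons.prems by auto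
      then have "(D, last T) \<in> ?S\<^sup>*" by (rule converse_rtrancl_into_rtrancl)
      moreover have "last (D # T) = last T" using Cons by simp
      ultimately show ?thesis by (simp only: list.sel(1))
    qed simp
  qed simp
  assume "\<exists>T. is_reconf_sequence R r G A T B"
  then obtain T where "is_reconf_sequence R r G A T B" by (elim exE)
  then show "(A, B) \<in> ?S\<^sup>*" using walk[of T] unfolding is_reconf_sequence_def by metis
next
  assume "(A, B) \<in> ?S\<^sup>*"
  then show "\<exists>T. is_reconf_sequence R r G A T B"
  proof (induction rule: rtrancl_induct)
    case base
    then show ?case using assms by (intro exI[of _ "[A]"]) (simp add: is_reconf_sequence_def)
  next
    case (step C D)
    then obtain T where "is_reconf_sequence R r G A T C" by blast
    then have "is_reconf_sequence R r G A (T @ [D]) D"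
      using step(2) by (auto simp: is_reconf_sequence_def successively_append_iff)
    then show ?case by blast
  qed
qed

lemma leaf_step_cong:
  assumes "\<And>i. i < n \<Longrightarrow> X i = X' i" "\<And>i. i < n \<Longrightarrow> Y i = Y' i"
  shows "leaf_step r R G n X Y = leaf_step r R G n X' Y'"
proof -
  have "{i. i < n \<and> X i} = {i. i < n \<and> X' i}" "{i. i < n \<and> Y i} = {i. i < n \<and> Y' i}" using assms by auto
  then show ?thesis unfolding leaf_step_def using assms by simp
qed

text \<open>Token sets correspond to vectors of \<open>n\<close> bits, and a leaf step between
  vectors that agree below \<open>n\<close> corresponds to no move.\<close>

lemma reach_leaf_step_iff:
  assumes G: "verts G = {..<n}" and A: "dist_dominating r G A" and B: "dist_dominating r G B"
  shows "savitch.reach n (leaf_step r R G n) (n + n) (\<lambda>i. i \<in> A) (\<lambda>i. i \<in> B) \<longleftrightarrow> (\<exists>T. is_reconf_sequence R r G A T B)"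
proof -
  \<comment> \<open>\<open>reach\<close> takes its end points as arguments, so source and target are
    left unspecified.\<close>
  interpret savitch n "n + n" "leaf_step r R G n" undefined undefined .
  let ?S = "{(C, D). dist_dominating r G C \<and> dist_dominating r G D \<and> reconf_move R G C D}"
  let ?B = "{(bits i, bits j) | i j. i < 2 ^ n \<and> j < 2 ^ n \<and> leaf_step r R G n (bits i) (bits j)}"
  have sub: "C \<subseteq> {..<n}" if "dist_dominating r G C" for C using that G by (simp add: dist_dominating_def)
  have set: "{i. i < n \<and> i \<in> C} = C" if "dist_dominating r G C" for C using sub[OF that] by blast
  have bits: "\<exists>m < 2 ^ n. (\<lambda>i. i \<in> C) = bits m" if "dist_dominating r G C" for C
    by (rule bits_surj) (use sub[OF that] in auto)
  obtain a where a: "a < 2 ^ n" "(\<lambda>i. i \<in> A) = bits a" using bits[OF A] by blast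
  obtain b where b: "b < 2 ^ n" "(\<lambda>i. i \<in> B) = bits b" using bits[OF B] by blast
  \<comment> \<open>The origin of the depth \<open>n + n\<close>: there are at most
    \<open>4 ^ n\<close> pairs of bit vectors.\<close>
  have big: "4 ^ n \<le> (2::nat) ^ (n + n)" by (simp add: power_add power_mult_distrib[symmetric])
  have refl: "leaf_step r R G n X X" for X by (simp add: leaf_step_def)
  have 1: "({i. i < n \<and> X i}, {i. i < n \<and> Y i}) \<in> ?S\<^sup>*" if "(X, Y) \<in> ?B\<^sup>*" for X Y
    using that
  proof (induction rule: rtrancl_induct)
    case (step Y Z)
    then have l: "leaf_step r R G n Y Z" by auto
    show ?case
    proof (cases "\<forall>i<n. Y i = Z i")
      case True
      then have "{i. i < n \<and> Y i} = {i. i < n \<and> Z i}" by auto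
      then show ?thesis using step.IH by simp
    next
      case False
      then have "({i. i < n \<and> Y i}, {i. i < n \<and> Z i}) \<in> ?S" using l unfolding leaf_step_def by blast
      then show ?thesis by (rule rtrancl_into_rtrancl[OF step.IH])
    qed
  qed simp
  have 2: "(\<lambda>i. i \<in> A, \<lambda>i. i \<in> C) \<in> ?B\<^sup>*" if "(A, C) \<in> ?S\<^sup>*" for C
    using that
  proof (induction rule: rtrancl_induct)
    case (step C D)
    then have d: "dist_dominating r G C" "dist_dominating r G D" "reconf_move R G C D" by auto
    then have l: "leaf_step r R G n (\<lambda>i. i \<in> C) (\<lambda>i. i \<in> D)" unfolding leaf_step_def by (simp only: set simp_thms)
    obtain c where c: "c < 2 ^ n" "(\<lambda>i. i \<in> C) = bits c" using bits[OF d(1)] by blast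
    obtain e where e: "e < 2 ^ n" "(\<lambda>i. i \<in> D) = bits e" using bits[OF d(2)] by blast
    have "(\<lambda>i. i \<in> C, \<lambda>i. i \<in> D) \<in> ?B" using l c(1) e(1) unfolding c(2) e(2) by blast
    then show ?case by (rule rtrancl_into_rtrancl[OF step.IH])
  qed simp
  have "reach (n + n) (bits a) (bits b) \<longleftrightarrow> (bits a, bits b) \<in> ?B\<^sup>*" by (rule reach_iff[OF refl big a(1) b(1)])
  also have "\<dots> \<longleftrightarrow> (A, B) \<in> ?S\<^sup>*"
    using 1[of "\<lambda>i. i \<in> A" "\<lambda>i. i \<in> B"] 2[of B] unfolding a(2) b(2) set[OF A] set[OF B] by blast
  finally show ?thesis unfolding ex_reconf_sequence_iff[OF A] a(2) b(2) .
qed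

section \<open>The iterated generator for reachability\<close>

definition reconf_words :: "nat \<Rightarrow> reconf_rule \<Rightarrow> language" where
  "reconf_words r R = {x. \<exists>n. well_formed x n \<and>
     (\<exists>T. is_reconf_sequence R r (inst_graph x n) (inst_set x n 0) T (inst_set x n 1))}"

definition savitch_gen :: "nat \<Rightarrow> reconf_rule \<Rightarrow> gen" where
  "savitch_gen r R = gen_with_size (Loop rows (Loop (col 4) (Emit (FNext r R))))"

lemma memb_outs:
  assumes w: "well_formed x n" and "l \<le> n + n" "k < n + 4"
  shows "memb (outs x m [length x] (savitch_gen r R)) n l k \<longleftrightarrow> evalf x m [length x, n, l, k] (FNext r R)"
proof -
  have "outs x m [length x] (savitch_gen r R) =
      concat (map (\<lambda>l. map (\<lambda>k. evalf x m [length x, n, l, k] (FNext r R)) [0..<n + 4]) [0..<n + n + 1])"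
    unfolding savitch_gen_def outs_with_size[OF w] by (simp add: concat_map_single del: upt_Suc)
  moreover have "l < n + n + 1" using assms(2) by simp
  ultimately show ?thesis unfolding memb_def
    using bitat_matrix[of l "n + n + 1" k "n + 4" "\<lambda>l k. evalf x m [length x, n, l, k] (FNext r R)"] assms(3) by simp
qed

text \<open>After \<open>t\<close> rounds the memory is the matrix of the state number
  \<open>t\<close> of Savitch's algorithm. The halting test looks for an answer of the top level,
  and acceptance for a positive one.\<close>

lemma decidable_reconf:
  assumes D: "D \<subseteq> instances r"
  shows "decidable_on D (reconf_words r R)"
proof (rule decidable_on_iterate[where g = "savitch_gen r R"
    and H = "with_size (FOr (FB levels (col 2)) (FB levels (col 3)))" and A = "with_size (FB levels (col 2))"])
  fix x assume "x \<in> D"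
  then obtain n where w: "well_formed x n" and dom: "dist_dominating r (inst_graph x n) (inst_set x n 0)"
    "dist_dominating r (inst_graph x n) (inst_set x n 1)" using D unfolding instances_def by blast
  let ?leaf = "leaf_step r R (inst_graph x n) n" and ?m = "mem_at x (savitch_gen r R)"
  interpret savitch n "n + n" ?leaf "\<lambda>i. i \<in> inst_set x n 0" "\<lambda>i. i \<in> inst_set x n 1" .
  let ?s = "\<lambda>t. (sstep ^^ t) sinit"
  have mem: "memb (?m t) n l k = mat (?s t) l k" if "l \<le> n + n" "k < n + 4" for t l k
    using that
  proof (induction t arbitrary: l k)
    case 0
    then show ?case using mat_sinit by (simp add: memb_def bitat_def)
  next
    case (Suc t)
    have "memb (?m (Suc t)) n l k \<longleftrightarrow> evalf x (?m t) [length x, n, l, k] (FNext r R)"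
      unfolding mem_at_simps by (rule memb_outs[OF w Suc.prems])
    also have "\<dots> \<longleftrightarrow> savitch.next_mat n (n + n) ?leaf (ibit x n n) (ibit x n (n + 1)) (memb (?m t) n) l k"
      by (rule evalf_FNext[OF w])
    also have "\<dots> \<longleftrightarrow> next_mat (mat (?s t)) l k"
      by (rule next_mat_cong[OF Suc.IH Suc.prems leaf_step_cong]) (simp_all add: inst_set_def)
    also have "\<dots> \<longleftrightarrow> mat (sstep (?s t)) l k"
      by (rule next_mat_sstep[OF bounded_iter Suc.prems leaf_step_cong])
    finally show ?case by simp
  qed
  have ret: "memb (?m t) n (n + n) (n + 2) \<longleftrightarrow> snd (snd (?s t)) = Some (SYes, n + n)"
    "memb (?m t) n (n + n) (n + 3) \<longleftrightarrow> snd (snd (?s t)) = Some (SNo, n + n)" for t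
    using mem[of "n + n" "n + 2" t] mem[of "n + n" "n + 3" t] by (cases "?s t"; simp only: mat_cols snd_conv; simp)+
  have H: "evalf x (?m t) [length x] (with_size (FOr (FB levels (col 2)) (FB levels (col 3)))) \<longleftrightarrow> halting (?s t)" for t
    using ret[of t] by (simp add: evalf_with_size[OF w] halting_def split: prod.splits)
  have A: "evalf x (?m t) [length x] (with_size (FB levels (col 2))) \<longleftrightarrow> snd (snd (?s t)) = Some (SYes, n + n)" for t
    using ret(1)[of t] by (simp add: evalf_with_size[OF w])
  let ?b = "reach (n + n) (\<lambda>i. i \<in> inst_set x n 0) (\<lambda>i. i \<in> inst_set x n 1)"
  obtain k W c where k: "?s k = (W, c, Some (answer ?b, n + n))" "\<forall>i<k. \<not> halting (?s i)" using first_halt by blast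
  have "?b \<longleftrightarrow> x \<in> reconf_words r R"
    using reach_leaf_step_iff[OF verts_inst dom, of R] by (simp add: reconf_words_def ex_well_formed[OF w])
  then have "snd (snd (?s k)) = Some (SYes, n + n) \<longleftrightarrow> x \<in> reconf_words r R" using k(1) by simp
  moreover have "halting (?s k)" using k(1) by (simp add: halting_def)
  ultimately show "\<exists>k. evalf x (?m k) [length x] (with_size (FOr (FB levels (col 2)) (FB levels (col 3)))) \<and>
      (\<forall>i<k. \<not> evalf x (?m i) [length x] (with_size (FOr (FB levels (col 2)) (FB levels (col 3))))) \<and>
      (evalf x (?m k) [length x] (with_size (FB levels (col 2))) \<longleftrightarrow> x \<in> reconf_words r R)"
    unfolding H A using k(2) by blast
qed

lemma DrDSR_chordal_PSPACE: "DrDSR r R chordal \<in> PSPACE"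
proof -
  have "decidable_on UNIV (instances r \<inter> chordal_words)"
    by (rule decidable_on_Int[OF decidable_instances]) (simp add: decidable_chordal)
  then have "decidable_on UNIV (instances r \<inter> chordal_words \<inter> reconf_words r R)"
    by (rule decidable_on_Int) (rule decidable_reconf, blast)
  moreover have "instances r \<inter> chordal_words \<inter> reconf_words r R = DrDSR r R chordal" (is "?l = ?r")
  proof (rule set_eqI)
    fix x
    show "x \<in> ?l \<longleftrightarrow> x \<in> ?r"
    proof (cases "\<exists>n. well_formed x n")
      case True
      then obtain n where n: "well_formed x n" by blast
      show ?thesis unfolding DrDSR_iff instances_def chordal_words_def reconf_words_def Int_iff mem_Collect_eq ex_well_formed[OF n]
        by (rule iffI; elim conjE; intro conjI; assumption)
    next
      case False
      then show ?thesis unfolding DrDSR_iff instances_def by blast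
    qed
  qed
  ultimately show ?thesis using decidable_on_UNIV_PSPACE by simp
qed

theorem theorem20:
  fixes r :: nat and R :: reconf_rule
  assumes "r \<ge> 2"
  shows "PSPACE_complete (DrDSR r R chordal)"
  unfolding PSPACE_complete_def using DrDSR_chordal_PSPACE PSPACE_hard_DrDSR[of r R] assms by simp

end
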